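(* Let $\Delta$ be a square root as follows: \[ \Delta^2=4\,\frac{(\upsilon-1)^3(\upsilon^3-8\upsilon^2+5\upsilon+1)}{\upsilon^3}, \] and put $x=\upsilon\Delta/(\upsilon-1)$, $y=\psi/\upsilon$. Then \[ \mathcal A_0(\Gamma^{2}\cap\Gamma(7))=\mathbf C(\psi,\upsilon,\Delta)=\mathbf C(x,y). \] Moreover, $x$ and $y$ satisfy \[ \begin{aligned} &64y^{28}-x^6y^{21}-52x^4y^{21}-1520x^2y^{21}-18496y^{21}-84x^4y^{14}+5264x^2y^{14}\\ &\qquad-3648y^{14}-1072x^2y^7+64y^7+16x^2=0. \end{aligned} \] The normalization of the plane curve defined by this equation has genus $17$.
   Context: For a congruence subgroup $G\subset\mathrm{SL}_2(\mathbf Z)$, $\mathcal A_0(G)$ denotes the field of modular functions for $G$ over $\mathbf C$. The group $\Gamma^2\subset\mathrm{SL}_2(\mathbf Z)$ is the inverse image of the subgroup of order $3$ of $\mathrm{SL}_2(\mathbf F_2)$ under reduction modulo $2$. For $k=1,2,3$ put $a_k(\tau)=\sum_{n\in\mathbf Z}(-1)^{n+k+1}q^{(14n+7-2k)^2/56}$, where $q^r=e^{2\pi i r\tau}$, and $\psi=-a_2a_3/a_1^2$, $\upsilon=a_2^2a_3/a_1^3$. Then $\psi^7=\upsilon^4(\upsilon-1)$ and $\mathcal A_0(\Gamma(7))=\mathbf C(\psi,\upsilon)$. $\Delta$ is (up to sign) the square root $(g_1-g_2)(g_2-g_3)(g_3-g_1)$ of the discriminant of the cubic $T^3+T^2-\frac{\upsilon^2-1}{\upsilon}T+\frac{(\upsilon-1)^2}{\upsilon}$,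 whose roots are $g_1(\tau)=\phi_1(\tau)^2/\phi_1(2\tau)$, $g_2(\tau)=\phi_1(\tau)\phi_1(\tau/2)\phi_1(2\tau)-\phi_1(2\tau)/\phi_2(\tau)$, $g_3(\tau)=-\phi_1(\tau)\phi_1(\tau/2)\phi_1(2\tau)-\phi_1(\tau)^2\phi_2(\tau)/\phi_2(2\tau)$, with $\phi_1=-a_3/a_2$, $\phi_2=-a_2/a_1$. *)

theory Defs
  imports
    "HOL-Algebra.Embedded_Algebras"
    "HOL-Algebra.QuotRing"
    "HOL-Library.Z2"
    "HOL-Number_Theory.Cong"
    "HOL-Computational_Algebra.Computational_Algebra"
    "HOL-Complex_Analysis.Complex_Analysis"
begin

unbundle no fps_syntax

section \<open>The field of meromorphic functions on the upper half-plane\<close>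

definition upper_half_plane :: "complex set" (\<open>\<H>\<close>)
  where "\<H> = {z. Im z > 0}"

lemma open_upper_half_plane [simp, intro]: "open \<H>"
  unfolding upper_half_plane_def by (rule open_halfspace_Im_gt)

lemma connected_upper_half_plane [simp, intro]: "connected \<H>"
  unfolding upper_half_plane_def by (intro convex_connected convex_halfspace_Im_gt)

lemma ii_in_upper_half_plane [simp, intro]: "\<i> \<in> \<H>"
  by (simp add: upper_half_plane_def)

text \<open>
  A meromorphic function on \<open>\<H>\<close> is represented by its unique representative without removable
  singularities that takes the value 0 at its poles and outside \<open>\<H>\<close>.
\<close>

typedef mero_uhp =
  "{f. f nicely_meromorphic_on \<H> \<and> (\<forall>z. z \<notin> \<H> \<longrightarrow> f z = 0)}"
  morphisms eval_mero Abs_mero_uhp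
proof -
  have "(\<lambda>_. 0) nicely_meromorphic_on \<H>"
    by (rule nicely_meromorphic_on_const)
  thus ?thesis by auto
qed

definition mero_of :: "(complex \<Rightarrow> complex) \<Rightarrow> mero_uhp" where
  "mero_of f = Abs_mero_uhp
     (\<lambda>z. if f meromorphic_on \<H> \<and> z \<in> \<H> then remove_sings f z else 0)"

lemma eval_mero_nicely_meromorphic: "eval_mero f nicely_meromorphic_on \<H>"
  using eval_mero[of f] by auto

lemma eval_mero_meromorphic [meromorphic_intros]: "eval_mero f meromorphic_on \<H>"
  using eval_mero_nicely_meromorphic[of f] by (auto simp: nicely_meromorphic_on_def)

lemma eval_mero_outside: "z \<notin> \<H> \<Longrightarrow> eval_mero f z = 0"
  using eval_mero[of f] by auto

lemma remove_sings_eval_mero: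
  assumes "z \<in> \<H>"
  shows   "remove_sings (eval_mero f) z = eval_mero f z"
  using eval_mero_nicely_meromorphic[of f] assms
  unfolding nicely_meromorphic_on_def by (metis remove_sings_at_pole remove_sings_eqI)

lemma mero_uhp_eqI:
  assumes "\<And>z. z \<in> \<H> \<Longrightarrow> eventually (\<lambda>w. eval_mero f w = eval_mero g w) (at z)"
  shows   "f = g"
proof -
  have "eval_mero f z = eval_mero g z" for z
  proof (cases "z \<in> \<H>")
    case True
    have "remove_sings (eval_mero f) z = remove_sings (eval_mero g) z"
      by (rule remove_sings_cong) (use assms[OF True] in auto)
    thus ?thesis using True by (simp add: remove_sings_eval_mero)
  qed (simp add: eval_mero_outside)
  thus ?thesis using eval_mero_inject by blast
qed

lemma eval_mero_of:
  assumes "f meromorphic_on \<H>"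
  shows   "eval_mero (mero_of f) z = (if z \<in> \<H> then remove_sings f z else 0)"
proof -
  let ?g = "\<lambda>z. if z \<in> \<H> then remove_sings f z else 0"
  have nice: "remove_sings f nicely_meromorphic_on \<H>"
    by (rule remove_sings_nicely_meromorphic) fact
  have ev: "eventually (\<lambda>w. ?g w = remove_sings f w) (at z)" if "z \<in> \<H>" for z
  proof -
    have "eventually (\<lambda>w. w \<in> \<H>) (at z)"
      using that by (intro eventually_at_in_open') auto
    thus ?thesis by eventually_elim auto
  qed
  have "?g meromorphic_on \<H> \<longleftrightarrow> remove_sings f meromorphic_on \<H>"
    by (intro meromorphic_on_cong ev refl)
  hence 1: "?g meromorphic_on \<H>"
    using nice by (simp add: nicely_meromorphic_on_def)
  have 2: "(is_pole ?g z \<and> ?g z = 0) \<or> ?g \<midarrow>z\<rightarrow> ?g z" if z: "z \<in> \<H>" for z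
  proof -
    have 1: "is_pole ?g z \<longleftrightarrow> is_pole (remove_sings f) z"
      by (intro is_pole_cong ev z refl)
    have 2: "(?g \<midarrow>z\<rightarrow> c) \<longleftrightarrow> (remove_sings f \<midarrow>z\<rightarrow> c)" for c
      by (intro filterlim_cong ev z refl)
    have 3: "?g z = remove_sings f z" using z by simp
    show ?thesis
      unfolding 1 2 3 using nice z unfolding nicely_meromorphic_on_def by blast
  qed
  have "?g \<in> {f. f nicely_meromorphic_on \<H> \<and> (\<forall>z. z \<notin> \<H> \<longrightarrow> f z = 0)}"
    unfolding nicely_meromorphic_on_def using 1 2 by simp
  from Abs_mero_uhp_inverse[OF this] show ?thesis
    using assms by (simp add: mero_of_def)
qed

lemma eventually_eval_mero_of:
  assumes "f meromorphic_on \<H>" "z \<in> \<H>"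
  shows   "eventually (\<lambda>w. eval_mero (mero_of f) w = f w) (at z)"
proof -
  have "isolated_singularity_at f z"
    using assms by (meson meromorphic_on_altdef)
  hence "eventually (\<lambda>w. remove_sings f w = f w) (at z)"
    by (rule eventually_remove_sings_eq_at)
  moreover have "eventually (\<lambda>w. w \<in> \<H>) (at z)"
    using assms(2) by (intro eventually_at_in_open') auto
  ultimately show ?thesis
    by eventually_elim (simp add: eval_mero_of assms(1))
qed

definition const_mero :: "complex \<Rightarrow> mero_uhp"
  where "const_mero c = mero_of (\<lambda>_. c)"

instantiation mero_uhp :: field
begin

definition zero_mero_uhp :: mero_uhp where "0 = const_mero 0"

definition one_mero_uhp :: mero_uhp where "1 = const_mero 1"

definition plus_mero_uhp :: "mero_uhp \<Rightarrow> mero_uhp \<Rightarrow> mero_uhp"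
  where "f + g = mero_of (\<lambda>z. eval_mero f z + eval_mero g z)"

definition minus_mero_uhp :: "mero_uhp \<Rightarrow> mero_uhp \<Rightarrow> mero_uhp"
  where "f - g = mero_of (\<lambda>z. eval_mero f z - eval_mero g z)"

definition uminus_mero_uhp :: "mero_uhp \<Rightarrow> mero_uhp"
  where "- f = mero_of (\<lambda>z. - eval_mero f z)"

definition times_mero_uhp :: "mero_uhp \<Rightarrow> mero_uhp \<Rightarrow> mero_uhp"
  where "f * g = mero_of (\<lambda>z. eval_mero f z * eval_mero g z)"

definition inverse_mero_uhp :: "mero_uhp \<Rightarrow> mero_uhp"
  where "inverse f = mero_of (\<lambda>z. inverse (eval_mero f z))"

definition divide_mero_uhp :: "mero_uhp \<Rightarrow> mero_uhp \<Rightarrow> mero_uhp"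
  where "f div g = mero_of (\<lambda>z. eval_mero f z / eval_mero g z)"

context
  fixes z :: complex
  assumes z: "z \<in> \<H>"
begin

lemma eventually_eval_const_mero: "eventually (\<lambda>w. eval_mero (const_mero c) w = c) (at z)"
  unfolding const_mero_def by (intro eventually_eval_mero_of z meromorphic_intros)

lemma eventually_eval_zero_mero: "eventually (\<lambda>w. eval_mero 0 w = 0) (at z)"
  unfolding zero_mero_uhp_def by (rule eventually_eval_const_mero)

lemma eventually_eval_one_mero: "eventually (\<lambda>w. eval_mero 1 w = 1) (at z)"
  unfolding one_mero_uhp_def by (rule eventually_eval_const_mero)

lemma eventually_eval_plus_mero:
  "eventually (\<lambda>w. eval_mero (f + g) w = eval_mero f w + eval_mero g w) (at z)"
  unfolding plus_mero_uhp_def by (intro eventually_eval_mero_of z meromorphic_intros)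

lemma eventually_eval_minus_mero:
  "eventually (\<lambda>w. eval_mero (f - g) w = eval_mero f w - eval_mero g w) (at z)"
  unfolding minus_mero_uhp_def by (intro eventually_eval_mero_of z meromorphic_intros)

lemma eventually_eval_uminus_mero:
  "eventually (\<lambda>w. eval_mero (- f) w = - eval_mero f w) (at z)"
  unfolding uminus_mero_uhp_def by (intro eventually_eval_mero_of z meromorphic_intros)

lemma eventually_eval_times_mero:
  "eventually (\<lambda>w. eval_mero (f * g) w = eval_mero f w * eval_mero g w) (at z)"
  unfolding times_mero_uhp_def by (intro eventually_eval_mero_of z meromorphic_intros)

lemma eventually_eval_inverse_mero:
  "eventually (\<lambda>w. eval_mero (inverse f) w = inverse (eval_mero f w)) (at z)"
  unfolding inverse_mero_uhp_def by (intro eventually_eval_mero_of z meromorphic_intros)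

lemma eventually_eval_divide_mero:
  "eventually (\<lambda>w. eval_mero (f div g) w = eval_mero f w / eval_mero g w) (at z)"
  unfolding divide_mero_uhp_def by (intro eventually_eval_mero_of z meromorphic_intros)

lemmas eventually_eval_mero =
  eventually_eval_zero_mero eventually_eval_one_mero
  eventually_eval_plus_mero eventually_eval_minus_mero eventually_eval_uminus_mero
  eventually_eval_times_mero eventually_eval_inverse_mero eventually_eval_divide_mero

end

lemma eval_const_mero: "eval_mero (const_mero c) z = (if z \<in> \<H> then c else 0)"
  unfolding const_mero_def by (subst eval_mero_of) auto

lemma eventually_eval_mero_nonzero:
  assumes "f \<noteq> 0" "z \<in> \<H>"
  shows   "eventually (\<lambda>w. eval_mero f w \<noteq> 0) (at z)"
proof (rule ccontr)
  assume "\<not> ?thesis"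
  hence "frequently (\<lambda>w. eval_mero f w = 0) (at z)"
    by (simp add: frequently_def)
  from frequently_eq_meromorphic_imp_constant[OF this eval_mero_nicely_meromorphic _ _ assms(2)]
  have *: "eval_mero f w = 0" if "w \<in> \<H>" for w
    using that by auto
  have "eval_mero f w = eval_mero 0 w" for w
    unfolding zero_mero_uhp_def eval_const_mero using *[of w] eval_mero_outside[of w f] by auto
  hence "f = 0" using eval_mero_inject by blast
  with assms(1) show False by contradiction
qed

instance
proof
  fix f g h :: mero_uhp
  show "f + g + h = f + (g + h)"
  proof (rule mero_uhp_eqI)
    fix z assume z: "z \<in> \<H>"
    show "eventually (\<lambda>w. eval_mero (f + g + h) w = eval_mero (f + (g + h)) w) (at z)"
      using eventually_eval_plus_mero[OF z, of "f + g" h] eventually_eval_plus_mero[OF z, of f g]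
            eventually_eval_plus_mero[OF z, of f "g + h"] eventually_eval_plus_mero[OF z, of g h]
      by eventually_elim simp
  qed
  show "f + g = g + f"
    by (simp add: plus_mero_uhp_def add.commute)
  show "0 + f = f"
  proof (rule mero_uhp_eqI)
    fix z assume z: "z \<in> \<H>"
    show "eventually (\<lambda>w. eval_mero (0 + f) w = eval_mero f w) (at z)"
      using eventually_eval_plus_mero[OF z, of 0 f] eventually_eval_zero_mero[OF z]
      by eventually_elim simp
  qed
  show "- f + f = 0"
  proof (rule mero_uhp_eqI)
    fix z assume z: "z \<in> \<H>"
    show "eventually (\<lambda>w. eval_mero (- f + f) w = eval_mero 0 w) (at z)"
      using eventually_eval_plus_mero[OF z, of "- f" f] eventually_eval_zero_mero[OF z]
            eventually_eval_uminus_mero[OF z, of f]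
      by eventually_elim simp
  qed
  show "f - g = f + - g"
  proof (rule mero_uhp_eqI)
    fix z assume z: "z \<in> \<H>"
    show "eventually (\<lambda>w. eval_mero (f - g) w = eval_mero (f + - g) w) (at z)"
      using eventually_eval_plus_mero[OF z, of f "- g"] eventually_eval_minus_mero[OF z, of f g]
            eventually_eval_uminus_mero[OF z, of g]
      by eventually_elim simp
  qed
  show "f * g * h = f * (g * h)"
  proof (rule mero_uhp_eqI)
    fix z assume z: "z \<in> \<H>"
    show "eventually (\<lambda>w. eval_mero (f * g * h) w = eval_mero (f * (g * h)) w) (at z)"
      using eventually_eval_times_mero[OF z, of "f * g" h] eventually_eval_times_mero[OF z, of f g]
            eventually_eval_times_mero[OF z, of f "g * h"] eventually_eval_times_mero[OF z, of g h]
      by eventually_elim simp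
  qed
  show "f * g = g * f"
    by (simp add: times_mero_uhp_def mult.commute)
  show "1 * f = f"
  proof (rule mero_uhp_eqI)
    fix z assume z: "z \<in> \<H>"
    show "eventually (\<lambda>w. eval_mero (1 * f) w = eval_mero f w) (at z)"
      using eventually_eval_times_mero[OF z, of 1 f] eventually_eval_one_mero[OF z]
      by eventually_elim simp
  qed
  show "(f + g) * h = f * h + g * h"
  proof (rule mero_uhp_eqI)
    fix z assume z: "z \<in> \<H>"
    show "eventually (\<lambda>w. eval_mero ((f + g) * h) w = eval_mero (f * h + g * h) w) (at z)"
      using eventually_eval_times_mero[OF z, of "f + g" h] eventually_eval_plus_mero[OF z, of f g]
            eventually_eval_plus_mero[OF z, of "f * h" "g * h"]
            eventually_eval_times_mero[OF z, of f h] eventually_eval_times_mero[OF z, of g h]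
      by eventually_elim (simp add: algebra_simps)
  qed
  show "(0 :: mero_uhp) \<noteq> 1"
  proof
    assume "(0 :: mero_uhp) = 1"
    hence "eval_mero 0 \<i> = eval_mero 1 \<i>" by simp
    thus False by (simp add: zero_mero_uhp_def one_mero_uhp_def eval_const_mero)
  qed
  show "inverse f * f = 1" if "f \<noteq> 0"
  proof (rule mero_uhp_eqI)
    fix z assume z: "z \<in> \<H>"
    show "eventually (\<lambda>w. eval_mero (inverse f * f) w = eval_mero 1 w) (at z)"
      using eventually_eval_times_mero[OF z, of "inverse f" f]
            eventually_eval_inverse_mero[OF z, of f] eventually_eval_one_mero[OF z]
            eventually_eval_mero_nonzero[OF that z]
      by eventually_elim simp
  qed
  show "f div g = f * inverse g"
  proof (rule mero_uhp_eqI)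
    fix z assume z: "z \<in> \<H>"
    show "eventually (\<lambda>w. eval_mero (f div g) w = eval_mero (f * inverse g) w) (at z)"
      using eventually_eval_times_mero[OF z, of f "inverse g"]
            eventually_eval_inverse_mero[OF z, of g] eventually_eval_divide_mero[OF z, of f g]
      by eventually_elim (simp add: field_simps)
  qed
  show "inverse (0 :: mero_uhp) = 0"
  proof (rule mero_uhp_eqI)
    fix z assume z: "z \<in> \<H>"
    show "eventually (\<lambda>w. eval_mero (inverse 0) w = eval_mero 0 w) (at z)"
      using eventually_eval_inverse_mero[OF z, of 0] eventually_eval_zero_mero[OF z]
      by eventually_elim simp
  qed
qed

end

definition is_subfield :: "'a :: field set \<Rightarrow> bool" where
  "is_subfield K \<longleftrightarrow> 0 \<in> K \<and> 1 \<in> K \<and>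
     (\<forall>a\<in>K. \<forall>b\<in>K. a + b \<in> K \<and> a * b \<in> K) \<and> (\<forall>a\<in>K. - a \<in> K \<and> inverse a \<in> K)"

text \<open>The field \<open>\<complex>(S)\<close> generated by a set \<open>S\<close> of meromorphic functions on \<open>\<H>\<close>.\<close>

definition complex_adjoin :: "mero_uhp set \<Rightarrow> mero_uhp set" where
  "complex_adjoin S = is_subfield hull (range const_mero \<union> S)"


section \<open>Modular functions\<close>

definition SL2Z :: "(int ^ 2 ^ 2) set"
  where "SL2Z = {A. det A = 1}"

definition Gamma_principal :: "nat \<Rightarrow> (int ^ 2 ^ 2) set" where
  "Gamma_principal N = {A \<in> SL2Z. \<forall>i j. [A $ i $ j = mat 1 $ i $ j] (mod int N)}"

definition SL2_F2 :: "(bit ^ 2 ^ 2) monoid" where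
  "SL2_F2 = \<lparr>carrier = {A. det A = 1}, monoid.mult = (**), one = mat 1\<rparr>"

lemma group_SL2_F2: "group SL2_F2"
proof (rule groupI)
  fix x assume "x \<in> carrier SL2_F2"
  hence d: "det x = 1" by (simp add: SL2_F2_def)
  define y :: "bit^2^2"
    where "y = (\<chi> i j. if i = 1 then (if j = 1 then x$2$2 else - x$1$2)
                        else (if j = 1 then - x$2$1 else x$1$1))"
  have "det y = 1" "y ** x = mat 1"
    using d by (auto simp: y_def det_2 vec_eq_iff forall_2 matrix_matrix_mult_def sum_2 mat_def)
  thus "\<exists>y\<in>carrier SL2_F2. y \<otimes>\<^bsub>SL2_F2\<^esub> x = \<one>\<^bsub>SL2_F2\<^esub>"
    by (auto simp: SL2_F2_def)
qed (auto simp: SL2_F2_def det_mul matrix_mul_assoc)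

lemma order_3_subgroup_SL2_F2:
  defines "C3 \<equiv> {mat 1, vector [vector [0, 1], vector [1, 1]], vector [vector [1, 1], vector [1, 0]]}"
  shows "(THE H. subgroup H SL2_F2 \<and> card H = 3) = C3"
proof (rule the_equality)
  interpret group SL2_F2 by (rule group_SL2_F2)
  have card: "card C3 = 3"
    by (simp add: C3_def vec_eq_iff forall_2 mat_def)
  have sub: "subgroup C3 SL2_F2"
    proof
    show "C3 \<subseteq> carrier SL2_F2" by (auto simp: C3_def SL2_F2_def det_2 mat_def)
    show mc: "x \<otimes>\<^bsub>SL2_F2\<^esub> y \<in> C3" if "x \<in> C3" "y \<in> C3" for x y
      using that unfolding C3_def SL2_F2_def
      by (elim insertE emptyE; hypsubst; simp add: vec_eq_iff forall_2 mat_def matrix_matrix_mult_def sum_2)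
    show "\<one>\<^bsub>SL2_F2\<^esub> \<in> C3" by (simp add: C3_def SL2_F2_def)
    show "inv\<^bsub>SL2_F2\<^esub> x \<in> C3" if x: "x \<in> C3" for x
    proof -
      have "x ** x ** x = mat 1"
        using x unfolding C3_def by (elim insertE emptyE; hypsubst; simp add: vec_eq_iff forall_2 mat_def matrix_matrix_mult_def sum_2)
      moreover have "x \<in> carrier SL2_F2" using x by (auto simp: C3_def SL2_F2_def det_2 mat_def)
      ultimately have "inv\<^bsub>SL2_F2\<^esub> x = x \<otimes>\<^bsub>SL2_F2\<^esub> x"
        by (intro inv_equality) (auto simp: SL2_F2_def det_mul)
      thus ?thesis using mc[OF x x] by simp
    qed
  qed
  show "subgroup C3 SL2_F2 \<and> card C3 = 3" using card sub by simp
  fix H assume H: "subgroup H SL2_F2 \<and> card H = 3"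
  have "H \<subseteq> C3"
  proof
    fix x assume x: "x \<in> H"
    interpret H: group "SL2_F2\<lparr>carrier := H\<rparr>"
      using H subgroup_imp_group by blast
    have "x [^]\<^bsub>SL2_F2\<lparr>carrier := H\<rparr>\<^esub> (3::nat) = \<one>\<^bsub>SL2_F2\<lparr>carrier := H\<rparr>\<^esub>"
      using H.pow_order_eq_1[of x] x H by (simp add: Coset.order_def)
    hence c: "x ** x ** x = mat 1"
      by (simp add: numeral_3_eq_3 nat_pow_def SL2_F2_def matrix_mul_assoc)
    show "x \<in> C3"
      using c
      by (cases "x$1$1"; cases "x$1$2"; cases "x$2$1"; cases "x$2$2")
         (simp_all add: C3_def vec_eq_iff forall_2 mat_def matrix_matrix_mult_def sum_2)
  qed
  moreover have "finite C3" by (simp add: C3_def)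
  ultimately show "H = C3" using card H by (simp add: card_subset_eq)
qed

definition Gamma_sup2 :: "(int ^ 2 ^ 2) set" where
  "Gamma_sup2 = {A \<in> SL2Z. map_matrix of_int A \<in> (THE H. subgroup H SL2_F2 \<and> card H = 3)}"

definition moebius :: "int ^ 2 ^ 2 \<Rightarrow> complex \<Rightarrow> complex" where
  "moebius A z = (of_int (A $ 1 $ 1) * z + of_int (A $ 1 $ 2)) /
                 (of_int (A $ 2 $ 1) * z + of_int (A $ 2 $ 2))"

text \<open>
  \<open>f\<close> is, for large imaginary part, a Laurent series with finite principal part in
  \<open>q\<^sup>1\<^sup>/\<^sup>N = exp (2\<pi>iz/N)\<close> for some \<open>N\<close>.
\<close>

definition meromorphic_at_ii_inf :: "(complex \<Rightarrow> complex) \<Rightarrow> bool" where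
  "meromorphic_at_ii_inf f \<longleftrightarrow>
     (\<exists>N::nat. N > 0 \<and> (\<exists>g. g meromorphic_on {0} \<and>
        (\<exists>c. \<forall>z. Im z > c \<longrightarrow> f z = g (exp (2 * of_real pi * \<i> * z / of_nat N)))))"

definition modular_functions :: "(int ^ 2 ^ 2) set \<Rightarrow> mero_uhp set" where
  "modular_functions G =
     {f. (\<forall>A\<in>G. \<forall>z\<in>\<H>. eval_mero f (moebius A z) = eval_mero f z) \<and>
         (\<forall>A\<in>SL2Z. meromorphic_at_ii_inf (\<lambda>z. eval_mero f (moebius A z)))}"

definition theta_a :: "nat \<Rightarrow> complex \<Rightarrow> complex" where
  "theta_a k \<tau> = (\<Sum>\<^sub>\<infinity>n::int. (-1) powi (n + int k + 1) *
     exp (2 * of_real pi * \<i> * (of_int ((14 * n + 7 - 2 * int k)\<^sup>2) / 56) * \<tau>))"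

definition psi7 :: mero_uhp where
  "psi7 = - (mero_of (theta_a 2) * mero_of (theta_a 3) / mero_of (theta_a 1) ^ 2)"

definition upsilon7 :: mero_uhp where
  "upsilon7 = mero_of (theta_a 2) ^ 2 * mero_of (theta_a 3) / mero_of (theta_a 1) ^ 3"


section \<open>The genus of an algebraic function field\<close>

text \<open>
  Normalised discrete valuations of \<open>K\<close> that are trivial on \<open>k\<close>; these are the closed points of the
  nonsingular projective curve over \<open>k\<close> with function field \<open>K\<close>. A valuation is fixed to be
  \<^const>\<open>undefined\<close> outside \<open>K - {0}\<close>, so that each point is counted once.
\<close>

definition places :: "('a, 'b) ring_scheme \<Rightarrow> 'a set \<Rightarrow> ('a \<Rightarrow> int) set" where
  "places K k = {v \<in> extensional (carrier K - {\<zero>\<^bsub>K\<^esub>}).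
     v ` (carrier K - {\<zero>\<^bsub>K\<^esub>}) = UNIV \<and>
     (\<forall>a \<in> carrier K - {\<zero>\<^bsub>K\<^esub>}. \<forall>b \<in> carrier K - {\<zero>\<^bsub>K\<^esub>}.
        v (a \<otimes>\<^bsub>K\<^esub> b) = v a + v b \<and>
        (a \<oplus>\<^bsub>K\<^esub> b \<noteq> \<zero>\<^bsub>K\<^esub> \<longrightarrow> min (v a) (v b) \<le> v (a \<oplus>\<^bsub>K\<^esub> b))) \<and>
     (\<forall>c \<in> k - {\<zero>\<^bsub>K\<^esub>}. v c = 0)}"

definition divisors :: "('a, 'b) ring_scheme \<Rightarrow> 'a set \<Rightarrow> (('a \<Rightarrow> int) \<Rightarrow> int) set" where
  "divisors K k = {D. finite {v. D v \<noteq> 0} \<and> {v. D v \<noteq> 0} \<subseteq> places K k}"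

text \<open>
  Places are counted with degree 1, so this is the degree of a divisor only when \<open>k\<close> is
  algebraically closed; below \<open>k\<close> is always (a copy of) the complex numbers.
\<close>

definition divisor_degree :: "(('a \<Rightarrow> int) \<Rightarrow> int) \<Rightarrow> int" where
  "divisor_degree D = (\<Sum>v | D v \<noteq> 0. D v)"

definition riemann_roch_space ::
    "('a, 'b) ring_scheme \<Rightarrow> 'a set \<Rightarrow> (('a \<Rightarrow> int) \<Rightarrow> int) \<Rightarrow> 'a set" where
  "riemann_roch_space K k D =
     {f \<in> carrier K. f \<noteq> \<zero>\<^bsub>K\<^esub> \<longrightarrow> (\<forall>v \<in> places K k. v f + D v \<ge> 0)}"

text \<open>
  The genus of a function field \<open>K/k\<close> is the maximum of \<open>deg D - \<ell>(D) + 1\<close> over all divisors \<open>D\<close>.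
\<close>

definition has_genus :: "('a, 'b) ring_scheme \<Rightarrow> 'a set \<Rightarrow> nat \<Rightarrow> bool" where
  "has_genus K k g \<longleftrightarrow>
     (\<exists>D \<in> divisors K k. \<exists>l. ring.dimension K l k (riemann_roch_space K k D) \<and>
        divisor_degree D - int l + 1 = int g) \<and>
     (\<forall>D \<in> divisors K k. \<forall>l. ring.dimension K l k (riemann_roch_space K k D) \<longrightarrow>
        divisor_degree D - int l + 1 \<le> int g)"


section \<open>Plane curves\<close>

text \<open>
  Polynomials in \<open>\<complex>[X,Y]\<close> are elements of \<^typ>\<open>complex poly poly\<close>, with \<open>Y\<close> the outer variable.
  The function field of an irreducible curve \<open>F = 0\<close> is the residue field of the local ring of the
  affine plane at (the generic point of) the curve, that is, the fraction field of \<open>\<complex>[X,Y]/(F)\<close>.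
\<close>

definition var_X :: "complex poly poly" where "var_X = [:[:0, 1:]:]"

definition var_Y :: "complex poly poly" where "var_Y = [:0, 1:]"

definition curve_local_ring :: "complex poly poly \<Rightarrow> complex poly poly fract ring" where
  "curve_local_ring F =
     \<lparr>carrier = {Fract a b | a b. \<not> F dvd b}, monoid.mult = (*), one = 1, zero = 0, add = (+)\<rparr>"

definition curve_maximal_ideal :: "complex poly poly \<Rightarrow> complex poly poly fract set" where
  "curve_maximal_ideal F = {Fract a b | a b. F dvd a \<and> \<not> F dvd b}"

definition curve_function_field :: "complex poly poly \<Rightarrow> complex poly poly fract set ring" where
  "curve_function_field F = curve_local_ring F Quot curve_maximal_ideal F"

definition curve_constants :: "complex poly poly \<Rightarrow> complex poly poly fract set set" where
  "curve_constants F =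
     range (\<lambda>c. curve_maximal_ideal F +>\<^bsub>curve_local_ring F\<^esub> Fract [:[:c:]:] 1)"

text \<open>The normalization of the (projective closure of the) plane curve \<open>F = 0\<close> has genus \<open>g\<close>.\<close>

definition normalization_has_genus :: "complex poly poly \<Rightarrow> nat \<Rightarrow> bool" where
  "normalization_has_genus F g \<longleftrightarrow>
     irreducible F \<and> has_genus (curve_function_field F) (curve_constants F) g"

definition curve_eqn :: "'a :: comm_ring_1 \<Rightarrow> 'a \<Rightarrow> 'a" where
  "curve_eqn x y =
     64 * y ^ 28 - x ^ 6 * y ^ 21 - 52 * x ^ 4 * y ^ 21 - 1520 * x ^ 2 * y ^ 21 - 18496 * y ^ 21
     - 84 * x ^ 4 * y ^ 14 + 5264 * x ^ 2 * y ^ 14 - 3648 * y ^ 14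
     - 1072 * x ^ 2 * y ^ 7 + 64 * y ^ 7 + 16 * x ^ 2"

end

theory Submission
  imports Defs
begin

text \<open>
  Jacobi's product turns the theta quotients into quotients of the Weierstrass sigma function at the points of
  order 7 of \<open>\<complex>/(\<int> + 7\<tau>\<int>)\<close>. So \<open>\<upsilon>\<close> is a quotient of differences of the Weierstrass function at these points,
  and the three-term relation gives Klein's equation \<open>\<psi>\<^sup>7 = \<upsilon>\<^sup>4(\<upsilon> - 1)\<close>; \<open>\<Delta>\<close> is, up to a factor, the product of the
  differences of the values at the half periods. This gives the behaviour under \<open>SL\<^sub>2(\<int>)\<close> and at the cusps.

  A modular function for the intersection group without poles where \<open>\<upsilon>\<close> is finite and vanishing at the cusp
  \<open>\<infinity>\<close> is 0, so functions that are regular where \<open>\<upsilon>\<close> is finite are controlled by their order at \<open>\<infinity>\<close>, and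
  counting dimensions shows that any 15 modular functions are dependent over \<open>\<complex>(\<upsilon>)\<close>. The 14 functions \<open>bb m\<close>,
  normalised powers of a 14th root of a polynomial in \<open>\<upsilon>\<close>, have orders at \<open>\<infinity>\<close> that are distinct modulo 14. They
  form a basis, and an integral one since translations separate them. Hence \<open>\<infinity>\<close> is the only pole of \<open>\<upsilon>\<close>, the
  orders of regular functions at \<open>\<infinity>\<close> omit exactly 17 numbers, and comparing an arbitrary divisor with a multiple
  of \<open>\<infinity>\<close> yields Riemann's inequality with \<open>g = 17\<close>. Finally, the orders at \<open>\<infinity>\<close> and at a zero of \<open>\<upsilon>\<close> show that
  \<open>1, y, \<dots>, y\<^sup>2\<^sup>7\<close> are independent over \<open>\<complex>(x)\<close>, so the equation is irreducible and the curve has function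
  field \<open>\<complex>(x, y)\<close>.
\<close>

text \<open>The genus refers to all discrete valuations of the function field, whereas analysis sees
  only points and cusps. The integral basis is the bridge: a function without poles at the points
  and cusps where \<open>ups7\<close> is finite is a combination of the \<open>bb m\<close> over
  \<open>C[ups7]\<close>, hence integral over \<open>C[ups7]\<close>, hence nonnegative at every
  valuation at which \<open>ups7\<close> is nonnegative. The number 14 is 7 * 2: \<open>psi7\<close>
  contributes a 7th root and \<open>Delta7\<close> a square root over \<open>C(ups7)\<close>. With q
  = exp(2 pi i tau), the parameter at infinity is q^(1/14), in which \<open>ups7\<close> has order
  -14. So the whole degree sits at one place, and counting pole orders at that place does the work
  of the Riemann-Roch theorem. The number 17 is the sum over m < 14 of floor(\<open>ww m\<close> /
  14), where \<open>ww m\<close> is the pole order of \<open>bb m\<close>. Expansions of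
  \<open>psi7\<close> and \<open>Delta7\<close> at the other cusps are avoided: both are roots of
  rational functions of \<open>ups7\<close>, and a root of a function meromorphic at a cusp is
  meromorphic there.\<close>

abbreviation (input) cst :: "complex \<Rightarrow> mero_uhp" where "cst \<equiv> const_mero"

abbreviation (input) evm :: "mero_uhp \<Rightarrow> complex \<Rightarrow> complex" where "evm \<equiv> eval_mero"

abbreviation (input) ups7 :: mero_uhp where "ups7 \<equiv> upsilon7"

notation (input) tendsto (infixr "--->" 55)

section \<open>The Weierstrass sigma function\<close>

definition ee :: "complex => complex" where
 "ee z = exp (2 * of_real pi * \<i> * z)"

lemma ee_add: "ee (a + b) = ee a * ee b"
 and ee_diff: "ee (a - b) = ee a / ee b"
 and ee_minus: "ee (- a) = inverse (ee a)"
 and ee_0 [simp]: "ee 0 = 1"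
 and ee_nonzero [simp]: "ee a ~= 0"
 by (simp_all add: ee_def algebra_simps exp_add exp_diff exp_minus)

lemma ee_of_nat_mult: "ee (of_nat n * a) = ee a ^ n"
 by (simp add: ee_def exp_of_nat_mult [symmetric] mult_ac)

lemma ee_eq_1_iff: "ee z = 1 \<longleftrightarrow> (EX n::int. z = of_int n)"
proof
 assume "ee z = 1"
 then obtain n :: int where n: "Re (2 * of_real pi * \<i> * z) = 0" "Im (2 * of_real pi * \<i> * z) = of_int (2 * n) * pi"
  unfolding ee_def exp_eq_1 by blast
 hence "z = of_int n" by (auto simp: complex_eq_iff)
 thus "EX n::int. z = of_int n" ..
next
 assume "EX n::int. z = of_int n"
 then obtain n :: int where "z = of_int n" ..
 thus "ee z = 1" unfolding ee_def exp_eq_1 by (intro conjI exI[of _ n]) auto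
qed

lemma ee_of_int [simp]: "ee (of_int n) = 1"
 by (subst ee_eq_1_iff) auto

lemma ee_half: "ee (1 / 2) = - 1"
 by (simp add: ee_def)

lemma norm_ee: "norm (ee z) = exp (- 2 * pi * Im z)"
 by (simp add: ee_def)

lemma norm_ee_less_1: "z : \<H> ==> norm (ee z) < 1"
 by (simp add: norm_ee upper_half_plane_def)

lemma ee_holomorphic [holomorphic_intros]:
 "f holomorphic_on S ==> (%s. ee (f s)) holomorphic_on S"
 unfolding ee_def by (intro holomorphic_intros)


text \<open>The q-Pochhammer symbol (x; q)_infinity. As a bare limit of partial products it is
  directly accessible to uniform limits in x and q.\<close>

definition qpoch :: "complex => complex => complex" where
 "qpoch x q = lim (%n. \<Prod>k<n. 1 - x * q ^ k)"

text \<open>On a compact set |x| and |q| attain their maxima, the latter below 1, so one geometric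
  series dominates the deviations of all factors from 1.\<close>

lemma qpoch_uniform_limit:
 fixes x q :: "complex => complex"
 assumes A: "compact A" and x: "continuous_on A x" and q: "continuous_on A q"
  and q1: "!!s. s : A ==> norm (q s) < 1"
 shows "uniform_limit A (%n s. \<Prod>k<n. 1 - x s * q s ^ k) (%s. qpoch (x s) (q s)) sequentially"
proof (cases "A = {}")
 case False
 have "continuous_on A (%s. norm (q s))" by (intro continuous_intros q)
 from continuous_attains_sup[OF A False this] obtain s0
  where s0: "s0 : A" "!!s. s : A ==> norm (q s) <= norm (q s0)" by blast
 have "continuous_on A (%s. norm (x s))" by (intro continuous_intros x)
 from continuous_attains_sup[OF A False this] obtain s1
  where s1: "s1 : A" "!!s. s : A ==> norm (x s) <= norm (x s1)" by blast
 have "uniformly_convergent_on A (%N s. \<Sum>n<N. norm (- (x s * q s ^ n)))"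
 proof (rule Weierstrass_m_test')
  show "norm (norm (- (x s * q s ^ n))) <= norm (x s1) * norm (q s0) ^ n" if "s : A" for s n
   using s0(2)[OF that] s1(2)[OF that] by (auto simp: norm_mult norm_power intro!: mult_mono power_mono)
  show "summable (%n. norm (x s1) * norm (q s0) ^ n)"
   using q1[OF s0(1)] by (intro summable_mult summable_geometric) auto
 qed
 hence "uniformly_convergent_on A (%N s. \<Prod>n<N. 1 + (- (x s * q s ^ n)))"
  by (intro uniformly_convergent_on_prod A continuous_intros x q)
 thus ?thesis
  unfolding qpoch_def by (simp add: uniformly_convergent_uniform_limit_iff)
qed auto

lemma qpoch_LIMSEQ:
 assumes "norm q < 1"
 shows   "(%n. \<Prod>k<n. 1 - x * q ^ k) \<longlonglongrightarrow> qpoch x q"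
 using tendsto_uniform_limitI[OF qpoch_uniform_limit[of "{0}" "%_. x" "%_. q"], of 0] assms
 by simp

lemma qpoch_holomorphic:
 assumes "open S" "x holomorphic_on S" "q holomorphic_on S" "!!s. s : S ==> norm (q s) < 1"
 shows   "(%s. qpoch (x s) (q s)) holomorphic_on S"
proof (rule holomorphic_uniform_sequence[OF assms(1)])
 show "(%s. \<Prod>k<n. 1 - x s * q s ^ k) holomorphic_on S" for n
  by (intro holomorphic_intros assms)
 fix s assume "s : S"
 then obtain d where d: "d > 0" "cball s d <= S"
  using assms(1) open_contains_cball by blast
 have "uniform_limit (cball s d) (%n s. \<Prod>k<n. 1 - x s * q s ^ k) (%s. qpoch (x s) (q s)) sequentially"
  by (intro qpoch_uniform_limit)
    (use d assms in \<open>auto intro!: holomorphic_on_imp_continuous_on intro: holomorphic_on_subset\<close>)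
 thus "EX d>0. cball s d <= S \<and>
     uniform_limit (cball s d) (%n s. \<Prod>k<n. 1 - x s * q s ^ k) (%s. qpoch (x s) (q s)) sequentially"
  using d by blast
qed

lemma qpoch_rec:
 assumes "norm q < 1"
 shows   "qpoch x q = (1 - x) * qpoch (q * x) q"
proof -
 have "(%n. \<Prod>k<Suc n. 1 - x * q ^ k) \<longlonglongrightarrow> qpoch x q"
  using qpoch_LIMSEQ[OF assms] by (rule LIMSEQ_Suc)
 also have "(%n. \<Prod>k<Suc n. 1 - x * q ^ k) = (%n. (1 - x) * (\<Prod>k<n. 1 - (q * x) * q ^ k))"
  by (simp add: prod.lessThan_Suc_shift mult_ac del: prod.lessThan_Suc)
 finally have "(%n. (1 - x) * (\<Prod>k<n. 1 - (q * x) * q ^ k)) \<longlonglongrightarrow> qpoch x q" .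
 moreover have "(%n. (1 - x) * (\<Prod>k<n. 1 - (q * x) * q ^ k)) \<longlonglongrightarrow> (1 - x) * qpoch (q * x) q"
  by (intro tendsto_intros qpoch_LIMSEQ assms)
 ultimately show ?thesis using LIMSEQ_unique by blast
qed

lemma qpoch_nonzero:
 assumes q: "norm q < 1" and nz: "!!n. x * q ^ n ~= 1"
 shows   "qpoch x q ~= 0"
proof -
 have "summable (%n. norm x * norm q ^ n)"
  using q by (intro summable_mult summable_geometric) auto
 hence "summable (%n. norm ((1 - x * q ^ n) - 1))"
  by (simp add: norm_mult norm_power)
 hence "abs_convergent_prod (%n. 1 - x * q ^ n)"
  by (rule summable_imp_abs_convergent_prod)
 hence conv: "convergent_prod (%n. 1 - x * q ^ n)"
  by (rule abs_convergent_prod_imp_convergent_prod)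
 have "prodinf (%n. 1 - x * q ^ n) ~= 0"
  by (rule prodinf_nonzero[OF conv]) (use nz in auto)
 moreover have "(%n. \<Prod>k<n. 1 - x * q ^ k) \<longlonglongrightarrow> prodinf (%n. 1 - x * q ^ n)"
  using convergent_prod_LIMSEQ[OF conv] by (subst (asm) LIMSEQ_lessThan_iff_atMost [symmetric])
 ultimately show ?thesis
  using LIMSEQ_unique[OF qpoch_LIMSEQ[OF q, of x]] by metis
qed

lemma qpoch_0_right [simp]: "qpoch x 0 = 1 - x"
proof -
 have "(\<Prod>k<Suc n. 1 - x * 0 ^ k) = 1 - x" for n
  by (subst prod.lessThan_Suc_shift) simp
 hence "(%n. \<Prod>k<Suc n. 1 - x * 0 ^ k) \<longlonglongrightarrow> 1 - x" by (simp del: prod.lessThan_Suc)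
 moreover have "(%n. \<Prod>k<Suc n. 1 - x * 0 ^ k) \<longlonglongrightarrow> qpoch x 0"
  by (rule LIMSEQ_Suc) (rule qpoch_LIMSEQ, simp)
 ultimately show ?thesis
  by (rule LIMSEQ_unique[symmetric])
qed

lemma qpoch_0_left [simp]: "qpoch 0 q = 1"
 by (simp add: qpoch_def)

text \<open>The product of the Weierstrass sigma function of the lattice Z + TZ, without its factor
  exp(eta z^2 / 2) and with derivative 1 at 0. Dropping that factor makes the function antiperiodic
  under z -> z + 1.\<close>

definition sig :: "complex => complex => complex" where
 "sig T z = ee (- z / 2) * (1 - ee z) * qpoch (ee (T + z)) (ee T) * qpoch (ee (T - z)) (ee T) /
       (- (2 * of_real pi * \<i>) * qpoch (ee T) (ee T) ^ 2)"

lemma qpoch_ee_nonzero: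
 assumes "T : \<H>"
 shows   "qpoch (ee T) (ee T) ~= 0"
proof (rule qpoch_nonzero)
 have n: "norm (ee T) < 1" by (rule norm_ee_less_1) fact
 thus "norm (ee T) < 1" .
 have "norm (ee T * ee T ^ n) < 1" for n
  using power_less_one_iff[of "norm (ee T)" "Suc n"] n by (simp add: norm_mult norm_power)
 thus "ee T * ee T ^ n ~= 1" for n
  by (metis norm_one less_irrefl)
qed

lemma sig_holomorphic [holomorphic_intros]:
 assumes "open S" "t holomorphic_on S" "z holomorphic_on S" "!!s. s : S ==> t s : \<H>"
 shows   "(%s. sig (t s) (z s)) holomorphic_on S"
 unfolding sig_def
 by (intro holomorphic_intros qpoch_holomorphic assms) 
   (use assms in \<open>auto simp: qpoch_ee_nonzero intro: norm_ee_less_1\<close>)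

lemma sig_minus: "sig T (- z) = - sig T z"
proof -
 have "ee (z / 2) * (1 - ee (- z)) = - (ee (- z / 2) * (1 - ee z))"
 proof -
  have "ee z = ee (z / 2) * ee (z / 2)" by (simp flip: ee_add)
  thus ?thesis by (simp add: ee_minus field_simps)
 qed
 thus ?thesis unfolding sig_def
  by (simp add: mult.assoc mult.left_commute)
qed

lemma sig_0 [simp]: "sig T 0 = 0"
 by (simp add: sig_def)

lemma sig_plus_1: "sig T (z + 1) = - sig T z"
proof -
 have 1: "ee (z + 1) = ee z" "ee (T + (z + 1)) = ee (T + z)" "ee (T - (z + 1)) = ee (T - z)"
  using ee_of_int[of 1] by (simp_all add: ee_add ee_diff)
 have "ee (- (z + 1) / 2) = ee (- z / 2) * inverse (ee (1 / 2))"
  by (simp flip: ee_minus ee_add add: add_divide_distrib diff_divide_distrib)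
 thus ?thesis unfolding sig_def 1 by (simp add: ee_half)
qed

text \<open>The shift by \<open>T\<close> takes the leading factor off the first infinite product
  and adds one to the second.\<close>

lemma sig_plus_tau:
 assumes "T : \<H>"
 shows   "sig T (z + T) = - ee (- T / 2 - z) * sig T z"
proof -
 have n: "norm (ee T) < 1" by (rule norm_ee_less_1) fact
 have 1: "(1 - ee (T + z)) * qpoch (ee (T + (z + T))) (ee T) = qpoch (ee (T + z)) (ee T)"
  using qpoch_rec[OF n, of "ee (T + z)"] by (simp add: ee_add mult_ac flip: ee_add)
 have 2: "qpoch (ee (- z)) (ee T) = (1 - ee (- z)) * qpoch (ee (T - z)) (ee T)"
  using qpoch_rec[OF n, of "ee (- z)"] by (simp add: ee_add ee_diff ee_minus divide_inverse)
 have 3: "ee (- (z + T) / 2) * (1 - ee (- z)) = - ee (- T / 2 - z) * (ee (- z / 2) * (1 - ee z))"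
 proof -
  have "ee (- (z + T) / 2) = ee (- z / 2) * ee (- T / 2)"
   by (simp flip: ee_add add: add_divide_distrib diff_divide_distrib)
  moreover have "ee (- T / 2 - z) * ee z = ee (- T / 2)" "ee (- z) = inverse (ee z)"
   by (simp_all add: ee_diff ee_minus)
  moreover have "ee (- T / 2 - z) = ee (- T / 2) * inverse (ee z)"
   by (simp only: ee_diff divide_inverse)
  ultimately show ?thesis by (simp add: algebra_simps)
 qed
 have "ee (- (z + T) / 2) * (1 - ee (z + T)) * qpoch (ee (T + (z + T))) (ee T) * qpoch (ee (T - (z + T))) (ee T)
   = ee (- (z + T) / 2) * ((1 - ee (T + z)) * qpoch (ee (T + (z + T))) (ee T)) * qpoch (ee (- z)) (ee T)"
  by (simp add: add_ac)
 also have "\<dots> = (ee (- (z + T) / 2) * (1 - ee (- z))) * (qpoch (ee (T + z)) (ee T) * qpoch (ee (T - z)) (ee T))"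
  unfolding 1 2 by (simp add: mult_ac)
 also have "\<dots> = - ee (- T / 2 - z) * (ee (- z / 2) * (1 - ee z) * qpoch (ee (T + z)) (ee T) * qpoch (ee (T - z)) (ee T))"
  unfolding 3 by (simp add: mult_ac)
 finally show ?thesis unfolding sig_def by simp
qed

lemma quasi_period_1:
 fixes f :: "complex => complex"
 assumes "!!z. f (z + 1) = - f z"
 shows   "f (z + of_int m) = ee (of_int m / 2) * f z"
proof (induction m rule: int_induct[where k = 0])
 case (step1 i)
 have "f (z + of_int (i + 1)) = - f (z + of_int i)"
  using assms[of "z + of_int i"] by (simp add: add_ac)
 also have "\<dots> = ee (of_int (i + 1) / 2) * f z"
  unfolding step1 by (simp add: add_divide_distrib ee_add ee_half)
 finally show ?case .
next
 case (step2 i)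
 have "f (z + of_int (i - 1)) = - f (z + of_int i)"
  using assms[of "z + of_int (i - 1)"] by (simp add: add_ac)
 also have "\<dots> = ee (of_int (i - 1) / 2) * f z"
  unfolding step2 by (simp add: diff_divide_distrib ee_diff ee_half)
 finally show ?case .
qed auto

lemma quasi_period_tau:
 fixes f :: "complex => complex"
 assumes f: "!!z. f (z + T) = - ee (- T / 2 - z) * f z"
 shows   "f (z + of_int n * T) = ee (of_int n / 2 - of_int n ^ 2 * T / 2 - of_int n * z) * f z"
proof (induction n rule: int_induct[where k = 0])
 case (step1 i)
 have "f (z + of_int (i + 1) * T) = - ee (- T / 2 - (z + of_int i * T)) * f (z + of_int i * T)"
  using f[of "z + of_int i * T"] by (simp add: algebra_simps)
 also have "\<dots> = ee (1 / 2 + (- T / 2 - (z + of_int i * T)) + (of_int i / 2 - of_int i ^ 2 * T / 2 - of_int i * z)) * f z"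
  unfolding step1 by (simp add: ee_add ee_half)
 also have "1 / 2 + (- T / 2 - (z + of_int i * T)) + (of_int i / 2 - of_int i ^ 2 * T / 2 - of_int i * z)
   = of_int (i + 1) / 2 - of_int (i + 1) ^ 2 * T / 2 - of_int (i + 1) * z"
  by (simp add: field_simps power2_eq_square)
 finally show ?case .
next
 case (step2 i)
 have "f (z + of_int i * T) = - ee (- T / 2 - (z + of_int (i - 1) * T)) * f (z + of_int (i - 1) * T)"
  using f[of "z + of_int (i - 1) * T"] by (simp add: algebra_simps)
 hence "f (z + of_int (i - 1) * T) = f (z + of_int i * T) * inverse (ee (1 / 2) * ee (- T / 2 - (z + of_int (i - 1) * T)))"
  by (simp add: ee_half)
 also have "\<dots> = ee (- (1 / 2 + (- T / 2 - (z + of_int (i - 1) * T))) + (of_int i / 2 - of_int i ^ 2 * T / 2 - of_int i * z)) * f z"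
  unfolding step2 ee_add[of "- (1 / 2 + (- T / 2 - (z + of_int (i - 1) * T)))"] ee_minus ee_add[of "1 / 2"] by (simp only: mult_ac)
 also have "- (1 / 2 + (- T / 2 - (z + of_int (i - 1) * T))) + (of_int i / 2 - of_int i ^ 2 * T / 2 - of_int i * z)
   = of_int (i - 1) / 2 - of_int (i - 1) ^ 2 * T / 2 - of_int (i - 1) * z"
  by (simp add: field_simps power2_eq_square)
 finally show ?case .
qed auto

text \<open>Kept for an arbitrary \<open>f\<close> with the quasi-periods of \<open>sig T\<close>,
  because it is also applied to functions that are only later recognised as multiples of
  \<open>sig T\<close>.\<close>

lemma quasi_period:
 fixes f :: "complex => complex"
 assumes "!!z. f (z + 1) = - f z" "!!z. f (z + T) = - ee (- T / 2 - z) * f z"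
 shows   "f (z + of_int m + of_int n * T) = ee (of_int (m + n) / 2 - of_int n ^ 2 * T / 2 - of_int n * z) * f z"
proof -
 have "f (z + of_int m + of_int n * T) = ee (of_int n / 2 - of_int n ^ 2 * T / 2 - of_int n * (z + of_int m)) * (ee (of_int m / 2) * f z)"
  by (subst quasi_period_tau[of f, OF assms(2)], subst quasi_period_1[of f, OF assms(1)]) simp
 also have "\<dots> = ee ((of_int (m + n) / 2 - of_int n ^ 2 * T / 2 - of_int n * z) - of_int (m * n)) * f z"
  by (simp flip: ee_add mult.assoc add: algebra_simps add_divide_distrib)
 also have "\<dots> = ee (of_int (m + n) / 2 - of_int n ^ 2 * T / 2 - of_int n * z) * f z"
  by (subst ee_diff) (simp only: ee_of_int div_by_1)
 finally show ?thesis by simp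
qed

lemma sig_lattice:
 assumes "T : \<H>"
 shows   "sig T (z + of_int m + of_int n * T) = ee (of_int (m + n) / 2 - of_int n ^ 2 * T / 2 - of_int n * z) * sig T z"
 using quasi_period[of "sig T" T z m n] sig_plus_1 sig_plus_tau[OF assms] by simp

lemma sig_eq_0_iff:
 assumes "T : \<H>"
 shows   "sig T z = 0 \<longleftrightarrow> (EX m n. z = of_int m + of_int n * T)"
proof
 assume "EX m n. z = of_int m + of_int n * T"
 then obtain m n where z: "z = of_int m + of_int n * T" by blast
 show "sig T z = 0" using sig_lattice[OF assms, of 0 m n] by (simp add: z)
next
 assume *: "sig T z = 0"
 have n: "norm (ee T) < 1" by (rule norm_ee_less_1) fact
 have pow: "ee w * ee T ^ k = ee (of_nat k * T + w)" for w k
  by (simp add: ee_add ee_of_nat_mult)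
 from * consider "ee z = 1" | "qpoch (ee (T + z)) (ee T) = 0" | "qpoch (ee (T - z)) (ee T) = 0"
  using qpoch_ee_nonzero[OF assms] unfolding sig_def by auto
 thus "EX m n. z = of_int m + of_int n * T"
 proof cases
  case 1
  then obtain m where "z = of_int m" by (auto simp: ee_eq_1_iff)
  thus ?thesis by (intro exI[of _ m] exI[of _ 0]) auto
 next
  case 2
  then obtain k where "ee (T + z) * ee T ^ k = 1" using qpoch_nonzero[OF n] by blast
  then obtain m where "of_nat k * T + (T + z) = of_int m" by (auto simp: ee_eq_1_iff pow)
  hence "z = of_int m + of_int (- int k - 1) * T" by (simp add: algebra_simps)
  thus ?thesis by blast
 next
  case 3
  then obtain k where "ee (T - z) * ee T ^ k = 1" using qpoch_nonzero[OF n] by blast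
  then obtain m where "of_nat k * T + (T - z) = of_int m" by (auto simp: ee_eq_1_iff pow)
  hence "z = of_int (- m) + of_int (int k + 1) * T" by (simp add: algebra_simps)
  thus ?thesis by blast
 qed
qed

lemma sig_deriv_0:
 assumes "T : \<H>"
 shows   "(sig T has_field_derivative 1) (at 0)"
proof -
 define h where "h = (%z. ee (- z / 2) * qpoch (ee (T + z)) (ee T) * qpoch (ee (T - z)) (ee T) /
       (- (2 * of_real pi * \<i>) * qpoch (ee T) (ee T) ^ 2))"
 have "h holomorphic_on UNIV" unfolding h_def
  by (intro holomorphic_intros qpoch_holomorphic) (use assms in \<open>auto simp: qpoch_ee_nonzero norm_ee_less_1\<close>)
 then obtain h' where h': "(h has_field_derivative h') (at 0)"
  by (meson UNIV_I holomorphic_derivI open_UNIV)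
 have "((%z. 1 - ee z) has_field_derivative (- (2 * of_real pi * \<i>))) (at 0)"
  unfolding ee_def by (auto intro!: derivative_eq_intros)
 from DERIV_mult[OF this h'] have "((%z. (1 - ee z) * h z) has_field_derivative (- (2 * of_real pi * \<i>) * h 0)) (at 0)"
  by simp
 moreover have "- (2 * of_real pi * \<i>) * h 0 = 1"
  using qpoch_ee_nonzero[OF assms] by (simp add: h_def power2_eq_square)
 moreover have "(%z. (1 - ee z) * h z) = sig T"
  by (auto simp: fun_eq_iff h_def sig_def)
 ultimately show ?thesis by simp
qed

lemma sig_not_zero_somewhere:
 assumes "T : \<H>"
 shows   "sig T (T / 2) ~= 0"
proof
 assume "sig T (T / 2) = 0"
 then obtain m n where "T / 2 = of_int m + of_int n * T" using sig_eq_0_iff[OF assms] by blast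
 hence "Im T / 2 = of_int n * Im T" by (auto simp: complex_eq_iff)
 hence "of_int (2 * n) = (1::real)" using assms by (simp add: upper_half_plane_def field_simps)
 hence "2 * n = 1" by linarith
 thus False by presburger
qed

lemma sig_deriv_nonzero:
 assumes "T : \<H>" "sig T a = 0"
 obtains c where "c ~= 0" "(sig T has_field_derivative c) (at a)"
proof -
 obtain m n where a: "a = of_int m + of_int n * T" using assms(2) sig_eq_0_iff[OF assms(1), of a] by auto
 define g where "g = (%z. ee (of_int (m + n) / 2 - of_int n ^ 2 * T / 2 - of_int n * z))"
 have "g holomorphic_on UNIV" unfolding g_def by (intro holomorphic_intros) auto
 then obtain g' where g': "(g has_field_derivative g') (at 0)"
  by (meson UNIV_I holomorphic_derivI open_UNIV)
 have "((%z. g z * sig T z) has_field_derivative g 0) (at 0)"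
  using DERIV_mult[OF g' sig_deriv_0[OF assms(1)]] by simp
 also have "(%z. g z * sig T z) = (%z. sig T (a + z))"
  using sig_lattice[OF assms(1)] by (simp add: g_def a add_ac)
 finally have "(sig T has_field_derivative g 0) (at a)"
  using DERIV_at_within_shift[of "sig T" "g 0" a 0 UNIV] by simp
 thus ?thesis using that[of "g 0"] by (simp add: g_def)
qed

section \<open>Division by sigma and Liouville's theorem\<close>

lemma sig_isolated_zeros:
 assumes "T : \<H>"
 shows   "EX r>0. ALL w:ball z r - {z}. sig T (w - a) ~= 0"
proof (cases "sig T (z - a) = 0")
 case True
 have h: "(%w. sig T (w - a)) holomorphic_on UNIV"
  by (intro holomorphic_intros) (use assms in auto)
 have "sig T ((T / 2 + a) - a) ~= 0" using sig_not_zero_somewhere[OF assms] by simp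
 then obtain r where "r > 0" "!!w. w : ball z r - {z} ==> sig T (w - a) ~= 0"
  using isolated_zeros[OF h open_UNIV connected_UNIV UNIV_I True UNIV_I, of "T / 2 + a"] by metis
 thus ?thesis by blast
next
 case False
 have "isCont (%w. sig T (w - a)) z"
  by (rule continuous_on_interior[of UNIV], rule holomorphic_on_imp_continuous_on)
    (use assms in \<open>auto intro!: holomorphic_intros\<close>)
 from continuous_at_avoid[OF this False] obtain e where "e > 0" "!!y. dist z y < e ==> sig T (y - a) ~= 0"
  by metis
 thus ?thesis by (intro exI[of _ e]) auto
qed

text \<open>The common factor is nonzero on a punctured disc around z, so the two continuous
  functions agree there and hence at the centre.\<close>

lemma sig_cancel:
 assumes "T : \<H>" "continuous_on UNIV g" "continuous_on UNIV h"
  and "!!z. g z * sig T (z - a) = h z * sig T (z - a)"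
 shows "g z = h z"
proof -
 obtain r where r: "r > 0" "!!w. w : ball z r - {z} ==> sig T (w - a) ~= 0"
  using sig_isolated_zeros[OF assms(1)] by blast
 have "eventually (%w. w : ball z r - {z}) (at z)"
  using r(1) by (intro eventually_at_in_open) auto
 hence ev: "eventually (%w. g w = h w) (at z)"
  by eventually_elim (use r(2) assms(4) in force)
 have "(g ---> g z) (at z)" "(h ---> h z) (at z)"
  using assms(2,3) by (auto simp: continuous_on_def)
 moreover from this(1) ev have "(h ---> g z) (at z)" by (rule Lim_transform_eventually)
 ultimately show ?thesis using tendsto_unique by (metis trivial_limit_at)
qed

text \<open>The zeros of sigma are simple, so the quotient has only removable singularities;
  l'Hopital's rule supplies its value there.\<close>

lemma sig_division:
 assumes t: "T : \<H>" and f: "f holomorphic_on UNIV"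
  and z: "!!z. sig T (z - a) = 0 ==> f z = 0"
 obtains g where "g holomorphic_on UNIV" "!!z. f z = g z * sig T (z - a)"
proof -
 define s where "s = (%z. sig T (z - a))"
 have s: "s holomorphic_on UNIV" unfolding s_def by (intro holomorphic_intros) (use t in auto)
 define g where "g = (%z. if s z = 0 then deriv f z / deriv s z else f z / s z)"
 have sd: "deriv s z ~= 0" if sz: "s z = 0" for z
 proof -
  obtain c where c: "c ~= 0" "(sig T has_field_derivative c) (at (z - a))"
   using sig_deriv_nonzero[OF t, of "z - a"] sz unfolding s_def by metis
  have "((%z. z - a) has_field_derivative 1) (at z)" by (auto intro!: derivative_eq_intros)
  from DERIV_chain2[of "sig T" c "%z. z - a" z 1 UNIV, OF c(2) this]
  have "(s has_field_derivative c) (at z)" by (simp add: s_def)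
  thus ?thesis using c(1) DERIV_imp_deriv by blast
 qed
 have "g holomorphic_on ball z r" if r: "ALL w:ball z r - {z}. s w ~= 0" "r > 0" for z r
 proof (rule no_isolated_singularity'[of "{z}"])
  have "(%w. f w / s w) holomorphic_on ball z r - {z}"
   by (intro holomorphic_intros holomorphic_on_subset[OF f] holomorphic_on_subset[OF s]) (use r in auto)
  also have "?this \<longleftrightarrow> g holomorphic_on ball z r - {z}"
   using r by (intro holomorphic_cong) (auto simp: g_def)
  finally show "g holomorphic_on ball z r - {z}" .
  fix y assume "y : {z}"
  hence [simp]: "y = z" by simp
  have ev: "eventually (%w. f w / s w = g w) (at z)"
  proof -
   have "eventually (%w. w : ball z r - {z}) (at z)"
    using r(2) by (intro eventually_at_in_open) auto
   thus ?thesis by eventually_elim (use r(1) in \<open>auto simp: g_def\<close>)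
  qed
  have "((%w. f w / s w) ---> g z) (at z)"
  proof (cases "s z = 0")
   case True
   show ?thesis
   proof (rule lhopital_complex_simple)
    show "(f has_field_derivative deriv f z) (at z)" "(s has_field_derivative deriv s z) (at z)"
     using f s by (meson UNIV_I holomorphic_derivI open_UNIV)+
    show "f z = 0" using z True by (simp add: s_def)
   qed (use True sd in \<open>auto simp: g_def\<close>)
  next
   case False
   have "(f ---> f z) (at z)" "(s ---> s z) (at z)"
    using f s by (auto dest!: holomorphic_on_imp_continuous_on simp: continuous_on_def)
   thus ?thesis using False by (auto simp: g_def intro!: tendsto_divide)
  qed
  hence "(g ---> g z) (at z)" using ev by (rule Lim_transform_eventually)
  thus "(g ---> g y) (at y within ball z r)" by (auto intro: tendsto_within_subset)
 qed auto
 hence "g field_differentiable (at z)" for z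
  using sig_isolated_zeros[OF t, of z a] unfolding s_def
  by (meson centre_in_ball holomorphic_on_imp_differentiable_at open_ball)
 hence "g holomorphic_on UNIV" by (auto simp: holomorphic_on_def intro: field_differentiable_at_within)
 moreover have "f z = g z * sig T (z - a)" for z
  using z[of z] by (auto simp: g_def s_def)
 ultimately show ?thesis using that by blast
qed

text \<open>All values are attained on a compact period parallelogram, so Liouville's theorem
  applies.\<close>

lemma doubly_periodic_entire_const:
 assumes t: "T : \<H>" and g: "g holomorphic_on UNIV"
  and p1: "!!z. g (z + 1) = g z" and p2: "!!z. g (z + T) = g z"
 obtains c where "!!z. g z = c"
proof -
 have p1': "g (z + of_int m) = g z" for z m
 proof (induction m rule: int_induct[where k = 0])
  case (step1 i) thus ?case using p1[of "z + of_int i"] by (simp add: add_ac)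
 next
  case (step2 i) thus ?case using p1[of "z + of_int (i - 1)"] by (simp add: add_ac)
 qed auto
 have p2': "g (z + of_int m * T) = g z" for z m
 proof (induction m rule: int_induct[where k = 0])
  case (step1 i) thus ?case using p2[of "z + of_int i * T"] by (simp add: algebra_simps)
 next
  case (step2 i) thus ?case using p2[of "z + of_int (i - 1) * T"] by (simp add: algebra_simps)
 qed auto
 define K where "K = (%(s, t). complex_of_real s + of_real t * T) ` ({0..1} \<times> {0..1})"
 have "compact K" unfolding K_def case_prod_unfold
  by (intro compact_continuous_image compact_Times continuous_intros) auto
 hence "compact (g ` K)"
  by (intro compact_continuous_image holomorphic_on_imp_continuous_on holomorphic_on_subset[OF g]) auto
 moreover have "range g <= g ` K"
 proof safe
  fix z
  define t where "t = Im z / Im T"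
  define s where "s = Re z - t * Re T"
  have z: "z = of_real s + of_real t * T"
   using t by (simp add: complex_eq_iff s_def t_def upper_half_plane_def)
  have "of_real (frac s) + of_real (frac t) * T : K" unfolding K_def
   by (rule image_eqI[of _ _ "(frac s, frac t)"]) (auto simp: frac_lt_1 less_imp_le)
  moreover have "g z = g (of_real (frac s) + of_real (frac t) * T)"
  proof -
   have "z = (of_real (frac s) + of_real (frac t) * T) + of_int \<lfloor>t\<rfloor> * T + of_int \<lfloor>s\<rfloor>"
    unfolding z by (simp add: frac_def algebra_simps)
   thus ?thesis using p1' p2' by metis
  qed
  ultimately show "g z : g ` K" by simp
 qed
 ultimately have "bounded (range g)" using compact_imp_bounded bounded_subset by blast
 from Liouville_theorem[OF g this] show ?thesis using that unfolding constant_on_def by auto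
qed

text \<open>The quotient by \<open>sig T\<close> is entire and doubly periodic. The modular
  transformation, the three-term relation and Jacobi's product are all consequences of this
  uniqueness.\<close>

lemma sig_characterization:
 assumes t: "T : \<H>" and f: "f holomorphic_on UNIV" and f0: "f 0 = 0"
  and p1: "!!z. f (z + 1) = - f z" and p2: "!!z. f (z + T) = - ee (- T / 2 - z) * f z"
 obtains c where "!!z. f z = c * sig T z"
proof -
 have "f z = 0" if sz: "sig T (z - 0) = 0" for z
 proof -
  obtain m n where "z = of_int m + of_int n * T" using sz sig_eq_0_iff[OF t, of z] by auto
  thus ?thesis using quasi_period[of f T 0 m n, OF p1 p2] f0 by simp
 qed
 from sig_division[OF t f this] obtain g where g: "g holomorphic_on UNIV" "!!z. f z = g z * sig T z"
  by (metis diff_zero)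
 have gc: "continuous_on A g" "continuous_on UNIV (%z. g (z + w))" for w A
  by (intro holomorphic_on_imp_continuous_on holomorphic_on_subset[OF g(1)] subset_UNIV,
    rule continuous_on_compose2[OF holomorphic_on_imp_continuous_on[OF g(1)]])
    (auto intro!: continuous_intros)
 have "g (z + 1) = g z" for z
 proof (rule sig_cancel[OF t, of "%z. g (z + 1)" g 0 z])
  show "g (z + 1) * sig T (z - 0) = g z * sig T (z - 0)" for z
   using p1[of z] unfolding g(2) sig_plus_1 by simp
 qed (use gc in auto)
 moreover have "g (z + T) = g z" for z
 proof (rule sig_cancel[OF t, of "%z. g (z + T)" g 0 z])
  show "g (z + T) * sig T (z - 0) = g z * sig T (z - 0)" for z
   using p2[of z] unfolding g(2) sig_plus_tau[OF t] by simp
 qed (use gc in auto)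
 ultimately obtain c where "!!z. g z = c" using doubly_periodic_entire_const[OF t g(1)] by metis
 thus ?thesis using that g(2) by auto
qed

section \<open>Modular transformation of the sigma function\<close>

lemma uhp_moebius:
 assumes "T : \<H>" "a * d - b * c = (1::int)"
 shows   "of_int c * T + of_int d ~= 0"
  and   "(of_int a * T + of_int b) / (of_int c * T + of_int d) : \<H>"
  and   "Im ((of_int a * T + of_int b) / (of_int c * T + of_int d)) = Im T / norm (of_int c * T + of_int d) ^ 2"
proof -
 show nz: "of_int c * T + of_int d ~= 0"
 proof
  assume *: "of_int c * T + of_int d = 0"
  hence "of_int c * Im T = 0" by (auto simp: complex_eq_iff)
  hence "c = 0" using assms(1) by (simp add: upper_half_plane_def)
  with * have "d = 0" by simp
  with \<open>c = 0\<close> assms(2) show False by simp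
 qed
 have "real_of_int a * of_int d - of_int b * of_int c = 1"
  using assms(2) by (metis of_int_1 of_int_diff of_int_mult)
 hence "Im ((of_int a * T + of_int b) * cnj (of_int c * T + of_int d)) = Im T"
  by (simp add: algebra_simps)
 thus im: "Im ((of_int a * T + of_int b) / (of_int c * T + of_int d)) = Im T / norm (of_int c * T + of_int d) ^ 2"
  by (subst complex_div_cnj) (simp del: complex_cnj_add)
 show "(of_int a * T + of_int b) / (of_int c * T + of_int d) : \<H>"
  unfolding upper_half_plane_def mem_Collect_eq im using assms(1) nz by (simp add: upper_half_plane_def)
qed

lemma ee_half_odd: "odd n ==> ee (of_int n / 2) = - 1"
 by (elim oddE) (simp add: add_divide_distrib ee_add ee_half)

text \<open>After correction by the Gaussian factor, the left side as a function of z has the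
  quasi-periods of \<open>sig T\<close>; comparing derivatives at 0 then gives the constant
  1/j.\<close>

lemma sig_modular:
 fixes a b c d :: int
 assumes t: "T : \<H>" and det: "a * d - b * c = 1"
 defines "j \<equiv> of_int c * T + of_int d"
 shows   "sig ((of_int a * T + of_int b) / j) (z / j) = ee (of_int c * z ^ 2 / (2 * j)) / j * sig T z"
proof -
 define t' where "t' = (of_int a * T + of_int b) / j"
 have j: "j ~= 0" and t': "t' : \<H>"
  using uhp_moebius[OF t det] by (auto simp: j_def t'_def)
 have det': "of_int a * of_int d - of_int b * of_int c = (1::complex)"
  using det by (metis of_int_1 of_int_diff of_int_mult)
 have tj: "t' * j = of_int a * T + of_int b" using j by (simp add: t'_def)
 \<comment> \<open>Divided by \<open>j\<close>, the old periods 1 and \<open>T\<close> become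
   integral combinations of 1 and \<open>t'\<close>.\<close>
 have j1: "1 / j = of_int a + of_int (- c) * t'"
 proof -
  have "(of_int a + of_int (- c) * t') * j = of_int a * j - of_int c * (t' * j)" by (simp add: algebra_simps)
  also have "\<dots> = 1" unfolding tj unfolding j_def using det' by (simp add: algebra_simps)
  finally show ?thesis using j by (simp add: field_simps)
 qed
 have j2: "T / j = of_int (- b) + of_int d * t'"
 proof -
  have "(of_int (- b) + of_int d * t') * j = - of_int b * j + of_int d * (t' * j)" by (simp add: algebra_simps)
  also have "\<dots> = (of_int a * of_int d - of_int b * of_int c) * T" unfolding tj unfolding j_def by (simp add: algebra_simps)
  finally show ?thesis using j by (simp add: field_simps det')
 qed
 define f where "f = (%z. ee (- of_int c * z ^ 2 / (2 * j)) * sig t' (z / j))"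
 have f: "f holomorphic_on UNIV" unfolding f_def
  by (intro holomorphic_intros) (use t' j in auto)
 have f1: "f (z + 1) = - f z" for z
 proof -
  \<comment> \<open>Modulo 2 this is a + c + a c, which is even only if a and c both are; the
    determinant excludes that.\<close>
  have "odd (a - c - c * a)"
  proof
   assume "even (a - c - c * a)"
   hence "even a & even c" by auto
   hence "even (a * d - b * c)" by simp
   thus False using det by simp
  qed
  have "(z + 1) / j = z / j + of_int a + of_int (- c) * t'"
   using j1 by (simp add: add_divide_distrib)
  hence "f (z + 1) = ee (- of_int c * (z + 1) ^ 2 / (2 * j)) *
    (ee (of_int (a - c) / 2 - of_int (- c) ^ 2 * t' / 2 - of_int (- c) * (z / j)) * sig t' (z / j))"
   unfolding f_def using sig_lattice[OF t', of "z / j" a "- c"] by simp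
  also have "\<dots> = ee (- of_int c * (z + 1) ^ 2 / (2 * j) + (of_int (a - c) / 2 - of_int (- c) ^ 2 * t' / 2 - of_int (- c) * (z / j))) * sig t' (z / j)"
   by (simp only: ee_add mult.assoc)
  also have "- of_int c * (z + 1) ^ 2 / (2 * j) + (of_int (a - c) / 2 - of_int (- c) ^ 2 * t' / 2 - of_int (- c) * (z / j)) =
    - of_int c * z ^ 2 / (2 * j) + of_int (a - c - c * a) / 2"
  proof -
   have "of_int c * (1 / j) = of_int c * (of_int a + of_int (- c) * t')" using j1 by simp
   hence e1: "of_int c / (2 * j) = (of_int c * of_int a - of_int c ^ 2 * t') / 2"
    using j by (simp add: field_simps power2_eq_square)
   have e2: "- of_int c * (z + 1) ^ 2 / (2 * j) = - of_int c * z ^ 2 / (2 * j) - of_int c * (z / j) - of_int c / (2 * j)"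
    using j by (simp add: field_simps power2_eq_square)
   show ?thesis unfolding e2 e1 by (simp add: diff_divide_distrib add_divide_distrib algebra_simps)
  qed
  finally show ?thesis unfolding f_def ee_add ee_half_odd[OF \<open>odd _\<close>] by simp
 qed
 have f2: "f (z + T) = - ee (- T / 2 - z) * f z" for z
 proof -
  have "odd (d - b - b * d)"
  proof
   assume "even (d - b - b * d)"
   hence "even b & even d" by auto
   hence "even (a * d - b * c)" by simp
   thus False using det by simp
  qed
  have "(z + T) / j = z / j + of_int (- b) + of_int d * t'"
   using j2 by (simp add: add_divide_distrib)
  hence "f (z + T) = ee (- of_int c * (z + T) ^ 2 / (2 * j)) *
    (ee (of_int (- b + d) / 2 - of_int d ^ 2 * t' / 2 - of_int d * (z / j)) * sig t' (z / j))"
   unfolding f_def using sig_lattice[OF t', of "z / j" "- b" d] by simp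
  also have "\<dots> = ee (- of_int c * (z + T) ^ 2 / (2 * j) + (of_int (- b + d) / 2 - of_int d ^ 2 * t' / 2 - of_int d * (z / j))) * sig t' (z / j)"
   by (simp only: ee_add mult.assoc)
  also have "- of_int c * (z + T) ^ 2 / (2 * j) + (of_int (- b + d) / 2 - of_int d ^ 2 * t' / 2 - of_int d * (z / j)) =
    - of_int c * z ^ 2 / (2 * j) + of_int (d - b - b * d) / 2 + (- T / 2 - z)"
  proof -
   have 1: "of_int c * T * (T / j) = - of_int c * T * of_int b + of_int c * T * of_int d * t'"
    unfolding j2 by (simp add: algebra_simps)
   have 2: "of_int c * T * of_int d * t' + of_int d ^ 2 * t' = of_int d * (of_int a * T + of_int b)"
    unfolding tj[symmetric] j_def by (simp add: algebra_simps power2_eq_square)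
   have 3: "of_int c * T * (T / j) + of_int d ^ 2 * t' = T + of_int b * of_int d"
   proof -
    have "of_int c * T * (T / j) + of_int d ^ 2 * t' = (of_int a * of_int d - of_int b * of_int c) * T + of_int b * of_int d"
     unfolding 1 using 2 by (simp add: algebra_simps)
    thus ?thesis unfolding det' by simp
   qed
   have 4: "of_int c * T / j + of_int d / j = 1"
    using j unfolding j_def by (simp add: add_divide_distrib [symmetric])
   have e1: "- of_int c * (z + T) ^ 2 / (2 * j) = of_int d * (z / j) - of_int c * z ^ 2 / (2 * j) - (of_int c * T / j + of_int d / j) * z - of_int c * T * (T / j) / 2"
    using j by (simp add: field_simps power2_eq_square)
   have e2: "of_int d ^ 2 * t' = T + of_int b * of_int d - of_int c * T * (T / j)"
    using 3 by (simp add: algebra_simps)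
   show ?thesis unfolding e1 e2 4 by (simp add: diff_divide_distrib add_divide_distrib algebra_simps)
  qed
  finally show ?thesis unfolding f_def ee_add ee_half_odd[OF \<open>odd _\<close>] by simp
 qed
 obtain C where C: "!!z. f z = C * sig T z"
  using sig_characterization[OF t f _ f1 f2] by (metis f_def div_0 mult_zero_right sig_0)
 have "((%z. sig t' (z / j)) has_field_derivative 1 * (1 / j)) (at 0)"
  by (rule DERIV_chain2[of "sig t'"]) (use sig_deriv_0[OF t'] j in \<open>auto intro!: derivative_eq_intros\<close>)
 moreover have "((%z. ee (- of_int c * z ^ 2 / (2 * j))) has_field_derivative 0) (at 0)"
  unfolding ee_def by (auto intro!: derivative_eq_intros simp: j)
 ultimately have "(f has_field_derivative (1 / j)) (at 0)"
  unfolding f_def by (auto intro!: derivative_eq_intros)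
 moreover have "(f has_field_derivative C) (at 0)"
  unfolding C using sig_deriv_0[OF t] by (auto intro!: derivative_eq_intros)
 ultimately have "C = 1 / j" by (rule DERIV_unique[symmetric])
 moreover have "sig t' (z / j) = ee (of_int c * z ^ 2 / (2 * j)) * f z"
  unfolding f_def by (simp flip: mult.assoc ee_add)
 ultimately show ?thesis unfolding C by (simp add: t'_def)
qed

text \<open>With b and c fixed, the left side is an even function of a that vanishes on the lattice.
  Its quotient by \<open>sig T\<close> is odd with the quasi-periods of sigma, hence a multiple of
  \<open>sig T\<close>, and the value at a = b determines the factor.\<close>

lemma sig_three_term:
 assumes t: "T : \<H>" and b: "sig T b ~= 0"
 shows "sig T (a + c) * sig T (a - c) * sig T b ^ 2 - sig T (a + b) * sig T (a - b) * sig T c ^ 2 =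
     sig T (b + c) * sig T (b - c) * sig T a ^ 2"
proof -
 define f where "f = (%a. sig T (a + c) * sig T (a - c) * sig T b ^ 2 - sig T (a + b) * sig T (a - b) * sig T c ^ 2)"
 have f: "f holomorphic_on UNIV" unfolding f_def
  by (intro holomorphic_intros) (use t in auto)
 have "f z = 0" if sz: "sig T (z - 0) = 0" for z
 proof -
  obtain m n where z: "z = of_int m + of_int n * T" using sz sig_eq_0_iff[OF t, of z] by auto
  have "sig T (z + x) * sig T (z - x) = - (ee (of_int (m + n) / 2 - of_int n ^ 2 * T / 2) ^ 2 * sig T x ^ 2)" for x
  proof -
   have "sig T (z + x) = ee (of_int (m + n) / 2 - of_int n ^ 2 * T / 2 - of_int n * x) * sig T x"
    using sig_lattice[OF t, of x m n] by (simp add: z add_ac)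
   moreover have "sig T (z - x) = - (ee (of_int (m + n) / 2 - of_int n ^ 2 * T / 2 + of_int n * x) * sig T x)"
    using sig_lattice[OF t, of "- x" m n] by (simp add: z sig_minus algebra_simps)
   ultimately show ?thesis by (simp add: ee_add ee_diff power2_eq_square)
  qed
  thus ?thesis by (simp add: f_def)
 qed
 from sig_division[OF t f this] obtain g where g: "g holomorphic_on UNIV" "!!z. f z = g z * sig T z"
  by (metis diff_zero)
 have gc: "continuous_on A g" "continuous_on UNIV (%z. g (z + w))" "continuous_on UNIV (%z. g (- z))" for w A
  by (intro holomorphic_on_imp_continuous_on holomorphic_on_subset[OF g(1)] subset_UNIV,
    (rule continuous_on_compose2[OF holomorphic_on_imp_continuous_on[OF g(1)]],
    (auto intro!: continuous_intros)[2])+)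
 have g1: "g (z + 1) = - g z" for z
 proof (rule sig_cancel[OF t, of "%z. g (z + 1)" "%z. - g z" 0 z])
  fix z
  have "f (z + 1) = f z"
   unfolding f_def using sig_plus_1[of T] by (simp add: add.commute[of z 1] add.assoc) (simp add: add.commute[of 1] diff_add_eq[symmetric])
  thus "g (z + 1) * sig T (z - 0) = - g z * sig T (z - 0)"
   unfolding g(2) sig_plus_1 by (simp add: minus_equation_iff)
 qed (use gc in \<open>auto intro!: continuous_intros\<close>)
 have g2: "g (z + T) = - ee (- T / 2 - z) * g z" for z
 proof (rule sig_cancel[OF t, of "%z. g (z + T)" "%z. - ee (- T / 2 - z) * g z" 0 z])
  fix z
  have *: "sig T (z + T + x) * sig T (z + T - x) = ee (- T / 2 - z) ^ 2 * (sig T (z + x) * sig T (z - x))" for x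
  proof -
   have "sig T (z + T + x) = - ee (- T / 2 - (z + x)) * sig T (z + x)"
    using sig_plus_tau[OF t, of "z + x"] by (simp add: add_ac)
   moreover have "sig T (z + T - x) = - ee (- T / 2 - (z - x)) * sig T (z - x)"
    using sig_plus_tau[OF t, of "z - x"] by (simp add: algebra_simps)
   ultimately show ?thesis by (simp add: ee_add ee_diff power2_eq_square)
  qed
  have "f (z + T) = ee (- T / 2 - z) ^ 2 * f z"
   unfolding f_def * by (simp add: algebra_simps)
  hence "ee (- T / 2 - z) * (g (z + T) * sig T z) = ee (- T / 2 - z) * (- ee (- T / 2 - z) * g z * sig T z)"
   unfolding g(2) sig_plus_tau[OF t] by (simp only: power2_eq_square) (simp add: mult_ac, metis minus_minus)
  thus "g (z + T) * sig T (z - 0) = - ee (- T / 2 - z) * g z * sig T (z - 0)"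
   by (simp only: mult_cancel_left ee_nonzero diff_zero simp_thms)
 qed (use gc g(1) in \<open>auto intro!: holomorphic_on_imp_continuous_on holomorphic_intros\<close>)
 have "g (- z) = - g z" for z
 proof (rule sig_cancel[OF t, of "%z. g (- z)" "%z. - g z" 0 z])
  fix z
  have "f (- z) = f z"
   unfolding f_def using sig_minus[of T "z - c"] sig_minus[of T "z + c"] sig_minus[of T "z - b"] sig_minus[of T "z + b"]
   by simp
  thus "g (- z) * sig T (z - 0) = - g z * sig T (z - 0)"
   unfolding g(2) sig_minus by (simp add: minus_equation_iff)
 qed (use gc in \<open>auto intro!: continuous_intros\<close>)
 from this[of 0] have "g 0 = 0" by simp
 then obtain K where K: "!!z. g z = K * sig T z"
  using sig_characterization[OF t g(1) _ g1 g2] by metis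
 have "f b = K * sig T b ^ 2" by (simp add: g(2) K power2_eq_square)
 hence "K * sig T b ^ 2 = sig T (b + c) * sig T (b - c) * sig T b ^ 2" by (auto simp: f_def)
 hence "K = sig T (b + c) * sig T (b - c)" using b by simp
 thus ?thesis using g(2)[of a] unfolding K by (simp add: f_def power2_eq_square)
qed

lemma sig_real_eq_0_iff:
 assumes "T : \<H>"
 shows   "sig T (of_real r + of_real s * T) = 0 \<longleftrightarrow> r : \<int> & s : \<int>"
proof
 assume "sig T (of_real r + of_real s * T) = 0"
 then obtain m n where *: "of_real r + of_real s * T = of_int m + of_int n * T"
  using sig_eq_0_iff[OF assms, of "of_real r + of_real s * T"] by auto
 hence "s * Im T = of_int n * Im T" by (auto simp: complex_eq_iff)
 hence "s = of_int n" using assms by (simp add: upper_half_plane_def)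
 with * have "complex_of_real r = of_int m" by simp
 hence "r = of_int m" by (metis of_real_eq_iff of_real_of_int_eq)
 with \<open>s = of_int n\<close> show "r : \<int> & s : \<int>" by simp
next
 assume "r : \<int> & s : \<int>"
 then obtain m n where "r = of_int m" "s = of_int n" by (auto elim!: Ints_cases)
 thus "sig T (of_real r + of_real s * T) = 0"
  using sig_eq_0_iff[OF assms, of "of_real r + of_real s * T"] by auto
qed

text \<open>Zeros that are pairwise incongruent modulo the lattice can be divided out one after the
  other, because the remaining factors do not vanish at the zero in question.\<close>

lemma sig_division_list:
 assumes t: "T : \<H>" and f: "f holomorphic_on UNIV"
  and "!!a z. a : set as ==> sig T (z - a) = 0 ==> f z = 0"
  and "sorted_wrt (%a b. sig T (a - b) ~= 0) as"
 shows "EX g. g holomorphic_on UNIV & (ALL z. f z = g z * (\<Prod>a\<leftarrow>as. sig T (z - a)))"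
 using assms(3,4)
proof (induction as)
 case Nil
 thus ?case using f by auto
next
 case (Cons a as)
 then obtain g where g: "g holomorphic_on UNIV" "!!z. f z = g z * (\<Prod>a\<leftarrow>as. sig T (z - a))"
  by auto
 have "g z = 0" if z: "sig T (z - a) = 0" for z
 proof -
  have "sig T (z - b) ~= 0" if b: "b : set as" for b
  proof
   assume *: "sig T (z - b) = 0"
   obtain m n where 1: "z - a = of_int m + of_int n * T" using z sig_eq_0_iff[OF t, of "z - a"] by auto
   obtain m' n' where 2: "z - b = of_int m' + of_int n' * T" using * sig_eq_0_iff[OF t, of "z - b"] by auto
   have "a - b = of_int (m' - m) + of_int (n' - n) * T"
    using 1 2 by (simp add: algebra_simps)
   hence "sig T (a - b) = 0" using sig_eq_0_iff[OF t] by blast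
   thus False using Cons.prems(2) b by auto
  qed
  hence "(\<Prod>a\<leftarrow>as. sig T (z - a)) ~= 0" by (auto simp: prod_list_zero_iff)
  moreover have "f z = 0" using Cons.prems(1)[of a z] z by simp
  ultimately show ?thesis using g(2)[of z] by simp
 qed
 from sig_division[OF t g(1) this] obtain h where "h holomorphic_on UNIV" "!!z. g z = h z * sig T (z - a)"
  by metis
 thus ?case using g(2) by (intro exI[of _ h]) (auto simp: mult_ac)
qed

text \<open>The left side vanishes at all half periods. The last one enters with a minus sign so
  that the shifts 0, 1/2, T/2, -(1 + T)/2 sum to zero; this gives both sides the same multiplier
  under z -> z + T. Their quotient is then constant and is found from the derivatives at 0.\<close>

lemma sig_double:
 assumes t: "T : \<H>"
 shows "sig T (2 * z) * (sig T (1 / 2) * sig T (T / 2) * sig T ((1 + T) / 2)) =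
     - 2 * (sig T z * sig T (z + 1 / 2) * sig T (z + T / 2) * sig T (z - (1 + T) / 2))"
proof -
 define as where "as = [0, - 1 / 2, - T / 2, (1 + T) / 2]"
 define f where "f = (%z. sig T (2 * z))"
 have f: "f holomorphic_on UNIV" unfolding f_def by (intro holomorphic_intros) (use t in auto)
 have half: "(1::real) / 2 ~: \<int>" "- (1::real) / 2 ~: \<int>"
  using Ints_cases[of "1 / 2 :: real"] fraction_not_in_Ints[of 2 1, where 'a = real] fraction_not_in_Ints[of 2 "-1", where 'a = real] by auto
 have nz: "sig T (of_real r + of_real s * T) ~= 0" if "r ~: \<int> \<or> s ~: \<int>" for r s
  using sig_real_eq_0_iff[OF t, of r s] that by blast
 have "EX g. g holomorphic_on UNIV & (ALL z. f z = g z * (\<Prod>a\<leftarrow>as. sig T (z - a)))"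
 proof (rule sig_division_list[OF t f])
  fix a z assume a: "a : set as" and "sig T (z - a) = 0"
  then obtain m n where z: "z = a + of_int m + of_int n * T"
   using sig_eq_0_iff[OF t, of "z - a"] by (auto simp: algebra_simps)
  have "EX m n. 2 * a = of_int m + of_int n * T"
  proof -
   have "2 * 0 = of_int 0 + of_int 0 * T" "2 * (- 1 / 2) = of_int (- 1) + of_int 0 * T"
    "2 * (- T / 2) = of_int 0 + of_int (- 1) * T" "2 * ((1 + T) / 2) = of_int 1 + of_int 1 * T"
    by auto
   moreover have "a = 0 \<or> a = - 1 / 2 \<or> a = - T / 2 \<or> a = (1 + T) / 2" using a by (auto simp: as_def)
   ultimately show ?thesis by metis
  qed
  then obtain m' n' where "2 * a = of_int m' + of_int n' * T" by blast
  hence "2 * z = of_int (m' + 2 * m) + of_int (n' + 2 * n) * T"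
   by (simp add: z algebra_simps)
  thus "f z = 0" unfolding f_def using sig_eq_0_iff[OF t, of "2 * z"] by blast
 next
  show "sorted_wrt (%a b. sig T (a - b) ~= 0) as"
  proof -
   have "sig T (0 - (- 1 / 2)) ~= 0" using nz[of "1/2" 0] half by simp
   moreover have "sig T (0 - (- T / 2)) ~= 0" using nz[of 0 "1/2"] half by simp
   moreover have "sig T (0 - (1 + T) / 2) ~= 0"
    using nz[of "-1/2" "-1/2"] half by (simp add: add_divide_distrib)
   moreover have "sig T (- 1 / 2 - (- T / 2)) ~= 0" using nz[of "-1/2" "1/2"] half by simp
   moreover have "sig T (- 1 / 2 - (1 + T) / 2) ~= 0"
    using nz[of "-1" "-1/2"] half by (simp add: add_divide_distrib)
   moreover have "sig T (- T / 2 - (1 + T) / 2) ~= 0"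
    using nz[of "-1/2" "-1"] half by (simp add: add_divide_distrib algebra_simps)
   ultimately show ?thesis unfolding as_def
    by (simp only: sorted_wrt.simps list.set ball_simps simp_thms)
  qed
 qed
 then obtain g where g: "g holomorphic_on UNIV" and fg: "!!z. f z = g z * (\<Prod>a\<leftarrow>as. sig T (z - a))" by blast
 define h where "h = (%z. sig T (z + 1 / 2) * sig T (z + T / 2) * sig T (z - (1 + T) / 2))"
 have fgh: "f z = g z * (sig T z * h z)" for z
  by (simp add: fg as_def h_def)
 have h: "h holomorphic_on UNIV" unfolding h_def by (intro holomorphic_intros) (use t in auto)
 have dense: "eventually (%w. sig T w * h w ~= 0) (at z)" for z
 proof -
  have *: "eventually (%w. sig T (w - a) ~= 0) (at z)" for a
  proof -
   obtain r where r: "r > 0" "!!w. w : ball z r - {z} ==> sig T (w - a) ~= 0"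
    using sig_isolated_zeros[OF t] by blast
   have "eventually (%w. w : ball z r - {z}) (at z)"
    using r(1) by (intro eventually_at_in_open) auto
   thus ?thesis by eventually_elim (use r(2) in force)
  qed
  show ?thesis
   using *[of 0] *[of "- 1 / 2"] *[of "- T / 2"] *[of "(1 + T) / 2"]
   by eventually_elim (simp add: h_def)
 qed
 have cancel: "g1 z = g2 z" if "continuous_on UNIV g1" "continuous_on UNIV g2"
  "!!z. g1 z * (sig T z * h z) = g2 z * (sig T z * h z)" for g1 g2 z
 proof -
  have ev: "eventually (%w. g1 w = g2 w) (at z)"
   using dense[of z] by eventually_elim (use that(3) in force)
  have "(g1 ---> g1 z) (at z)" "(g2 ---> g2 z) (at z)"
   using that(1,2) by (auto simp: continuous_on_def)
  moreover from this(1) ev have "(g2 ---> g1 z) (at z)" by (rule Lim_transform_eventually)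
  ultimately show ?thesis using tendsto_unique by (metis trivial_limit_at)
 qed
 have gc: "continuous_on UNIV g" "continuous_on UNIV (%z. g (z + w))" for w
  by (intro holomorphic_on_imp_continuous_on holomorphic_on_subset[OF g] subset_UNIV,
    (rule continuous_on_compose2[OF holomorphic_on_imp_continuous_on[OF g]],
    (auto intro!: continuous_intros)[2])+)
 have "g (z + 1) = g z" for z
 proof (rule cancel[of "%z. g (z + 1)" g, OF gc(2,1)])
  fix z
  have "f (z + 1) = f z" unfolding f_def using sig_plus_1[of T "2 * z + 1"] sig_plus_1[of T "2 * z"]
   by (simp add: algebra_simps)
  moreover have "sig T (z + 1) * h (z + 1) = sig T z * h z"
   unfolding h_def using sig_plus_1[of T "z + 1 / 2"] sig_plus_1[of T "z + T / 2"] sig_plus_1[of T "z - (1 + T) / 2"] sig_plus_1[of T z]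
   by (simp add: algebra_simps)
  ultimately show "g (z + 1) * (sig T z * h z) = g z * (sig T z * h z)"
   unfolding fgh by simp
 qed
 moreover have "g (z + T) = g z" for z
 proof (rule cancel[of "%z. g (z + T)" g, OF gc(2,1)])
  fix z
  have "f (z + T) = ee (- 2 * T - 4 * z) * f z"
   unfolding f_def using sig_lattice[OF t, of "2 * z" 0 2] ee_of_int[of 1]
   by (simp add: algebra_simps ee_add ee_diff ee_minus) (simp add: field_simps)
  moreover have "sig T (z + T) * h (z + T) = ee (- 2 * T - 4 * z) * (sig T z * h z)"
  proof -
   have *: "sig T (z + T + x) = - ee (- T / 2 - (z + x)) * sig T (z + x)" for x
    using sig_plus_tau[OF t, of "z + x"] by (simp add: add_ac)
   define e where "e = (%x. ee (- T / 2 - (z + x)))"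
   have "e 0 * e (1 / 2) * e (T / 2) * e (- ((1 + T) / 2)) = ee (- 2 * T - 4 * z)"
    unfolding e_def ee_add[symmetric] by (rule arg_cong[of _ _ ee]) (simp add: field_simps)
   moreover have "sig T (z + T) = - e 0 * sig T z" "sig T (z + T + 1 / 2) = - e (1 / 2) * sig T (z + 1 / 2)"
    "sig T (z + T + T / 2) = - e (T / 2) * sig T (z + T / 2)"
    "sig T (z + T - (1 + T) / 2) = - e (- ((1 + T) / 2)) * sig T (z - (1 + T) / 2)"
    using *[of 0] *[of "1 / 2"] *[of "T / 2"] *[of "- ((1 + T) / 2)"] by (simp_all add: e_def)
   ultimately show ?thesis unfolding h_def by (simp add: mult_ac)
  qed
  ultimately show "g (z + T) * (sig T z * h z) = g z * (sig T z * h z)"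
   unfolding fgh by (simp add: mult.left_commute[of "g _"])
 qed
 ultimately obtain C where C: "!!z. g z = C"
  using doubly_periodic_entire_const[OF t g] by metis
 have "(f has_field_derivative 1 * 2) (at 0)"
  unfolding f_def by (rule DERIV_chain2[of "sig T"]) (use sig_deriv_0[OF t] in \<open>auto intro!: derivative_eq_intros\<close>)
 moreover have "(f has_field_derivative C * h 0) (at 0)"
 proof -
  obtain h' where "(h has_field_derivative h') (at 0)" using h by (meson UNIV_I holomorphic_derivI open_UNIV)
  hence "((%z. C * (sig T z * h z)) has_field_derivative C * h 0) (at 0)"
   using sig_deriv_0[OF t] by (auto intro!: derivative_eq_intros)
  thus ?thesis using fgh C by presburger
 qed
 ultimately have "2 = C * h 0" using DERIV_unique by fastforce
 moreover have "h 0 = - (sig T (1 / 2) * sig T (T / 2) * sig T ((1 + T) / 2))"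
  using sig_minus[of T "(1 + T) / 2"] by (simp add: h_def)
 ultimately have 1: "C * (sig T (1 / 2) * sig T (T / 2) * sig T ((1 + T) / 2)) = - 2"
  by (metis add.inverse_inverse mult_minus_right)
 have 2: "sig T (2 * z) = C * (sig T z * h z)" using fgh[of z] C by (simp add: f_def)
 have "sig T (2 * z) * (sig T (1 / 2) * sig T (T / 2) * sig T ((1 + T) / 2)) =
   (C * (sig T (1 / 2) * sig T (T / 2) * sig T ((1 + T) / 2))) * (sig T z * h z)"
  unfolding 2 by (simp only: mult_ac)
 thus ?thesis unfolding 1 by (simp only: h_def mult.assoc)
qed

section \<open>Differences of the Weierstrass function at division points\<close>

text \<open>This is wp(b) - wp(a) for the Weierstrass function wp of Z + TZ. The Gaussian factor by
  which \<open>sig\<close> differs from the classical sigma function cancels.\<close>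

definition pE :: "complex => complex => complex => complex" where
 "pE T a b = sig T (a + b) * sig T (a - b) / (sig T a ^ 2 * sig T b ^ 2)"

lemma pE_swap: "pE T b a = - pE T a b"
 using sig_minus[of T "a - b"] by (simp add: pE_def add_ac mult_ac)

lemma pE_minus_left: "pE T (- a) b = pE T a b"
 using sig_minus[of T "a - b"] sig_minus[of T "a + b"] sig_minus[of T a]
 by (simp add: pE_def add_ac mult_ac)

text \<open>Differences add up: this is the three-term relation divided by the three
  squares.\<close>

lemma pE_add:
 assumes "T : \<H>" "sig T a ~= 0" "sig T b ~= 0" "sig T c ~= 0"
 shows   "pE T a b + pE T b c = pE T a c"
proof -
 have "sig T (a + c) * sig T (a - c) * sig T b ^ 2 = sig T (a + b) * sig T (a - b) * sig T c ^ 2 +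
     sig T (b + c) * sig T (b - c) * sig T a ^ 2"
  using sig_three_term[OF assms(1,3), of a c] by (simp add: algebra_simps)
 hence "sig T (a + c) * sig T (a - c) * sig T b ^ 2 / (sig T a ^ 2 * sig T b ^ 2 * sig T c ^ 2) = 
   (sig T (a + b) * sig T (a - b) * sig T c ^ 2 + sig T (b + c) * sig T (b - c) * sig T a ^ 2) / (sig T a ^ 2 * sig T b ^ 2 * sig T c ^ 2)"
  by simp
 thus ?thesis using assms by (simp add: pE_def add_divide_distrib)
qed

lemma pE_lattice_left:
 assumes "T : \<H>"
 shows   "pE T (a + of_int m + of_int n * T) b = pE T a b"
proof -
 define e where "e = of_int (m + n) / 2 - of_int n ^ 2 * T / 2"
 have 1: "sig T (x + of_int m + of_int n * T) = ee (e - of_int n * x) * sig T x" for x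
  using sig_lattice[OF assms] by (simp add: e_def)
 have "sig T (a + of_int m + of_int n * T + b) = ee (e - of_int n * (a + b)) * sig T (a + b)"
    "sig T (a + of_int m + of_int n * T - b) = ee (e - of_int n * (a - b)) * sig T (a - b)"
  using 1[of "a + b"] 1[of "a - b"] by (simp_all add: algebra_simps)
 moreover have "ee (e - of_int n * (a + b)) * ee (e - of_int n * (a - b)) = ee (e - of_int n * a) ^ 2"
  unfolding power2_eq_square ee_add[symmetric] by (simp add: algebra_simps)
 ultimately show ?thesis unfolding pE_def 1
  by (simp add: power_mult_distrib mult_ac)
qed

lemma pE_lattice_right:
 assumes "T : \<H>"
 shows   "pE T a (b + of_int m + of_int n * T) = pE T a b"
 using pE_lattice_left[OF assms, of b m n a] by (metis pE_swap)

text \<open>The Gaussian factors cancel because (x + y)^2 + (x - y)^2 = 2 x^2 + 2 y^2; the powers of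
  \<open>j\<close> that remain give weight 2.\<close>

lemma pE_modular:
 fixes a b c d :: int
 assumes t: "T : \<H>" and det: "a * d - b * c = 1"
 defines "j \<equiv> of_int c * T + of_int d"
 shows   "pE ((of_int a * T + of_int b) / j) (x / j) (y / j) = j ^ 2 * pE T x y"
proof -
 have j: "j ~= 0" using uhp_moebius[OF t det] by (auto simp: j_def)
 define e where "e = (%z. ee (of_int c * z ^ 2 / (2 * j)))"
 have 1: "sig ((of_int a * T + of_int b) / j) (z / j) = e z / j * sig T z" for z
  using sig_modular[OF t det, of z] by (simp add: j_def e_def)
 have 2: "x / j + y / j = (x + y) / j" "x / j - y / j = (x - y) / j"
  by (simp_all add: add_divide_distrib diff_divide_distrib)
 have 3: "e (x + y) * e (x - y) = e x ^ 2 * e y ^ 2"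
  unfolding e_def power2_eq_square ee_add[symmetric]
  by (rule arg_cong[of _ _ ee]) (use j in \<open>simp add: field_simps\<close>)
 have "e (x + y) / j * sig T (x + y) * (e (x - y) / j * sig T (x - y)) / ((e x / j * sig T x) ^ 2 * (e y / j * sig T y) ^ 2)
   = (e (x + y) * e (x - y)) / (e x ^ 2 * e y ^ 2) * (j ^ 2 * (sig T (x + y) * sig T (x - y) / (sig T x ^ 2 * sig T y ^ 2)))"
  using j by (simp add: power_mult_distrib power_divide power2_eq_square mult_ac)
 also have "\<dots> = j ^ 2 * (sig T (x + y) * sig T (x - y) / (sig T x ^ 2 * sig T y ^ 2))"
  unfolding 3 by (simp add: e_def)
 finally show ?thesis unfolding pE_def 2 1 .
qed

text \<open>The equation wp'^2 = 4 (wp - e1)(wp - e2)(wp - e3) with wp'(z) = - sigma(2z) /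
  sigma(z)^4. Multiplying the duplication formula at z by the one at -z produces the six factors z +
  h and z - h for the half periods h.\<close>

lemma pE_prod_half_periods:
 assumes t: "T : \<H>" and z: "sig T z ~= 0"
 shows "pE T z (1 / 2) * pE T z (T / 2) * pE T z ((1 + T) / 2) = - (sig T (2 * z) ^ 2 / (4 * sig T z ^ 8))"
proof -
 have half: "(1::real) / 2 ~: \<int>"
  using fraction_not_in_Ints[of 2 1, where 'a = real] by auto
 define w1 w2 w3 where "w1 = sig T (1 / 2)" "w2 = sig T (T / 2)" "w3 = sig T ((1 + T) / 2)"
 note w_def = w1_w2_w3_def
 have w: "w1 ~= 0" "w2 ~= 0" "w3 ~= 0"
  using sig_real_eq_0_iff[OF t, of "1/2" 0] sig_real_eq_0_iff[OF t, of 0 "1/2"] sig_real_eq_0_iff[OF t, of "1/2" "1/2"] half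
  by (auto simp: w_def add_divide_distrib)
 define s where "s = sig T z"
 define p1 m1 p2 m2 p3 m3 where "p1 = sig T (z + 1 / 2)" "m1 = sig T (z - 1 / 2)"
  "p2 = sig T (z + T / 2)" "m2 = sig T (z - T / 2)" "p3 = sig T (z + (1 + T) / 2)" "m3 = sig T (z - (1 + T) / 2)"
 note p_def = this
 have 1: "sig T (2 * z) * (w1 * w2 * w3) = - 2 * (s * p1 * p2 * m3)"
  using sig_double[OF t, of z] by (simp add: w_def s_def p_def)
 have "sig T (2 * z) * (w1 * w2 * w3) = - (sig T (2 * (- z)) * (w1 * w2 * w3))"
  using sig_minus[of T "2 * z"] by simp
 also have "\<dots> = 2 * (sig T (- z) * sig T (- z + 1 / 2) * sig T (- z + T / 2) * sig T (- z - (1 + T) / 2))"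
  using sig_double[OF t, of "- z"] by (simp add: w_def)
 also have "sig T (- z) = - s" by (simp add: s_def sig_minus)
 also have "sig T (- z + 1 / 2) = - m1" using sig_minus[of T "z - 1 / 2"] by (simp add: p_def)
 also have "sig T (- z + T / 2) = - m2" using sig_minus[of T "z - T / 2"] by (simp add: p_def)
 also have "sig T (- z - (1 + T) / 2) = - p3" using sig_minus[of T "z + (1 + T) / 2"] by (simp add: p_def)
 finally have 2: "sig T (2 * z) * (w1 * w2 * w3) = 2 * (s * m1 * m2 * p3)" by simp
 have "(sig T (2 * z) * (w1 * w2 * w3)) * (sig T (2 * z) * (w1 * w2 * w3)) =
    (- 2 * (s * p1 * p2 * m3)) * (2 * (s * m1 * m2 * p3))"
  by (subst (1) 1, subst (1) 2, rule refl)
 hence "sig T (2 * z) ^ 2 * (w1 * w2 * w3) ^ 2 = - 4 * s ^ 2 * (p1 * m1 * (p2 * m2) * (p3 * m3))"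
  by (simp add: power2_eq_square mult_ac)
 hence 3: "p1 * m1 * (p2 * m2) * (p3 * m3) = - (sig T (2 * z) ^ 2 * (w1 * w2 * w3) ^ 2) / (4 * s ^ 2)"
  using z by (simp add: s_def field_simps)
 have "pE T z (1 / 2) * pE T z (T / 2) * pE T z ((1 + T) / 2) =
    p1 * m1 * (p2 * m2) * (p3 * m3) / (s ^ 6 * (w1 * w2 * w3) ^ 2)"
  unfolding pE_def p_def[symmetric] s_def[symmetric] w_def[symmetric]
  by (simp add: power2_eq_square eval_nat_numeral mult_ac)
 also have "\<dots> = - (sig T (2 * z) ^ 2 / (4 * s ^ 8))"
  unfolding 3 using w z by (simp add: s_def field_simps eval_nat_numeral)
 finally show ?thesis by (simp add: s_def)
qed

text \<open>The Klein form at the division point k T / 7, up to a constant. The exponent is (k/7)^2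
  T / 2, chosen so that k and 7 - k give the same value and no exponentials remain in
  \<open>pE_skl\<close>.\<close>

definition skl :: "complex => int => complex" where
 "skl T k = ee (of_int k ^ 2 * T / 98) * sig T (of_int k * T / 7)"

lemma skl_minus: "skl T (- k) = - skl T k"
 by (simp add: skl_def sig_minus)

lemma skl_7_minus:
 assumes "T : \<H>"
 shows   "skl T (7 - k) = skl T k"
proof -
 have "of_int (7 - k) * T / 7 = of_int (- k) * T / 7 + T" by (simp add: field_simps)
 hence "sig T (of_int (7 - k) * T / 7) = ee (- T / 2 + of_int k * T / 7) * sig T (of_int k * T / 7)"
  using sig_plus_tau[OF assms, of "of_int (- k) * T / 7"] by (simp only:) (simp add: sig_minus)
 hence "skl T (7 - k) = ee (of_int (7 - k) ^ 2 * T / 98) * (ee (- T / 2 + of_int k * T / 7) * sig T (of_int k * T / 7))"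
  by (simp only: skl_def)
 also have "\<dots> = ee (of_int (7 - k) ^ 2 * T / 98 + (- T / 2 + of_int k * T / 7)) * sig T (of_int k * T / 7)"
  by (simp only: ee_add mult.assoc)
 also have "of_int (7 - k) ^ 2 * T / 98 + (- T / 2 + of_int k * T / 7) = of_int k ^ 2 * T / 98"
  by (simp add: field_simps power2_eq_square)
 finally show ?thesis by (simp add: skl_def)
qed

lemma not_in_Ints_divide_7:
 assumes "~ 7 dvd (k::int)"
 shows   "real_of_int k / 7 ~: \<int>"
 using fraction_not_in_Ints[of 7 k, where 'a = real] assms by auto

lemma sig_seventh_nonzero:
 assumes "T : \<H>" "~ 7 dvd k"
 shows   "sig T (of_int k * T / 7) ~= 0"
 using sig_real_eq_0_iff[OF assms(1), of 0 "of_int k / 7"] not_in_Ints_divide_7[OF assms(2)] by simp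

lemma skl_nonzero:
 assumes "T : \<H>" "~ 7 dvd k"
 shows   "skl T k ~= 0"
 using sig_seventh_nonzero[OF assms] by (simp add: skl_def)

lemma pE_skl: "pE T (of_int j * T / 7) (of_int k * T / 7) =
 skl T (j + k) * skl T (j - k) / (skl T j ^ 2 * skl T k ^ 2)"
proof -
 define e where "e = (%k::int. ee (of_int k ^ 2 * T / 98))"
 have skl_e: "skl T k = e k * sig T (of_int k * T / 7)" for k by (simp add: skl_def e_def)
 have e: "e (j + k) * e (j - k) = e j ^ 2 * e k ^ 2"
  unfolding e_def power2_eq_square ee_add[symmetric]
  by (rule arg_cong[of _ _ ee]) (simp add: field_simps)
 have "skl T (j + k) * skl T (j - k) / (skl T j ^ 2 * skl T k ^ 2) =
   (e (j + k) * e (j - k)) / (e j ^ 2 * e k ^ 2) * (sig T (of_int (j + k) * T / 7) * sig T (of_int (j - k) * T / 7) /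
   (sig T (of_int j * T / 7) ^ 2 * sig T (of_int k * T / 7) ^ 2))"
  unfolding skl_e by (simp add: power_mult_distrib mult_ac)
 also have "\<dots> = pE T (of_int j * T / 7) (of_int k * T / 7)"
  unfolding e by (simp add: e_def pE_def add_divide_distrib diff_divide_distrib algebra_simps)
 finally show ?thesis ..
qed

lemma sig_double_skl:
 "sig T (2 * (of_int k * T / 7)) ^ 2 / sig T (of_int k * T / 7) ^ 8 = skl T (2 * k) ^ 2 / skl T k ^ 8"
proof -
 have e: "ee (of_int (2 * k) ^ 2 * T / 98) ^ 2 = ee (of_int k ^ 2 * T / 98) ^ 8"
  unfolding ee_of_nat_mult[symmetric] by (simp add: field_simps power2_eq_square)
 show ?thesis
  unfolding skl_def power_mult_distrib e by (simp add: mult.assoc)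
qed

lemma pE_seventh:
 assumes t: "T : \<H>"
 shows "pE T (T / 7) (2 * T / 7) = - (skl T 3 / (skl T 1 * skl T 2 ^ 2))"
  and "pE T (T / 7) (3 * T / 7) = - (skl T 2 / (skl T 1 ^ 2 * skl T 3))"
  and "pE T (2 * T / 7) (3 * T / 7) = - (skl T 1 / (skl T 2 * skl T 3 ^ 2))"
proof -
 have nz: "skl T 1 ~= 0" "skl T 2 ~= 0" "skl T 3 ~= 0" by (rule skl_nonzero[OF t]; simp)+
 have 4: "skl T 4 = skl T 3" "skl T 5 = skl T 2" "skl T (- 1) = - skl T 1" "skl T (- 2) = - skl T 2"
  using skl_7_minus[OF t, of 3] skl_7_minus[OF t, of 2] skl_minus[of T 1] skl_minus[of T 2] by simp_all
 show "pE T (T / 7) (2 * T / 7) = - (skl T 3 / (skl T 1 * skl T 2 ^ 2))"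
  using pE_skl[of T 1 2] nz by (simp add: 4 power2_eq_square)
 show "pE T (T / 7) (3 * T / 7) = - (skl T 2 / (skl T 1 ^ 2 * skl T 3))"
  using pE_skl[of T 1 3] nz by (simp add: 4 power2_eq_square)
 show "pE T (2 * T / 7) (3 * T / 7) = - (skl T 1 / (skl T 2 * skl T 3 ^ 2))"
  using pE_skl[of T 2 3] nz by (simp add: 4 power2_eq_square)
qed

text \<open>The differences of wp at T/7, 2T/7, 3T/7 add up, and clearing denominators gives Klein's
  quartic x^3 y + y^3 z + z^3 x = 0 with x = - \<open>skl T 1\<close>, y = \<open>skl T 2\<close>, z
  = \<open>skl T 3\<close>.\<close>

lemma klein_quartic:
 assumes t: "T : \<H>"
 shows "skl T 2 ^ 3 * skl T 3 = skl T 1 ^ 3 * skl T 2 + skl T 1 * skl T 3 ^ 3"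
proof -
 have nz: "skl T 1 ~= 0" "skl T 2 ~= 0" "skl T 3 ~= 0" by (rule skl_nonzero[OF t]; simp)+
 have "pE T (T / 7) (2 * T / 7) + pE T (2 * T / 7) (3 * T / 7) = pE T (T / 7) (3 * T / 7)"
  by (rule pE_add[OF t]) (use sig_seventh_nonzero[OF t, of 1] sig_seventh_nonzero[OF t, of 2] sig_seventh_nonzero[OF t, of 3] in auto)
 hence "(skl T 3 / (skl T 1 * skl T 2 ^ 2) + skl T 1 / (skl T 2 * skl T 3 ^ 2)) * (skl T 1 ^ 2 * skl T 2 ^ 2 * skl T 3 ^ 2) =
   skl T 2 / (skl T 1 ^ 2 * skl T 3) * (skl T 1 ^ 2 * skl T 2 ^ 2 * skl T 3 ^ 2)"
  unfolding pE_seventh[OF t] by (metis minus_add_distrib neg_equal_iff_equal)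
 moreover have "(skl T 3 / (skl T 1 * skl T 2 ^ 2) + skl T 1 / (skl T 2 * skl T 3 ^ 2)) * (skl T 1 ^ 2 * skl T 2 ^ 2 * skl T 3 ^ 2) =
   skl T 1 ^ 3 * skl T 2 + skl T 1 * skl T 3 ^ 3"
  using nz by (simp add: distrib_right power2_eq_square power3_eq_cube)
 moreover have "skl T 2 / (skl T 1 ^ 2 * skl T 3) * (skl T 1 ^ 2 * skl T 2 ^ 2 * skl T 3 ^ 2) = skl T 2 ^ 3 * skl T 3"
  using nz by (simp add: power2_eq_square power3_eq_cube)
 ultimately show ?thesis by simp
qed

definition ups :: "complex => complex" where
 "ups T = skl T 2 ^ 2 * skl T 3 / skl T 1 ^ 3"

lemma ups_minus_1:
 assumes t: "T : \<H>"
 shows "ups T - 1 = skl T 3 ^ 3 / (skl T 1 ^ 2 * skl T 2)"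
proof -
 have nz: "skl T 1 ~= 0" "skl T 2 ~= 0" "skl T 3 ~= 0" by (rule skl_nonzero[OF t]; simp)+
 have "ups T * (skl T 1 ^ 3 * skl T 2) = skl T 2 ^ 3 * skl T 3"
  using nz by (simp add: ups_def power2_eq_square power3_eq_cube)
 hence "(ups T - 1) * (skl T 1 ^ 3 * skl T 2) = skl T 1 * skl T 3 ^ 3"
  using klein_quartic[OF t] by (simp add: left_diff_distrib)
 hence "ups T - 1 = skl T 1 * skl T 3 ^ 3 / (skl T 1 ^ 3 * skl T 2)"
  using nz by (simp add: nonzero_eq_divide_eq)
 thus ?thesis using nz by (simp add: power2_eq_square power3_eq_cube mult.assoc)
qed

text \<open>A monic cubic is determined by three values. Those at 0, 1 and (d - 1)/d give the
  elementary symmetric functions of its roots as rational functions of d, and with them the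
  discriminant. The factor 8 d (d - 1) is the scaling that turns it into the prescribed square of
  Delta.\<close>

lemma cubic_discriminant:
 fixes w1 w2 w3 d :: complex
 assumes d: "d ~= 0" "d ~= 1"
  and p0: "w1 * w2 * w3 = (d - 1) / 4"
  and p1: "(1 - w1) * (1 - w2) * (1 - w3) = - 1 / (4 * d ^ 2 * (d - 1))"
  and pX: "((d - 1) / d - w1) * ((d - 1) / d - w2) * ((d - 1) / d - w3) = - ((d - 1) ^ 3 / (4 * d ^ 4))"
 shows "(8 * d * (d - 1) * ((w1 - w2) * (w2 - w3) * (w3 - w1))) ^ 2 =
     4 * ((d - 1) ^ 3 * (d ^ 3 - 8 * d ^ 2 + 5 * d + 1) / d ^ 3)"
proof -
 define s1 s2 s3 where "s1 = w1 + w2 + w3" "s2 = w1 * w2 + w2 * w3 + w3 * w1" "s3 = w1 * w2 * w3"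
 note s_def = this
 define X where "X = (d - 1) / d"
 have disc: "((w1 - w2) * (w2 - w3) * (w3 - w1)) ^ 2 = s1 ^ 2 * s2 ^ 2 - 4 * s2 ^ 3 - 4 * s1 ^ 3 * s3 - 27 * s3 ^ 2 + 18 * s1 * s2 * s3"
  unfolding s_def by (simp add: algebra_simps power2_eq_square power3_eq_cube)
 have e0: "s3 = (d - 1) / 4" using p0 by (simp add: s_def)
 have "1 - s1 + s2 - s3 = - 1 / (4 * d ^ 2 * (d - 1))"
  using p1 by (simp add: s_def algebra_simps)
 hence e1: "s2 = s1 + ((d - 1) / 4 - 1 - 1 / (4 * d ^ 2 * (d - 1)))"
  unfolding e0 by (simp add: algebra_simps)
 have "X ^ 3 - s1 * X ^ 2 + s2 * X - s3 = - ((d - 1) ^ 3 / (4 * d ^ 4))"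
  using pX unfolding X_def[symmetric] by (simp add: s_def algebra_simps power2_eq_square power3_eq_cube)
 hence e2: "X ^ 3 - (s2 - ((d - 1) / 4 - 1 - 1 / (4 * d ^ 2 * (d - 1)))) * X ^ 2 + s2 * X - (d - 1) / 4 + (d - 1) ^ 3 / (4 * d ^ 4) = 0"
  unfolding e0 using e1 by simp
 have a: "s2 * (X - X ^ 2) + (X ^ 3 + ((d - 1) / 4 - 1 - 1 / (4 * d ^ 2 * (d - 1))) * X ^ 2 - (d - 1) / 4 + (d - 1) ^ 3 / (4 * d ^ 4)) = 0"
  using e2 by (simp add: algebra_simps)
 have b: "X ^ 3 + ((d - 1) / 4 - 1 - 1 / (4 * d ^ 2 * (d - 1))) * X ^ 2 - (d - 1) / 4 + (d - 1) ^ 3 / (4 * d ^ 4) =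
   - ((d ^ 2 + d - 1) / (2 * d)) * ((d - 1) / d ^ 2)"
 proof -
  have "1 / (4 * d ^ 2 * (d - 1)) * X ^ 2 = (d - 1) / (4 * d ^ 4)"
   using d by (simp add: X_def field_simps eval_nat_numeral)
  hence "X ^ 3 + ((d - 1) / 4 - 1 - 1 / (4 * d ^ 2 * (d - 1))) * X ^ 2 - (d - 1) / 4 + (d - 1) ^ 3 / (4 * d ^ 4) =
    (d - 1) ^ 3 / d ^ 3 + ((d - 1) / 4 - 1) * ((d - 1) ^ 2 / d ^ 2) - (d - 1) / (4 * d ^ 4) - (d - 1) / 4 + (d - 1) ^ 3 / (4 * d ^ 4)"
   by (simp only: left_diff_distrib[of _ "1 / (4 * d ^ 2 * (d - 1))"]) (simp add: X_def power_divide)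
  also have "\<dots> = (4 * d * (d - 1) ^ 3 + (d - 5) * d ^ 2 * (d - 1) ^ 2 - (d - 1) - d ^ 4 * (d - 1) + (d - 1) ^ 3) / (4 * d ^ 4)"
   using d by (simp add: add_divide_distrib diff_divide_distrib eval_nat_numeral) (simp add: field_simps)
  also have "4 * d * (d - 1) ^ 3 + (d - 5) * d ^ 2 * (d - 1) ^ 2 - (d - 1) - d ^ 4 * (d - 1) + (d - 1) ^ 3 = - (2 * d * (d ^ 2 + d - 1) * (d - 1))"
   by (simp add: algebra_simps eval_nat_numeral)
  also have "\<dots> / (4 * d ^ 4) = - ((d ^ 2 + d - 1) / (2 * d)) * ((d - 1) / d ^ 2)"
   using d by (simp add: eval_nat_numeral mult.assoc mult.commute[of "d - 1"])
  finally show ?thesis .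
 qed
 have X2: "X - X ^ 2 = (d - 1) / d ^ 2" using d by (simp add: X_def field_simps power2_eq_square)
 have "(s2 - (d ^ 2 + d - 1) / (2 * d)) * ((d - 1) / d ^ 2) = 0"
  unfolding left_diff_distrib[of s2] using a[unfolded b X2] by simp
 hence e3: "s2 = (d ^ 2 + d - 1) / (2 * d)" using d by simp
 \<comment> \<open>\<open>N1\<close> and \<open>N2\<close> are the numerators of \<open>s1\<close>
   and \<open>s2\<close> over the denominators 4 d^2 (d - 1) and 2 d. They turn the discriminant
   formula into a polynomial identity in d.\<close>
 define N1 where "N1 = 2 * d * (d - 1) * (d ^ 2 + d - 1) - d ^ 2 * (d - 1) ^ 2 + 4 * d ^ 2 * (d - 1) + 1"
 define N2 where "N2 = d ^ 2 + d - 1"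
 have e3: "s2 = N2 / (2 * d)" using e3 by (simp add: N2_def)
 have e4: "s1 = N1 / (4 * d ^ 2 * (d - 1))"
 proof -
  define M where "M = 4 * d ^ 2 * (d - 1)"
  have M: "M ~= 0" using d by (simp add: M_def)
  have "s1 = N2 / (2 * d) - ((d - 1) / 4 - 1) + 1 / M"
   using e1 e3 by (simp add: M_def)
  hence "s1 * M = N2 / (2 * d) * M - ((d - 1) / 4 - 1) * M + 1 / M * M"
   by (simp only: distrib_right left_diff_distrib)
  also have "1 / M * M = 1" using M by simp
  also have "N2 / (2 * d) * M = 2 * d * (d - 1) * N2"
   unfolding M_def using d by (simp add: eval_nat_numeral)
  also have "((d - 1) / 4 - 1) * M = (d - 5) * d ^ 2 * (d - 1)"
   unfolding M_def by (simp add: field_simps)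
  also have "2 * d * (d - 1) * N2 - (d - 5) * d ^ 2 * (d - 1) + 1 = N1"
   unfolding N1_def N2_def by (simp add: algebra_simps eval_nat_numeral)
  finally show ?thesis using M by (simp add: nonzero_eq_divide_eq M_def)
 qed
 have poly: "N1 ^ 2 * N2 ^ 2 - 32 * d ^ 3 * (d - 1) ^ 2 * N2 ^ 3 - N1 ^ 3 - 108 * d ^ 6 * (d - 1) ^ 4 + 36 * d ^ 3 * N1 * N2 * (d - 1) ^ 2 =
   4 * d * (d - 1) ^ 3 * (d ^ 3 - 8 * d ^ 2 + 5 * d + 1)"
  unfolding N1_def N2_def by (simp add: algebra_simps eval_nat_numeral)
 have "(8 * d * (d - 1)) ^ 2 * (s1 ^ 2 * s2 ^ 2) * d ^ 4 = N1 ^ 2 * N2 ^ 2"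
    "(8 * d * (d - 1)) ^ 2 * (4 * s2 ^ 3) * d ^ 4 = 32 * d ^ 3 * (d - 1) ^ 2 * N2 ^ 3"
    "(8 * d * (d - 1)) ^ 2 * (4 * s1 ^ 3 * s3) * d ^ 4 = N1 ^ 3"
    "(8 * d * (d - 1)) ^ 2 * (27 * s3 ^ 2) * d ^ 4 = 108 * d ^ 6 * (d - 1) ^ 4"
    "(8 * d * (d - 1)) ^ 2 * (18 * s1 * s2 * s3) * d ^ 4 = 36 * d ^ 3 * N1 * N2 * (d - 1) ^ 2"
  unfolding e0 e3 e4 using d by (simp_all add: eval_nat_numeral)
 hence "(8 * d * (d - 1) * ((w1 - w2) * (w2 - w3) * (w3 - w1))) ^ 2 * d ^ 4 = 4 * d * (d - 1) ^ 3 * (d ^ 3 - 8 * d ^ 2 + 5 * d + 1)"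
  unfolding power_mult_distrib[of "8 * d * (d - 1)"] disc poly[symmetric]
  by (simp only: distrib_left right_diff_distrib distrib_right left_diff_distrib)
 hence "(8 * d * (d - 1) * ((w1 - w2) * (w2 - w3) * (w3 - w1))) ^ 2 = 4 * d * (d - 1) ^ 3 * (d ^ 3 - 8 * d ^ 2 + 5 * d + 1) / d ^ 4"
  using d by (simp add: nonzero_eq_divide_eq)
 thus ?thesis using d by (simp add: eval_nat_numeral)
qed

text \<open>A square root of the discriminant of the half-period cubic, of weight 6. A cyclic
  permutation of the half periods only permutes the factors, while a transposition changes the sign;
  this is where the subgroup of order 3 modulo 2 enters.\<close>

definition Dfun :: "complex => complex" where
 "Dfun T = pE T (T / 2) (1 / 2) * pE T ((1 + T) / 2) (T / 2) * pE T (1 / 2) ((1 + T) / 2)"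

lemma sig_half_nonzero:
 assumes t: "T : \<H>"
 shows "sig T (1 / 2) ~= 0" "sig T (T / 2) ~= 0" "sig T ((1 + T) / 2) ~= 0"
proof -
 have half: "(1::real) / 2 ~: \<int>"
  using fraction_not_in_Ints[of 2 1, where 'a = real] by auto
 show "sig T (1 / 2) ~= 0" "sig T (T / 2) ~= 0" "sig T ((1 + T) / 2) ~= 0"
  using sig_real_eq_0_iff[OF t, of "1/2" 0] sig_real_eq_0_iff[OF t, of 0 "1/2"] sig_real_eq_0_iff[OF t, of "1/2" "1/2"] half
  by (auto simp: add_divide_distrib)
qed

text \<open>The cube of a difference at points of order 7 also has weight 6, so the quotient has
  weight 0.\<close>

definition Del :: "complex => complex" where
 "Del T = 8 * ups T * (ups T - 1) * (Dfun T / pE T (T / 7) (3 * T / 7) ^ 3)"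

lemma ups_neq:
 assumes t: "T : \<H>"
 shows "ups T ~= 0" "ups T ~= 1"
proof -
 have nz: "skl T 1 ~= 0" "skl T 2 ~= 0" "skl T 3 ~= 0" by (rule skl_nonzero[OF t]; simp)+
 show "ups T ~= 0" using nz by (simp add: ups_def)
 have "ups T - 1 ~= 0" using nz by (simp add: ups_minus_1[OF t])
 thus "ups T ~= 1" by simp
qed

text \<open>
  The abscissae of the half periods are the roots of a monic cubic whose values at the abscissae of the
  points \<open>\<tau>/7\<close>, \<open>2\<tau>/7\<close>, \<open>3\<tau>/7\<close> are given by the duplication formula; hence its discriminant is a
  rational function of \<open>ups \<tau>\<close>.
\<close>

lemma Del_square:
 assumes t: "T : \<H>"
 shows "Del T ^ 2 = 4 * ((ups T - 1) ^ 3 * (ups T ^ 3 - 8 * ups T ^ 2 + 5 * ups T + 1) / ups T ^ 3)"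
proof -
 define s1 s2 s3 where "s1 = skl T 1" "s2 = skl T 2" "s3 = skl T 3"
 note s_def = this
 have nz: "s1 ~= 0" "s2 ~= 0" "s3 ~= 0" unfolding s_def by (rule skl_nonzero[OF t]; simp)+
 define d where "d = ups T"
 have d: "d ~= 0" "d ~= 1" using ups_neq[OF t] by (simp_all add: d_def)
 have d_eq: "d = s2 ^ 2 * s3 / s1 ^ 3" by (simp add: d_def ups_def s_def)
 have d1_eq: "d - 1 = s3 ^ 3 / (s1 ^ 2 * s2)" using ups_minus_1[OF t] by (simp add: d_def s_def)
 define X2 X3 where "X2 = pE T (T / 7) (2 * T / 7)" "X3 = pE T (T / 7) (3 * T / 7)"
 note X_def = this
 have X2: "X2 = - (s3 / (s1 * s2 ^ 2))" and X3: "X3 = - (s2 / (s1 ^ 2 * s3))"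
  using pE_seventh[OF t] by (simp_all add: X_def s_def)
 have X3nz: "X3 ~= 0" using X3 nz by simp
 have X23: "X2 / X3 = (d - 1) / d"
  unfolding X2 X3 d1_eq unfolding d_eq using nz by (simp add: field_simps power2_eq_square power3_eq_cube)
 \<comment> \<open>Abscissae are translated and scaled so that T/7, 3T/7 and 2T/7 lie at 0, 1 and (d
   - 1)/d, the three nodes of \<open>cubic_discriminant\<close>.\<close>
 define w1 w2 w3 where "w1 = pE T (T / 7) (1 / 2) / X3" "w2 = pE T (T / 7) (T / 2) / X3" "w3 = pE T (T / 7) ((1 + T) / 2) / X3"
 note w_def = this
 note hnz = sig_half_nonzero[OF t]
 have snz: "sig T (T / 7) ~= 0" "sig T (2 * T / 7) ~= 0" "sig T (3 * T / 7) ~= 0"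
  using sig_seventh_nonzero[OF t, of 1] sig_seventh_nonzero[OF t, of 2] sig_seventh_nonzero[OF t, of 3] by auto
 have s46: "skl T 4 = s3" "skl T 6 = s1"
  using skl_7_minus[OF t, of 3] skl_7_minus[OF t, of 1] by (simp_all add: s_def)
 have w: "w1 = pE T (T / 7) (1 / 2) / X3" "w2 = pE T (T / 7) (T / 2) / X3" "w3 = pE T (T / 7) ((1 + T) / 2) / X3"
  by (simp_all add: w_def)
 have sub: "(X2 / X3 - pE T (T / 7) h / X3) = - (pE T (2 * T / 7) h / X3)"
      "(1 - pE T (T / 7) h / X3) = - (pE T (3 * T / 7) h / X3)" if h: "sig T h ~= 0" for h
 proof -
  have "X2 - pE T (T / 7) h = - pE T (2 * T / 7) h"
   using pE_add[OF t snz(1,2) h] by (simp add: X_def algebra_simps)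
  thus "(X2 / X3 - pE T (T / 7) h / X3) = - (pE T (2 * T / 7) h / X3)"
   by (simp add: diff_divide_distrib[symmetric])
  have "X3 - pE T (T / 7) h = - pE T (3 * T / 7) h"
   using pE_add[OF t snz(1,3) h] by (simp add: X_def algebra_simps)
  moreover have "1 - pE T (T / 7) h / X3 = (X3 - pE T (T / 7) h) / X3"
   using X3nz by (simp add: diff_divide_distrib)
  ultimately show "(1 - pE T (T / 7) h / X3) = - (pE T (3 * T / 7) h / X3)"
   by simp
 qed
 have prod: "pE T (of_int k * T / 7) (1 / 2) * pE T (of_int k * T / 7) (T / 2) * pE T (of_int k * T / 7) ((1 + T) / 2) =
   - (skl T (2 * k) ^ 2 / (4 * skl T k ^ 8))" if "~ 7 dvd k" for k
 proof -
  have "sig T (2 * (of_int k * T / 7)) ^ 2 / (4 * sig T (of_int k * T / 7) ^ 8) = (skl T (2 * k) ^ 2 / skl T k ^ 8) / 4"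
   unfolding sig_double_skl[symmetric] by simp
  thus ?thesis unfolding pE_prod_half_periods[OF t sig_seventh_nonzero[OF t that]] by simp
 qed
 have p0: "w1 * w2 * w3 = (d - 1) / 4"
 proof -
  have "w1 * w2 * w3 = - (s2 ^ 2 / (4 * s1 ^ 8)) / X3 ^ 3"
   using prod[of 1] by (simp add: w s_def power3_eq_cube)
  also have "\<dots> = (d - 1) / 4"
   unfolding d1_eq X3 using nz by (simp add: field_simps eval_nat_numeral)
  finally show ?thesis .
 qed
 have p1: "(1 - w1) * (1 - w2) * (1 - w3) = - 1 / (4 * d ^ 2 * (d - 1))"
 proof -
  have "(1 - w1) * (1 - w2) * (1 - w3) = (s1 ^ 2 / (4 * s3 ^ 8)) / X3 ^ 3"
   unfolding w sub(2)[OF hnz(1)] sub(2)[OF hnz(2)] sub(2)[OF hnz(3)]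
   using prod[of 3] s46 by (simp add: s_def power3_eq_cube)
  also have "\<dots> = - 1 / (4 * d ^ 2 * (d - 1))"
   unfolding d1_eq X3 unfolding d_eq using nz by (simp add: field_simps eval_nat_numeral)
  finally show ?thesis .
 qed
 have p2: "((d - 1) / d - w1) * ((d - 1) / d - w2) * ((d - 1) / d - w3) = - ((d - 1) ^ 3 / (4 * d ^ 4))"
 proof -
  have "((d - 1) / d - w1) * ((d - 1) / d - w2) * ((d - 1) / d - w3) = (s3 ^ 2 / (4 * s2 ^ 8)) / X3 ^ 3"
   unfolding w X23[symmetric] sub(1)[OF hnz(1)] sub(1)[OF hnz(2)] sub(1)[OF hnz(3)]
   using prod[of 2] s46 by (simp add: s_def power3_eq_cube)
  also have "\<dots> = - ((d - 1) ^ 3 / (4 * d ^ 4))"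
   unfolding d1_eq X3 unfolding d_eq using nz by (simp add: field_simps eval_nat_numeral)
  finally show ?thesis .
 qed
 have diff: "pE T (T / 7) h / X3 - pE T (T / 7) h' / X3 = pE T h' h / X3" if "sig T h ~= 0" "sig T h' ~= 0" for h h'
  using pE_add[OF t snz(1) that(2,1)] by (simp add: diff_divide_distrib[symmetric] add_divide_distrib[symmetric] flip: diff_eq_eq) (simp add: algebra_simps)
 have "(w1 - w2) * (w2 - w3) * (w3 - w1) = Dfun T / X3 ^ 3"
  unfolding w diff[OF hnz(1,2)] diff[OF hnz(2,3)] diff[OF hnz(3,1)] by (simp add: Dfun_def power3_eq_cube)
 thus ?thesis
  using cubic_discriminant[OF d p0 p1 p2] by (simp add: Del_def d_def X_def)
qed

section \<open>Theta series\<close>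

text \<open>Jacobi's odd theta function up to a constant, with exactly the quasi-periods of
  \<open>sig T\<close>.\<close>

definition thetasum :: "complex => complex => complex" where
 "thetasum T z = (\<Sum>\<^sub>\<infinity>n::int. ee (of_int n / 2 + T * (of_int n + 1 / 2) ^ 2 / 2 + (of_int n + 1 / 2) * z))"

lemma has_sum_geometric_int:
 fixes r :: real
 assumes r: "0 <= r" "r < 1"
 shows "((%n::int. r ^ nat \<bar>n\<bar>) has_sum ((1 + r) / (1 - r))) UNIV"
proof -
 have geo: "((%n. r ^ n) has_sum (1 / (1 - r))) (UNIV :: nat set)"
  by (rule norm_summable_imp_has_sum) (use r geometric_sums[of r] in \<open>auto intro!: summable_geometric simp: norm_power\<close>)
 have "bij_betw int UNIV {0..}"
  by (intro bij_betwI[where g = nat]) auto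
 hence 1: "((%n::int. r ^ nat \<bar>n\<bar>) has_sum (1 / (1 - r))) {0..}"
  using geo by (subst has_sum_reindex_bij_betw[symmetric, where g = int and A = UNIV]) auto
 have "bij_betw (%n. - int (Suc n)) UNIV {..<0}"
  by (intro bij_betwI[where g = "%n. nat (- n) - 1"]) auto
 moreover have "((%n. r * r ^ n) has_sum (r * (1 / (1 - r)))) (UNIV :: nat set)"
  by (intro has_sum_cmult_right geo)
 ultimately have 2: "((%n::int. r ^ nat \<bar>n\<bar>) has_sum (r / (1 - r))) {..<0}"
  by (subst has_sum_reindex_bij_betw[symmetric, where g = "%n. - int (Suc n)" and A = UNIV])
    (auto simp: nat_add_distrib)
 have "((%n::int. r ^ nat \<bar>n\<bar>) has_sum (1 / (1 - r) + r / (1 - r))) ({0..} \<union> {..<0})"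
  by (rule has_sum_Un_disjoint[OF 1 2]) auto
 moreover have "{0..} \<union> {..<0} = (UNIV :: int set)" by auto
 ultimately show ?thesis by (simp add: add_divide_distrib)
qed

text \<open>Completing the square in |n + 1/2|: the linear coefficient 2 pi B is enlarged by 1, and
  the compensating -|n + 1/2| provides the geometric decay.\<close>

lemma thetasum_term_bound:
 assumes "Im T \<ge> \<delta>" "\<delta> > 0" "\<bar>Im z\<bar> <= B"
 shows "norm (ee (of_int n / 2 + T * (of_int n + 1 / 2) ^ 2 / 2 + (of_int n + 1 / 2) * z)) <=
     exp ((2 * pi * B + 1) ^ 2 / (4 * pi * \<delta>) + 1 / 2) * exp (- 1) ^ nat \<bar>n\<bar>"
proof -
 define x where "x = real_of_int n + 1 / 2"
 have xc: "of_int n + 1 / 2 = complex_of_real x" by (simp add: x_def)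
 have "norm (ee (of_int n / 2 + T * (of_int n + 1 / 2) ^ 2 / 2 + (of_int n + 1 / 2) * z)) =
    exp (- 2 * pi * (Im T * x ^ 2 / 2 + x * Im z))"
  unfolding norm_ee xc by (simp flip: of_real_power)
 also have "\<dots> <= exp ((2 * pi * B + 1) ^ 2 / (4 * pi * \<delta>) + 1 / 2 - real_of_int \<bar>n\<bar>)"
 proof -
  have "- (x * Im z) <= \<bar>x\<bar> * \<bar>Im z\<bar>" by (metis abs_ge_minus_self abs_mult)
  also have "\<dots> <= \<bar>x\<bar> * B" by (intro mult_left_mono assms) auto
  finally have 1: "- (x * Im z) <= \<bar>x\<bar> * B" .
  have 2: "Im T * x ^ 2 \<ge> \<delta> * x ^ 2" by (intro mult_right_mono assms) auto
  have 3: "real_of_int \<bar>n\<bar> <= \<bar>x\<bar> + 1 / 2" by (auto simp: x_def)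
  have "- 2 * pi * (Im T * x ^ 2 / 2 + x * Im z) = - pi * (Im T * x ^ 2) + 2 * pi * (- (x * Im z))"
   by (simp add: algebra_simps)
  also have "\<dots> <= - pi * (\<delta> * x ^ 2) + 2 * pi * (\<bar>x\<bar> * B)"
  proof -
   have "2 * pi * (- (x * Im z)) <= 2 * pi * (\<bar>x\<bar> * B)" "pi * (\<delta> * x ^ 2) <= pi * (Im T * x ^ 2)"
    using 1 2 by (intro mult_left_mono; simp)+
   thus ?thesis by linarith
  qed
  also have "\<dots> = - (pi * \<delta>) * \<bar>x\<bar> ^ 2 + (2 * pi * B + 1) * \<bar>x\<bar> - \<bar>x\<bar>"
   by (simp add: algebra_simps)
  also have "\<dots> <= (2 * pi * B + 1) ^ 2 / (4 * pi * \<delta>) - \<bar>x\<bar>"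
  proof -
   have "0 <= (2 * (pi * \<delta>) * \<bar>x\<bar> - (2 * pi * B + 1)) ^ 2 / (4 * (pi * \<delta>))"
    using assms(2) by simp
   also have "\<dots> = (pi * \<delta>) * \<bar>x\<bar> ^ 2 - (2 * pi * B + 1) * \<bar>x\<bar> + (2 * pi * B + 1) ^ 2 / (4 * (pi * \<delta>))"
    using assms(2) by (simp add: power2_diff field_simps) (simp add: power2_eq_square algebra_simps)
   finally show ?thesis by (simp add: mult_ac)
  qed
  finally show ?thesis using 3 by simp
 qed
 also have "\<dots> = exp ((2 * pi * B + 1) ^ 2 / (4 * pi * \<delta>) + 1 / 2) * exp (- 1) ^ nat \<bar>n\<bar>"
  by (simp flip: exp_of_nat_mult exp_add)
 finally show ?thesis .
qed

lemma exp_int_summable: "(%n::int. C * exp (- 1) ^ nat \<bar>n\<bar> :: real) summable_on UNIV"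
 by (intro summable_on_cmult_right has_sum_imp_summable[OF has_sum_geometric_int]) auto

lemma thetasum_holomorphic:
 assumes "open S" "t holomorphic_on S" "z holomorphic_on S" "!!s. s : S ==> t s : \<H>"
 shows "(%s. thetasum (t s) (z s)) holomorphic_on S"
proof -
 have "(%s. thetasum (t s) (z s)) field_differentiable at s" if "s : S" for s
 proof -
  obtain d where d: "d > 0" "cball s d <= S" using assms(1) \<open>s : S\<close> open_contains_cball by blast
  have ct: "continuous_on (cball s d) (%s. Im (t s))" "continuous_on (cball s d) (%s. \<bar>Im (z s)\<bar>)"
   using holomorphic_on_imp_continuous_on[OF holomorphic_on_subset[OF assms(2) d(2)]]
      holomorphic_on_imp_continuous_on[OF holomorphic_on_subset[OF assms(3) d(2)]]
   by (auto intro!: continuous_intros)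
  have ne: "cball s d ~= {}" using d by auto
  obtain s0 where s0: "s0 : cball s d" "!!x. x : cball s d ==> Im (t s0) <= Im (t x)"
   using continuous_attains_inf[OF compact_cball ne ct(1)] by blast
  obtain s1 where s1: "s1 : cball s d" "!!x. x : cball s d ==> \<bar>Im (z x)\<bar> <= \<bar>Im (z s1)\<bar>"
   using continuous_attains_sup[OF compact_cball ne ct(2)] by blast
  have pos: "Im (t s0) > 0" using s0(1) d(2) assms(4) by (auto simp: upper_half_plane_def)
  have ul: "uniform_limit (cball s d) (%X y. \<Sum>n\<in>X. ee (of_int n / 2 + t y * (of_int n + 1 / 2) ^ 2 / 2 + (of_int n + 1 / 2) * z y))
    (%y. thetasum (t y) (z y)) (finite_subsets_at_top UNIV)"
   unfolding thetasum_def
  proof (rule Weierstrass_m_test_general)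
   show "norm (ee (of_int n / 2 + t y * (of_int n + 1 / 2) ^ 2 / 2 + (of_int n + 1 / 2) * z y)) <=
     exp ((2 * pi * \<bar>Im (z s1)\<bar> + 1) ^ 2 / (4 * pi * Im (t s0)) + 1 / 2) * exp (- 1) ^ nat \<bar>n\<bar>"
    if "y : cball s d" for n y
    by (rule thetasum_term_bound) (use s0 s1 pos that in auto)
  qed (rule exp_int_summable)
  have ev: "eventually (%X. continuous_on (cball s d) (%y. \<Sum>n\<in>X. ee (of_int n / 2 + t y * (of_int n + 1 / 2) ^ 2 / 2 + (of_int n + 1 / 2) * z y)) \<and>
    (%y. \<Sum>n\<in>X. ee (of_int n / 2 + t y * (of_int n + 1 / 2) ^ 2 / 2 + (of_int n + 1 / 2) * z y)) holomorphic_on ball s d) (finite_subsets_at_top UNIV)"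
  proof (intro always_eventually allI conjI)
   fix X
   have *: "(%y. \<Sum>n\<in>X. ee (of_int n / 2 + t y * (of_int n + 1 / 2) ^ 2 / 2 + (of_int n + 1 / 2) * z y)) holomorphic_on S"
    by (intro holomorphic_intros assms) auto
   show "(%y. \<Sum>n\<in>X. ee (of_int n / 2 + t y * (of_int n + 1 / 2) ^ 2 / 2 + (of_int n + 1 / 2) * z y)) holomorphic_on ball s d"
    by (rule holomorphic_on_subset[OF *]) (use d in auto)
   show "continuous_on (cball s d) (%y. \<Sum>n\<in>X. ee (of_int n / 2 + t y * (of_int n + 1 / 2) ^ 2 / 2 + (of_int n + 1 / 2) * z y))"
    by (rule holomorphic_on_imp_continuous_on, rule holomorphic_on_subset[OF *]) (use d in auto)
  qed
  have "(%s. thetasum (t s) (z s)) holomorphic_on ball s d"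
   using holomorphic_uniform_limit[OF ev ul finite_subsets_at_top_neq_bot] by blast
  thus ?thesis using d by (meson centre_in_ball holomorphic_on_imp_differentiable_at open_ball)
 qed
 thus ?thesis by (auto simp: holomorphic_on_def intro: field_differentiable_at_within)
qed

lemma thetasum_plus_1: "thetasum T (z + 1) = - thetasum T z"
proof -
 have "ee (of_int n / 2 + T * (of_int n + 1 / 2) ^ 2 / 2 + (of_int n + 1 / 2) * (z + 1)) =
   (- 1) * ee (of_int n / 2 + T * (of_int n + 1 / 2) ^ 2 / 2 + (of_int n + 1 / 2) * z)" for n :: int
 proof -
  have "ee (of_int n / 2 + T * (of_int n + 1 / 2) ^ 2 / 2 + (of_int n + 1 / 2) * (z + 1)) =
   ee ((of_int n / 2 + T * (of_int n + 1 / 2) ^ 2 / 2 + (of_int n + 1 / 2) * z) + (of_int n + 1 / 2))"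
   by (rule arg_cong[of _ _ ee]) (simp add: field_simps)
  thus ?thesis by (simp only: ee_add[of _ "of_int n + 1 / 2"] ee_add[of "of_int n"] ee_of_int ee_half mult_1 mult.commute)
 qed
 thus ?thesis unfolding thetasum_def by (simp only: infsum_cmult_right') simp
qed

lemma thetasum_plus_tau: "thetasum T (z + T) = - ee (- T / 2 - z) * thetasum T z"
proof -
 define f where "f = (%n::int. ee (of_int n / 2 + T * (of_int n + 1 / 2) ^ 2 / 2 + (of_int n + 1 / 2) * z))"
 have "ee (of_int n / 2 + T * (of_int n + 1 / 2) ^ 2 / 2 + (of_int n + 1 / 2) * (z + T)) = - ee (- T / 2 - z) * f (n + 1)" for n
 proof -
  have "of_int n / 2 + T * (of_int n + 1 / 2) ^ 2 / 2 + (of_int n + 1 / 2) * (z + T) =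
    - (1 / 2) + (- T / 2 - z) + (of_int (n + 1) / 2 + T * (of_int (n + 1) + 1 / 2) ^ 2 / 2 + (of_int (n + 1) + 1 / 2) * z)"
   by (simp add: field_simps power2_eq_square)
  thus ?thesis unfolding f_def by (simp only: ee_add[of "- (1 / 2) + (- T / 2 - z)"] ee_add[of "- (1 / 2)"] ee_minus ee_half) simp
 qed
 hence "thetasum T (z + T) = - ee (- T / 2 - z) * (\<Sum>\<^sub>\<infinity>n. f (n + 1))"
  unfolding thetasum_def by (simp only: infsum_cmult_right')
 also have "(\<Sum>\<^sub>\<infinity>n. f (n + 1)) = (\<Sum>\<^sub>\<infinity>n. f n)"
  by (rule infsum_reindex_bij_betw) (auto intro!: bij_betwI[where g = "%n. n - 1"])
 finally show ?thesis by (simp add: thetasum_def f_def)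
qed

lemma thetasum_minus: "thetasum T (- z) = - thetasum T z"
proof -
 define f where "f = (%n::int. ee (of_int n / 2 + T * (of_int n + 1 / 2) ^ 2 / 2 + (of_int n + 1 / 2) * z))"
 have "ee (of_int n / 2 + T * (of_int n + 1 / 2) ^ 2 / 2 + (of_int n + 1 / 2) * (- z)) = (- 1) * f (- 1 - n)" for n :: int
 proof -
  have "of_int n / 2 + T * (of_int n + 1 / 2) ^ 2 / 2 + (of_int n + 1 / 2) * (- z) =
    of_int n + 1 / 2 + (of_int (- 1 - n) / 2 + T * (of_int (- 1 - n) + 1 / 2) ^ 2 / 2 + (of_int (- 1 - n) + 1 / 2) * z)"
   by (simp add: field_simps power2_eq_square)
  thus ?thesis unfolding f_def by (simp only: ee_add[of "of_int n + 1 / 2"] ee_add[of "of_int n"] ee_of_int ee_half mult_1)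
 qed
 hence "thetasum T (- z) = (- 1) * (\<Sum>\<^sub>\<infinity>n. f (- 1 - n))"
  unfolding thetasum_def by (simp only: infsum_cmult_right')
 also have "(\<Sum>\<^sub>\<infinity>n. f (- 1 - n)) = (\<Sum>\<^sub>\<infinity>n. f n)"
  by (rule infsum_reindex_bij_betw) (auto intro!: bij_betwI[where g = "%n. - 1 - n"])
 finally show ?thesis by (simp add: thetasum_def f_def)
qed

text \<open>Jacobi's triple product up to a factor depending only on \<open>T\<close>, which cancels
  in the quotients defining psi and upsilon.\<close>

lemma thetasum_conv_sig:
 assumes "T : \<H>"
 obtains C where "!!z. thetasum T z = C * sig T z"
proof (rule sig_characterization[OF assms, of "thetasum T"])
 show "thetasum T holomorphic_on UNIV"
  using thetasum_holomorphic[of UNIV "%_. T" "%z. z"] assms by auto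
 show "thetasum T 0 = 0" using thetasum_minus[of T 0] by simp
qed (use that in \<open>auto simp: thetasum_plus_1 thetasum_plus_tau\<close>)

lemma minus_one_powi_ee: "(- 1) powi m = ee (of_int m / 2)"
proof (cases "even m")
 case True
 then obtain k where "m = 2 * k" by auto
 thus ?thesis by (simp add: True)
next
 case False
 thus ?thesis by (simp add: ee_half_odd)
qed

text \<open>With x = n + 1/2 one has (14 n + 7 - 2 k)^2 / 56 = 7 x^2 / 2 - k x + k^2 / 14. Hence the
  modulus 7T and the argument -kT, a point of order 7 modulo Z + 7TZ.\<close>

lemma theta_a_conv_thetasum:
 "theta_a k T = ee (of_nat (k + 1) / 2) * ee (of_nat k ^ 2 * T / 14) * thetasum (7 * T) (- of_nat k * T)"
proof -
 have "(- 1) powi (n + int k + 1) * exp (2 * of_real pi * \<i> * (of_int ((14 * n + 7 - 2 * int k)\<^sup>2) / 56) * T) =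
   ee (of_nat (k + 1) / 2) * ee (of_nat k ^ 2 * T / 14) *
   ee (of_int n / 2 + (7 * T) * (of_int n + 1 / 2) ^ 2 / 2 + (of_int n + 1 / 2) * (- of_nat k * T))" for n
 proof -
  have "exp (2 * of_real pi * \<i> * (of_int ((14 * n + 7 - 2 * int k)\<^sup>2) / 56) * T) = ee ((of_int ((14 * n + 7 - 2 * int k)\<^sup>2) / 56) * T)"
   by (simp only: ee_def mult.assoc)
  also have "(-1) powi (n + int k + 1) * \<dots> = ee (of_int (n + int k + 1) / 2 + (of_int ((14 * n + 7 - 2 * int k)\<^sup>2) / 56) * T)"
   unfolding minus_one_powi_ee ee_add ..
  also have "of_int (n + int k + 1) / 2 + (of_int ((14 * n + 7 - 2 * int k)\<^sup>2) / 56) * T =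
    of_nat (k + 1) / 2 + of_nat k ^ 2 * T / 14 +
    (of_int n / 2 + (7 * T) * (of_int n + 1 / 2) ^ 2 / 2 + (of_int n + 1 / 2) * (- of_nat k * T))"
   by (simp add: power2_eq_square) (simp add: field_simps)
  finally show ?thesis by (simp only: ee_add)
 qed
 thus ?thesis unfolding theta_a_def thetasum_def by (simp only: infsum_cmult_right')
qed

lemma theta_a_conv_skl:
 assumes "T : \<H>"
 obtains C where "!!k. theta_a k T = (- 1) ^ k * C * skl (7 * T) (int k)"
proof -
 have t7: "7 * T : \<H>" using assms by (auto simp: upper_half_plane_def)
 obtain C where C: "!!z. thetasum (7 * T) z = C * sig (7 * T) z" using thetasum_conv_sig[OF t7] by metis
 have "theta_a k T = (- 1) ^ k * C * skl (7 * T) (int k)" for k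
 proof -
  have "ee (of_nat (k + 1) / 2) = - ((- 1) ^ k)"
   using minus_one_powi_ee[of "int (k + 1)"] by (simp only: power_int_of_nat of_int_of_nat_eq) simp
  thus ?thesis unfolding theta_a_conv_thetasum C skl_def
   using sig_minus[of "7 * T" "of_nat k * T"] by (simp add: mult_ac)
 qed
 thus ?thesis using that by blast
qed

lemma theta_a_holomorphic: "theta_a k holomorphic_on \<H>"
proof -
 have "(%T. ee (of_nat (k + 1) / 2) * ee (of_nat k ^ 2 * T / 14) * thetasum (7 * T) (- of_nat k * T)) holomorphic_on \<H>"
  by (intro holomorphic_intros thetasum_holomorphic) (auto, auto simp: upper_half_plane_def)
 thus ?thesis unfolding theta_a_conv_thetasum[symmetric] .
qed

text \<open>Guarantees that the common factor in \<open>theta_a_conv_skl\<close> is not identically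
  zero. Index 3 has the smallest leading exponent, 1/56, and at the point i the term n = 0 outweighs
  all the others together.\<close>

lemma theta_a_3_nonzero: "theta_a 3 \<i> ~= 0"
proof
 assume zero: "theta_a 3 \<i> = 0"
 define c where "c = (%n::int. (- 1) powi (n + 4) * exp (2 * of_real pi * \<i> * (of_int ((14 * n + 1)\<^sup>2) / 56) * \<i>))"
 have theta: "theta_a 3 \<i> = (\<Sum>\<^sub>\<infinity>n. c n)" unfolding theta_a_def c_def
  by (rule infsum_cong) (simp add: algebra_simps)
 have norm_c: "norm (c n) = exp (- 2 * pi * (of_int ((14 * n + 1)\<^sup>2) / 56))" for n
 proof -
  have "norm (c n) = norm (exp (2 * of_real pi * \<i> * (of_int ((14 * n + 1)\<^sup>2) / 56) * \<i>))"
   unfolding c_def by (simp only: norm_mult norm_power_int norm_minus_cancel norm_one power_int_1_left mult_1)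
  thus ?thesis by (simp add: mult_ac)
 qed
 define K where "K = exp (- 2 * pi / 56)"
 have bound: "norm (c n) <= K * (1 / 8) ^ nat \<bar>n\<bar>" for n
 proof -
  have "real_of_int (n ^ 2) \<ge> real_of_int \<bar>n\<bar>"
  proof (cases "n = 0")
   case False
   hence "\<bar>n\<bar> * 1 <= \<bar>n\<bar> * \<bar>n\<bar>" by (intro mult_left_mono) auto
   thus ?thesis by (subst of_int_le_iff) (simp add: power2_eq_square flip: abs_mult)
  qed auto
  hence "7 * real_of_int (n ^ 2) + of_int n \<ge> 6 * real_of_int \<bar>n\<bar>" by linarith
  hence "real_of_int ((14 * n + 1)\<^sup>2) / 56 \<ge> 1 / 56 + 3 * real_of_int \<bar>n\<bar>"
   by (simp add: power2_eq_square algebra_simps)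
  hence "pi * (real_of_int ((14 * n + 1)\<^sup>2) / 56) \<ge> pi * (1 / 56 + 3 * real_of_int \<bar>n\<bar>)"
   by (intro mult_left_mono) auto
  hence "norm (c n) <= exp (- 2 * pi / 56 + real (nat \<bar>n\<bar>) * (- 6 * pi))"
   unfolding norm_c by (simp add: algebra_simps)
  also have "\<dots> = K * exp (- 6 * pi) ^ nat \<bar>n\<bar>"
   by (simp only: exp_add K_def exp_of_nat_mult)
  also have "\<dots> <= K * (1 / 8) ^ nat \<bar>n\<bar>"
  proof (intro mult_left_mono power_mono)
   have "8 <= 1 + 6 * pi" using pi_gt3 by simp
   also have "\<dots> <= exp (6 * pi)" using exp_ge_add_one_self[of "6 * pi"] by simp
   finally show "exp (- 6 * pi) <= 1 / 8" by (simp add: exp_minus field_simps)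
  qed (auto simp: K_def)
  finally show ?thesis .
 qed
 have hs: "((%n::int. (1 / 8 :: real) ^ nat \<bar>n\<bar>) has_sum (9 / 7)) UNIV"
  using has_sum_geometric_int[of "1/8"] by simp
 have sm: "(%n::int. K * (1 / 8) ^ nat \<bar>n\<bar>) summable_on A" for A
  by (rule summable_on_subset_banach[of _ UNIV], intro summable_on_cmult_right has_sum_imp_summable[OF hs]) auto
 have cs: "c summable_on A" for A
  by (rule abs_summable_summable, rule summable_on_comparison_test[OF sm]) (use bound in auto)
 have "(\<Sum>\<^sub>\<infinity>n. c n) = c 0 + (\<Sum>\<^sub>\<infinity>n\<in>UNIV - {0}. c n)"
  using infsum_Un_disjoint[OF cs cs, of "{0}" "UNIV - {0}"] by simp
 hence "norm (c 0) = norm (\<Sum>\<^sub>\<infinity>n\<in>UNIV - {0}. c n)"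
  using zero unfolding theta by (metis add_eq_0_iff norm_minus_cancel)
 also have "\<dots> <= (\<Sum>\<^sub>\<infinity>n\<in>UNIV - {0}. K * (1 / 8) ^ nat \<bar>n\<bar>)"
  by (rule norm_infsum_le[OF has_sum_infsum[OF cs] has_sum_infsum[OF sm]]) (use bound in auto)
 also have "\<dots> = K * (2 / 7)"
 proof -
  have "((%n::int. K * (1 / 8) ^ nat \<bar>n\<bar>) has_sum (K * (9 / 7) - K)) (UNIV - {0})"
   using has_sum_Diff[OF has_sum_cmult_right[OF hs, of K] has_sum_finite[of "{0::int}"]] by simp
  thus ?thesis by (simp add: infsumI algebra_simps)
 qed
 also have "\<dots> < K" by (simp add: K_def)
 also have "K = norm (c 0)" by (simp add: norm_c K_def)
 finally show False by simp
qed

section \<open>The functions in terms of theta series\<close>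

no_notation fps_nth (infixl "$" 75)

lemma eval_mero_of_holomorphic:
 assumes "f holomorphic_on \<H>" "z : \<H>"
 shows   "evm (mero_of f) z = f z"
proof -
 have "f analytic_on \<H>" using assms(1) by (simp add: analytic_on_open)
 hence "f meromorphic_on \<H>" "f analytic_on {z}"
  using assms(2) by (auto intro: analytic_on_imp_meromorphic_on elim: analytic_on_subset)
 thus ?thesis using assms(2) by (simp add: eval_mero_of)
qed

section \<open>Psi, upsilon and Delta as holomorphic functions on the upper half-plane\<close>

lemma mult_7_in_uhp: "T : \<H> ==> 7 * T : \<H>"
 by (simp add: upper_half_plane_def)

definition psi_fun :: "complex => complex" where
 "psi_fun T = skl (7 * T) 2 * skl (7 * T) 3 / skl (7 * T) 1 ^ 2"

definition upsf :: "complex => complex" where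
 "upsf T = ups (7 * T)"

definition Delta_fun :: "complex => complex" where
 "Delta_fun T = Del (7 * T)"

lemma skl_7_holomorphic: "(%T. skl (7 * T) k) holomorphic_on \<H>"
 unfolding skl_def by (intro holomorphic_intros) (auto intro: mult_7_in_uhp)

lemma skl_7_nonzero:
 assumes "T : \<H>"
 shows   "skl (7 * T) 1 ~= 0" "skl (7 * T) 2 ~= 0" "skl (7 * T) 3 ~= 0"
 by (rule skl_nonzero[OF mult_7_in_uhp[OF assms]]; simp)+

lemma psi_fun_holomorphic: "psi_fun holomorphic_on \<H>"
 unfolding psi_fun_def by (intro holomorphic_intros skl_7_holomorphic) (auto simp: skl_7_nonzero)

lemma upsf_holomorphic: "upsf holomorphic_on \<H>"
 unfolding upsf_def ups_def by (intro holomorphic_intros skl_7_holomorphic) (auto simp: skl_7_nonzero)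

lemma psi_fun_7:
 assumes "T : \<H>"
 shows   "psi_fun T ^ 7 = upsf T ^ 4 * (upsf T - 1)"
 unfolding upsf_def ups_minus_1[OF mult_7_in_uhp[OF assms]]
 unfolding psi_fun_def ups_def using skl_7_nonzero[OF assms]
 by (simp add: power_mult_distrib power_divide field_simps flip: power_add power_mult power_Suc)

lemma upsf_neq:
 assumes "T : \<H>"
 shows   "upsf T ~= 0" "upsf T ~= 1"
 unfolding upsf_def by (rule ups_neq[OF mult_7_in_uhp[OF assms]])+

lemma pE_holomorphic:
 assumes "open S" "t holomorphic_on S" "a holomorphic_on S" "b holomorphic_on S" "!!s. s : S ==> t s : \<H>"
  and "!!s. s : S ==> sig (t s) (a s) ~= 0" "!!s. s : S ==> sig (t s) (b s) ~= 0"
 shows "(%s. pE (t s) (a s) (b s)) holomorphic_on S"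
 unfolding pE_def by (intro holomorphic_intros assms) (use assms in auto)

lemma pE_13_nonzero:
 assumes "T : \<H>"
 shows   "pE T (T / 7) (3 * T / 7) ~= 0"
proof -
 have nz: "skl T 1 ~= 0" "skl T 2 ~= 0" "skl T 3 ~= 0" by (rule skl_nonzero[OF assms]; simp)+
 thus ?thesis unfolding pE_seventh(2)[OF assms] by simp
qed

lemma Delta_fun_holomorphic: "Delta_fun holomorphic_on \<H>"
 unfolding Delta_fun_def Del_def Dfun_def upsf_def[symmetric]
proof (intro holomorphic_intros pE_holomorphic upsf_holomorphic)
 fix s assume "s : \<H>"
 hence s: "7 * s : \<H>" by (rule mult_7_in_uhp)
 show "7 * s : \<H>" "7 * s : \<H>" "7 * s : \<H>" "7 * s : \<H>" by fact+
 show "sig (7 * s) (7 * s / 2) ~= 0" "sig (7 * s) (1 / 2) ~= 0" "sig (7 * s) ((1 + 7 * s) / 2) ~= 0"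
    "sig (7 * s) (7 * s / 2) ~= 0" "sig (7 * s) (1 / 2) ~= 0" "sig (7 * s) ((1 + 7 * s) / 2) ~= 0"
  using sig_half_nonzero[OF s] by simp_all
 show "sig (7 * s) (7 * s / 7) ~= 0" "sig (7 * s) (3 * (7 * s) / 7) ~= 0"
  using sig_seventh_nonzero[OF s, of 1] sig_seventh_nonzero[OF s, of 3] by simp_all
 show "pE (7 * s) (7 * s / 7) (3 * (7 * s) / 7) ^ 3 ~= 0" using pE_13_nonzero[OF s] by simp
qed auto

lemma Delta_fun_square:
 assumes "T : \<H>"
 shows   "Delta_fun T ^ 2 = 4 * ((upsf T - 1) ^ 3 *
       (upsf T ^ 3 - 8 * upsf T ^ 2 + 5 * upsf T + 1) / upsf T ^ 3)"
 unfolding Delta_fun_def upsf_def by (rule Del_square[OF mult_7_in_uhp[OF assms]])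

lemma theta_a_3_eventually_nonzero:
 assumes "z : \<H>"
 shows   "eventually (%w. w : \<H> & theta_a 3 w ~= 0) (at z)"
proof -
 have ev: "eventually (%w. w : \<H>) (at z)"
  using assms by (intro eventually_at_in_open') auto
 have "eventually (%w. theta_a 3 w ~= 0) (at z)"
 proof (cases "theta_a 3 z = 0")
  case True
  obtain r where "r > 0" "!!w. w : ball z r - {z} ==> theta_a 3 w ~= 0"
   using isolated_zeros[OF theta_a_holomorphic open_upper_half_plane connected_upper_half_plane assms True
     ii_in_upper_half_plane theta_a_3_nonzero] by metis
  hence "eventually (%w. w : ball z r - {z}) (at z)" by (intro eventually_at_in_open) auto
  thus ?thesis by eventually_elim fact
 next
  case False
  have "isCont (theta_a 3) z"
   using holomorphic_on_imp_continuous_on[OF theta_a_holomorphic] assms continuous_on_eq_continuous_at open_upper_half_plane by blast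
  thus ?thesis using False by (intro tendsto_imp_eventually_ne) (auto simp: isCont_def)
 qed
 with ev show ?thesis by eventually_elim auto
qed

lemma eventually_eval_theta:
 assumes "z : \<H>"
 shows   "eventually (%w. evm (mero_of (theta_a k)) w = theta_a k w) (at z)"
 by (intro eventually_eval_mero_of assms analytic_on_imp_meromorphic_on)
   (simp add: analytic_on_open theta_a_holomorphic)

text \<open>The common factor of the theta series cancels wherever it is nonzero, and equality on
  punctured neighbourhoods is equality in \<open>mero_uhp\<close>. The signs (-1)^k absorb the minus
  sign in \<open>psi7\<close>.\<close>

lemma psi7_conv: "psi7 = mero_of psi_fun"
proof (rule mero_uhp_eqI)
 fix z assume z: "z : \<H>"
 let ?a = "%k. mero_of (theta_a k)"
 show "eventually (%w. evm psi7 w = evm (mero_of psi_fun) w) (at z)"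
  using theta_a_3_eventually_nonzero[OF z] eventually_eval_theta[OF z, of 1] eventually_eval_theta[OF z, of 2]
   eventually_eval_theta[OF z, of 3] eventually_eval_uminus_mero[OF z, of "?a 2 * ?a 3 / (?a 1 * ?a 1)"]
   eventually_eval_divide_mero[OF z, of "?a 2 * ?a 3" "?a 1 * ?a 1"] eventually_eval_times_mero[OF z, of "?a 2" "?a 3"]
   eventually_eval_times_mero[OF z, of "?a 1" "?a 1"]
 proof eventually_elim
  case (elim w)
  hence w: "w : \<H>" by simp
  obtain C where C: "!!k. theta_a k w = (- 1) ^ k * C * skl (7 * w) (int k)" using theta_a_conv_skl[OF w] by metis
  have "C ~= 0" using elim C[of 3] by auto
  have "evm psi7 w = - (theta_a 2 w * theta_a 3 w / (theta_a 1 w * theta_a 1 w))"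
   using elim by (simp add: psi7_def power2_eq_square)
  also have "\<dots> = psi_fun w" using \<open>C ~= 0\<close> by (simp add: C psi_fun_def power2_eq_square)
  finally show ?case using w by (simp add: eval_mero_of_holomorphic psi_fun_holomorphic)
 qed
qed

lemma upsilon7_conv: "ups7 = mero_of upsf"
proof (rule mero_uhp_eqI)
 fix z assume z: "z : \<H>"
 let ?a = "%k. mero_of (theta_a k)"
 show "eventually (%w. evm ups7 w = evm (mero_of upsf) w) (at z)"
  using theta_a_3_eventually_nonzero[OF z] eventually_eval_theta[OF z, of 1] eventually_eval_theta[OF z, of 2]
   eventually_eval_theta[OF z, of 3] eventually_eval_divide_mero[OF z, of "?a 2 * ?a 2 * ?a 3" "?a 1 * ?a 1 * ?a 1"] 
   eventually_eval_times_mero[OF z, of "?a 2 * ?a 2" "?a 3"] eventually_eval_times_mero[OF z, of "?a 2" "?a 2"]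
   eventually_eval_times_mero[OF z, of "?a 1 * ?a 1" "?a 1"] eventually_eval_times_mero[OF z, of "?a 1" "?a 1"]
 proof eventually_elim
  case (elim w)
  hence w: "w : \<H>" by simp
  obtain C where C: "!!k. theta_a k w = (- 1) ^ k * C * skl (7 * w) (int k)" using theta_a_conv_skl[OF w] by metis
  have "C ~= 0" using elim C[of 3] by auto
  have "evm ups7 w = theta_a 2 w * theta_a 2 w * theta_a 3 w / (theta_a 1 w * theta_a 1 w * theta_a 1 w)"
   using elim by (simp add: upsilon7_def power2_eq_square power3_eq_cube)
  also have "\<dots> = upsf w" using \<open>C ~= 0\<close> by (simp add: C upsf_def ups_def power2_eq_square power3_eq_cube mult.assoc)
  finally show ?case using w by (simp add: eval_mero_of_holomorphic upsf_holomorphic)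
 qed
qed

lemma eval_upsilon7: "z : \<H> ==> evm ups7 z = upsf z"
 and eval_psi7: "z : \<H> ==> evm psi7 z = psi_fun z"
 by (simp_all add: upsilon7_conv psi7_conv eval_mero_of_holomorphic upsf_holomorphic psi_fun_holomorphic)


section \<open>Behaviour under Gamma(7) and Gamma_0(7)\<close>

lemma SL2Z_det: "A : SL2Z \<longleftrightarrow> A $ 1 $ 1 * A $ 2 $ 2 - A $ 1 $ 2 * A $ 2 $ 1 = 1"
 by (simp add: SL2Z_def det_2)

lemma moebius_in_uhp:
 assumes "A : SL2Z" "z : \<H>"
 shows   "moebius A z : \<H>"
 unfolding moebius_def by (rule uhp_moebius) (use assms in \<open>auto simp: SL2Z_det\<close>)

text \<open>Conjugation by diag(7, 1): when 7 divides the lower left entry, the conjugate matrix is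
  again integral and acts on 7z.\<close>

lemma moebius_7_dvd:
 fixes A :: "int ^ 2 ^ 2"
 assumes "A $ 2 $ 1 = 7 * c"
 shows "7 * moebius A z = (of_int (A $ 1 $ 1) * (7 * z) + of_int (7 * A $ 1 $ 2)) / (of_int c * (7 * z) + of_int (A $ 2 $ 2))"
 unfolding moebius_def using assms by (simp add: algebra_simps add_divide_distrib)

text \<open>
  \<open>skl\<close> transforms with trivial multiplier under \<open>\<Gamma>(7)\<close>; the sign is trivial
  because \<open>a\<close> and \<open>b\<close> cannot both be even.
\<close>

lemma skl_Gamma7:
 assumes A: "A : Gamma_principal 7" and z: "T : \<H>"
 shows   "skl (7 * moebius A T) k = skl (7 * T) k / (of_int (A $ 2 $ 1) * T + of_int (A $ 2 $ 2))"
proof -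
 have cong: "[A $ 1 $ 1 = 1] (mod 7)" "[A $ 1 $ 2 = 0] (mod 7)" "[A $ 2 $ 1 = 0] (mod 7)"
  using A by (auto simp: Gamma_principal_def mat_def forall_2)
 define a b c d where "a = A $ 1 $ 1" "b = A $ 1 $ 2" "c = A $ 2 $ 1" "d = A $ 2 $ 2"
 note abcd = this
 obtain a1 where a1: "a = 1 + 7 * a1"
  using cong(1) unfolding abcd[symmetric] cong_iff_lin by (metis cong_iff_lin cong_sym)
 obtain b1 where b1: "b = 7 * b1" using cong(2) unfolding abcd[symmetric] cong_0_iff by auto
 obtain c1 where c1: "c = 7 * c1" using cong(3) unfolding abcd[symmetric] cong_0_iff by auto
 have det: "a * d - b * c = 1" using A by (auto simp: Gamma_principal_def SL2Z_det abcd)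
 hence det1: "a * d - (7 * b) * c1 = 1" by (simp add: c1)
 define t where "t = 7 * T"
 have t: "t : \<H>" using z by (simp add: t_def mult_7_in_uhp)
 define j where "j = of_int c1 * t + of_int d"
 define w where "w = of_int a * t + of_int (7 * b)"
 have j: "j ~= 0" using uhp_moebius[OF t det1] by (simp add: j_def)
 have m: "7 * moebius A T = w / j"
  using moebius_7_dvd[of A c1 T] c1 by (simp add: w_def j_def t_def abcd)
 have jj: "j = of_int (A $ 2 $ 1) * T + of_int (A $ 2 $ 2)"
  using c1 by (simp add: j_def t_def abcd)
 define z where "z = of_int k * w / 7"
 \<comment> \<open>The determinant relation. It merges the two exponents with denominator
   \<open>j\<close> into one without it.\<close>
 have wj: "1 + of_int c1 * w = of_int a * j"
 proof -
  have "of_int a * of_int d - (7 * of_int b) * of_int c1 = (1::complex)"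
   using arg_cong[OF det1, of "of_int :: int => complex"] by simp
  thus ?thesis by (simp add: w_def j_def algebra_simps)
 qed
 have zl: "z = of_int k * t / 7 + of_int (k * b) + of_int (k * a1) * t"
  by (simp add: z_def w_def a1 algebra_simps add_divide_distrib)
 have "skl (w / j) k = ee (of_int k ^ 2 * (w / j) / 98) * sig (w / j) (z / j)"
  by (simp add: skl_def z_def mult.commute)
 also have "sig (w / j) (z / j) = ee (of_int c1 * z ^ 2 / (2 * j)) / j * sig t z"
  unfolding w_def j_def by (rule sig_modular[OF t det1])
 also have "sig t z = ee (of_int (k * b + k * a1) / 2 - of_int (k * a1) ^ 2 * t / 2 - of_int (k * a1) * (of_int k * t / 7)) * sig t (of_int k * t / 7)"
  unfolding zl by (rule sig_lattice[OF t])
 also have "ee (of_int k ^ 2 * (w / j) / 98) * (ee (of_int c1 * z ^ 2 / (2 * j)) / j *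
    (ee (of_int (k * b + k * a1) / 2 - of_int (k * a1) ^ 2 * t / 2 - of_int (k * a1) * (of_int k * t / 7)) * sig t (of_int k * t / 7)))
   = ee (of_int k ^ 2 * (w / j) / 98 + of_int c1 * z ^ 2 / (2 * j) +
    (of_int (k * b + k * a1) / 2 - of_int (k * a1) ^ 2 * t / 2 - of_int (k * a1) * (of_int k * t / 7))) * sig t (of_int k * t / 7) / j"
  by (simp add: ee_add)
 also have "of_int k ^ 2 * (w / j) / 98 + of_int c1 * z ^ 2 / (2 * j) = of_int k ^ 2 * w / 98 * ((1 + of_int c1 * w) / j)"
  using j by (simp add: z_def field_simps power2_eq_square)
 also have "(1 + of_int c1 * w) / j = of_int a" using j by (simp add: wj)
 also have "of_int k ^ 2 * w / 98 * of_int a + (of_int (k * b + k * a1) / 2 - of_int (k * a1) ^ 2 * t / 2 - of_int (k * a1) * (of_int k * t / 7))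
   = of_int k ^ 2 * t / 98 + of_int (k * (k * a * b1 + 7 * b1 + a1)) / 2"
  by (simp add: w_def a1 b1 field_simps power2_eq_square)
 also have "ee \<dots> = ee (of_int k ^ 2 * t / 98)"
 proof -
  have "even (k * (k * a * b1 + 7 * b1 + a1))"
  proof (cases "even a1")
   case False
   hence "even a" by (simp add: a1)
   hence "odd b" using det by (metis dvd_diff dvd_mult2 odd_one)
   hence "odd b1" by (simp add: b1)
   thus ?thesis using False \<open>even a\<close> by simp
  next
   case True
   hence "odd a" by (simp add: a1)
   thus ?thesis using True by auto
  qed
  then obtain n where "k * (k * a * b1 + 7 * b1 + a1) = 2 * n" by (rule evenE)
  hence "of_int (k * (k * a * b1 + 7 * b1 + a1)) / 2 = (of_int n :: complex)" by simp
  thus ?thesis by (simp only: ee_add ee_of_int mult_1_right)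
 qed
 finally show ?thesis unfolding m jj[symmetric] by (simp add: skl_def t_def)
qed

lemma psi_fun_Gamma7:
 assumes "A : Gamma_principal 7" "T : \<H>"
 shows   "psi_fun (moebius A T) = psi_fun T"
proof -
 have "of_int (A $ 2 $ 1) * T + of_int (A $ 2 $ 2) ~= 0"
  using assms uhp_moebius(1)[of T "A $ 1 $ 1" "A $ 2 $ 2" "A $ 1 $ 2" "A $ 2 $ 1"]
  by (auto simp: Gamma_principal_def SL2Z_det)
 thus ?thesis unfolding psi_fun_def skl_Gamma7[OF assms] by (simp add: power_divide power2_eq_square)
qed

lemma upsf_Gamma7:
 assumes "A : Gamma_principal 7" "T : \<H>"
 shows   "upsf (moebius A T) = upsf T"
proof -
 have "of_int (A $ 2 $ 1) * T + of_int (A $ 2 $ 2) ~= 0"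
  using assms uhp_moebius(1)[of T "A $ 1 $ 1" "A $ 2 $ 2" "A $ 1 $ 2" "A $ 2 $ 1"]
  by (auto simp: Gamma_principal_def SL2Z_det)
 thus ?thesis unfolding upsf_def ups_def skl_Gamma7[OF assms] by (simp add: power_divide power2_eq_square power3_eq_cube)
qed

definition P7 :: "complex => int => int => complex" where
 "P7 T k l = pE (7 * T) (of_int k * T) (of_int l * T)"

text \<open>In \<open>of_int k * moebius A T\<close> = (k a T + k b) / j the summand k b is a period
  and drops out, so only the indices are multiplied by a.\<close>

lemma P7_Gamma0:
 fixes A :: "int ^ 2 ^ 2"
 assumes A: "A : SL2Z" "7 dvd A $ 2 $ 1" and z: "T : \<H>"
 shows   "P7 (moebius A T) k l = (of_int (A $ 2 $ 1) * T + of_int (A $ 2 $ 2)) ^ 2 * P7 T (k * A $ 1 $ 1) (l * A $ 1 $ 1)"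
proof -
 define a b c d where "a = A $ 1 $ 1" "b = A $ 1 $ 2" "c = A $ 2 $ 1" "d = A $ 2 $ 2"
 note abcd = this
 obtain c1 where c1: "c = 7 * c1" using A(2) by (auto simp: abcd)
 have det1: "a * d - (7 * b) * c1 = 1" using A(1) c1 by (simp add: SL2Z_det abcd algebra_simps)
 have t: "7 * T : \<H>" using z by (rule mult_7_in_uhp)
 define j where "j = of_int c1 * (7 * T) + of_int d"
 define w where "w = of_int a * (7 * T) + of_int (7 * b)"
 have m: "7 * moebius A T = w / j"
  using moebius_7_dvd[of A c1 T] c1 by (simp add: w_def j_def abcd)
 have jj: "j = of_int (A $ 2 $ 1) * T + of_int (A $ 2 $ 2)"
  using c1 by (simp add: j_def abcd)
 have 1: "of_int k * moebius A T = (of_int (k * a) * T + of_int (k * b) + of_int 0 * (7 * T)) / j" for k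
 proof -
  have "of_int k * moebius A T = of_int k * (7 * moebius A T) / 7" by simp
  also have "\<dots> = (of_int (k * a) * T + of_int (k * b) + of_int 0 * (7 * T)) / j"
   unfolding m by (simp add: w_def add_divide_distrib distrib_left mult_ac)
  finally show ?thesis .
 qed
 have "P7 (moebius A T) k l = j ^ 2 * pE (7 * T) (of_int (k * a) * T + of_int (k * b) + of_int 0 * (7 * T)) (of_int (l * a) * T + of_int (l * b) + of_int 0 * (7 * T))"
  unfolding P7_def m 1 unfolding w_def j_def by (rule pE_modular[OF t det1])
 also have "\<dots> = j ^ 2 * P7 T (k * a) (l * a)"
  unfolding pE_lattice_left[OF t] pE_lattice_right[OF t] P7_def ..
 finally show ?thesis unfolding jj by (simp add: abcd)
qed

lemma P7_swap: "P7 T l k = - P7 T k l"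
 unfolding P7_def by (rule pE_swap)

lemma P7_minus_left: "P7 T (- k) l = P7 T k l"
 by (simp add: P7_def pE_minus_left)

lemma P7_periodic_left:
 assumes "T : \<H>"
 shows   "P7 T (k + 7 * m) l = P7 T k l"
 using pE_lattice_left[OF mult_7_in_uhp[OF assms], of "of_int k * T" 0 m "of_int l * T"]
 by (simp add: P7_def algebra_simps)

lemma P7_cong:
 assumes "T : \<H>" "[k = k'] (mod 7) \<or> [k = - k'] (mod 7)" "[l = l'] (mod 7) \<or> [l = - l'] (mod 7)"
 shows   "P7 T k l = P7 T k' l'"
proof -
 have *: "P7 T k l = P7 T k' l" if "[k = k'] (mod 7) \<or> [k = - k'] (mod 7)" for k k' l
  using that
 proof
  assume "[k = k'] (mod 7)"
  then obtain m where "k = k' + 7 * m" by (metis cong_iff_lin cong_sym)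
  thus ?thesis using P7_periodic_left[OF assms(1)] by simp
 next
  assume "[k = - k'] (mod 7)"
  then obtain m where "k = - k' + 7 * m" by (metis cong_iff_lin cong_sym)
  thus ?thesis using P7_periodic_left[OF assms(1), of "- k'"] P7_minus_left by simp
 qed
 have "P7 T k l = P7 T k' l" by (rule *) fact
 also have "\<dots> = P7 T k' l'" using *[OF assms(3), of k'] P7_swap by (metis minus_minus)
 finally show ?thesis .
qed

lemma P7_values:
 assumes "T : \<H>"
 defines "s \<equiv> skl (7 * T)"
 shows "P7 T 1 2 = - (s 3 / (s 1 * s 2 ^ 2))" "P7 T 1 3 = - (s 2 / (s 1 ^ 2 * s 3))" "P7 T 2 3 = - (s 1 / (s 2 * s 3 ^ 2))"
 using pE_seventh[OF mult_7_in_uhp[OF assms(1)]] by (simp_all add: P7_def s_def)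

lemma P7_nonzero:
 assumes "T : \<H>"
 shows "P7 T 1 2 ~= 0" "P7 T 1 3 ~= 0" "P7 T 2 3 ~= 0"
 using skl_7_nonzero[OF assms] by (simp_all add: P7_values[OF assms])

text \<open>As quotients of weight 2 differences, upsilon and upsilon - 1 inherit their behaviour
  under Gamma_0(7) from the permutation of the indices modulo 7.\<close>

lemma upsf_P7:
 assumes "T : \<H>"
 shows "upsf T = P7 T 1 3 / P7 T 2 3"
  and "upsf T - 1 = P7 T 1 2 / P7 T 2 3"
 unfolding P7_values[OF assms] upsf_def ups_minus_1[OF mult_7_in_uhp[OF assms]] unfolding ups_def
 using skl_7_nonzero[OF assms] by (simp_all add: power2_eq_square power3_eq_cube mult.assoc)

lemma P7_cong_mult:
 assumes "T : \<H>" "[a = r] (mod 7) \<or> [a = - r] (mod 7)"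
  and "[k * r = k'] (mod 7) \<or> [k * r = - k'] (mod 7)" "[l * r = l'] (mod 7) \<or> [l * r = - l'] (mod 7)"
 shows "P7 T (k * a) (l * a) = P7 T k' l'"
proof -
 have *: "[k * a = k'] (mod 7) \<or> [k * a = - k'] (mod 7)" if "[k * r = k'] (mod 7) \<or> [k * r = - k'] (mod 7)" for k k'
 proof -
  have "[k * a = k * r] (mod 7) \<or> [k * a = - (k * r)] (mod 7)"
   using assms(2) cong_scalar_left[of a r 7 k] cong_scalar_left[of a "- r" 7 k] by auto
  moreover have "[- (k * r) = - k'] (mod 7) \<or> [- (k * r) = k'] (mod 7)"
   using that cong_minus_minus_iff[of "k * r" k' 7] cong_minus_minus_iff[of "k * r" "- k'" 7] by auto
  ultimately show ?thesis using that cong_trans by blast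
 qed
 show ?thesis by (rule P7_cong[OF assms(1)]) (use * assms(3,4) in auto)
qed

text \<open>Up to sign, multiplication by 2 modulo 7 permutes the indices 1 -> 2 -> 3 -> 1. So
  upsilon runs through the three substitutions u, (u - 1)/u, 1/(1 - u), which form a group of order
  3.\<close>

lemma upsf_Gamma0:
 fixes A :: "int ^ 2 ^ 2"
 assumes A: "A : SL2Z" "7 dvd A $ 2 $ 1" and z: "T : \<H>"
 shows "[A $ 1 $ 1 = 1] (mod 7) \<or> [A $ 1 $ 1 = - 1] (mod 7) ==> upsf (moebius A T) = upsf T"
  and "[A $ 1 $ 1 = 2] (mod 7) \<or> [A $ 1 $ 1 = - 2] (mod 7) ==> upsf (moebius A T) = (upsf T - 1) / upsf T"
  and "[A $ 1 $ 1 = 3] (mod 7) \<or> [A $ 1 $ 1 = - 3] (mod 7) ==> upsf (moebius A T) = 1 / (1 - upsf T)"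
proof -
 define a where "a = A $ 1 $ 1"
 have nz: "of_int (A $ 2 $ 1) * T + of_int (A $ 2 $ 2) ~= 0"
  using assms uhp_moebius(1)[of T "A $ 1 $ 1" "A $ 2 $ 2" "A $ 1 $ 2" "A $ 2 $ 1"]
  by (auto simp: SL2Z_det)
 have eq: "upsf (moebius A T) = P7 T (1 * a) (3 * a) / P7 T (2 * a) (3 * a)"
  unfolding upsf_P7[OF moebius_in_uhp[OF A(1) z]] P7_Gamma0[OF assms] a_def using nz by simp
 note nz7 = P7_nonzero[OF z]
 show "upsf (moebius A T) = upsf T" if "[A $ 1 $ 1 = 1] (mod 7) \<or> [A $ 1 $ 1 = - 1] (mod 7)"
 proof -
  have "P7 T (1 * a) (3 * a) = P7 T 1 3" "P7 T (2 * a) (3 * a) = P7 T 2 3"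
   by (rule P7_cong_mult[OF z that[folded a_def]]; simp add: cong_iff_dvd_diff)+
  thus ?thesis unfolding eq upsf_P7(1)[OF z] by simp
 qed
 show "upsf (moebius A T) = (upsf T - 1) / upsf T" if "[A $ 1 $ 1 = 2] (mod 7) \<or> [A $ 1 $ 1 = - 2] (mod 7)"
 proof -
  have "P7 T (1 * a) (3 * a) = P7 T 2 1" "P7 T (2 * a) (3 * a) = P7 T 3 1"
   by (rule P7_cong_mult[OF z that[folded a_def]]; simp add: cong_iff_dvd_diff)+
  moreover have "P7 T 2 1 = - P7 T 1 2" "P7 T 3 1 = - P7 T 1 3" by (rule P7_swap)+
  ultimately show ?thesis unfolding eq upsf_P7(2)[OF z] unfolding upsf_P7(1)[OF z] using nz7 by simp
 qed
 show "upsf (moebius A T) = 1 / (1 - upsf T)" if "[A $ 1 $ 1 = 3] (mod 7) \<or> [A $ 1 $ 1 = - 3] (mod 7)"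
 proof -
  have "P7 T (1 * a) (3 * a) = P7 T 3 2" "P7 T (2 * a) (3 * a) = P7 T 1 2"
   by (rule P7_cong_mult[OF z that[folded a_def]]; simp add: cong_iff_dvd_diff)+
  moreover have "P7 T 3 2 = - P7 T 2 3" by (rule P7_swap)
  moreover have "1 - upsf T = - (P7 T 1 2 / P7 T 2 3)" using upsf_P7(2)[OF z] by (simp add: algebra_simps)
  ultimately show ?thesis unfolding eq using nz7 by simp
 qed
qed

section \<open>Action of the modular group\<close>

definition mat2 :: "int => int => int => int => int ^ 2 ^ 2" where
 "mat2 a b c d = vector [vector [a, b], vector [c, d]]"

lemma mat2_nth [simp]:
 "mat2 a b c d $ 1 $ 1 = a" "mat2 a b c d $ 1 $ 2 = b" "mat2 a b c d $ 2 $ 1 = c" "mat2 a b c d $ 2 $ 2 = d"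
 by (simp_all add: mat2_def)

lemma mat2_mult_nth:
 fixes A B :: "int ^ 2 ^ 2"
 shows "(A ** B) $ 1 $ 1 = A $ 1 $ 1 * B $ 1 $ 1 + A $ 1 $ 2 * B $ 2 $ 1"
  "(A ** B) $ 1 $ 2 = A $ 1 $ 1 * B $ 1 $ 2 + A $ 1 $ 2 * B $ 2 $ 2"
  "(A ** B) $ 2 $ 1 = A $ 2 $ 1 * B $ 1 $ 1 + A $ 2 $ 2 * B $ 2 $ 1"
  "(A ** B) $ 2 $ 2 = A $ 2 $ 1 * B $ 1 $ 2 + A $ 2 $ 2 * B $ 2 $ 2"
 by (simp_all add: matrix_matrix_mult_def sum_2)

lemma mat2_eq_iff:
 fixes A B :: "int ^ 2 ^ 2"
 shows "A = B \<longleftrightarrow> A $ 1 $ 1 = B $ 1 $ 1 & A $ 1 $ 2 = B $ 1 $ 2 & A $ 2 $ 1 = B $ 2 $ 1 & A $ 2 $ 2 = B $ 2 $ 2"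
 by (auto simp: vec_eq_iff forall_2)

lemma SL2Z_mult: "A : SL2Z ==> B : SL2Z ==> A ** B : SL2Z"
 by (simp add: SL2Z_def det_mul)

lemma SL2Z_mat2: "mat2 a b c d : SL2Z \<longleftrightarrow> a * d - b * c = 1"
 by (simp add: SL2Z_det)

lemma SL2Z_one: "mat 1 : SL2Z"
 by (simp add: SL2Z_def)

definition adj2 :: "int ^ 2 ^ 2 => int ^ 2 ^ 2" where
 "adj2 A = mat2 (A $ 2 $ 2) (- A $ 1 $ 2) (- A $ 2 $ 1) (A $ 1 $ 1)"

lemma adj2_SL2Z: "A : SL2Z ==> adj2 A : SL2Z"
 by (simp add: adj2_def SL2Z_det algebra_simps)

lemma adj2_mult:
 assumes "A : SL2Z"
 shows "A ** adj2 A = mat 1" "adj2 A ** A = mat 1"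
 using assms by (auto simp: mat2_eq_iff mat2_mult_nth adj2_def mat_def SL2Z_det algebra_simps)

lemma moebius_one [simp]: "moebius (mat 1) z = z"
 by (simp add: moebius_def mat_def)

lemma moebius_mult:
 assumes "A : SL2Z" "B : SL2Z" "z : \<H>"
 shows   "moebius (A ** B) z = moebius A (moebius B z)"
proof -
 define j where "j = of_int (B $ 2 $ 1) * z + of_int (B $ 2 $ 2)"
 have j: "j ~= 0"
  using assms(2,3) uhp_moebius(1)[of z "B $ 1 $ 1" "B $ 2 $ 2" "B $ 1 $ 2" "B $ 2 $ 1"]
  by (auto simp: SL2Z_det j_def)
 define w where "w = of_int (B $ 1 $ 1) * z + of_int (B $ 1 $ 2)"
 have *: "of_int p * (w / j) + of_int q = (of_int p * w + of_int q * j) / j" for p q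
  using j by (simp add: field_simps)
 have "moebius A (moebius B z) = (of_int (A $ 1 $ 1) * w + of_int (A $ 1 $ 2) * j) / (of_int (A $ 2 $ 1) * w + of_int (A $ 2 $ 2) * j)"
  unfolding moebius_def w_def[symmetric] j_def[symmetric] * using j by simp
 also have "\<dots> = moebius (A ** B) z"
  unfolding moebius_def mat2_mult_nth w_def j_def by (simp add: algebra_simps)
 finally show ?thesis ..
qed

definition shiftm :: "int => int ^ 2 ^ 2" where
 "shiftm n = mat2 1 n 0 1"

lemma shiftm_SL2Z [simp]: "shiftm n : SL2Z"
 by (simp add: shiftm_def SL2Z_det)

lemma moebius_shiftm [simp]: "moebius (shiftm n) z = z + of_int n"
 by (simp add: moebius_def shiftm_def)

lemma of_int_bit_eq: "(of_int n :: bit) = 0 \<longleftrightarrow> even n" "(of_int n :: bit) = 1 \<longleftrightarrow> odd n"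
proof -
 have "(of_int n :: bit) = 0" if "even n" using that by (elim evenE) simp
 moreover have "(of_int n :: bit) = 1" if "odd n" using that by (elim oddE) simp
 ultimately show "(of_int n :: bit) = 0 \<longleftrightarrow> even n" "(of_int n :: bit) = 1 \<longleftrightarrow> odd n" by force+
qed

text \<open>The three matrices of the order 3 subgroup of SL_2(F_2), read off as parities of the
  entries.\<close>

definition parity3 :: "int => int => int => int => bool" where
 "parity3 a b c d \<longleftrightarrow> odd a & even b & even c & odd d \<or> even a & odd b & odd c & odd d \<or> odd a & odd b & odd c & even d"

lemma Gamma_sup2_iff:
 "A : Gamma_sup2 \<longleftrightarrow> A : SL2Z & parity3 (A $ 1 $ 1) (A $ 1 $ 2) (A $ 2 $ 1) (A $ 2 $ 2)"
 unfolding Gamma_sup2_def order_3_subgroup_SL2_F2 parity3_def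
 by (auto simp: vec_eq_iff forall_2 map_matrix_def mat_def of_int_bit_eq)

definition Hp :: "complex => int => int => complex" where
 "Hp T m n = (of_int m * T + of_int n) / 2"

lemma pE_half_cong:
 assumes t: "T : \<H>" and "even (m - m')" "even (n - n')" "even (k - k')" "even (l - l')"
 shows "pE T (Hp T m n) (Hp T k l) = pE T (Hp T m' n') (Hp T k' l')"
proof -
 have *: "EX p q. Hp T m n = Hp T m' n' + of_int p + of_int q * T" if e: "even (m - m')" "even (n - n')" for m n m' n'
 proof -
  obtain q where "m - m' = 2 * q" using e by blast
  moreover obtain p where "n - n' = 2 * p" using e by blast
  ultimately have "m = m' + 2 * q" "n = n' + 2 * p" by simp_all
  thus ?thesis by (intro exI[of _ p] exI[of _ q]) (simp add: Hp_def field_simps)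
 qed
 obtain p q where 1: "Hp T m n = Hp T m' n' + of_int p + of_int q * T" using *[OF assms(2,3)] by blast
 obtain p' q' where 2: "Hp T k l = Hp T k' l' + of_int p' + of_int q' * T" using *[OF assms(4,5)] by blast
 show ?thesis unfolding 1 2 pE_lattice_left[OF t] pE_lattice_right[OF t] ..
qed

text \<open>Each of the three residue matrices permutes the half periods cyclically modulo the
  lattice, hence only permutes the three factors, and each factor has weight 2.\<close>

lemma Dfun_modular:
 assumes t: "T : \<H>" and det: "a * d - b * c = 1" and par: "parity3 a b c d"
 shows "Dfun ((of_int a * T + of_int b) / (of_int c * T + of_int d)) = (of_int c * T + of_int d) ^ 6 * Dfun T"
proof -
 define j where "j = of_int c * T + of_int d"
 define w where "w = of_int a * T + of_int b"
 have j: "j ~= 0" using uhp_moebius[OF t det] by (simp add: j_def)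
 have h: "w / j / 2 = Hp T a b / j" "1 / 2 = Hp T c d / j" "(1 + w / j) / 2 = Hp T (a + c) (b + d) / j"
 proof -
  have H: "Hp T a b = w / 2" "Hp T c d = j / 2" "Hp T (a + c) (b + d) = (j + w) / 2"
   by (simp_all add: Hp_def w_def j_def algebra_simps)
  show "w / j / 2 = Hp T a b / j" "1 / 2 = Hp T c d / j" "(1 + w / j) / 2 = Hp T (a + c) (b + d) / j"
   unfolding H using j by (simp_all add: add_divide_distrib)
 qed
 have m: "pE (w / j) (x / j) (y / j) = j ^ 2 * pE T x y" for x y
  unfolding w_def j_def by (rule pE_modular[OF t det])
 have D: "Dfun T = pE T (Hp T 1 0) (Hp T 0 1) * pE T (Hp T 1 1) (Hp T 1 0) * pE T (Hp T 0 1) (Hp T 1 1)"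
  by (simp add: Dfun_def Hp_def add.commute)
 have "Dfun (w / j) = j ^ 6 * (pE T (Hp T a b) (Hp T c d) * pE T (Hp T (a + c) (b + d)) (Hp T a b) * pE T (Hp T c d) (Hp T (a + c) (b + d)))"
  unfolding Dfun_def h(1,3) unfolding h(2) m by (simp add: eval_nat_numeral)
 also from par have "pE T (Hp T a b) (Hp T c d) * pE T (Hp T (a + c) (b + d)) (Hp T a b) * pE T (Hp T c d) (Hp T (a + c) (b + d)) = Dfun T"
  unfolding parity3_def
 proof (elim disjE conjE)
  assume "odd a" "even b" "even c" "odd d"
  note p = this
  have "pE T (Hp T a b) (Hp T c d) = pE T (Hp T 1 0) (Hp T 0 1)"
   "pE T (Hp T (a + c) (b + d)) (Hp T a b) = pE T (Hp T 1 1) (Hp T 1 0)"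
   "pE T (Hp T c d) (Hp T (a + c) (b + d)) = pE T (Hp T 0 1) (Hp T 1 1)"
   by (rule pE_half_cong[OF t]; use p in simp)+
  thus ?thesis by (simp add: D)
 next
  assume "even a" "odd b" "odd c" "odd d"
  note p = this
  have "pE T (Hp T a b) (Hp T c d) = pE T (Hp T 0 1) (Hp T 1 1)"
   "pE T (Hp T (a + c) (b + d)) (Hp T a b) = pE T (Hp T 1 0) (Hp T 0 1)"
   "pE T (Hp T c d) (Hp T (a + c) (b + d)) = pE T (Hp T 1 1) (Hp T 1 0)"
   by (rule pE_half_cong[OF t]; use p in simp)+
  thus ?thesis by (simp add: D)
 next
  assume "odd a" "odd b" "odd c" "even d"
  note p = this
  have "pE T (Hp T a b) (Hp T c d) = pE T (Hp T 1 1) (Hp T 1 0)"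
   "pE T (Hp T (a + c) (b + d)) (Hp T a b) = pE T (Hp T 0 1) (Hp T 1 1)"
   "pE T (Hp T c d) (Hp T (a + c) (b + d)) = pE T (Hp T 1 0) (Hp T 0 1)"
   by (rule pE_half_cong[OF t]; use p in simp)+
  thus ?thesis by (simp add: D)
 qed
 finally show ?thesis by (simp add: w_def j_def)
qed

text \<open>Conjugation by diag(7, 1) preserves all parities because 7 is odd, so
  \<open>Dfun_modular\<close> applies at 7T. The weight 6 factors of numerator and denominator
  cancel.\<close>

lemma Delta_fun_Gamma:
 assumes A: "A : Gamma_sup2 \<inter> Gamma_principal 7" and z: "T : \<H>"
 shows   "Delta_fun (moebius A T) = Delta_fun T"
proof -
 have A7: "A : Gamma_principal 7" and SL: "A : SL2Z" and par: "parity3 (A $ 1 $ 1) (A $ 1 $ 2) (A $ 2 $ 1) (A $ 2 $ 2)"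
  using A by (auto simp: Gamma_sup2_iff)
 have dv: "7 dvd A $ 2 $ 1" and a1: "[A $ 1 $ 1 = 1] (mod 7)"
  using A7 by (auto simp: Gamma_principal_def mat_def forall_2 cong_0_iff)
 then obtain c1 where c1: "A $ 2 $ 1 = 7 * c1" by auto
 define j where "j = of_int (A $ 2 $ 1) * T + of_int (A $ 2 $ 2)"
 have j: "j ~= 0"
  using SL z uhp_moebius(1)[of T "A $ 1 $ 1" "A $ 2 $ 2" "A $ 1 $ 2" "A $ 2 $ 1"]
  by (auto simp: SL2Z_det j_def)
 have "pE (7 * moebius A T) (7 * moebius A T / 7) (3 * (7 * moebius A T) / 7) = P7 (moebius A T) 1 3"
  by (simp add: P7_def)
 also have "\<dots> = j ^ 2 * P7 T (1 * A $ 1 $ 1) (3 * A $ 1 $ 1)"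
  unfolding P7_Gamma0[OF SL dv z] j_def ..
 also have "P7 T (1 * A $ 1 $ 1) (3 * A $ 1 $ 1) = P7 T 1 3"
  by (rule P7_cong_mult[OF z, of _ 1]) (use a1 in \<open>auto simp: cong_iff_dvd_diff\<close>)
 also have "\<dots> = pE (7 * T) (7 * T / 7) (3 * (7 * T) / 7)" by (simp add: P7_def)
 finally have X: "pE (7 * moebius A T) (7 * moebius A T / 7) (3 * (7 * moebius A T) / 7) = j ^ 2 * pE (7 * T) (7 * T / 7) (3 * (7 * T) / 7)" .
 have D: "Dfun (7 * moebius A T) = j ^ 6 * Dfun (7 * T)"
 proof -
  have "parity3 (A $ 1 $ 1) (7 * A $ 1 $ 2) c1 (A $ 2 $ 2)"
   using par unfolding parity3_def c1 by simp
  moreover have "A $ 1 $ 1 * A $ 2 $ 2 - (7 * A $ 1 $ 2) * c1 = 1"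
   using SL by (simp add: SL2Z_det c1 algebra_simps)
  ultimately have "Dfun (7 * moebius A T) = (of_int c1 * (7 * T) + of_int (A $ 2 $ 2)) ^ 6 * Dfun (7 * T)"
   unfolding moebius_7_dvd[OF c1] by (intro Dfun_modular mult_7_in_uhp z)
  also have "of_int c1 * (7 * T) + of_int (A $ 2 $ 2) = j" by (simp add: j_def c1)
  finally show ?thesis .
 qed
 have "Dfun (7 * moebius A T) / (pE (7 * moebius A T) (7 * moebius A T / 7) (3 * (7 * moebius A T) / 7)) ^ 3 =
    Dfun (7 * T) / pE (7 * T) (7 * T / 7) (3 * (7 * T) / 7) ^ 3"
  unfolding X D using j by (simp add: power_mult_distrib flip: power_mult)
 thus ?thesis
  unfolding Delta_fun_def Del_def upsf_def[symmetric] upsf_Gamma7[OF A7 z] by simp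
qed

section \<open>Congruence subgroups and their cosets\<close>

lemma Gamma_principal_iff:
 "A : Gamma_principal N \<longleftrightarrow> A : SL2Z & [A $ 1 $ 1 = 1] (mod int N) & [A $ 1 $ 2 = 0] (mod int N) \<and>
   [A $ 2 $ 1 = 0] (mod int N) & [A $ 2 $ 2 = 1] (mod int N)"
 by (auto simp: Gamma_principal_def mat_def forall_2)

lemma Gamma_principal_14_subset: "Gamma_principal 14 <= Gamma_sup2 \<inter> Gamma_principal 7"
proof
 fix A :: "int ^ 2 ^ 2" assume A: "A : Gamma_principal 14"
 have m7: "[x = y] (mod 7)" if "[x = y] (mod 14)" for x y :: int
  using that cong_modulus_mult[of x y 7 2] by simp
 have m2: "even x" if "[x = 0] (mod 14)" for x :: int
  using that dvd_trans[of 2 14 x] by (simp add: cong_0_iff)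
 have m2': "odd x" if "[x = 1] (mod 14)" for x :: int
  using that dvd_trans[of 2 14 "x - 1"] by (simp add: cong_iff_dvd_diff)
 from A have "A : SL2Z" "[A $ 1 $ 1 = 1] (mod 14)" "[A $ 1 $ 2 = 0] (mod 14)" "[A $ 2 $ 1 = 0] (mod 14)" "[A $ 2 $ 2 = 1] (mod 14)"
  by (simp_all add: Gamma_principal_iff)
 thus "A : Gamma_sup2 \<inter> Gamma_principal 7"
  by (simp add: Gamma_principal_iff Gamma_sup2_iff parity3_def m7 m2 m2')
qed

lemma Gamma_principal_cosets:
 assumes A: "A : SL2Z" "B : SL2Z"
  and c: "[A $ 1 $ 1 = B $ 1 $ 1] (mod int N)" "[A $ 1 $ 2 = B $ 1 $ 2] (mod int N)"
   "[A $ 2 $ 1 = B $ 2 $ 1] (mod int N)" "[A $ 2 $ 2 = B $ 2 $ 2] (mod int N)"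
 shows "A ** adj2 B : Gamma_principal N" "(A ** adj2 B) ** B = A"
proof -
 have det: "B $ 1 $ 1 * B $ 2 $ 2 - B $ 1 $ 2 * B $ 2 $ 1 = 1" using A by (simp add: SL2Z_det)
 have 1: "[A $ 1 $ 1 * B $ 2 $ 2 - A $ 1 $ 2 * B $ 2 $ 1 = B $ 1 $ 1 * B $ 2 $ 2 - B $ 1 $ 2 * B $ 2 $ 1] (mod int N)"
  by (intro cong_diff cong_mult c cong_refl)
 have 2: "[A $ 2 $ 2 * B $ 1 $ 1 - A $ 2 $ 1 * B $ 1 $ 2 = B $ 2 $ 2 * B $ 1 $ 1 - B $ 2 $ 1 * B $ 1 $ 2] (mod int N)"
  by (intro cong_diff cong_mult c cong_refl)
 have 3: "[A $ 1 $ 2 * B $ 1 $ 1 - A $ 1 $ 1 * B $ 1 $ 2 = B $ 1 $ 2 * B $ 1 $ 1 - B $ 1 $ 1 * B $ 1 $ 2] (mod int N)"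
  by (intro cong_diff cong_mult c cong_refl)
 have 4: "[A $ 2 $ 1 * B $ 2 $ 2 - A $ 2 $ 2 * B $ 2 $ 1 = B $ 2 $ 1 * B $ 2 $ 2 - B $ 2 $ 2 * B $ 2 $ 1] (mod int N)"
  by (intro cong_diff cong_mult c cong_refl)
 show "A ** adj2 B : Gamma_principal N"
  unfolding Gamma_principal_iff
  using 1 2 3 4 SL2Z_mult[OF A(1) adj2_SL2Z[OF A(2)]] det
  by (simp add: mat2_mult_nth adj2_def algebra_simps)
 show "(A ** adj2 B) ** B = A"
  by (simp add: matrix_mul_assoc[symmetric] adj2_mult[OF A(2)])
qed

lemma Gamma_principal_normal:
 assumes A: "A : SL2Z" "B : Gamma_principal N"
 obtains B' where "B' : Gamma_principal N" "A ** B = B' ** A"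
proof -
 have B: "B : SL2Z" "[B $ 1 $ 1 = 1] (mod int N)" "[B $ 1 $ 2 = 0] (mod int N)"
   "[B $ 2 $ 1 = 0] (mod int N)" "[B $ 2 $ 2 = 1] (mod int N)"
  using A(2) by (auto simp: Gamma_principal_iff)
 have *: "[p * x + q * y = p * x' + q * y'] (mod int N)" if "[x = x'] (mod int N)" "[y = y'] (mod int N)" for p q x y x' y'
  using that by (intro cong_add cong_mult cong_refl)
 have "[(A ** B) $ 1 $ 1 = A $ 1 $ 1] (mod int N)" "[(A ** B) $ 1 $ 2 = A $ 1 $ 2] (mod int N)"
  "[(A ** B) $ 2 $ 1 = A $ 2 $ 1] (mod int N)" "[(A ** B) $ 2 $ 2 = A $ 2 $ 2] (mod int N)"
  unfolding mat2_mult_nth using *[OF B(2,4)] *[OF B(3,5)] by simp_all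
 from Gamma_principal_cosets[OF SL2Z_mult[OF A(1) B(1)] A(1) this] show ?thesis using that by metis
qed

text \<open>Up to sign and a translation, Gamma_1(7) is covered by the group of the theorem. So all
  cusps that are equivalent to infinity under Gamma_1(7) and signs carry the same orders as infinity
  itself.\<close>

lemma Gamma1_7_decomposition:
 assumes A: "A : SL2Z" "7 dvd A $ 2 $ 1" "[A $ 1 $ 1 = 1] (mod 7) \<or> [A $ 1 $ 1 = - 1] (mod 7)"
 obtains B n where "B : Gamma_sup2 \<inter> Gamma_principal 7" "!!z. z : \<H> ==> moebius A z = moebius B (z + of_int n)"
proof -
 have main: "EX B n. B : Gamma_sup2 \<inter> Gamma_principal 7 & (ALL z:\<H>. moebius A z = moebius B (z + of_int n))"
  if A: "A : SL2Z" "7 dvd A $ 2 $ 1" "[A $ 1 $ 1 = 1] (mod 7)" for A :: "int ^ 2 ^ 2"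
 proof -
  define a b c d where "a = A $ 1 $ 1" "b = A $ 1 $ 2" "c = A $ 2 $ 1" "d = A $ 2 $ 2"
  note abcd = this
  have det: "a * d - b * c = 1" using A(1) by (simp add: SL2Z_det abcd)
  have par: "odd (a * d - b * c)" using det by simp
  \<comment> \<open>Modulo 7, n = b clears the upper right entry. The translation by 1 represents
    the nontrivial coset of the order 3 subgroup modulo 2, and b, b + 7 have different parities, so
    one of them works.\<close>
  obtain n where n: "n = b \<or> n = b + 7" and p3: "parity3 a (b - a * n) c (d - c * n)"
  proof (cases "parity3 a (b - a * b) c (d - c * b)")
   case False
   have "parity3 a (b - a * (b + 7)) c (d - c * (b + 7))"
    using False par unfolding parity3_def by auto
   thus ?thesis using that[of "b + 7"] by simp
  qed (use that[of b] in simp)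
  define B where "B = mat2 a (b - a * n) c (d - c * n)"
  have B: "B : SL2Z" using det by (simp add: B_def SL2Z_mat2 algebra_simps)
  have BA: "B ** shiftm n = A"
   by (simp add: mat2_eq_iff mat2_mult_nth B_def shiftm_def abcd)
  have a1: "[a = 1] (mod 7)" and c0: "[c = 0] (mod 7)" using A by (auto simp: abcd cong_0_iff)
  have nb: "[n = b] (mod 7)" using n by (auto simp: cong_iff_dvd_diff)
  have "[b - a * n = b - 1 * b] (mod 7)" by (intro cong_diff cong_mult a1 nb cong_refl)
  moreover have "[a * d - b * c = 1 * d - b * 0] (mod 7)" by (intro cong_diff cong_mult a1 c0 cong_refl)
  hence "[d = 1] (mod 7)" using det by (simp add: cong_sym)
  hence "[d - c * n = 1 - 0 * n] (mod 7)" by (intro cong_diff cong_mult c0 cong_refl)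
  ultimately have "B : Gamma_principal 7"
   using B a1 c0 by (simp add: Gamma_principal_iff B_def)
  moreover have "B : Gamma_sup2" using B p3 by (simp add: Gamma_sup2_iff B_def)
  moreover have "moebius A z = moebius B (z + of_int n)" if "z : \<H>" for z
   using moebius_mult[OF B shiftm_SL2Z that, of n] by (simp add: BA)
  ultimately show ?thesis by blast
 qed
 show ?thesis
 proof (cases "[A $ 1 $ 1 = 1] (mod 7)")
  case True
  thus ?thesis using main[OF A(1,2)] that by blast
 next
  case False
  hence m1: "[A $ 1 $ 1 = - 1] (mod 7)" using A(3) by simp
  have "[- (A $ 1 $ 1) = 1] (mod 7)" using m1 cong_minus_minus_iff[of "- (A $ 1 $ 1)" 1 7] by simp
  hence "EX B n. B : Gamma_sup2 \<inter> Gamma_principal 7 & (ALL z:\<H>. moebius (- A) z = moebius B (z + of_int n))"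
   using A by (intro main) (auto simp: SL2Z_det)
  moreover have "moebius (- A) z = moebius A z" for z
  proof -
   have "moebius (- A) z = - (of_int (A $ 1 $ 1) * z + of_int (A $ 1 $ 2)) / - (of_int (A $ 2 $ 1) * z + of_int (A $ 2 $ 2))"
    by (simp add: moebius_def)
   thus ?thesis unfolding minus_divide_divide moebius_def .
  qed
  ultimately show ?thesis using that by auto
 qed
qed

section \<open>The weight 0 slash action on meromorphic functions\<close>

lemma moebius_analytic:
 assumes "A : SL2Z"
 shows   "moebius A analytic_on \<H>"
 unfolding moebius_def
proof (intro analytic_intros)
 fix z assume z: "z : \<H>"
 show "of_int (A $ 2 $ 1) * z + of_int (A $ 2 $ 2) ~= 0"
  by (rule uhp_moebius(1)[OF z, of "A $ 1 $ 1" _ "A $ 1 $ 2"]) (use assms in \<open>simp add: SL2Z_det\<close>)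
qed

lemma filtermap_moebius_at:
 assumes A: "A : SL2Z" and z: "z : \<H>"
 shows   "filterlim (moebius A) (at (moebius A z)) (at z)"
proof -
 have "isCont (moebius A) z"
  using moebius_analytic[OF A] z by (meson analytic_at_imp_isCont analytic_on_analytic_at)
 hence "(moebius A ---> moebius A z) (at z)" by (simp add: isCont_def)
 moreover have "eventually (%w. w : \<H> & w ~= z) (at z)"
  using eventually_at_in_open'[OF open_upper_half_plane z] eventually_neq_at_within[of z z UNIV]
  by eventually_elim auto
 hence "eventually (%w. moebius A w ~= moebius A z) (at z)"
 proof eventually_elim
  case (elim w)
  show ?case
  proof
   assume "moebius A w = moebius A z"
   hence "moebius (adj2 A) (moebius A w) = moebius (adj2 A) (moebius A z)" by simp
   hence "w = z" using elim z moebius_mult[OF adj2_SL2Z[OF A] A] adj2_mult[OF A] by simp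
   thus False using elim by simp
  qed
 qed
 ultimately show ?thesis by (simp add: filterlim_at)
qed

definition mslash :: "mero_uhp => int ^ 2 ^ 2 => mero_uhp" where
 "mslash f A = mero_of (%z. evm f (moebius A z))"

text \<open>The composition is already in the normal form of \<open>mero_uhp\<close>, with value 0
  at poles, because Moebius maps send punctured neighbourhoods to punctured neighbourhoods. So
  \<open>mero_of\<close> changes no value and the equation holds at every point.\<close>

lemma eval_mslash:
 assumes A: "A : SL2Z" and z: "z : \<H>"
 shows   "evm (mslash f A) z = evm f (moebius A z)"
proof -
 have mero: "(%z. evm f (moebius A z)) meromorphic_on \<H>"
  by (rule meromorphic_on_compose[OF eval_mero_meromorphic moebius_analytic[OF A]]) (use moebius_in_uhp[OF A] in auto)
 have Az: "moebius A z : \<H>" by (rule moebius_in_uhp[OF A z])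
 from eval_mero_nicely_meromorphic[of f] Az
 have "is_pole (evm f) (moebius A z) & evm f (moebius A z) = 0 \<or> evm f \<midarrow>moebius A z\<rightarrow> evm f (moebius A z)"
  unfolding nicely_meromorphic_on_def by blast
 hence "remove_sings (%z. evm f (moebius A z)) z = evm f (moebius A z)"
 proof
  assume *: "is_pole (evm f) (moebius A z) & evm f (moebius A z) = 0"
  hence "is_pole (%z. evm f (moebius A z)) z"
   unfolding is_pole_def using filterlim_compose filtermap_moebius_at[OF A z] by blast
  thus ?thesis using * by simp
 next
  assume "evm f \<midarrow>moebius A z\<rightarrow> evm f (moebius A z)"
  hence "((%z. evm f (moebius A z)) ---> evm f (moebius A z)) (at z)"
   using filterlim_compose filtermap_moebius_at[OF A z] by blast
  thus ?thesis by (rule remove_sings_eqI)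
 qed
 thus ?thesis unfolding mslash_def eval_mero_of[OF mero] using z by simp
qed

lemma eval_mero_ext:
 assumes "!!z. z : \<H> ==> evm f z = evm g z"
 shows   "f = g"
 using assms eval_mero_outside by (metis eval_mero_inject ext)

lemma eventually_eval_mslash:
 assumes A: "A : SL2Z" and z: "z : \<H>"
 shows "eventually (%w. w : \<H> & (ALL f. evm (mslash f A) w = evm f (moebius A w))) (at z)"
 using eventually_at_in_open'[OF open_upper_half_plane z] by eventually_elim (simp add: eval_mslash[OF A])

lemma mslash_add:
 assumes A: "A : SL2Z"
 shows   "mslash (f + g) A = mslash f A + mslash g A"
proof (rule mero_uhp_eqI)
 fix z assume z: "z : \<H>"
 have "eventually (%w. evm (f + g) (moebius A w) = evm f (moebius A w) + evm g (moebius A w)) (at z)"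
  by (rule eventually_compose_filterlim[OF eventually_eval_plus_mero filtermap_moebius_at[OF A z]]) (rule moebius_in_uhp[OF A z])
 with eventually_eval_mslash[OF A z] eventually_eval_plus_mero[OF z, of "mslash f A" "mslash g A"]
 show "eventually (%w. evm (mslash (f + g) A) w = evm (mslash f A + mslash g A) w) (at z)"
  by eventually_elim simp
qed

lemma mslash_mult:
 assumes A: "A : SL2Z"
 shows   "mslash (f * g) A = mslash f A * mslash g A"
proof (rule mero_uhp_eqI)
 fix z assume z: "z : \<H>"
 have "eventually (%w. evm (f * g) (moebius A w) = evm f (moebius A w) * evm g (moebius A w)) (at z)"
  by (rule eventually_compose_filterlim[OF eventually_eval_times_mero filtermap_moebius_at[OF A z]]) (rule moebius_in_uhp[OF A z])
 with eventually_eval_mslash[OF A z] eventually_eval_times_mero[OF z, of "mslash f A" "mslash g A"]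
 show "eventually (%w. evm (mslash (f * g) A) w = evm (mslash f A * mslash g A) w) (at z)"
  by eventually_elim simp
qed

lemma mslash_const: "A : SL2Z ==> mslash (cst c) A = cst c"
 by (rule eval_mero_ext) (simp add: eval_mslash eval_const_mero moebius_in_uhp)

lemma mslash_0: "A : SL2Z ==> mslash 0 A = 0"
 and mslash_1: "A : SL2Z ==> mslash 1 A = 1"
 by (simp_all add: zero_mero_uhp_def one_mero_uhp_def mslash_const)

lemma mslash_uminus: "A : SL2Z ==> mslash (- f) A = - mslash f A"
 using mslash_add[of A f "- f"] by (simp add: mslash_0 add_eq_0_iff)

lemma mslash_diff: "A : SL2Z ==> mslash (f - g) A = mslash f A - mslash g A"
 using mslash_add[of A f "- g"] by (simp add: mslash_uminus)

lemma mslash_inverse: "A : SL2Z ==> mslash (inverse f) A = inverse (mslash f A)"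
 using mslash_mult[of A f "inverse f"] by (cases "f = 0") (auto simp: mslash_0 mslash_1 inverse_unique)

lemma mslash_divide: "A : SL2Z ==> mslash (f / g) A = mslash f A / mslash g A"
 by (simp add: divide_inverse mslash_mult mslash_inverse)

lemma mslash_power: "A : SL2Z ==> mslash (f ^ n) A = mslash f A ^ n"
 by (induction n) (auto simp: mslash_1 mslash_mult)

lemma mslash_sum: "A : SL2Z ==> mslash (sum f I) A = (\<Sum>i\<in>I. mslash (f i) A)"
 by (induction I rule: infinite_finite_induct) (auto simp: mslash_0 mslash_add)

lemma mslash_prod: "A : SL2Z ==> mslash (prod f I) A = (\<Prod>i\<in>I. mslash (f i) A)"
 by (induction I rule: infinite_finite_induct) (auto simp: mslash_1 mslash_mult)

lemma mslash_mslash: "A : SL2Z ==> B : SL2Z ==> mslash (mslash f A) B = mslash f (A ** B)"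
 by (rule eval_mero_ext) (simp add: eval_mslash moebius_in_uhp moebius_mult SL2Z_mult)

lemma mslash_one: "mslash f (mat 1) = f"
 by (rule eval_mero_ext) (simp add: eval_mslash SL2Z_one)

lemma mslash_eq_0_iff:
 assumes "A : SL2Z"
 shows "mslash f A = 0 \<longleftrightarrow> f = 0"
proof
 assume "mslash f A = 0"
 hence "mslash (mslash f A) (adj2 A) = 0" by (simp add: mslash_0 adj2_SL2Z[OF assms])
 thus "f = 0" by (simp add: mslash_mslash[OF assms adj2_SL2Z[OF assms]] adj2_mult[OF assms] mslash_one)
qed (simp add: mslash_0 assms)

section \<open>Behaviour at the cusps and valuations\<close>

lemma const_mero_add: "cst (a + b) = cst a + cst b"
proof (rule mero_uhp_eqI)
 fix z assume z: "z : \<H>"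
 show "eventually (%w. evm (cst (a + b)) w = evm (cst a + cst b) w) (at z)"
  using eventually_eval_plus_mero[OF z, of "cst a" "cst b"] eventually_eval_const_mero[OF z, of a]
   eventually_eval_const_mero[OF z, of b] eventually_eval_const_mero[OF z, of "a + b"]
  by eventually_elim simp
qed

lemma const_mero_mult: "cst (a * b) = cst a * cst b"
proof (rule mero_uhp_eqI)
 fix z assume z: "z : \<H>"
 show "eventually (%w. evm (cst (a * b)) w = evm (cst a * cst b) w) (at z)"
  using eventually_eval_times_mero[OF z, of "cst a" "cst b"] eventually_eval_const_mero[OF z, of a]
   eventually_eval_const_mero[OF z, of b] eventually_eval_const_mero[OF z, of "a * b"]
  by eventually_elim simp
qed

lemma const_mero_0 [simp]: "cst 0 = 0" and const_mero_1 [simp]: "cst 1 = 1"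
 by (simp_all add: zero_mero_uhp_def one_mero_uhp_def)

lemma const_mero_minus: "cst (- a) = - cst a"
 using const_mero_add[of a "- a"] by (simp add: add_eq_0_iff)

lemma const_mero_eq_iff [simp]: "cst a = cst b \<longleftrightarrow> a = b"
proof
 assume "cst a = cst b"
 hence "evm (cst a) \<i> = evm (cst b) \<i>" by simp
 thus "a = b" by (simp add: eval_const_mero)
qed simp

lemma const_mero_eq_0_iff [simp]: "cst a = 0 \<longleftrightarrow> a = 0"
 using const_mero_eq_iff[of a 0] by simp

lemma const_mero_inverse: "cst (inverse a) = inverse (cst a)"
proof (cases "a = 0")
 case False
 hence "cst a * cst (inverse a) = 1" by (simp flip: const_mero_mult)
 thus ?thesis by (rule inverse_unique[symmetric])
qed simp

lemma const_mero_of_nat: "cst (of_nat n) = of_nat n"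
 by (induction n) (auto simp: const_mero_add)

lemma const_mero_numeral: "cst (numeral n) = numeral n"
 using const_mero_of_nat[of "numeral n"] by simp

text \<open>Field operations in \<open>mero_uhp\<close> are pointwise only off a discrete set. Where
  the pointwise expression is analytic, this gives the exact value.\<close>

lemma eval_mero_eqI_analytic:
 assumes "z : \<H>" "eventually (%w. evm h w = F w) (at z)" "F analytic_on {z}"
 shows   "evm h z = F z" "evm h analytic_on {z}"
proof -
 have "remove_sings (evm h) z = remove_sings F z"
  by (rule remove_sings_cong) (use assms in auto)
 thus *: "evm h z = F z" using assms by (simp add: remove_sings_eval_mero)
 have "eventually (%w. evm h w = F w) (nhds z)"
  using assms(2) * by (auto simp: eventually_nhds_conv_at)
 from analytic_at_cong[OF this refl] assms(3) show "evm h analytic_on {z}" by simp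
qed

section \<open>Meromorphy at the cusp infinity\<close>

definition qmero :: "mero_uhp => bool" where
 "qmero f \<longleftrightarrow> (EX N g c. N > (0::nat) & g meromorphic_on {0} & (ALL z. Im z > c --> evm f z = g (ee (z / of_nat N))))"

lemma meromorphic_at_ii_inf_iff_qmero:
 assumes A: "A : SL2Z"
 shows "meromorphic_at_ii_inf (%z. evm f (moebius A z)) \<longleftrightarrow> qmero (mslash f A)"
proof
 assume "meromorphic_at_ii_inf (%z. evm f (moebius A z))"
 then obtain N g c where N: "N > 0" "g meromorphic_on {0}"
  "!!z. Im z > c ==> evm f (moebius A z) = g (exp (2 * of_real pi * \<i> * z / of_nat N))"
  unfolding meromorphic_at_ii_inf_def by blast
 have "evm (mslash f A) z = g (ee (z / of_nat N))" if "Im z > max c 0" for z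
  using that N(3)[of z] by (simp add: eval_mslash[OF A] upper_half_plane_def ee_def)
 thus "qmero (mslash f A)" unfolding qmero_def using N by blast
next
 assume "qmero (mslash f A)"
 then obtain N g c where N: "N > 0" "g meromorphic_on {0}"
  "!!z. Im z > c ==> evm (mslash f A) z = g (ee (z / of_nat N))"
  unfolding qmero_def by blast
 have "evm f (moebius A z) = g (exp (2 * of_real pi * \<i> * z / of_nat N))" if "Im z > max c 0" for z
  using that N(3)[of z] by (simp add: eval_mslash[OF A] upper_half_plane_def ee_def)
 thus "meromorphic_at_ii_inf (%z. evm f (moebius A z))"
  unfolding meromorphic_at_ii_inf_def using N by blast
qed

lemma norm_ee_small:
 assumes "N > (0::nat)" "r > 0" "Im z > of_nat N / (2 * pi * r)"
 shows   "norm (ee (z / of_nat N)) < r"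
proof -
 define x where "x = 2 * pi * Im z / of_nat N"
 have "1 / r < x" using assms by (simp add: x_def field_simps)
 also have "x < 1 + x" by simp
 also have "\<dots> <= exp x" by (rule exp_ge_add_one_self)
 finally have "exp (- x) < r" using assms(2) by (simp add: exp_minus field_simps)
 thus ?thesis by (simp add: norm_ee x_def)
qed

text \<open>On a small punctured disc around 0 the function \<open>g\<close> has no poles and,
  unless f = 0, no zeros. The height is raised until the half-plane is mapped into that
  disc.\<close>

lemma qmeroE:
 assumes "qmero f"
 obtains N g c where "N > (0::nat)" "c \<ge> 0" "g meromorphic_on {0}"
  "!!z. Im z > c ==> evm f z = g (ee (z / of_nat N))"
  "!!z. Im z > c ==> evm f analytic_on {z}"
  "!!z. Im z > c ==> f ~= 0 ==> evm f z ~= 0"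
  "f ~= 0 ==> eventually (%t. g t ~= 0) (at 0)"
proof -
 obtain N g c where N: "N > (0::nat)" and g: "g meromorphic_on {0}"
  and eq: "!!z. Im z > c ==> evm f z = g (ee (z / of_nat N))"
  using assms unfolding qmero_def by blast
 have iso: "isolated_singularity_at g 0" "not_essential g 0"
  using g by (auto simp: meromorphic_at_iff)
 obtain r1 where r1: "r1 > 0" "g analytic_on ball 0 r1 - {0}"
  using iso(1) unfolding isolated_singularity_at_def by blast
 have nz: "eventually (%t. g t ~= 0) (at 0)" if "f ~= 0"
 proof (rule ccontr)
  assume "~ ?thesis"
  hence "frequently (%t. g t = 0) (at 0)" by (simp add: frequently_def)
  hence "eventually (%t. g t = 0) (at 0)" using iso not_essential_frequently_0_imp_eventually_0 by blast
  then obtain r where r: "r > 0" "!!t. t ~= 0 ==> dist t 0 < r ==> g t = 0"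
   unfolding eventually_at by auto
  define c' where "c' = max (max c 0) (of_nat N / (2 * pi * r))"
  define z where "z = \<i> * of_real (c' + 1)"
  have z: "Im z > c'" "z : \<H>" by (auto simp: z_def upper_half_plane_def c'_def)
  have "open {w. Im w > c'}" by (rule open_halfspace_Im_gt)
  hence "eventually (%w. w : {w. Im w > c'}) (at z)" using z by (intro eventually_at_in_open') auto
  hence "eventually (%w. evm f w = 0) (at z)"
  proof eventually_elim
   case (elim w)
   hence "norm (ee (w / of_nat N)) < r" by (intro norm_ee_small N r) (auto simp: c'_def)
   thus ?case using elim r(2)[of "ee (w / of_nat N)"] eq[of w] by (auto simp: c'_def)
  qed
  with eventually_eval_mero_nonzero[OF that z(2)] have "eventually (%w. False) (at z)"
   by eventually_elim simp
  thus False by simp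
 qed
 have "EX r2>0. f ~= 0 --> (ALL t. t ~= 0 & norm t < r2 --> g t ~= 0)"
 proof (cases "f = 0")
  case False
  with nz obtain r where "r > 0" "!!t. t ~= 0 ==> dist t 0 < r ==> g t ~= 0" unfolding eventually_at by auto
  thus ?thesis by auto
 qed (auto intro: exI[of _ 1])
 then obtain r2 where r2: "r2 > 0" "f ~= 0 --> (ALL t. t ~= 0 & norm t < r2 --> g t ~= 0)" by blast
 define r where "r = min r1 r2"
 have r: "r > 0" using r1 r2 by (simp add: r_def)
 define c' where "c' = max (max c 0) (of_nat N / (2 * pi * r))"
 have small: "norm (ee (z / of_nat N)) < r" if "Im z > c'" for z
  using that by (intro norm_ee_small N r) (auto simp: c'_def)
 show ?thesis
 proof (rule that[of N c' g])
  show "N > 0" "g meromorphic_on {0}" "c' \<ge> 0" using N g by (auto simp: c'_def)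
  show e: "evm f z = g (ee (z / of_nat N))" if "Im z > c'" for z
   using eq that by (auto simp: c'_def)
  show "eventually (%t. g t ~= 0) (at 0)" if "f ~= 0" by (rule nz[OF that])
  show "evm f z ~= 0" if "Im z > c'" "f ~= 0" for z
   using e[OF that(1)] small[OF that(1)] r2(2) that(2) by (auto simp: r_def)
  show "evm f analytic_on {z}" if z: "Im z > c'" for z
  proof -
   have "(%z. ee (z / of_nat N)) analytic_on {z}" unfolding ee_def using N by (intro analytic_intros) auto
   moreover have "g analytic_on {ee (z / of_nat N)}"
    by (rule analytic_on_subset[OF r1(2)]) (use small[OF z] in \<open>auto simp: r_def\<close>)
   ultimately have an: "(%z. g (ee (z / of_nat N))) analytic_on {z}"
    using analytic_on_compose_gen[of "%z. ee (z / of_nat N)" "{z}" g "{ee (z / of_nat N)}"] by (simp add: o_def)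
   have "eventually (%w. w : {w. Im w > c'}) (nhds z)"
    using z open_halfspace_Im_gt[of c'] by (intro eventually_nhds_in_open) auto
   hence "eventually (%w. evm f w = g (ee (w / of_nat N))) (nhds z)"
    by eventually_elim (use e in auto)
   from analytic_at_cong[OF this refl] an show ?thesis by simp
  qed
 qed
qed

lemma meromorphic_compose_power:
 assumes "g meromorphic_on {0}" "n > 0"
 shows   "(%t. g (t ^ n)) meromorphic_on {0}"
 by (rule meromorphic_on_compose[OF assms(1)]) (use assms(2) in \<open>auto intro!: analytic_intros\<close>)

lemma ee_div_power:
 assumes "M > (0::nat)" "N > 0"
 shows   "ee (z / of_nat (M * N)) ^ N = ee (z / of_nat M)" "ee (z / of_nat (M * N)) ^ M = ee (z / of_nat N)"
 using assms by (auto simp flip: ee_of_nat_mult)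

text \<open>Expansions in q^(1/N) and q^(1/M) are both rewritten in q^(1/(N M)) by substituting
  powers of the variable.\<close>

lemma qmero_lift2:
 assumes f: "qmero f" and g: "qmero g"
  and mero: "!!F G. F meromorphic_on {0} ==> G meromorphic_on {0} ==> (%t. op (F t) (G t)) meromorphic_on {0}"
  and ev: "!!z. z : \<H> ==> eventually (%w. evm h w = op (evm f w) (evm g w)) (at z)"
  and an: "!!z F G. F analytic_on {z} ==> G analytic_on {z} ==> (%t. op (F t) (G t)) analytic_on {z}"
 shows "qmero h" "EX c. ALL z. Im z > c --> evm h z = op (evm f z) (evm g z)"
proof -
 obtain N F c where F: "N > (0::nat)" "c \<ge> 0" "F meromorphic_on {0}" "!!z. Im z > c ==> evm f z = F (ee (z / of_nat N))"
  "!!z. Im z > c ==> evm f analytic_on {z}" using qmeroE[OF f] by metis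
 obtain M G d where G: "M > (0::nat)" "d \<ge> 0" "G meromorphic_on {0}" "!!z. Im z > d ==> evm g z = G (ee (z / of_nat M))"
  "!!z. Im z > d ==> evm g analytic_on {z}" using qmeroE[OF g] by metis
 have eq: "evm h z = op (evm f z) (evm g z)" if "Im z > max c d" for z
  by (rule eval_mero_eqI_analytic(1)[OF _ ev an]) (use that F(2,5) G in \<open>auto simp: upper_half_plane_def\<close>)
 thus "EX c. ALL z. Im z > c --> evm h z = op (evm f z) (evm g z)" by blast
 have "(%t. op (F (t ^ M)) (G (t ^ N))) meromorphic_on {0}"
  by (intro mero meromorphic_compose_power F G)
 moreover have "evm h z = op (F (ee (z / of_nat (N * M)) ^ M)) (G (ee (z / of_nat (N * M)) ^ N))" if "Im z > max c d" for z
  unfolding ee_div_power[OF F(1) G(1)] using eq[OF that] F(4)[of z] G(4)[of z] that by simp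
 moreover have "N * M > 0" using F(1) G(1) by simp
 ultimately show "qmero h" unfolding qmero_def by blast
qed

lemma qmero_add: "qmero f ==> qmero g ==> qmero (f + g)"
 and qmero_add_ev: "qmero f ==> qmero g ==> EX c. ALL z. Im z > c --> evm (f + g) z = evm f z + evm g z"
proof -
 assume "qmero f" "qmero g"
 from qmero_lift2[OF this, of "%x y. x + y" "f + g"] eventually_eval_plus_mero
 show "qmero (f + g)" "EX c. ALL z. Im z > c --> evm (f + g) z = evm f z + evm g z"
  by (auto intro!: meromorphic_intros analytic_intros)
qed

lemma qmero_mult: "qmero f ==> qmero g ==> qmero (f * g)"
 and qmero_mult_ev: "qmero f ==> qmero g ==> EX c. ALL z. Im z > c --> evm (f * g) z = evm f z * evm g z"
proof -
 assume "qmero f" "qmero g"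
 from qmero_lift2[OF this, of "%x y. x * y" "f * g"] eventually_eval_times_mero
 show "qmero (f * g)" "EX c. ALL z. Im z > c --> evm (f * g) z = evm f z * evm g z"
  by (auto intro!: meromorphic_intros analytic_intros)
qed

lemma qmero_const: "qmero (cst a)"
 unfolding qmero_def
 by (rule exI[of _ 1], rule exI[of _ "%_. a"], rule exI[of _ 0]) (auto simp: eval_const_mero upper_half_plane_def)

lemma qmero_uminus: "qmero f ==> qmero (- f)"
 using qmero_mult[OF qmero_const[of "- 1"], of f] by (simp add: const_mero_minus)

lemma qmero_inverse:
 assumes "qmero f"
 shows   "qmero (inverse f)"
proof (cases "f = 0")
 case False
 obtain N F c where F: "N > (0::nat)" "c \<ge> 0" "F meromorphic_on {0}" "!!z. Im z > c ==> evm f z = F (ee (z / of_nat N))"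
  "!!z. Im z > c ==> evm f analytic_on {z}" "!!z. Im z > c ==> evm f z ~= 0" using qmeroE[OF assms] False by metis
 have "evm (inverse f) z = inverse (evm f z)" if "Im z > c" for z
  by (rule eval_mero_eqI_analytic(1)[OF _ eventually_eval_inverse_mero])
    (use that F in \<open>auto simp: upper_half_plane_def intro!: analytic_intros\<close>)
 moreover have "(%t. inverse (F t)) meromorphic_on {0}" using F by (intro meromorphic_intros)
 ultimately show ?thesis unfolding qmero_def using F(1,4) by metis
qed (use assms in simp)

lemma modular_functions_iff:
 assumes "G <= SL2Z"
 shows "f : modular_functions G \<longleftrightarrow> (ALL A:G. mslash f A = f) & (ALL A:SL2Z. qmero (mslash f A))"
proof -
 have "(ALL z:\<H>. evm f (moebius A z) = evm f z) \<longleftrightarrow> mslash f A = f" if "A : G" for A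
 proof
  assume "ALL z:\<H>. evm f (moebius A z) = evm f z"
  thus "mslash f A = f" using that assms by (intro eval_mero_ext) (auto simp: eval_mslash)
 next
  assume *: "mslash f A = f"
  show "ALL z:\<H>. evm f (moebius A z) = evm f z"
   using eval_mslash[of A _ f] that assms unfolding * by auto
 qed
 thus ?thesis unfolding modular_functions_def by (auto simp: meromorphic_at_ii_inf_iff_qmero)
qed

lemma modular_functions_subfield:
 assumes "G <= SL2Z"
 shows   "is_subfield (modular_functions G)"
 using assms qmero_const[of 0] qmero_const[of 1]
 by (auto simp: is_subfield_def modular_functions_iff[OF assms] subset_iff mslash_0 mslash_1 mslash_add mslash_mult mslash_uminus mslash_inverse
      qmero_add qmero_mult qmero_uminus qmero_inverse)

lemma modular_functions_const: "G <= SL2Z ==> cst c : modular_functions G"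
 by (auto simp: modular_functions_iff mslash_const subset_iff qmero_const)

lemma modular_functions_mono: "G <= G' ==> modular_functions G' <= modular_functions G"
 by (auto simp: modular_functions_def)


lemma is_subfieldD:
 assumes "is_subfield K"
 shows "0 : K" "1 : K" "a : K ==> b : K ==> a + b : K" "a : K ==> b : K ==> a * b : K"
  "a : K ==> - a : K" "a : K ==> inverse a : K" "a : K ==> b : K ==> a - b : K"
  "a : K ==> b : K ==> a / b : K" "a : K ==> a ^ n : K"
  "(!!i. i : I ==> f i : K) ==> sum f I : K"
  "(!!i. i : I ==> f i : K) ==> prod f I : K"
proof -
 show 1: "0 : K" "1 : K" using assms by (auto simp: is_subfield_def)
 show a: "a : K ==> b : K ==> a + b : K" for a b using assms by (auto simp: is_subfield_def)
 show m: "a : K ==> b : K ==> a * b : K" for a b using assms by (auto simp: is_subfield_def)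
 show u: "a : K ==> - a : K" and i: "a : K ==> inverse a : K" for a using assms by (auto simp: is_subfield_def)
 show "a - b : K" if "a : K" "b : K" using a[OF that(1) u[OF that(2)]] by simp
 show "a / b : K" if "a : K" "b : K" using m[OF that(1) i[OF that(2)]] by (simp add: divide_inverse)
 show "a ^ n : K" if "a : K" using that by (induction n) (auto intro: 1 m)
 show "sum f I : K" if "!!i. i : I ==> f i : K"
  using that by (induction I rule: infinite_finite_induct) (auto intro: 1 a)
 show "prod f I : K" if "!!i. i : I ==> f i : K"
  using that by (induction I rule: infinite_finite_induct) (auto intro: 1 m)
qed

text \<open>Surjectivity is left out, so that orders at points and cusps qualify even when
  restricted to a subfield on which they are ramified. The value at 0 is arbitrary; later statements
  therefore carry the alternative f = 0.\<close>

definition valuation_on :: "mero_uhp set => (mero_uhp => int) => bool" where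
 "valuation_on K v \<longleftrightarrow>
   (ALL f:K - {0}. ALL g:K - {0}. v (f * g) = v f + v g & (f + g ~= 0 --> min (v f) (v g) <= v (f + g))) \<and>
   (ALL c. c ~= 0 --> v (cst c) = 0)"

text \<open>Common ground for orders at a point and at a cusp: \<open>u\<close> is a local parameter
  along the filter \<open>F\<close>, and every nonzero element of \<open>K\<close> is asymptotic to
  a nonzero multiple of an integer power of \<open>u\<close>.\<close>

locale ord_frame =
 fixes F :: "complex filter" and u :: "complex => complex" and K :: "mero_uhp set"
 assumes F: "F ~= bot" and u0: "(u ---> 0) F" and unz: "eventually (%z. u z ~= 0) F"
  and K: "is_subfield K" and Kc: "cst c : K"
  and ev_add: "f : K ==> g : K ==> eventually (%z. evm (f + g) z = evm f z + evm g z) F"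
  and ev_mult: "f : K ==> g : K ==> eventually (%z. evm (f * g) z = evm f z * evm g z) F"
  and ev_const: "eventually (%z. evm (cst c) z = c) F"
  and ex_ord: "f : K ==> f ~= 0 ==> EX n c. c ~= 0 & ((%z. evm f z * u z powi (- n)) ---> c) F"
begin

definition ord :: "mero_uhp => int" where
 "ord f = (THE n. EX c. c ~= 0 & ((%z. evm f z * u z powi (- n)) ---> c) F)"

lemma upowi_tendsto_0: "k > 0 ==> ((%z. u z powi k) ---> 0) F"
 using tendsto_power[OF u0, of "nat k"] by (simp add: power_int_def zero_power)

lemma lower_order_tendsto_0:
 assumes "((%z. h z * u z powi (- m)) ---> c) F" "n < m"
 shows   "((%z. h z * u z powi (- n)) ---> 0) F"
proof -
 have "((%z. h z * u z powi (- m) * u z powi (m - n)) ---> c * 0) F"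
  by (intro tendsto_mult assms upowi_tendsto_0) (use assms in auto)
 moreover have "eventually (%z. h z * u z powi (- m) * u z powi (m - n) = h z * u z powi (- n)) F"
  using unz by eventually_elim (simp add: power_int_add[symmetric] mult.assoc)
 ultimately show ?thesis using Lim_transform_eventually by fastforce
qed

lemma ord_eqI:
 assumes "((%z. evm f z * u z powi (- n)) ---> c) F" "c ~= 0"
 shows   "ord f = n"
 unfolding ord_def
proof (rule the_equality)
 show "EX c. c ~= 0 & ((%z. evm f z * u z powi (- n)) ---> c) F" using assms by blast
 fix m assume "EX c. c ~= 0 & ((%z. evm f z * u z powi (- m)) ---> c) F"
 then obtain c' where c': "c' ~= 0" "((%z. evm f z * u z powi (- m)) ---> c') F" by blast
 show "m = n"
 proof (rule ccontr)
  assume "m ~= n"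
  then consider "n < m" | "m < n" by linarith
  thus False
  proof cases
   case 1
   from lower_order_tendsto_0[OF c'(2) this] assms show False using tendsto_unique[OF F] by blast
  next
   case 2
   from lower_order_tendsto_0[OF assms(1) this] c' show False using tendsto_unique[OF F] by blast
  qed
 qed
qed

lemma ord_limit:
 assumes "f : K" "f ~= 0"
 obtains c where "c ~= 0" "((%z. evm f z * u z powi (- ord f)) ---> c) F"
proof -
 obtain n c where "c ~= 0" "((%z. evm f z * u z powi (- n)) ---> c) F" using ex_ord[OF assms] by blast
 thus ?thesis using ord_eqI that by metis
qed

lemma ord_mult:
 assumes "f : K" "f ~= 0" "g : K" "g ~= 0"
 shows   "ord (f * g) = ord f + ord g"
proof -
 obtain c where c: "c ~= 0" "((%z. evm f z * u z powi (- ord f)) ---> c) F" using ord_limit assms by metis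
 obtain d where d: "d ~= 0" "((%z. evm g z * u z powi (- ord g)) ---> d) F" using ord_limit assms by metis
 have "((%z. (evm f z * u z powi (- ord f)) * (evm g z * u z powi (- ord g))) ---> c * d) F"
  by (intro tendsto_mult c d)
 moreover have "eventually (%z. (evm f z * u z powi (- ord f)) * (evm g z * u z powi (- ord g)) =
   evm (f * g) z * u z powi (- (ord f + ord g))) F"
  using ev_mult[OF assms(1,3)] unz
  by eventually_elim (simp add: power_int_diff power_int_minus field_simps)
 ultimately have "((%z. evm (f * g) z * u z powi (- (ord f + ord g))) ---> c * d) F"
  by (rule Lim_transform_eventually)
 thus ?thesis by (rule ord_eqI) (use c d in auto)
qed

lemma ord_ge_tendsto:
 assumes "f : K" "f = 0 \<or> n <= ord f"
 shows   "EX c. ((%z. evm f z * u z powi (- n)) ---> c) F"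
proof (cases "f = 0")
 case True
 have "eventually (%z. 0 = evm f z * u z powi (- n)) F"
  using ev_const[of 0] unfolding True by eventually_elim simp
 from Lim_transform_eventually[OF tendsto_const this] show ?thesis by blast
next
 case False
 obtain c where c: "c ~= 0" "((%z. evm f z * u z powi (- ord f)) ---> c) F"
  using ord_limit[OF assms(1) False] by metis
 show ?thesis
 proof (cases "n = ord f")
  case False
  thus ?thesis using lower_order_tendsto_0[OF c(2), of n] assms(2) \<open>f ~= 0\<close> by (intro exI[of _ 0]) auto
 qed (use c in auto)
qed

lemma ord_geI:
 assumes "f : K" "f ~= 0" "((%z. evm f z * u z powi (- n)) ---> c) F"
 shows   "n <= ord f" "c = 0 ==> n < ord f"
proof -
 obtain d where d: "d ~= 0" "((%z. evm f z * u z powi (- ord f)) ---> d) F"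
  using ord_limit[OF assms(1,2)] by metis
 show 1: "n <= ord f"
 proof (rule ccontr)
  assume "~ ?thesis"
  hence "((%z. evm f z * u z powi (- ord f)) ---> 0) F"
   using lower_order_tendsto_0[OF assms(3), of "ord f"] by simp
  thus False using d tendsto_unique[OF F] by blast
 qed
 show "n < ord f" if "c = 0"
 proof (rule ccontr)
  assume "~ ?thesis"
  with 1 have "n = ord f" by simp
  thus False using d assms(3) that tendsto_unique[OF F] by blast
 qed
qed

lemma tendsto_eval_add:
 assumes "f : K" "g : K" "((%z. evm f z * u z powi (- n)) ---> c) F" "((%z. evm g z * u z powi (- n)) ---> d) F"
 shows   "((%z. evm (f + g) z * u z powi (- n)) ---> c + d) F"
proof (rule Lim_transform_eventually[OF tendsto_add[OF assms(3,4)]])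
 show "eventually (%z. evm f z * u z powi (- n) + evm g z * u z powi (- n) = evm (f + g) z * u z powi (- n)) F"
  using ev_add[OF assms(1,2)] by eventually_elim (simp add: distrib_right)
qed

lemma ord_add:
 assumes "f : K" "f ~= 0" "g : K" "g ~= 0" "f + g ~= 0"
 shows   "min (ord f) (ord g) <= ord (f + g)"
proof -
 obtain c where c: "((%z. evm f z * u z powi (- min (ord f) (ord g))) ---> c) F"
  using ord_ge_tendsto[OF assms(1), of "min (ord f) (ord g)"] by auto
 obtain d where d: "((%z. evm g z * u z powi (- min (ord f) (ord g))) ---> d) F"
  using ord_ge_tendsto[OF assms(3), of "min (ord f) (ord g)"] by auto
 show ?thesis
  by (rule ord_geI(1)[OF is_subfieldD(3)[OF K assms(1,3)] assms(5) tendsto_eval_add[OF assms(1,3) c d]])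
qed

lemma ord_const: "c ~= 0 ==> ord (cst c) = 0"
proof (rule ord_eqI)
 show "((%z. evm (cst c) z * u z powi (- 0)) ---> c) F"
  by (rule Lim_transform_eventually[OF tendsto_const]) (use ev_const[of c] in \<open>eventually_elim, simp\<close>)
qed

lemma valuation_ord: "valuation_on K ord"
 unfolding valuation_on_def using ord_mult ord_add ord_const by auto

text \<open>The residue field is C: the constant is the limit of f / u^(ord g) divided by the
  leading coefficient of g.\<close>

lemma ord_residue:
 assumes "f : K" "g : K" "g ~= 0" "f = 0 \<or> ord g <= ord f"
 obtains c where "f - cst c * g = 0 \<or> ord g < ord (f - cst c * g)"
proof -
 obtain d where d: "d ~= 0" "((%z. evm g z * u z powi (- ord g)) ---> d) F" using ord_limit assms by metis
 obtain c where c: "((%z. evm f z * u z powi (- ord g)) ---> c) F"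
  using ord_ge_tendsto[OF assms(1), of "ord g"] assms(4) by auto
 define a where "a = - c / d"
 have cg: "cst a * g : K" using Kc assms(2) K by (intro is_subfieldD)
 have "((%z. evm (cst a * g) z * u z powi (- ord g)) ---> a * d) F"
 proof (rule Lim_transform_eventually[OF tendsto_mult[OF tendsto_const d(2)]])
  show "eventually (%z. a * (evm g z * u z powi (- ord g)) = evm (cst a * g) z * u z powi (- ord g)) F"
   using ev_mult[OF Kc assms(2), of a] ev_const[of a] by eventually_elim simp
 qed
 from tendsto_eval_add[OF assms(1) cg c this]
 have "((%z. evm (f + cst a * g) z * u z powi (- ord g)) ---> 0) F" using d by (simp add: a_def)
 hence "f + cst a * g = 0 \<or> ord g < ord (f + cst a * g)"
  using ord_geI(2)[OF is_subfieldD(3)[OF K assms(1) cg]] by blast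
 thus ?thesis using that[of "- a"] by (simp add: const_mero_minus)
qed

end

lemma ord_frame_point:
 assumes p: "p : \<H>"
 shows   "ord_frame (at p) (%z. z - p) UNIV"
proof
 show "((%z. z - p) ---> 0) (at p)" using LIM_zero tendsto_ident_at by blast
 show "eventually (%z. z - p ~= 0) (at p)" by (simp add: eventually_at_filter)
 fix f :: mero_uhp assume f: "f ~= 0"
 have "evm f meromorphic_on {p}" using eval_mero_meromorphic[of f] p by (auto intro: meromorphic_on_subset)
 moreover have "frequently (%w. evm f w ~= 0) (at p)"
  using eventually_eval_mero_nonzero[OF f p] by (intro eventually_frequently) auto
 ultimately obtain r where r: "zor_poly (evm f) p p ~= 0" "r > 0" "zor_poly (evm f) p holomorphic_on cball p r"
  "!!w. w : cball p r - {p} ==> evm f w = zor_poly (evm f) p w * (w - p) powi zorder (evm f) p"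
  using zorder_exist[of "evm f" p] by (auto simp: meromorphic_at_iff)
 have "continuous_on (cball p r) (zor_poly (evm f) p)" using r(3) by (rule holomorphic_on_imp_continuous_on)
 hence "isCont (zor_poly (evm f) p) p"
  by (rule continuous_on_interior) (use r(2) in simp)
 hence "(zor_poly (evm f) p ---> zor_poly (evm f) p p) (at p)" by (simp add: isCont_def)
 moreover have "eventually (%w. w : ball p r - {p}) (at p)" using r(2) by (intro eventually_at_in_open) auto
 hence "eventually (%w. zor_poly (evm f) p w = evm f w * (w - p) powi (- zorder (evm f) p)) (at p)"
  by eventually_elim (use r(4) in \<open>simp add: power_int_minus less_imp_le\<close>)
 ultimately have "((%w. evm f w * (w - p) powi (- zorder (evm f) p)) ---> zor_poly (evm f) p p) (at p)"
  by (rule Lim_transform_eventually)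
 thus "EX n c. c ~= 0 & ((%z. evm f z * (z - p) powi (- n)) ---> c) (at p)" using r(1) by blast
qed (use p in \<open>auto simp: is_subfield_def eventually_eval_plus_mero eventually_eval_times_mero eventually_eval_const_mero\<close>)

definition at_iinf :: "complex filter" where "at_iinf = filtercomap Im at_top"

lemma eventually_at_iinf: "eventually P at_iinf \<longleftrightarrow> (EX c. ALL z. Im z > c --> P z)"
 unfolding at_iinf_def eventually_filtercomap_at_top_dense by blast

lemma at_iinf_neq_bot: "at_iinf ~= bot"
proof
 assume "at_iinf = bot"
 hence "eventually (%_. False) at_iinf" by simp
 then obtain c where "!!z. ~ Im z > c" unfolding eventually_at_iinf by blast
 from this[of "\<i> * of_real (c + 1)"] show False by simp
qed

lemma ee_tendsto_0_at_iinf: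
 assumes "N > (0::nat)"
 shows   "((%z. ee (z / of_nat N)) ---> 0) at_iinf"
 unfolding tendsto_iff eventually_at_iinf using norm_ee_small[OF assms] by (metis dist_0_norm dist_commute)

lemma ee_power_int: "ee (of_int k * a) = ee a powi k"
proof (cases k)
 case (nonneg n)
 thus ?thesis by (simp add: ee_of_nat_mult)
next
 case (neg n)
 have "ee (of_int k * a) = inverse (ee (of_nat (Suc n) * a))"
  unfolding neg ee_minus[symmetric] by (simp only: of_int_minus of_int_of_nat_eq mult_minus_left)
 thus ?thesis unfolding neg ee_of_nat_mult power_int_minus by (simp only: power_int_of_nat)
qed

text \<open>A priori f expands in q^(1/N) for some N depending on f, with leading term q^(m/N).
  Comparing the limits at z and z + 14 shows that exp(2 pi i 14 m / N) = 1, so m/N is a multiple of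
  1/14 and q^(1/14) serves all of \<open>K\<close>.\<close>

lemma ord_frame_iinf:
 assumes K: "is_subfield K" "!!c. cst c : K" "!!f. f : K ==> qmero f"
  and per: "!!f. f : K ==> mslash f (shiftm 14) = f"
 shows   "ord_frame at_iinf (%z. ee (z / 14)) K"
proof
 show "((%z. ee (z / 14)) ---> 0) at_iinf" using ee_tendsto_0_at_iinf[of 14] by simp
 fix f g assume "f : K" "g : K"
 thus "eventually (%z. evm (f + g) z = evm f z + evm g z) at_iinf"
    "eventually (%z. evm (f * g) z = evm f z * evm g z) at_iinf"
  unfolding eventually_at_iinf using qmero_add_ev qmero_mult_ev K(3) by blast+
next
 show "eventually (%z. evm (cst c) z = c) at_iinf" for c
  unfolding eventually_at_iinf by (rule exI[of _ 0]) (auto simp: eval_const_mero upper_half_plane_def)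
next
 fix f assume f: "f : K" "f ~= 0"
 obtain N g c where g: "N > (0::nat)" "c \<ge> 0" "g meromorphic_on {0}" "!!z. Im z > c ==> evm f z = g (ee (z / of_nat N))"
  "eventually (%t. g t ~= 0) (at 0)" using qmeroE[OF K(3)[OF f(1)]] f(2) by metis
 define h m where "h = zor_poly g 0" "m = zorder g 0"
 note hm = this
 have "frequently (%w. g w ~= 0) (at 0)" using g(5) by (intro eventually_frequently) auto
 then obtain r where r: "h 0 ~= 0" "r > 0" "h holomorphic_on cball 0 r" "!!t. t : cball 0 r - {0} ==> g t = h t * t powi m"
  using zorder_exist[of g 0] g(3) by (auto simp: meromorphic_at_iff hm)
 have "continuous_on (cball 0 r) h" using r(3) by (rule holomorphic_on_imp_continuous_on)
 hence "isCont h 0"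
  by (rule continuous_on_interior) (use r(2) in simp)
 hence h0: "(h ---> h 0) (nhds 0)" by (simp add: isCont_def tendsto_at_iff_tendsto_nhds)
 have lim_t: "((%z. h (ee (z / of_nat N))) ---> h 0) at_iinf"
  by (rule filterlim_compose[OF h0 ee_tendsto_0_at_iinf[OF g(1)]])
 have lim_t14: "((%z. h (ee ((z + 14) / of_nat N))) ---> h 0) at_iinf"
 proof (rule filterlim_compose[OF h0])
  have "((%z. ee (14 / of_nat N) * ee (z / of_nat N)) ---> ee (14 / of_nat N) * 0) at_iinf"
   by (intro tendsto_intros ee_tendsto_0_at_iinf g)
  thus "((%z. ee ((z + 14) / of_nat N)) ---> 0) at_iinf"
   by (simp add: add_divide_distrib ee_add mult.commute)
 qed
 define c' where "c' = max c (of_nat N / (2 * pi * r))"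
 have eq: "evm f z = h (ee (z / of_nat N)) * ee (z / of_nat N) powi m" if "Im z > c'" for z
 proof -
  have "norm (ee (z / of_nat N)) < r" using that by (intro norm_ee_small g r) (auto simp: c'_def)
  thus ?thesis using r(4)[of "ee (z / of_nat N)"] g(4)[of z] that by (simp add: c'_def)
 qed
 have "((%z. h (ee (z / of_nat N))) ---> h 0 * ee (14 / of_nat N) powi m) at_iinf"
 proof (rule Lim_transform_eventually[OF tendsto_mult[OF lim_t14 tendsto_const]])
  show "eventually (%z. h (ee ((z + 14) / of_nat N)) * ee (14 / of_nat N) powi m = h (ee (z / of_nat N))) at_iinf"
   unfolding eventually_at_iinf
  proof (rule exI[of _ c'], intro allI impI)
   fix z assume z: "Im z > c'"
   hence zH: "z : \<H>" using g(2) by (auto simp: upper_half_plane_def c'_def)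
   have "evm f (z + 14) = evm f z"
    using eval_mslash[of "shiftm 14" z f] zH per[OF f(1)] by simp
   hence "h (ee ((z + 14) / of_nat N)) * ee ((z + 14) / of_nat N) powi m = h (ee (z / of_nat N)) * ee (z / of_nat N) powi m"
    using eq[OF z] eq[of "z + 14"] z by simp
   thus "h (ee ((z + 14) / of_nat N)) * ee (14 / of_nat N) powi m = h (ee (z / of_nat N))"
    by (simp add: add_divide_distrib ee_add power_int_mult_distrib)
  qed
 qed
 with lim_t have "h 0 * ee (14 / of_nat N) powi m = h 0" using tendsto_unique[OF at_iinf_neq_bot] by blast
 hence "ee (14 / of_nat N) powi m = 1" using r(1) by simp
 hence "ee (of_int m * (14 / of_nat N)) = 1" by (simp only: ee_power_int)
 then obtain n :: int where n: "of_int m * (14 / of_nat N) = (of_int n :: complex)" using ee_eq_1_iff by blast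
 have "((%z. evm f z * ee (z / 14) powi (- n)) ---> h 0) at_iinf"
 proof (rule Lim_transform_eventually[OF lim_t])
  show "eventually (%z. h (ee (z / of_nat N)) = evm f z * ee (z / 14) powi (- n)) at_iinf"
   unfolding eventually_at_iinf
  proof (rule exI[of _ c'], intro allI impI)
   fix z assume z: "Im z > c'"
   have "of_int n * (z / 14) = of_int m * (z / of_nat N)" using n[symmetric] by simp
   hence "ee (z / 14) powi n = ee (z / of_nat N) powi m" by (metis ee_power_int)
   thus "h (ee (z / of_nat N)) = evm f z * ee (z / 14) powi (- n)"
    unfolding eq[OF z] by (simp add: power_int_minus)
  qed
 qed
 thus "EX n c. c ~= 0 & ((%z. evm f z * ee (z / 14) powi (- n)) ---> c) at_iinf" using r(1) by blast
qed (use K at_iinf_neq_bot in auto)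

section \<open>The maximum principle on the modular curve\<close>

text \<open>Gamma(14) lies in the group of the theorem and is normal in SL_2(Z). So this larger
  field is stable under all slash operators, and any cusp can be moved to infinity inside
  it.\<close>

definition M14 :: "mero_uhp set" where "M14 = modular_functions (Gamma_principal 14)"

lemma Gamma_principal_subset: "Gamma_principal N <= SL2Z"
 by (auto simp: Gamma_principal_def)

lemma M14_iff: "f : M14 \<longleftrightarrow> (ALL A:Gamma_principal 14. mslash f A = f) & (ALL A:SL2Z. qmero (mslash f A))"
 unfolding M14_def by (rule modular_functions_iff[OF Gamma_principal_subset])

lemma M14_subfield: "is_subfield M14"
 unfolding M14_def by (rule modular_functions_subfield[OF Gamma_principal_subset])

lemmas M14_closed = is_subfieldD[OF M14_subfield]

lemma M14_const: "cst c : M14"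
 unfolding M14_def by (rule modular_functions_const[OF Gamma_principal_subset])

lemma M14_qmero: "f : M14 ==> qmero f"
 using M14_iff[of f] SL2Z_one mslash_one[of f] by metis

lemma M14_slash:
 assumes f: "f : M14" and A: "A : SL2Z"
 shows   "mslash f A : M14"
 unfolding M14_iff
proof (intro conjI ballI)
 fix B assume B: "B : Gamma_principal 14"
 obtain B' where B': "B' : Gamma_principal 14" "A ** B = B' ** A" using Gamma_principal_normal[OF A B] by metis
 have SL: "B : SL2Z" "B' : SL2Z" using B B' Gamma_principal_subset by blast+
 have "mslash (mslash f A) B = mslash (mslash f B') A"
  using SL A B' by (simp add: mslash_mslash)
 also have "mslash f B' = f" using f B' M14_iff by blast
 finally show "mslash (mslash f A) B = mslash f A" .
next
 fix B assume "B : SL2Z"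
 thus "qmero (mslash (mslash f A) B)" using f A by (simp add: mslash_mslash M14_iff SL2Z_mult)
qed

lemma shiftm_14: "shiftm 14 : Gamma_principal 14"
 by (simp add: Gamma_principal_iff) (simp add: shiftm_def cong_0_iff)

interpretation iinf: ord_frame at_iinf "%z. ee (z / 14)" M14
 by (rule ord_frame_iinf)
   (use M14_subfield M14_const M14_qmero M14_iff shiftm_14 in auto)

abbreviation vinf :: "mero_uhp => int" where "vinf \<equiv> iinf.ord"

text \<open>The order at the cusp A(infinity), measured in q^(1/14). On smaller fields it may be a
  proper multiple of the normalised order.\<close>

definition vcusp :: "int ^ 2 ^ 2 => mero_uhp => int" where "vcusp A f = vinf (mslash f A)"

definition vpt :: "complex => mero_uhp => int" where
 "vpt p = ord_frame.ord (at p) (%z. z - p)"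

lemma valuation_vcusp:
 assumes A: "A : SL2Z"
 shows   "valuation_on M14 (vcusp A)"
 unfolding valuation_on_def vcusp_def
proof (intro conjI ballI impI allI)
 fix f g assume fg: "f : M14 - {0}" "g : M14 - {0}"
 hence *: "mslash f A : M14" "mslash f A ~= 0" "mslash g A : M14" "mslash g A ~= 0"
  using M14_slash[OF _ A] mslash_eq_0_iff[OF A] by auto
 show "vinf (mslash (f * g) A) = vinf (mslash f A) + vinf (mslash g A)"
  unfolding mslash_mult[OF A] by (rule iinf.ord_mult[OF *])
 assume "f + g ~= 0"
 hence "mslash f A + mslash g A ~= 0" using mslash_eq_0_iff[OF A, of "f + g"] mslash_add[OF A] by simp
 thus "min (vinf (mslash f A)) (vinf (mslash g A)) <= vinf (mslash (f + g) A)"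
  unfolding mslash_add[OF A] by (rule iinf.ord_add[OF *])
next
 fix c :: complex assume "c ~= 0"
 thus "vinf (mslash (cst c) A) = 0" unfolding mslash_const[OF A] by (rule iinf.ord_const)
qed

lemma valuation_vpt:
 assumes "p : \<H>"
 shows   "valuation_on UNIV (vpt p)"
 unfolding vpt_def by (rule ord_frame.valuation_ord[OF ord_frame_point[OF assms]])

section \<open>Calculus of valuations\<close>

lemma valuation_on_subset: "valuation_on K v ==> L <= K ==> valuation_on L v"
 by (simp add: valuation_on_def subset_iff)

lemma valuation_mult: "valuation_on K v ==> f : K ==> f ~= 0 ==> g : K ==> g ~= 0 ==> v (f * g) = v f + v g"
 and valuation_add: "valuation_on K v ==> f : K ==> f ~= 0 ==> g : K ==> g ~= 0 ==> f + g ~= 0 ==> min (v f) (v g) <= v (f + g)"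
 and valuation_const: "valuation_on K v ==> c ~= 0 ==> v (cst c) = 0"
 by (simp_all add: valuation_on_def)

lemma valuation_1: "valuation_on K v ==> v 1 = 0"
 using valuation_const[of K v 1] by simp

lemma valuation_power:
 assumes "valuation_on K v" "is_subfield K" "f : K" "f ~= 0"
 shows   "v (f ^ n) = int n * v f"
 using assms by (induction n) (auto simp: valuation_1 valuation_mult is_subfieldD algebra_simps)

lemma valuation_inverse:
 assumes "valuation_on K v" "is_subfield K" "f : K" "f ~= 0"
 shows   "v (inverse f) = - v f"
 using valuation_mult[OF assms(1,3,4), of "inverse f"] assms by (simp add: is_subfieldD valuation_1)

lemma valuation_divide:
 assumes "valuation_on K v" "is_subfield K" "f : K" "f ~= 0" "g : K" "g ~= 0"
 shows   "v (f / g) = v f - v g"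
 using valuation_mult[OF assms(1,3,4), of "inverse g"] valuation_inverse[OF assms(1,2,5,6)] assms
 by (simp add: is_subfieldD divide_inverse)

lemma valuation_minus:
 assumes "valuation_on K v" "is_subfield K" "f : K" "f ~= 0" "range cst <= K"
 shows   "v (- f) = v f"
 using valuation_mult[OF assms(1) _ _ assms(3,4), of "cst (- 1)"] valuation_const[OF assms(1), of "- 1"]
  is_subfieldD(5)[OF assms(2) is_subfieldD(2)[OF assms(2)]]
 by (simp add: const_mero_minus)

lemma valuation_add_eq:
 assumes v: "valuation_on K v" "is_subfield K" "range cst <= K"
  and f: "f : K" "f ~= 0" and g: "g : K" "g = 0 \<or> v f < v g"
 shows   "f + g ~= 0" "v (f + g) = v f"
proof -
 show nz: "f + g ~= 0"
 proof
  assume "f + g = 0"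
  hence "g = - f" "g ~= 0" using f by (auto simp: add_eq_0_iff)
  thus False using g(2) valuation_minus[OF v(1,2) f v(3)] by simp
 qed
 show "v (f + g) = v f"
 proof (cases "g = 0")
  case False
  have "v f <= v (f + g)" using valuation_add[OF v(1) f g(1) False nz] g(2) False by simp
  moreover have "min (v (f + g)) (v (- g)) <= v f"
   using valuation_add[OF v(1) is_subfieldD(3)[OF v(2) f(1) g(1)] nz is_subfieldD(5)[OF v(2) g(1)]] False f by simp
  ultimately show ?thesis using valuation_minus[OF v(1,2) g(1) False v(3)] g(2) False by simp
 qed simp
qed

lemma valuation_sum_ge:
 assumes v: "valuation_on K v" "is_subfield K"
  and f: "!!i. i : I ==> f i : K & (f i = 0 \<or> n <= v (f i))"
 shows   "sum f I = 0 \<or> n <= v (sum f I)"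
 using f
proof (induction I rule: infinite_finite_induct)
 case (insert i I)
 have "sum f I : K" using insert.prems v(2) by (intro is_subfieldD) auto
 thus ?case using insert insert.prems[of i] valuation_add[OF v(1), of "f i" "sum f I"] by (cases "f i = 0"; cases "sum f I = 0"; cases "f i + sum f I = 0") auto
qed auto

text \<open>With pairwise different values, a strictly least term dominates the sum.\<close>

lemma valuation_sum_distinct:
 assumes v: "valuation_on K v" "is_subfield K" "range cst <= K"
  and I: "finite I" "!!i. i : I ==> f i : K" "EX i:I. f i ~= 0"
  and inj: "!!i j. i : I ==> j : I ==> f i ~= 0 ==> f j ~= 0 ==> v (f i) = v (f j) ==> i = j"
 shows   "sum f I ~= 0" "EX i:I. f i ~= 0 & v (sum f I) = v (f i) & (ALL j:I. f j ~= 0 --> v (f i) <= v (f j))"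
proof -
 define J where "J = {i : I. f i ~= 0}"
 have J: "finite J" "J ~= {}" using I by (auto simp: J_def)
 obtain i where i: "i : J" "!!j. j : J ==> v (f i) <= v (f j)"
  using arg_min_if_finite(1)[OF J, of "%i. v (f i)"] arg_min_least[OF J, of _ "%i. v (f i)"] by blast
 have sumJ: "sum f I = f i + sum f (J - {i})"
 proof -
  have "sum f I = sum f J" unfolding J_def using I(1) by (intro sum.mono_neutral_right) auto
  also have "\<dots> = f i + sum f (J - {i})" using J i by (simp add: sum.remove)
  finally show ?thesis .
 qed
 have "sum f (J - {i}) = 0 \<or> v (f i) + 1 <= v (sum f (J - {i}))"
 proof (rule valuation_sum_ge[OF v(1,2)])
  fix j assume "j : J - {i}"
  hence j: "j : I" "f j ~= 0" "j ~= i" "j : J" by (auto simp: J_def)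
  moreover have "v (f i) ~= v (f j)" using inj[of i j] j i by (auto simp: J_def)
  ultimately show "f j : K & (f j = 0 \<or> v (f i) + 1 <= v (f j))" using i(2)[of j] I(2) by fastforce
 qed
 hence *: "sum f (J - {i}) = 0 \<or> v (f i) < v (sum f (J - {i}))" by auto
 have iI: "f i : K" "f i ~= 0" "i : I" using i I by (auto simp: J_def)
 have sK: "sum f (J - {i}) : K" using I(2) v(2) by (intro is_subfieldD) (auto simp: J_def)
 show "sum f I ~= 0" unfolding sumJ by (rule valuation_add_eq(1)[OF v iI(1,2) sK *])
 have "v (sum f I) = v (f i)" unfolding sumJ by (rule valuation_add_eq(2)[OF v iI(1,2) sK *])
 thus "EX i:I. f i ~= 0 & v (sum f I) = v (f i) & (ALL j:I. f j ~= 0 --> v (f i) <= v (f j))"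
  using i(2) iI unfolding J_def by auto
qed

lemma vpt_nonneg_iff_analytic:
 assumes p: "p : \<H>" and f: "f ~= 0"
 shows   "0 <= vpt p f \<longleftrightarrow> evm f analytic_on {p}"
proof
 interpret ord_frame "at p" "%z. z - p" UNIV by (rule ord_frame_point[OF p])
 assume "0 <= vpt p f"
 then obtain c where "((%z. evm f z * (z - p) powi (- 0)) ---> c) (at p)"
  using ord_ge_tendsto[of f 0] by (auto simp: vpt_def)
 hence lim: "(evm f ---> c) (at p)" by simp
 hence "~ is_pole (evm f) p" using not_tendsto_and_filterlim_at_infinity[of "at p"] by (auto simp: is_pole_def)
 thus "evm f analytic_on {p}"
  using nicely_meromorphic_on_imp_analytic_at[OF eval_mero_nicely_meromorphic p] by blast
next
 interpret ord_frame "at p" "%z. z - p" UNIV by (rule ord_frame_point[OF p])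
 assume "evm f analytic_on {p}"
 hence "(evm f ---> evm f p) (at p)" using analytic_at_imp_isCont isContD by blast
 hence "((%z. evm f z * (z - p) powi (- 0)) ---> evm f p) (at p)" by simp
 thus "0 <= vpt p f" unfolding vpt_def using ord_geI(1)[OF UNIV_I f] by blast
qed

lemma vpt_pos_if_zero:
 assumes p: "p : \<H>" and f: "f ~= 0" and "evm f analytic_on {p}" "evm f p = 0"
 shows   "0 < vpt p f"
proof -
 interpret ord_frame "at p" "%z. z - p" UNIV by (rule ord_frame_point[OF p])
 have "(evm f ---> evm f p) (at p)" using assms(3) analytic_at_imp_isCont isContD by blast
 hence "((%z. evm f z * (z - p) powi (- 0)) ---> 0) (at p)" using assms(4) by simp
 thus ?thesis unfolding vpt_def using ord_geI(2)[OF UNIV_I f] by blast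
qed

text \<open>Since A z - A p = (z - p) / (j(z) j(p)), the local parameters at p and A p differ by a
  nonvanishing factor.\<close>

lemma vpt_slash:
 assumes A: "A : SL2Z" and p: "p : \<H>" and f: "f ~= 0"
 shows   "vpt p (mslash f A) = vpt (moebius A p) f"
proof -
 interpret A: ord_frame "at (moebius A p)" "%z. z - moebius A p" UNIV by (rule ord_frame_point[OF moebius_in_uhp[OF A p]])
 interpret p: ord_frame "at p" "%z. z - p" UNIV by (rule ord_frame_point[OF p])
 define n where "n = vpt (moebius A p) f"
 obtain c where c: "c ~= 0" "((%z. evm f z * (z - moebius A p) powi (- n)) ---> c) (at (moebius A p))"
  using A.ord_limit[OF UNIV_I f] unfolding n_def vpt_def by metis
 define j where "j = (%z. of_int (A $ 2 $ 1) * z + of_int (A $ 2 $ 2) :: complex)"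
 have j: "j z ~= 0" if "z : \<H>" for z
  using uhp_moebius(1)[OF that, of "A $ 1 $ 1" "A $ 2 $ 2" "A $ 1 $ 2" "A $ 2 $ 1"] A by (auto simp: SL2Z_det j_def)
 have diff: "moebius A z - moebius A p = (z - p) / (j z * j p)" if z: "z : \<H>" for z
 proof -
  have det: "of_int (A $ 1 $ 1) * of_int (A $ 2 $ 2) - of_int (A $ 1 $ 2) * of_int (A $ 2 $ 1) = (1 :: complex)"
   using A unfolding SL2Z_det by (metis of_int_1 of_int_diff of_int_mult)
  have "(moebius A z - moebius A p) * (j z * j p) = (of_int (A $ 1 $ 1) * of_int (A $ 2 $ 2) - of_int (A $ 1 $ 2) * of_int (A $ 2 $ 1)) * (z - p)"
  proof -
   have "moebius A z * (j z * j p) = (of_int (A $ 1 $ 1) * z + of_int (A $ 1 $ 2)) * j p"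
    using j[OF z] unfolding moebius_def j_def by simp
   moreover have "moebius A p * (j z * j p) = (of_int (A $ 1 $ 1) * p + of_int (A $ 1 $ 2)) * j z"
    using j[OF p] unfolding moebius_def j_def by simp
   ultimately show ?thesis unfolding left_diff_distrib by (simp add: j_def algebra_simps)
  qed
  thus ?thesis using j[OF z] j[OF p] det by (simp add: nonzero_eq_divide_eq)
 qed
 have "isCont j p" by (auto simp: j_def intro!: continuous_intros)
 hence "(j ---> j p) (at p)" by (simp add: isCont_def)
 hence "((%z. (j z * j p) powi (- n)) ---> (j p * j p) powi (- n)) (at p)"
  using j[OF p] by (intro tendsto_intros) auto
 moreover have "((%z. evm f (moebius A z) * (moebius A z - moebius A p) powi (- n)) ---> c) (at p)"
  by (rule filterlim_compose[OF c(2) filtermap_moebius_at[OF A p]])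
 ultimately have "((%z. (evm f (moebius A z) * (moebius A z - moebius A p) powi (- n)) * (j z * j p) powi (- n)) ---> c * (j p * j p) powi (- n)) (at p)"
  by (rule tendsto_mult[rotated])
 moreover have "eventually (%z. (evm f (moebius A z) * (moebius A z - moebius A p) powi (- n)) * (j z * j p) powi (- n) =
   evm (mslash f A) z * (z - p) powi (- n)) (at p)"
  using eventually_at_in_open'[OF open_upper_half_plane p] eventually_neq_at_within[of p p UNIV]
 proof eventually_elim
  case (elim z)
  hence "((z - p) / (j z * j p)) powi (- n) * (j z * j p) powi (- n) = (z - p) powi (- n)"
   using j[of z] j[OF p] by (simp add: power_int_mult_distrib[symmetric])
  thus ?case using elim by (simp only: eval_mslash[OF A] diff mult.assoc)
 qed
 ultimately have "((%z. evm (mslash f A) z * (z - p) powi (- n)) ---> c * (j p * j p) powi (- n)) (at p)"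
  by (rule Lim_transform_eventually)
 hence "p.ord (mslash f A) = n" by (rule p.ord_eqI) (use c j[OF p] in auto)
 thus ?thesis by (simp add: vpt_def n_def)
qed

text \<open>Matrices with the same entries modulo 14 differ by a left factor from Gamma(14), so
  there are only finitely many values.\<close>

lemma finite_SL2Z_image:
 fixes \<phi> :: "int ^ 2 ^ 2 => 'a"
 assumes "!!A B. A : SL2Z ==> B : Gamma_principal 14 ==> \<phi> (B ** A) = \<phi> A"
 shows   "finite (\<phi> ` SL2Z)"
proof -
 define key where "key = (%A :: int ^ 2 ^ 2. (A $ 1 $ 1 mod 14, A $ 1 $ 2 mod 14, A $ 2 $ 1 mod 14, A $ 2 $ 2 mod 14))"
 have "finite (key ` SL2Z)"
  by (rule finite_subset[of _ "{0..<14} \<times> {0..<14} \<times> {0..<14} \<times> {0..<14}"]) (auto simp: key_def)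
 moreover have "\<phi> ` SL2Z <= (%k. \<phi> (SOME A. A : SL2Z & key A = k)) ` (key ` SL2Z)"
 proof safe
  fix A :: "int ^ 2 ^ 2" assume A: "A : SL2Z"
  define B where "B = (SOME B. B : SL2Z & key B = key A)"
  have B: "B : SL2Z" "key B = key A" using someI[of "%B. B : SL2Z & key B = key A" A] A by (auto simp: B_def)
  have *: "[A $ 1 $ 1 = B $ 1 $ 1] (mod int 14)" "[A $ 1 $ 2 = B $ 1 $ 2] (mod int 14)" "[A $ 2 $ 1 = B $ 2 $ 1] (mod int 14)" "[A $ 2 $ 2 = B $ 2 $ 2] (mod int 14)"
   using B(2) by (simp_all add: key_def Cong.cong_def)
  have "\<phi> A = \<phi> ((A ** adj2 B) ** B)" by (simp only: Gamma_principal_cosets(2)[OF A B(1) *])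
  also have "\<dots> = \<phi> B" by (rule assms[OF B(1) Gamma_principal_cosets(1)[OF A B(1) *]])
  finally show "\<phi> A : (%k. \<phi> (SOME A. A : SL2Z & key A = k)) ` (key ` SL2Z)" using A by (auto simp: B_def)
 qed
 ultimately show ?thesis by (rule finite_surj)
qed

lemma M14_slash_Gamma:
 assumes "f : M14" "A : SL2Z" "B : Gamma_principal 14"
 shows "mslash f (B ** A) = mslash f A"
proof -
 have B: "B : SL2Z" using assms(3) Gamma_principal_subset by blast
 have "mslash f (B ** A) = mslash (mslash f B) A" using assms B by (simp add: mslash_mslash)
 thus ?thesis using assms M14_iff by simp
qed

lemma finite_M14_orbit: "f : M14 ==> g : M14 ==> finite ((%A. (mslash f A, mslash g A)) ` SL2Z)"
 by (rule finite_SL2Z_image) (simp add: M14_slash_Gamma)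

text \<open>Dirichlet approximation takes the place of reduction theory. The height 1/5 is cruder
  than the classical bound, but it suffices to confine the low part of the domain to a compact
  set.\<close>

lemma fundamental_domain:
 assumes z: "z : \<H>"
 obtains A where "A : SL2Z" "Im (moebius A z) \<ge> 1 / 5" "\<bar>Re (moebius A z)\<bar> <= 1 / 2"
proof -
 have "EX A:SL2Z. Im (moebius A z) \<ge> 1 / 5"
 proof (cases "Im z \<ge> 1 / 5")
  case True
  thus ?thesis using SL2Z_one by (intro bexI[of _ "mat 1"]) auto
 next
  case False
  define y where "y = Im z"
  have y: "0 < y" "y < 1" using z False by (auto simp: y_def upper_half_plane_def)
  define s where "s = sqrt y"
  have s: "0 < s" "s <= 1" "s ^ 2 = y" using y by (auto simp: s_def)
  \<comment> \<open>\<open>N\<close> of size 1/sqrt y balances the two squares in |k z - h|^2: (k Re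
    z - h)^2 is at most y and (k y)^2 at most 4 y. The sum 5 y is the origin of 1/5.\<close>
  define N where "N = nat \<lceil>1 / s\<rceil>"
  have N1: "1 / s <= real N" unfolding N_def by (rule real_nat_ceiling_ge)
  have N0: "N > 0" using s by (simp add: N_def)
  have N2: "real N <= 1 / s + 1" using s by (simp add: N_def)
  hence N3: "real N <= 2 / s" using s by (simp add: field_simps)
  obtain h k where hk: "coprime h k" "0 < k" "k <= int N" "\<bar>of_int k * Re z - of_int h\<bar> < 1 / real N"
   using Dirichlet_approx_coprime[OF N0] by blast
  have "gcd k (- h) = 1" using hk(1) by (simp add: coprime_iff_gcd_eq_1 gcd.commute)
  then obtain p q where "p * k + q * (- h) = 1" using bezout_int[of k "- h"] by auto
  hence det: "q * (- h) - (- p) * k = 1" by simp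
  define A where "A = mat2 q (- p) k (- h)"
  have A: "A : SL2Z" using det by (simp add: A_def SL2Z_mat2)
  have "norm (of_int k * z + of_int (- h)) ^ 2 = (of_int k * Re z - of_int h) ^ 2 + (of_int k * y) ^ 2"
   by (simp add: cmod_power2 y_def)
  also have "\<dots> <= y + 4 * y"
  proof (rule add_mono)
   have "\<bar>of_int k * Re z - of_int h\<bar> <= s"
   proof -
    have "1 / real N <= s" using N1 N0 s by (simp add: field_simps)
    thus ?thesis using hk(4) by linarith
   qed
   thus "(of_int k * Re z - of_int h) ^ 2 <= y" using s(3) by (metis abs_ge_zero power2_abs power_mono)
   have "real_of_int k <= 2 / s" using hk(3) N3 by linarith
   hence "real_of_int k * y <= 2 / s * y" using y by (intro mult_right_mono) auto
   also have "2 / s * y = 2 * s" using s(1) by (simp add: s(3)[symmetric] power2_eq_square)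
   finally have "(real_of_int k * y) ^ 2 <= (2 * s) ^ 2" using hk(2) y by (intro power_mono) auto
   thus "(real_of_int k * y) ^ 2 <= 4 * y" by (simp add: power_mult_distrib s(3))
  qed
  finally have le: "norm (of_int k * z + of_int (- h)) ^ 2 <= 5 * y" by simp
  have nz: "of_int k * z + of_int (- h) ~= 0" by (rule uhp_moebius(1)[OF z det])
  have "Im (moebius A z) = y / norm (of_int k * z + of_int (- h)) ^ 2"
   unfolding moebius_def A_def mat2_nth y_def by (rule uhp_moebius(3)[OF z det])
  also have "\<dots> \<ge> y / (5 * y)" using le y nz by (intro divide_left_mono) auto
  finally show ?thesis using A y by auto
 qed
 then obtain A where A: "A : SL2Z" "Im (moebius A z) \<ge> 1 / 5" by blast
 define n where "n = - round (Re (moebius A z))"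
 have "moebius (shiftm n ** A) z = moebius A z + of_int n"
  by (simp add: moebius_mult[OF shiftm_SL2Z A(1) z])
 moreover have "\<bar>Re (moebius A z) + of_int n\<bar> <= 1 / 2"
  using of_int_round_abs_le[of "Re (moebius A z)"] by (simp add: n_def abs_minus_commute)
 ultimately show ?thesis using A by (intro that[of "shiftm n ** A"]) (auto simp: SL2Z_mult)
qed

lemma holomorphic_uhp_imp_analytic_at: "F holomorphic_on \<H> ==> z : \<H> ==> F analytic_on {z}"
 using analytic_on_open[OF open_upper_half_plane, of F] analytic_on_analytic_at[of F \<H>] by blast

lemma eval_mero_prod_holomorphic:
 assumes "finite I" "!!i. i : I ==> evm (f i) holomorphic_on \<H>" "z : \<H>"
 shows   "evm (prod f I) z = (\<Prod>i\<in>I. evm (f i) z)"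
 using assms
proof (induction I arbitrary: z rule: finite_induct)
 case empty
 thus ?case unfolding prod.empty one_mero_uhp_def eval_const_mero by simp
next
 case (insert i I)
 have "(%w. \<Prod>i\<in>I. evm (f i) w) holomorphic_on \<H>" using insert.prems by (intro holomorphic_intros) auto
 hence *: "(%w. evm (f i) w * (\<Prod>i\<in>I. evm (f i) w)) analytic_on {z}"
  using insert.prems(1)[of i] insert.prems(2) by (intro analytic_intros holomorphic_uhp_imp_analytic_at) auto
 have "eventually (%w. w : \<H>) (at z)" using insert.prems(2) by (intro eventually_at_in_open') auto
 hence "eventually (%w. evm (prod f (insert i I)) w = evm (f i) w * (\<Prod>i\<in>I. evm (f i) w)) (at z)"
  using eventually_eval_times_mero[OF insert.prems(2), of "f i" "prod f I"]
 proof eventually_elim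
  case (elim w)
  thus ?case using insert.hyps insert.IH[of w] insert.prems(1) by simp
 qed
 from eval_mero_eqI_analytic(1)[OF insert.prems(2) this *] show ?case using insert.hyps by simp
qed

lemma holomorphic_if_vpt_nonneg:
 assumes "f ~= 0" "!!p. p : \<H> ==> 0 <= vpt p f"
 shows   "evm f holomorphic_on \<H>"
 using assms vpt_nonneg_iff_analytic analytic_on_analytic_at analytic_imp_holomorphic by blast

text \<open>
  The product of the finitely many conjugates of \<open>g\<close> is invariant under \<open>SL\<^sub>2(\<int>)\<close> and vanishes at
  the cusp, so by the maximum modulus principle it vanishes identically.
\<close>

lemma no_regular_function_vanishing_at_iinf:
 assumes g: "g : M14" "g ~= 0" and pt: "!!p. p : \<H> ==> 0 <= vpt p g"
  and cusp: "!!A. A : SL2Z ==> 0 <= vcusp A g"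
 shows "vinf g <= 0"
proof (rule ccontr)
 assume "~ ?thesis"
 hence pos: "vinf g > 0" by simp
 define Orb where "Orb = mslash g ` SL2Z"
 have fin: "finite Orb" unfolding Orb_def by (rule finite_SL2Z_image) (use M14_slash_Gamma[OF g(1)] in auto)
 define N where "N = \<Prod>Orb"
 have Orb: "h : M14" "h ~= 0" "0 <= vinf h" if "h : Orb" for h
  using that g cusp M14_slash[OF g(1)] by (auto simp: Orb_def mslash_eq_0_iff vcusp_def)
 have gO: "g : Orb" unfolding Orb_def using mslash_one[of g] SL2Z_one by (metis imageI)
 have hol_g: "evm g holomorphic_on \<H>" by (rule holomorphic_if_vpt_nonneg[OF g(2) pt])
 have hol: "evm h holomorphic_on \<H>" if "h : Orb" for h
 proof (rule holomorphic_if_vpt_nonneg)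
  show "h ~= 0" by (rule Orb(2)[OF that])
  fix p assume p: "p : \<H>"
  from that obtain A where A: "A : SL2Z" "h = mslash g A" by (auto simp: Orb_def)
  show "0 <= vpt p h" unfolding A(2) vpt_slash[OF A(1) p g(2)] by (rule pt[OF moebius_in_uhp[OF A(1) p]])
 qed
 have evN: "evm N z = (\<Prod>h\<in>Orb. evm h z)" if "z : \<H>" for z
  unfolding N_def using eval_mero_prod_holomorphic[OF fin, of "%h. h" z] hol that by simp
 have "(%z. \<Prod>h\<in>Orb. evm h z) holomorphic_on \<H>" using hol by (intro holomorphic_intros)
 hence holN: "evm N holomorphic_on \<H>" by (rule holomorphic_transform) (simp add: evN)
 have N0: "N ~= 0" unfolding N_def using fin Orb by simp
 have inv: "mslash N A = N" if A: "A : SL2Z" for A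
 proof -
  have bij: "bij_betw (%h. mslash h A) Orb Orb"
  proof (rule bij_betwI[where g = "%h. mslash h (adj2 A)"])
   show "(%h. mslash h A) : Orb \<rightarrow> Orb" "(%h. mslash h (adj2 A)) : Orb \<rightarrow> Orb"
    using A adj2_SL2Z[OF A] by (auto simp: Orb_def mslash_mslash SL2Z_mult)
   show "mslash (mslash h A) (adj2 A) = h" "mslash (mslash h (adj2 A)) A = h" for h
    using A adj2_SL2Z[OF A] adj2_mult[OF A] by (simp_all add: mslash_mslash mslash_one)
  qed
  have "mslash N A = (\<Prod>h\<in>Orb. mslash h A)" unfolding N_def by (simp add: mslash_prod[OF A])
  also have "\<dots> = N" unfolding N_def using prod.reindex_bij_betw[OF bij, of "%h. h"] by simp
  finally show ?thesis .
 qed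
 have invz: "evm N (moebius A z) = evm N z" if "A : SL2Z" "z : \<H>" for A z
  using eval_mslash[OF that, of N] inv[OF that(1)] by simp
 have lim: "(evm N ---> 0) at_iinf"
 proof -
  have 1: "\<Prod>(Orb - {g}) : M14" "\<Prod>(Orb - {g}) ~= 0" using Orb fin by (auto intro!: M14_closed)
  have "0 <= vinf (\<Prod>H)" if "H <= Orb" for H
  proof -
   have "finite H" using that fin finite_subset by blast
   thus ?thesis using that
   proof (induction H rule: finite_induct)
    case (insert h H)
    have "\<Prod>H : M14" "\<Prod>H ~= 0" using insert Orb by (auto intro!: M14_closed)
    thus ?case using insert iinf.ord_mult[of h "\<Prod>H"] Orb[of h] by simp
   qed (use valuation_1[OF iinf.valuation_ord] in simp)
  qed
  hence vN: "vinf N > 0"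
   using iinf.ord_mult[OF g 1] pos fin gO unfolding N_def by (simp add: prod.remove[OF fin gO, of "%h. h"] add_pos_nonneg)
  have NM: "N : M14" unfolding N_def using Orb by (auto intro!: M14_closed)
  obtain c where "((%z. evm N z * ee (z / 14) powi (- vinf N)) ---> c) at_iinf"
   by (rule iinf.ord_limit[OF NM N0])
  from iinf.lower_order_tendsto_0[OF this vN] show ?thesis by simp
 qed
 obtain z1 where z1: "z1 : \<H>" "evm N z1 ~= 0"
 proof -
  have "eventually (%w. evm N w ~= 0 & w : \<H>) (at \<i>)"
   using eventually_eval_mero_nonzero[OF N0 ii_in_upper_half_plane] eventually_at_in_open'[OF open_upper_half_plane ii_in_upper_half_plane]
   by eventually_elim auto
  hence "frequently (%w. evm N w ~= 0 & w : \<H>) (at \<i>)" by (rule eventually_frequently[rotated]) simp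
  from frequently_ex[OF this] show ?thesis using that by blast
 qed
 \<comment> \<open>Beyond some height |N| stays below |N(z1)|. Every value of |N| is therefore taken
   on the compact set \<open>K\<close> or lies below one that is, so the maximum over
   \<open>K\<close> is global.\<close>
 have "eventually (%z. norm (evm N z) < norm (evm N z1)) at_iinf"
  using lim z1(2) unfolding tendsto_iff by (simp add: dist_norm)
 then obtain c0 where c0: "!!z. Im z > c0 ==> norm (evm N z) < norm (evm N z1)"
  unfolding eventually_at_iinf by blast
 define K where "K = cbox (Complex (- 1 / 2) (1 / 5)) (Complex (1 / 2) (max c0 1))"
 have K_iff: "z : K \<longleftrightarrow> \<bar>Re z\<bar> <= 1 / 2 & 1 / 5 <= Im z & Im z <= max c0 1" for z
  by (auto simp: K_def in_cbox_complex_iff)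
 have KH: "K <= \<H>" by (auto simp: K_iff upper_half_plane_def)
 have Kne: "K ~= {}" using K_iff[of \<i>] by auto
 have red: "EX w. norm (evm N w) = norm (evm N z) & w : \<H> & (w : K \<or> Im w > c0)" if z: "z : \<H>" for z
 proof -
  obtain A where A: "A : SL2Z" "Im (moebius A z) \<ge> 1 / 5" "\<bar>Re (moebius A z)\<bar> <= 1 / 2" using fundamental_domain[OF z] by metis
  show ?thesis using invz[OF A(1) z] A moebius_in_uhp[OF A(1) z] by (intro exI[of _ "moebius A z"]) (auto simp: K_iff)
 qed
 have "continuous_on K (%z. norm (evm N z))"
  by (intro continuous_intros holomorphic_on_imp_continuous_on holomorphic_on_subset[OF holN KH])
 then obtain w0 where w0: "w0 : K" "!!w. w : K ==> norm (evm N w) <= norm (evm N w0)"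
  using continuous_attains_sup[of K] Kne compact_cbox unfolding K_def by blast
 obtain w1 where w1: "norm (evm N w1) = norm (evm N z1)" "w1 : K \<or> Im w1 > c0" using red[OF z1(1)] by blast
 hence "w1 : K" using c0[of w1] by auto
 hence z1w0: "norm (evm N z1) <= norm (evm N w0)" using w0(2) w1(1) by metis
 have "evm N constant_on \<H>"
 proof (rule maximum_modulus_principle[OF holN open_upper_half_plane connected_upper_half_plane open_upper_half_plane subset_refl])
  show "w0 : \<H>" using w0 KH by blast
  fix z assume "z : \<H>"
  then obtain w where w: "norm (evm N w) = norm (evm N z)" "w : K \<or> Im w > c0" using red by blast
  thus "norm (evm N z) <= norm (evm N w0)"
   using w0(2)[of w] c0[of w] z1w0 by auto
 qed
 then obtain k where k: "!!z. z : \<H> ==> evm N z = k" unfolding constant_on_def by blast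
 define w where "w = \<i> * of_real (max c0 0 + 1)"
 have "norm (evm N w) < norm (evm N z1)" by (rule c0) (simp add: w_def)
 moreover have "w : \<H>" by (simp add: w_def upper_half_plane_def)
 ultimately show False using k z1(1) by simp
qed

section \<open>Expansions at the cusps\<close>

lemma mero_of_add:
 assumes "f meromorphic_on \<H>" "g meromorphic_on \<H>"
 shows   "mero_of (%z. f z + g z) = mero_of f + mero_of g"
proof (rule mero_uhp_eqI)
 fix z assume z: "z : \<H>"
 have "(%z. f z + g z) meromorphic_on \<H>" using assms by (intro meromorphic_intros)
 from eventually_eval_mero_of[OF this z] eventually_eval_mero_of[OF assms(1) z] eventually_eval_mero_of[OF assms(2) z]
  eventually_eval_plus_mero[OF z, of "mero_of f" "mero_of g"]
 show "eventually (%w. evm (mero_of (%z. f z + g z)) w = evm (mero_of f + mero_of g) w) (at z)"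
  by eventually_elim simp
qed

lemma mero_of_mult:
 assumes "f meromorphic_on \<H>" "g meromorphic_on \<H>"
 shows   "mero_of (%z. f z * g z) = mero_of f * mero_of g"
proof (rule mero_uhp_eqI)
 fix z assume z: "z : \<H>"
 have "(%z. f z * g z) meromorphic_on \<H>" using assms by (intro meromorphic_intros)
 from eventually_eval_mero_of[OF this z] eventually_eval_mero_of[OF assms(1) z] eventually_eval_mero_of[OF assms(2) z]
  eventually_eval_times_mero[OF z, of "mero_of f" "mero_of g"]
 show "eventually (%w. evm (mero_of (%z. f z * g z)) w = evm (mero_of f * mero_of g) w) (at z)"
  by eventually_elim simp
qed

lemma mero_of_power:
 assumes "f meromorphic_on \<H>"
 shows   "mero_of (%z. f z ^ n) = mero_of f ^ n"
proof (induction n)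
 case 0
 thus ?case by (simp add: const_mero_def[symmetric])
next
 case (Suc n)
 have "(%z. f z ^ n) meromorphic_on \<H>" using assms by (intro meromorphic_intros)
 from mero_of_mult[OF assms this] Suc show ?case by simp
qed

lemma mero_of_cong: "(!!z. z : \<H> ==> f z = g z) ==> f holomorphic_on \<H> ==> g holomorphic_on \<H> ==> mero_of f = mero_of g"
 by (rule eval_mero_ext) (simp add: eval_mero_of_holomorphic)

lemma holomorphic_imp_meromorphic_uhp: "f holomorphic_on \<H> ==> f meromorphic_on \<H>"
 using analytic_on_open[OF open_upper_half_plane] analytic_on_imp_meromorphic_on by blast

lemmas ups_mero = holomorphic_imp_meromorphic_uhp[OF upsf_holomorphic]
lemmas psi_mero = holomorphic_imp_meromorphic_uhp[OF psi_fun_holomorphic]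
lemmas Delta_mero = holomorphic_imp_meromorphic_uhp[OF Delta_fun_holomorphic]

lemma mero_of_shift_const: "f meromorphic_on \<H> ==> mero_of (%z. f z - c) = mero_of f - cst c"
 using mero_of_add[of f "%_. - c", OF _ meromorphic_on_const] by (simp add: const_mero_def[symmetric] const_mero_minus)

lemma upsilon7_nz: "ups7 ~= 0" "ups7 ~= 1"
proof -
 show "ups7 ~= 0"
 proof
  assume "ups7 = 0"
  hence "evm ups7 \<i> = evm (cst 0) \<i>" by simp
  thus False using upsf_neq(1)[of \<i>] unfolding eval_const_mero by (simp add: eval_upsilon7)
 qed
 show "ups7 ~= 1"
 proof
  assume "ups7 = 1"
  hence "evm ups7 \<i> = evm (cst 1) \<i>" by simp
  thus False using upsf_neq(2)[of \<i>] unfolding eval_const_mero by (simp add: eval_upsilon7)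
 qed
qed

lemma psi7_power_7: "psi7 ^ 7 = ups7 ^ 4 * (ups7 - 1)"
proof -
 have "psi7 ^ 7 = mero_of (%z. psi_fun z ^ 7)" unfolding psi7_conv by (rule mero_of_power[symmetric, OF psi_mero])
 also have "\<dots> = mero_of (%z. upsf z ^ 4 * (upsf z - 1))"
  by (rule mero_of_cong) (auto intro!: holomorphic_intros upsf_holomorphic psi_fun_holomorphic simp: psi_fun_7)
 also have "\<dots> = ups7 ^ 4 * (ups7 - 1)"
  unfolding upsilon7_conv using ups_mero
  by (subst mero_of_mult) (auto intro!: meromorphic_intros simp: mero_of_power mero_of_shift_const)
 finally show ?thesis .
qed

definition Delta7 :: mero_uhp where "Delta7 = mero_of Delta_fun"

lemma eval_Delta7: "z : \<H> ==> evm Delta7 z = Delta_fun z"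
 by (simp add: Delta7_def eval_mero_of_holomorphic Delta_fun_holomorphic)

lemma Delta7_square:
 "Delta7 ^ 2 = 4 * ((ups7 - 1) ^ 3 * (ups7 ^ 3 - 8 * ups7 ^ 2 + 5 * ups7 + 1) / ups7 ^ 3)"
proof -
 let ?u = upsf
 have m: "(%z. ?u z - 1) meromorphic_on \<H>" "(%z. ?u z ^ 3) meromorphic_on \<H>" "(%z. ?u z ^ 2) meromorphic_on \<H>"
  using ups_mero by (auto intro!: meromorphic_intros)
 have c: "cst (- 8) = - 8" "cst 5 = 5"
  using const_mero_numeral[of "num.Bit0 (num.Bit0 (num.Bit0 num.One))"] const_mero_numeral[of "num.Bit1 (num.Bit0 num.One)"]
  by (simp_all add: const_mero_minus)
 have "Delta7 ^ 2 * ups7 ^ 3 = mero_of (%z. Delta_fun z ^ 2 * ?u z ^ 3)"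
  unfolding Delta7_def upsilon7_conv using Delta_mero ups_mero
  by (subst mero_of_mult) (auto intro!: meromorphic_intros simp: mero_of_power)
 also have "\<dots> = mero_of (%z. 4 * ((?u z - 1) ^ 3 * (?u z ^ 3 + (- 8) * ?u z ^ 2 + 5 * ?u z + 1)))"
  by (rule mero_of_cong) (auto intro!: holomorphic_intros upsf_holomorphic Delta_fun_holomorphic simp: Delta_fun_square upsf_neq)
 also have "\<dots> = cst 4 * (mero_of (%z. (?u z - 1) ^ 3) * mero_of (%z. ?u z ^ 3 + (- 8) * ?u z ^ 2 + 5 * ?u z + 1))"
  unfolding const_mero_def using m ups_mero
  by (subst mero_of_mult, (auto intro!: meromorphic_intros)[2])+ (rule refl)
 also have "mero_of (%z. (?u z - 1) ^ 3) = (ups7 - 1) ^ 3"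
  unfolding upsilon7_conv using ups_mero m by (simp add: mero_of_power mero_of_shift_const)
 also have "mero_of (%z. ?u z ^ 3 + (- 8) * ?u z ^ 2 + 5 * ?u z + 1) = mero_of (%z. ?u z ^ 3) + cst (- 8) * mero_of (%z. ?u z ^ 2) + cst 5 * mero_of ?u + cst 1"
  unfolding const_mero_def using m ups_mero
  by (subst mero_of_add, (auto intro!: meromorphic_intros)[2])+
    ((subst mero_of_mult, (auto intro!: meromorphic_intros)[2])+, rule refl)
 also have "mero_of (%z. ?u z ^ 3) = ups7 ^ 3" unfolding upsilon7_conv using ups_mero by (simp add: mero_of_power)
 also have "mero_of (%z. ?u z ^ 2) = ups7 ^ 2" unfolding upsilon7_conv using ups_mero by (simp add: mero_of_power)
 finally have "Delta7 ^ 2 * ups7 ^ 3 = 4 * ((ups7 - 1) ^ 3 * (ups7 ^ 3 - 8 * ups7 ^ 2 + 5 * ups7 + 1))"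
  unfolding c upsilon7_conv[symmetric] const_mero_numeral by simp
 thus ?thesis using upsilon7_nz(1) by (simp add: nonzero_eq_divide_eq)
qed

text \<open>The expansion of \<open>skl (7 * T) (int k)\<close> in t = q without its leading power
  of q and without the factors common to all k.\<close>

definition Rk :: "nat => complex => complex" where
 "Rk k t = (1 - t ^ k) * qpoch (t ^ (7 + k)) (t ^ 7) * qpoch (t ^ (7 - k)) (t ^ 7)"

lemma Rk_analytic: "Rk k analytic_on {0}"
proof -
 have "Rk k holomorphic_on ball 0 1" unfolding Rk_def
  by (intro holomorphic_intros qpoch_holomorphic) (auto simp: norm_power power_less_one_iff)
 thus ?thesis using analytic_at_ball[of "Rk k" 0] by (meson centre_in_ball open_ball analytic_at zero_less_one)
qed

lemma Rk_0: "0 < k ==> k < 7 ==> Rk k 0 = 1"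
 by (simp add: Rk_def power_0_left)

lemma skl_7_Rk:
 assumes "k < 7"
 shows "skl (7 * T) (int k) = ee ((of_nat k ^ 2 / 14 - of_nat k / 2) * T) * (Rk k (ee T) / (- (2 * of_real pi * \<i>) * qpoch (ee (7 * T)) (ee (7 * T)) ^ 2))"
proof -
 have p: "ee T ^ n = ee (of_nat n * T)" for n by (simp add: ee_of_nat_mult)
 have 7: "of_nat (7 - k) = (7 - of_nat k :: complex)" using assms by (simp add: of_nat_diff)
 have e: "ee (of_nat k ^ 2 * (7 * T) / 98) * ee (- (of_nat k * (7 * T) / 7) / 2) = ee ((of_nat k ^ 2 / 14 - of_nat k / 2) * T)"
  unfolding ee_add[symmetric] by (rule arg_cong[of _ _ ee]) (simp add: field_simps)
 have "skl (7 * T) (int k) = (ee (of_nat k ^ 2 * (7 * T) / 98) * ee (- (of_nat k * (7 * T) / 7) / 2)) * (Rk k (ee T) / (- (2 * of_real pi * \<i>) * qpoch (ee (7 * T)) (ee (7 * T)) ^ 2))"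
  unfolding skl_def sig_def Rk_def p 7 by (simp add: algebra_simps)
 thus ?thesis unfolding e .
qed

definition Uq :: "complex => complex" where "Uq t = Rk 2 t ^ 2 * Rk 3 t / Rk 1 t ^ 3"

lemma Uq_analytic: "Uq analytic_on {0}"
 unfolding Uq_def by (intro analytic_intros Rk_analytic) (simp add: Rk_0)

lemma Uq_0: "Uq 0 = 1"
 by (simp add: Uq_def Rk_0)

text \<open>The leading exponents 2 (4/14 - 1) + (9/14 - 3/2) - 3 (1/14 - 1/2) add up to -1: a
  simple pole in q.\<close>

lemma upsf_Uq:
 assumes "T : \<H>"
 shows   "upsf T = Uq (ee T) / ee T"
proof -
 define C where "C = - (2 * of_real pi * \<i>) * qpoch (ee (7 * T)) (ee (7 * T)) ^ 2"
 have C: "C ~= 0" using qpoch_ee_nonzero[OF mult_7_in_uhp[OF assms]] by (simp add: C_def)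
 have s: "skl (7 * T) 1 = ee ((1 / 14 - 1 / 2) * T) * (Rk 1 (ee T) / C)"
  "skl (7 * T) 2 = ee ((4 / 14 - 1) * T) * (Rk 2 (ee T) / C)"
  "skl (7 * T) 3 = ee ((9 / 14 - 3 / 2) * T) * (Rk 3 (ee T) / C)"
  using skl_7_Rk[of 1 T] skl_7_Rk[of 2 T] skl_7_Rk[of 3 T] unfolding C_def[symmetric] by simp_all
 have e: "ee ((4 / 14 - 1) * T) ^ 2 * ee ((9 / 14 - 3 / 2) * T) = ee ((1 / 14 - 1 / 2) * T) ^ 3 / ee T"
  unfolding ee_of_nat_mult[symmetric] ee_add[symmetric] ee_diff[symmetric] by (rule arg_cong[of _ _ ee]) (simp add: field_simps)
 have "upsf T = (ee ((4 / 14 - 1) * T) ^ 2 * ee ((9 / 14 - 3 / 2) * T)) / ee ((1 / 14 - 1 / 2) * T) ^ 3 * Uq (ee T)"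
  unfolding upsf_def ups_def s Uq_def using C by (simp add: power_mult_distrib power_divide power2_eq_square power3_eq_cube mult_ac)
 thus ?thesis unfolding e by simp
qed

lemma qmero_upsilon7: "qmero ups7"
 unfolding qmero_def
proof (intro exI conjI allI impI)
 show "(%t. Uq t / t) meromorphic_on {0}" using Uq_analytic by (intro meromorphic_intros analytic_on_imp_meromorphic_on)
 show "evm ups7 z = Uq (ee (z / of_nat 1)) / ee (z / of_nat 1)" if "Im z > 0" for z
  using that upsf_Uq[of z] by (simp add: eval_upsilon7 upper_half_plane_def)
qed simp

text \<open>\<open>sig\<close> with its nome as a free variable, so that it can be evaluated at the
  cusp q = 0.\<close>

definition sigq :: "complex => complex => complex" where
 "sigq q z = ee (- z / 2) * (1 - ee z) * qpoch (q * ee z) q * qpoch (q * ee (- z)) q / (- (2 * of_real pi * \<i>) * qpoch q q ^ 2)"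

lemma sig_sigq: "sig T z = sigq (ee T) z"
 unfolding sig_def sigq_def ee_add ee_diff ee_minus divide_inverse by (rule refl)

lemma sigq_analytic: "(%q. sigq q z) analytic_on {0}"
proof -
 have *: "(%q. qpoch (q * c) q) analytic_on {0}" for c
 proof -
  have "(%q. qpoch (q * c) q) holomorphic_on ball 0 1" by (intro qpoch_holomorphic holomorphic_intros) auto
  thus ?thesis by (meson centre_in_ball open_ball analytic_at zero_less_one)
 qed
 show ?thesis unfolding sigq_def using *[of "ee z"] *[of "ee (- z)"] *[of 1] by (intro analytic_intros) auto
qed

lemma sigq_0_nonzero:
 assumes "r ~: \<int>"
 shows   "sigq 0 (of_real r) ~= 0"
proof -
 have "ee (of_real r) ~= 1"
 proof
  assume "ee (of_real r) = 1"
  then obtain n :: int where "of_real r = (of_int n :: complex)" using ee_eq_1_iff by blast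
  hence "r = of_int n" by (metis of_real_eq_iff of_real_of_int_eq)
  thus False using assms by simp
 qed
 thus ?thesis by (simp add: sigq_def)
qed

text \<open>If 7 does not divide c, then 7 A(z) is a unimodular image of t = (z + j)/7 for a
  suitable integer j. The division points become real numbers k b'/7, which are not integers; there
  the sigma values are analytic and nonzero at q = 0, so upsilon stays finite at the cusp.\<close>

lemma upsilon_non_Gamma0:
 fixes A :: "int ^ 2 ^ 2"
 assumes A: "A : SL2Z" "~ 7 dvd A $ 2 $ 1"
 obtains g where "g analytic_on {0}" "!!z. z : \<H> ==> evm (mslash ups7 A) z = g (ee (z / 7))"
proof -
 define a b c d where "a = A $ 1 $ 1" "b = A $ 1 $ 2" "c = A $ 2 $ 1" "d = A $ 2 $ 2"
 note abcd = this
 have det: "a * d - b * c = 1" using A(1) by (simp add: SL2Z_det abcd)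
 have "prime (7::int)" by (simp add: prime_int_numeral_eq)
 hence "coprime c 7" using A(2) prime_imp_coprime[of 7 c] by (simp add: abcd coprime_commute)
 then obtain x where x: "[c * x = 1] (mod 7)" using cong_solve_coprime_int by blast
 \<comment> \<open>\<open>x\<close> inverts c modulo 7, so this \<open>j\<close> makes d - c j
   divisible by 7.\<close>
 define j where "j = d * x"
 have "[c * x * d = 1 * d] (mod 7)" by (intro cong_mult x cong_refl)
 hence "7 dvd (d - c * j)" by (simp add: j_def cong_iff_dvd_diff mult_ac dvd_diff_commute)
 then obtain d' where d': "d - c * j = 7 * d'" by auto
 define b' where "b' = b - a * j"
 have det': "(7 * a) * d' - b' * c = 1"
 proof -
  have "(7 * a) * d' - b' * c = a * (d - c * j) - (b - a * j) * c" unfolding d' b'_def by simp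
  thus ?thesis using det by (simp add: algebra_simps)
 qed
 have nb: "~ 7 dvd k * b'" if "~ 7 dvd k" for k
 proof
  assume "7 dvd k * b'"
  hence "7 dvd b'" using \<open>prime (7::int)\<close> that prime_dvd_mult_iff by blast
  hence "7 dvd (7 * a) * d' - b' * c" by (intro dvd_diff) (auto simp: mult.assoc)
  thus False using det' by simp
 qed
 define r where "r = (%k::int. real_of_int (k * b') / 7)"
 have rZ: "r k ~: \<int>" if "~ 7 dvd k" for k
  unfolding r_def by (rule not_in_Ints_divide_7[OF nb[OF that]])
 define pq where "pq = (%k l q. sigq q (of_real (r (k + l))) * sigq q (of_real (r (k - l))) / (sigq q (of_real (r k)) ^ 2 * sigq q (of_real (r l)) ^ 2))"
 define H where "H = (%q. pq 1 3 q / pq 2 3 q)"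
 define \<zeta> where "\<zeta> = ee (of_int j / 7)"
 have nz: "sigq 0 (of_real (r k)) ~= 0" if "~ 7 dvd k" for k by (rule sigq_0_nonzero[OF rZ[OF that]])
 have "H analytic_on {0}"
  unfolding H_def pq_def by (intro analytic_intros sigq_analytic) (use nz[of 1] nz[of 2] nz[of 3] nz[of 5] nz[of "- 1"] in auto)
 hence an: "(%t. H (\<zeta> * t)) analytic_on {0}"
  using analytic_on_compose_gen[of "%t. \<zeta> * t" "{0}" H "{0}"] by (auto simp: o_def intro!: analytic_intros)
 have "evm (mslash ups7 A) z = H (\<zeta> * ee (z / 7))" if z: "z : \<H>" for z
 proof -
  define t where "t = (z + of_int j) / 7"
  have t: "t : \<H>" using z by (simp add: t_def upper_half_plane_def)
  have et: "ee t = \<zeta> * ee (z / 7)" by (simp add: t_def \<zeta>_def add_divide_distrib ee_add mult.commute)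
  define w where "w = of_int (7 * a) * t + of_int b'"
  define J where "J = of_int c * t + of_int d'"
  have J: "J ~= 0" using uhp_moebius(1)[OF t det'] by (simp add: J_def)
  have cJ: "of_int c * z + of_int d = 7 * J"
  proof -
   have "of_int d = (7 * of_int d' + of_int c * of_int j :: complex)"
    using arg_cong[OF d', of "of_int :: int => complex"] by (simp add: algebra_simps)
   thus ?thesis by (simp add: J_def t_def algebra_simps)
  qed
  have aw: "of_int a * z + of_int b = w" by (simp add: w_def t_def b'_def algebra_simps)
  have m: "moebius A z = w / (7 * J)"
   unfolding moebius_def abcd[symmetric] cJ aw ..
  have P: "P7 (moebius A z) k l = J ^ 2 * pE t (of_real (r k)) (of_real (r l))" for k l
  proof -
   have k: "of_int k * moebius A z = (of_real (r k) + of_int 0 + of_int (k * a) * t) / J" for k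
    unfolding m w_def r_def using J by (simp add: field_simps)
   have "7 * moebius A z = w / J" unfolding m using J by simp
   hence "P7 (moebius A z) k l = pE (w / J) ((of_real (r k) + of_int 0 + of_int (k * a) * t) / J) ((of_real (r l) + of_int 0 + of_int (l * a) * t) / J)"
    unfolding P7_def k by simp
   also have "\<dots> = J ^ 2 * pE t (of_real (r k) + of_int 0 + of_int (k * a) * t) (of_real (r l) + of_int 0 + of_int (l * a) * t)"
    unfolding w_def J_def by (rule pE_modular[OF t det'])
   finally show ?thesis unfolding pE_lattice_left[OF t] pE_lattice_right[OF t] .
  qed
  have pE: "pE t (of_real (r k)) (of_real (r l)) = pq k l (ee t)" for k l
   unfolding pE_def pq_def sig_sigq by (simp add: r_def add_divide_distrib diff_divide_distrib algebra_simps)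
  have "evm (mslash ups7 A) z = upsf (moebius A z)"
   using z A by (simp add: eval_mslash eval_upsilon7 moebius_in_uhp)
  also have "\<dots> = pq 1 3 (ee t) / pq 2 3 (ee t)"
   unfolding upsf_P7(1)[OF moebius_in_uhp[OF A(1) z]] P pE using J by simp
  finally show ?thesis by (simp add: H_def et)
 qed
 from that[OF an this] show ?thesis .
qed

lemma qmero_upsilon7_slash:
 assumes A: "A : SL2Z"
 shows   "qmero (mslash ups7 A)"
proof (cases "7 dvd A $ 2 $ 1")
 case False
 obtain g where g: "g analytic_on {0}" "!!z. z : \<H> ==> evm (mslash ups7 A) z = g (ee (z / 7))"
  using upsilon_non_Gamma0[OF A False] by metis
 show ?thesis unfolding qmero_def
  by (rule exI[of _ 7], rule exI[of _ g], rule exI[of _ 0])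
    (use g in \<open>auto simp: upper_half_plane_def intro: analytic_on_imp_meromorphic_on\<close>)
next
 case True
 have SL: "A $ 1 $ 1 * A $ 2 $ 2 - A $ 1 $ 2 * A $ 2 $ 1 = 1" using A by (simp add: SL2Z_det)
 have "~ 7 dvd A $ 1 $ 1"
 proof
  assume "7 dvd A $ 1 $ 1"
  hence "7 dvd A $ 1 $ 1 * A $ 2 $ 2 - A $ 1 $ 2 * A $ 2 $ 1" using True by (intro dvd_diff) auto
  thus False using SL by simp
 qed
 define a where "a = A $ 1 $ 1"
 have "a mod 7 : {1, 2, 3, 4, 5, 6}" using \<open>~ 7 dvd A $ 1 $ 1\<close> unfolding a_def[symmetric] dvd_eq_mod_eq_0 by auto
 hence "a mod 7 = 1 \<or> a mod 7 = 2 \<or> a mod 7 = 3 \<or> a mod 7 = 4 \<or> a mod 7 = 5 \<or> a mod 7 = 6" by simp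
 hence "7 dvd a - 1 \<or> 7 dvd a + 1 \<or> 7 dvd a - 2 \<or> 7 dvd a + 2 \<or> 7 dvd a - 3 \<or> 7 dvd a + 3" by presburger
 then consider "[a = 1] (mod 7) \<or> [a = - 1] (mod 7)" | "[a = 2] (mod 7) \<or> [a = - 2] (mod 7)" | "[a = 3] (mod 7) \<or> [a = - 3] (mod 7)"
  by (auto simp: cong_iff_dvd_diff)
 thus ?thesis
 proof cases
  case 1
  have "mslash ups7 A = ups7"
   by (rule eval_mero_ext) (simp add: eval_mslash[OF A] eval_upsilon7 moebius_in_uhp[OF A] upsf_Gamma0(1)[OF A True _ 1[unfolded a_def]])
  thus ?thesis using qmero_upsilon7 by simp
 next
  case 2
  have "mslash ups7 A = (ups7 - 1) / ups7"
  proof -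
   have "mslash ups7 A * ups7 = ups7 - cst 1"
   proof -
    have h: "(%z. upsf (moebius A z)) holomorphic_on \<H>"
     by (rule holomorphic_transform[of "%z. (upsf z - 1) / upsf z"])
       (auto intro!: holomorphic_intros upsf_holomorphic simp: upsf_neq upsf_Gamma0(2)[OF A True _ 2[unfolded a_def]])
    have "mslash ups7 A = mero_of (%z. upsf (moebius A z))"
     by (rule eval_mero_ext) (simp add: eval_mslash[OF A] eval_upsilon7 moebius_in_uhp[OF A] eval_mero_of_holomorphic[OF h])
    hence "mslash ups7 A * ups7 = mero_of (%z. upsf (moebius A z) * upsf z)"
     unfolding upsilon7_conv using holomorphic_imp_meromorphic_uhp[OF h] ups_mero by (simp add: mero_of_mult)
    also have "\<dots> = mero_of (%z. upsf z - 1)"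
     by (rule mero_of_cong) (auto intro!: holomorphic_intros upsf_holomorphic h simp: upsf_neq upsf_Gamma0(2)[OF A True _ 2[unfolded a_def]])
    finally show ?thesis using mero_of_shift_const[OF ups_mero, of 1] by (simp add: upsilon7_conv)
   qed
   thus ?thesis using upsilon7_nz(1) by (simp add: nonzero_eq_divide_eq)
  qed
  moreover have "qmero ((ups7 - 1) / ups7)"
   using qmero_mult[OF qmero_add[OF qmero_upsilon7 qmero_const[of "- 1"]] qmero_inverse[OF qmero_upsilon7]]
   by (simp add: const_mero_minus divide_inverse)
  ultimately show ?thesis by simp
 next
  case 3
  have "mslash ups7 A = 1 / (1 - ups7)"
  proof -
   have "mslash ups7 A * (ups7 - cst 1) = cst (- 1)"
   proof -
    have h: "(%z. upsf (moebius A z)) holomorphic_on \<H>"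
     by (rule holomorphic_transform[of "%z. 1 / (1 - upsf z)"])
       (auto intro!: holomorphic_intros upsf_holomorphic simp: upsf_neq upsf_Gamma0(3)[OF A True _ 3[unfolded a_def]] upsf_neq(2)[symmetric])
    have "mslash ups7 A = mero_of (%z. upsf (moebius A z))"
     by (rule eval_mero_ext) (simp add: eval_mslash[OF A] eval_upsilon7 moebius_in_uhp[OF A] eval_mero_of_holomorphic[OF h])
    hence "mslash ups7 A * (ups7 - cst 1) = mero_of (%z. upsf (moebius A z) * (upsf z - 1))"
     unfolding upsilon7_conv mero_of_shift_const[OF ups_mero, symmetric] using holomorphic_imp_meromorphic_uhp[OF h] ups_mero
     by (subst mero_of_mult) (auto intro!: meromorphic_intros)
    also have "\<dots> = mero_of (%z. - 1)"
    proof (rule mero_of_cong)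
     fix z assume "z : \<H>"
     thus "upsf (moebius A z) * (upsf z - 1) = - 1"
      using upsf_neq(2)[of z] by (simp add: upsf_Gamma0(3)[OF A True _ 3[unfolded a_def]] field_simps)
    qed (auto intro!: holomorphic_intros upsf_holomorphic h)
    finally show ?thesis by (simp add: const_mero_def)
   qed
   hence "mslash ups7 A * (1 - ups7) = 1" by (simp add: const_mero_minus algebra_simps)
   thus ?thesis using upsilon7_nz(2) by (simp add: nonzero_eq_divide_eq)
  qed
  moreover have "qmero (1 / (1 - ups7))"
   using qmero_inverse[OF qmero_add[OF qmero_const[of 1] qmero_uminus[OF qmero_upsilon7]]]
   by (simp add: divide_inverse)
  ultimately show ?thesis by simp
 qed
qed

text \<open>Gives meromorphy of \<open>psi7\<close> and \<open>Delta7\<close> at all cusps from that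
  of upsilon, since a 7th power and a square of them are rational in upsilon.\<close>

lemma qmero_root:
 assumes h: "qmero (f ^ n)" and n: "n > 0"
 shows   "qmero f"
proof (cases "f = 0")
 case True
 thus ?thesis using qmero_const[of 0] by simp
next
 case False
 obtain N g c where g: "N > (0::nat)" "c \<ge> 0" "g meromorphic_on {0}" "!!z. Im z > c ==> evm (f ^ n) z = g (ee (z / of_nat N))"
  "!!z. Im z > c ==> evm (f ^ n) analytic_on {z}"
  "!!z. Im z > c ==> evm (f ^ n) z ~= 0" "eventually (%t. g t ~= 0) (at 0)" using qmeroE[OF h] False by (metis power_not_zero)
 define H m where "H = zor_poly g 0" "m = zorder g 0"
 note hm = this
 have "frequently (%w. g w ~= 0) (at 0)" using g(7) by (intro eventually_frequently) auto
 then obtain r where r: "H 0 ~= 0" "r > 0" "H holomorphic_on cball 0 r" "!!t. t : cball 0 r - {0} ==> g t = H t * t powi m"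
  using zorder_exist[of g 0] g(3) by (auto simp: meromorphic_at_iff hm)
 have "isCont H 0"
  by (rule continuous_on_interior[OF holomorphic_on_imp_continuous_on[OF r(3)]]) (use r(2) in simp)
 hence "(H ---> H 0) (at 0)" by (simp add: isCont_def)
 hence "eventually (%t. dist (H t) (H 0) < norm (H 0)) (at 0)" using r(1) unfolding tendsto_iff by simp
 then obtain r' where r': "r' > 0" "!!t. norm t < r' ==> t ~= 0 ==> dist (H t) (H 0) < norm (H 0)"
  unfolding eventually_at by auto
 define \<rho> where "\<rho> = min r r'"
 have \<rho>: "\<rho> > 0" using r r' by (simp add: \<rho>_def)
 have Hb: "norm (H t / H 0 - 1) < 1" if "norm t < \<rho>" for t
 proof (cases "t = 0")
  case False
  have "H t / H 0 - 1 = (H t - H 0) / H 0" using r(1) by (simp add: field_simps)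
  thus ?thesis using r'(2)[of t] that False r(1) by (simp add: \<rho>_def dist_norm norm_divide)
 qed (use r(1) in simp)
 have Hpos: "H t / H 0 ~: \<real>\<^sub>\<le>\<^sub>0" "H t / H 0 ~= 0" if "norm t < \<rho>" for t
 proof -
  have "\<bar>Re (H t / H 0 - 1)\<bar> < 1" using Hb[OF that] abs_Re_le_cmod order_le_less_trans by blast
  hence "Re (H t / H 0) > 0" by simp
  thus "H t / H 0 ~: \<real>\<^sub>\<le>\<^sub>0" "H t / H 0 ~= 0" by (auto simp: complex_nonpos_Reals_iff)
 qed
 obtain c0 where c0: "c0 ^ n = H 0"
 proof -
  have "exp (Ln (H 0) / of_nat n) ^ n = exp (of_nat n * (Ln (H 0) / of_nat n))" by (rule exp_of_nat_mult[symmetric])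
  also have "\<dots> = H 0" using n r(1) by simp
  finally show ?thesis using that by blast
 qed
 \<comment> \<open>An analytic n-th root of \<open>H\<close> near 0: \<open>H t / H 0\<close> stays
   in the right half-plane, where \<open>Ln\<close> is analytic, and \<open>c0\<close> is an n-th
   root of \<open>H 0\<close>.\<close>
 define L where "L = (%t. c0 * exp (Ln (H t / H 0) / of_nat n))"
 have Ln: "L t ^ n = H t" if "norm t < \<rho>" for t
 proof -
  have "L t ^ n = H 0 * exp (of_nat n * (Ln (H t / H 0) / of_nat n))" unfolding L_def power_mult_distrib c0 exp_of_nat_mult[symmetric] by (rule refl)
  also have "\<dots> = H t" using n r(1) Hpos[OF that] by simp
  finally show ?thesis .
 qed
 have c0nz: "c0 ~= 0" using c0 r(1) zero_power[OF n] by metis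
 have Lhol: "L holomorphic_on ball 0 \<rho>" unfolding L_def
  by (intro holomorphic_intros holomorphic_on_subset[OF r(3)]) (use Hpos r(1) n in \<open>auto simp: \<rho>_def\<close>)
 define c' where "c' = max c (of_nat N / (2 * pi * \<rho>))"
 define S where "S = {z. Im z > c'}"
 have SH: "z : \<H>" if "z : S" for z using that g(2) by (auto simp: S_def c'_def upper_half_plane_def)
 have small: "norm (ee (z / of_nat N)) < \<rho>" if "z : S" for z
  using that by (intro norm_ee_small g \<rho>) (auto simp: S_def c'_def)
 have an: "evm f analytic_on {z}" "evm f z ^ n = evm (f ^ n) z" if z: "z : S" for z
 proof -
  have zc: "Im z > c" using z by (simp add: S_def c'_def)
  have v: "valuation_on UNIV (vpt z)" by (rule valuation_vpt[OF SH[OF z]])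
  have "0 <= vpt z (f ^ n)" using vpt_nonneg_iff_analytic[OF SH[OF z]] g(5)[OF zc] False by simp
  hence "0 <= vpt z f" using valuation_power[OF v, of f n] False n by (simp add: is_subfield_def zero_le_mult_iff)
  thus a: "evm f analytic_on {z}" using vpt_nonneg_iff_analytic[OF SH[OF z] False] by simp
  have "eventually (%w. evm (f ^ k) w = evm f w ^ k) (at z)" for k
  proof (induction k)
   case 0
   show ?case using eventually_eval_one_mero[OF SH[OF z]] by simp
  next
   case (Suc k)
   from eventually_eval_times_mero[OF SH[OF z], of f "f ^ k"] Suc show ?case by eventually_elim simp
  qed
  from eval_mero_eqI_analytic(1)[OF SH[OF z] this, of n] a show "evm f z ^ n = evm (f ^ n) z"
   by (simp add: analytic_intros)
 qed
 \<comment> \<open>Its n-th power is 1 on the connected half-plane \<open>S\<close>, so by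
   continuity it is a constant root of unity.\<close>
 define \<phi> where "\<phi> = (%z. evm f z / (ee (z / of_nat (N * n)) powi m * L (ee (z / of_nat N))))"
 have \<phi>n: "\<phi> z ^ n = 1" if z: "z : S" for z
 proof -
  have zc: "Im z > c" using z by (simp add: S_def c'_def)
  have e: "(ee (z / of_nat (N * n)) powi m) ^ n = ee (z / of_nat N) powi m"
   unfolding ee_div_power(1)[OF g(1) n, symmetric] power_int_of_nat[symmetric] power_int_mult[symmetric]
   by (simp add: mult.commute)
  have "evm f z ^ n = H (ee (z / of_nat N)) * ee (z / of_nat N) powi m"
   using an(2)[OF z] g(4)[OF zc] r(4)[of "ee (z / of_nat N)"] small[OF z] by (simp add: \<rho>_def)
  moreover have "H (ee (z / of_nat N)) ~= 0" using Hpos(2)[OF small[OF z]] by auto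
  ultimately show ?thesis unfolding \<phi>_def power_divide power_mult_distrib e Ln[OF small[OF z]] by simp
 qed
 have Lnz: "L t ~= 0" if "norm t < \<rho>" for t using c0nz by (simp add: L_def)
 have contL: "continuous_on S (%z. L (ee (z / of_nat N)))"
 proof (rule continuous_on_compose2[OF holomorphic_on_imp_continuous_on[OF Lhol]])
  show "continuous_on S (%z. ee (z / of_nat N))" unfolding ee_def using g(1) by (intro continuous_intros) auto
  show "(%z. ee (z / of_nat N)) ` S <= ball 0 \<rho>" using small by auto
 qed
 have conte: "continuous_on S (%z. ee (z / of_nat (N * n)) powi m)"
  unfolding ee_power_int[symmetric] unfolding ee_def using g(1) n by (intro continuous_intros) auto
 have contf: "continuous_on S (evm f)"
  using an(1) analytic_at_imp_isCont continuous_at_imp_continuous_on by blast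
 have cont: "continuous_on S \<phi>" unfolding \<phi>_def
  by (intro continuous_intros contf conte contL) (use Lnz small in auto)
 have "finite (\<phi> ` S)"
 proof (rule finite_subset[OF _ finite_roots_unity])
  show "\<phi> ` S <= {z. z ^ n = 1}" using \<phi>n by auto
 qed (use n in simp)
 moreover have "connected S" unfolding S_def by (intro convex_connected convex_halfspace_Im_gt)
 ultimately have "\<phi> constant_on S" using cont by (intro continuous_finite_range_constant)
 then obtain k where k: "!!z. z : S ==> \<phi> z = k" unfolding constant_on_def by blast
 show ?thesis unfolding qmero_def
 proof (intro exI conjI allI impI)
  show "N * n > 0" using g(1) n by simp
  have "L analytic_on {0}" using Lhol \<rho> by (meson centre_in_ball open_ball analytic_at)
  hence "(%s. L (s ^ n)) meromorphic_on {0}"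
   by (intro meromorphic_compose_power analytic_on_imp_meromorphic_on n)
  thus "(%s. k * (s powi m * L (s ^ n))) meromorphic_on {0}" by (intro meromorphic_intros)
  fix z assume "Im z > c'"
  hence z: "z : S" by (simp add: S_def)
  show "evm f z = k * (ee (z / of_nat (N * n)) powi m * L (ee (z / of_nat (N * n)) ^ n))"
   unfolding ee_div_power(1)[OF g(1) n] k[OF z, symmetric] \<phi>_def using Lnz[OF small[OF z]] by simp
 qed
qed

section \<open>Functions that are regular where upsilon is finite\<close>

definition MG :: "mero_uhp set" where "MG = modular_functions (Gamma_sup2 \<inter> Gamma_principal 7)"

lemma G_SL2Z: "Gamma_sup2 \<inter> Gamma_principal 7 <= SL2Z"
 using Gamma_principal_subset by blast

lemma MG_subfield: "is_subfield MG"
 unfolding MG_def by (rule modular_functions_subfield[OF G_SL2Z])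

lemmas MG_closed = is_subfieldD[OF MG_subfield]

lemma MG_const: "cst c : MG"
 unfolding MG_def by (rule modular_functions_const[OF G_SL2Z])

lemma MG_M14: "f : MG ==> f : M14"
 using modular_functions_mono[OF Gamma_principal_14_subset] by (auto simp: MG_def M14_def)

lemma range_const_M14: "range cst <= M14" and range_const_MG: "range cst <= MG"
 using M14_const MG_const by auto

lemma qmero_subfield: "is_subfield {f. qmero f}"
 using qmero_const[of 0] qmero_const[of 1]
 by (simp add: is_subfield_def qmero_add qmero_mult qmero_uminus qmero_inverse)

lemmas qmero_closed = is_subfieldD[OF qmero_subfield, unfolded mem_Collect_eq]

lemma qmero_numeral: "qmero (numeral n)"
 using qmero_const[of "numeral n"] by (simp add: const_mero_numeral)

lemma mslash_numeral: "A : SL2Z ==> mslash (numeral n) A = numeral n"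
 using mslash_const[of A "numeral n"] by (simp add: const_mero_numeral)

lemma MG_I:
 assumes "!!A z. A : Gamma_sup2 \<inter> Gamma_principal 7 ==> z : \<H> ==> evm f (moebius A z) = evm f z"
  and "!!A. A : SL2Z ==> qmero (mslash f A)"
 shows "f : MG"
 unfolding MG_def modular_functions_iff[OF G_SL2Z]
proof (intro conjI ballI)
 fix A assume A: "A : Gamma_sup2 \<inter> Gamma_principal 7"
 hence "A : SL2Z" using G_SL2Z by blast
 thus "mslash f A = f" using assms(1)[OF A] by (intro eval_mero_ext) (simp add: eval_mslash)
qed (rule assms(2))

lemma upsilon7_MG: "ups7 : MG"
proof (rule MG_I)
 fix A z assume A: "A : Gamma_sup2 \<inter> Gamma_principal 7" and z: "z : \<H>"
 hence "A : SL2Z" using G_SL2Z by blast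
 thus "evm ups7 (moebius A z) = evm ups7 z"
  using A z by (simp add: eval_upsilon7 moebius_in_uhp upsf_Gamma7)
qed (rule qmero_upsilon7_slash)

lemma psi7_MG: "psi7 : MG"
proof (rule MG_I)
 fix A z assume A: "A : Gamma_sup2 \<inter> Gamma_principal 7" and z: "z : \<H>"
 hence "A : SL2Z" using G_SL2Z by blast
 thus "evm psi7 (moebius A z) = evm psi7 z"
  using A z by (simp add: eval_psi7 moebius_in_uhp psi_fun_Gamma7)
next
 fix A assume A: "A : SL2Z"
 have "mslash psi7 A ^ 7 = mslash (psi7 ^ 7) A" by (simp add: mslash_power[OF A])
 also have "\<dots> = mslash ups7 A ^ 4 * (mslash ups7 A - 1)"
  unfolding psi7_power_7 by (simp add: mslash_mult[OF A] mslash_power[OF A] mslash_diff[OF A] mslash_1[OF A])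
 also have "qmero \<dots>" by (intro qmero_closed(2,4,7,9) qmero_upsilon7_slash A)
 finally show "qmero (mslash psi7 A)" by (rule qmero_root) simp
qed

lemma Delta7_MG: "Delta7 : MG"
proof (rule MG_I)
 fix A z assume A: "A : Gamma_sup2 \<inter> Gamma_principal 7" and z: "z : \<H>"
 hence "A : SL2Z" using G_SL2Z by blast
 thus "evm Delta7 (moebius A z) = evm Delta7 z"
  using A z by (simp add: eval_Delta7 moebius_in_uhp Delta_fun_Gamma)
next
 fix A assume A: "A : SL2Z"
 have "mslash Delta7 A ^ 2 = mslash (Delta7 ^ 2) A" by (simp add: mslash_power[OF A])
 also have "\<dots> = 4 * ((mslash ups7 A - 1) ^ 3 * (mslash ups7 A ^ 3 - 8 * mslash ups7 A ^ 2 + 5 * mslash ups7 A + 1) / mslash ups7 A ^ 3)"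
  unfolding Delta7_square
  by (simp add: mslash_mult[OF A] mslash_power[OF A] mslash_diff[OF A] mslash_add[OF A] mslash_divide[OF A] mslash_1[OF A] mslash_numeral[OF A])
 also have "qmero \<dots>" by (intro qmero_closed(2,3,4,7,8,9) qmero_upsilon7_slash A qmero_numeral)
 finally show "qmero (mslash Delta7 A)" by (rule qmero_root) simp
qed

lemma Uq_tendsto: "((%z. Uq (ee z)) ---> 1) at_iinf"
proof -
 have "isCont Uq 0" using Uq_analytic by (simp add: analytic_at_imp_isCont)
 from isCont_tendsto_compose[OF this] ee_tendsto_0_at_iinf[of 1] show ?thesis by (simp add: Uq_0)
qed

lemma ee_tendsto: "(ee ---> 0) at_iinf"
 using ee_tendsto_0_at_iinf[of 1] by simp

lemma eventually_iinf_uhp: "eventually (%z. z : \<H>) at_iinf"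
 unfolding eventually_at_iinf upper_half_plane_def by blast

lemma vinf_upsilon7: "vinf ups7 = - 14"
proof (rule iinf.ord_eqI)
 have e: "ee (z / 14) ^ 14 = ee z" for z
  using ee_of_nat_mult[of 14 "z / 14"] by simp
 show "((%z. evm ups7 z * ee (z / 14) powi (- (- 14))) ---> 1) at_iinf"
 proof (rule Lim_transform_eventually[OF Uq_tendsto])
  show "eventually (%z. Uq (ee z) = evm ups7 z * ee (z / 14) powi (- (- 14))) at_iinf"
   using eventually_iinf_uhp by eventually_elim (simp add: e eval_upsilon7 upsf_Uq)
 qed
qed simp

text \<open>Gamma_1(7) together with its negatives. By \<open>Gamma1_7_decomposition\<close> all its
  matrices lead to the one cusp at which upsilon has its pole.\<close>

definition Cinf :: "(int ^ 2 ^ 2) set" where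
 "Cinf = {A : SL2Z. 7 dvd A $ 2 $ 1 & ([A $ 1 $ 1 = 1] (mod 7) \<or> [A $ 1 $ 1 = - 1] (mod 7))}"

text \<open>The valuations of the points and cusps at which \<open>\<upsilon>\<close> is finite.\<close>

definition W :: "(mero_uhp => int) set" where "W = vpt ` \<H> \<union> vcusp ` (SL2Z - Cinf)"

lemma W_valuation: "v : W ==> valuation_on M14 v"
 unfolding W_def using valuation_on_subset[OF valuation_vpt] valuation_vcusp by auto

text \<open>Says that the residue field of v is C without forming it: a constant multiple cancels
  the leading term.\<close>

definition residual :: "mero_uhp set => (mero_uhp => int) => bool" where
 "residual K v \<longleftrightarrow> (ALL f:K. ALL g:K. g ~= 0 & (f = 0 \<or> v g <= v f) -->
   (EX c. f - cst c * g = 0 \<or> v g < v (f - cst c * g)))"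

lemma (in ord_frame) residual_ord: "residual K ord"
 unfolding residual_def using ord_residue by metis

lemma W_residual: "v : W ==> residual M14 v"
proof -
 assume "v : W"
 then consider p where "p : \<H>" "v = vpt p" | A where "A : SL2Z" "v = vcusp A" unfolding W_def by blast
 thus ?thesis
 proof cases
  case 1
  then interpret ord_frame "at p" "%z. z - p" UNIV by (intro ord_frame_point)
  show ?thesis using residual_ord unfolding residual_def 1 vpt_def by blast
 next
  case 2
  show ?thesis unfolding residual_def 2 vcusp_def
  proof (intro ballI impI)
   fix f g assume f: "f : M14" "g : M14" "g ~= 0 & (f = 0 \<or> vinf (mslash g A) <= vinf (mslash f A))"
   have z: "mslash (f - cst c * g) A = mslash f A - cst c * mslash g A" for c
    by (simp add: mslash_diff mslash_mult mslash_const 2)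
   have "EX c. mslash f A - cst c * mslash g A = 0 \<or> vinf (mslash g A) < vinf (mslash f A - cst c * mslash g A)"
    using iinf.residual_ord M14_slash[OF f(1) 2(1)] M14_slash[OF f(2) 2(1)] f(3) mslash_eq_0_iff[OF 2(1)]
    unfolding residual_def by blast
   thus "EX c. f - cst c * g = 0 \<or> vinf (mslash g A) < vinf (mslash (f - cst c * g) A)"
    unfolding z[symmetric] mslash_eq_0_iff[OF 2(1)] .
  qed
 qed
qed

text \<open>At points upsilon is holomorphic. At cusps outside Gamma_0(7) its expansion in q^(1/7)
  is analytic. At the remaining cusps it becomes (u - 1)/u or 1/(1 - u), and since u tends to
  infinity the limits are 1 and 0.\<close>

lemma W_upsilon7:
 assumes "v : W"
 shows   "0 <= v ups7"
proof -
 consider p where "p : \<H>" "v = vpt p" | A where "A : SL2Z" "A ~: Cinf" "v = vcusp A"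
  using assms unfolding W_def by blast
 thus ?thesis
 proof cases
  case 1
  have "evm ups7 analytic_on {p}"
   by (rule eval_mero_eqI_analytic(2)[OF 1(1) _ holomorphic_uhp_imp_analytic_at[OF upsf_holomorphic 1(1)]])
     (use eventually_at_in_open'[OF open_upper_half_plane 1(1)] in \<open>auto elim!: eventually_mono simp: eval_upsilon7\<close>)
  thus ?thesis using vpt_nonneg_iff_analytic[OF 1(1)] upsilon7_nz 1 by simp
 next
  case 2
  note A = 2(1)
  have "EX L. (evm (mslash ups7 A) ---> L) at_iinf"
  proof (cases "7 dvd A $ 2 $ 1")
   case False
   obtain g where g: "g analytic_on {0}" "!!z. z : \<H> ==> evm (mslash ups7 A) z = g (ee (z / 7))"
    using upsilon_non_Gamma0[OF A False] by metis
   have "isCont g 0" using g(1) by (simp add: analytic_at_imp_isCont)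
   from isCont_tendsto_compose[OF this] ee_tendsto_0_at_iinf[of 7]
   have "((%z. g (ee (z / 7))) ---> g 0) at_iinf" by simp
   hence "(evm (mslash ups7 A) ---> g 0) at_iinf"
    by (rule Lim_transform_eventually) (use eventually_iinf_uhp g(2) in \<open>auto elim!: eventually_mono\<close>)
   thus ?thesis by blast
  next
   case True
   have SL: "A $ 1 $ 1 * A $ 2 $ 2 - A $ 1 $ 2 * A $ 2 $ 1 = 1" using A by (simp add: SL2Z_det)
   define a where "a = A $ 1 $ 1"
   have "~ 7 dvd a"
   proof
    assume "7 dvd a"
    hence "7 dvd A $ 1 $ 1 * A $ 2 $ 2 - A $ 1 $ 2 * A $ 2 $ 1" using True by (intro dvd_diff) (auto simp: a_def)
    thus False using SL by simp
   qed
   moreover have "~ 7 dvd a - 1" "~ 7 dvd a + 1"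
    using 2 True by (auto simp: Cinf_def a_def cong_iff_dvd_diff)
   ultimately have "7 dvd a - 2 \<or> 7 dvd a + 2 \<or> 7 dvd a - 3 \<or> 7 dvd a + 3" by presburger
   then consider "[a = 2] (mod 7) \<or> [a = - 2] (mod 7)" | "[a = 3] (mod 7) \<or> [a = - 3] (mod 7)"
    by (auto simp: cong_iff_dvd_diff)
   thus ?thesis
   proof cases
    case 1
    have "((%z. 1 - ee z / Uq (ee z)) ---> 1 - 0 / 1) at_iinf"
     by (intro tendsto_intros ee_tendsto Uq_tendsto) simp
    hence "(evm (mslash ups7 A) ---> 1 - 0 / 1) at_iinf"
    proof (rule Lim_transform_eventually)
     show "\<forall>\<^sub>F z in at_iinf. 1 - ee z / Uq (ee z) = evm (mslash ups7 A) z"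
      using eventually_iinf_uhp
     proof eventually_elim
      case (elim z)
      have "evm (mslash ups7 A) z = (upsf z - 1) / upsf z"
       using elim by (simp add: eval_mslash[OF A] eval_upsilon7 moebius_in_uhp[OF A] upsf_Gamma0(2)[OF A True _ 1[unfolded a_def]])
      also have "\<dots> = 1 - 1 / upsf z" using upsf_neq[OF elim] by (simp add: field_simps)
      finally show ?case using elim by (simp add: upsf_Uq)
     qed
    qed
    thus ?thesis by blast
   next
    case 2
    have "((%z. ee z / (ee z - Uq (ee z))) ---> 0 / (0 - 1)) at_iinf"
     by (intro tendsto_intros ee_tendsto Uq_tendsto) simp
    hence "(evm (mslash ups7 A) ---> 0 / (0 - 1)) at_iinf"
    proof (rule Lim_transform_eventually)
     show "\<forall>\<^sub>F z in at_iinf. ee z / (ee z - Uq (ee z)) = evm (mslash ups7 A) z"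
      using eventually_iinf_uhp
     proof eventually_elim
      case (elim z)
      have "evm (mslash ups7 A) z = 1 / (1 - upsf z)"
       using elim by (simp add: eval_mslash[OF A] eval_upsilon7 moebius_in_uhp[OF A] upsf_Gamma0(3)[OF A True _ 2[unfolded a_def]])
      also have "1 - upsf z = (ee z - Uq (ee z)) / ee z" using elim by (simp add: upsf_Uq diff_divide_distrib)
      finally show ?case by simp
     qed
    qed
    thus ?thesis by blast
   qed
  qed
  then obtain L where "((%z. evm (mslash ups7 A) z * ee (z / 14) powi (- 0)) ---> L) at_iinf" by auto
  from iinf.ord_geI(1)[OF M14_slash[OF MG_M14[OF upsilon7_MG] A] _ this] show ?thesis
   using mslash_eq_0_iff[OF A] upsilon7_nz by (simp add: 2 vcusp_def)
 qed
qed

text \<open>A translation multiplies the leading coefficient by a 14th root of unity that records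
  the order modulo 14; this later identifies the characters of the basis functions.\<close>

lemma iinf_shift_limit:
 assumes "((%z. evm f z * ee (z / 14) powi (- v)) ---> c) at_iinf"
 shows "((%z. evm (mslash f (shiftm n)) z * ee (z / 14) powi (- v)) ---> ee (of_int (n * v) / 14) * c) at_iinf"
proof -
 have "filterlim (%z. z + of_int n) at_iinf at_iinf"
  unfolding filterlim_iff eventually_at_iinf
 proof (intro allI impI, elim exE)
  fix P :: "complex => bool" and c
  assume "ALL z. c < Im z --> P z"
  thus "EX c. ALL z. c < Im z --> P (z + of_int n)" by (intro exI[of _ c]) simp
 qed
 from tendsto_mult[OF tendsto_const filterlim_compose[OF assms this]]
 show ?thesis
 proof (rule Lim_transform_eventually)
  show "\<forall>\<^sub>F z in at_iinf. ee (of_int (n * v) / 14) * (evm f (z + of_int n) * ee ((z + of_int n) / 14) powi (- v)) =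
    evm (mslash f (shiftm n)) z * ee (z / 14) powi (- v)"
   using eventually_iinf_uhp
  proof eventually_elim
   case (elim z)
   have "ee (of_int (n * v) / 14) * ee (of_int (- v) * ((z + of_int n) / 14)) = ee (of_int (- v) * (z / 14))"
    unfolding ee_add[symmetric] by (rule arg_cong[of _ _ ee]) (simp add: field_simps)
   thus ?case unfolding ee_power_int by (simp add: eval_mslash[OF shiftm_SL2Z elim])
  qed
 qed
qed

lemma vinf_shift:
 assumes "f : M14" "f ~= 0"
 shows   "vinf (mslash f (shiftm n)) = vinf f"
proof -
 obtain c where c: "c ~= 0" "((%z. evm f z * ee (z / 14) powi (- vinf f)) ---> c) at_iinf"
  using iinf.ord_limit[OF assms] by metis
 show ?thesis by (rule iinf.ord_eqI[OF iinf_shift_limit[OF c(2)]]) (use c(1) in \<open>simp add: ee_def\<close>)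
qed

text \<open>The form in which the maximum principle is used. Cusps in \<open>Cinf\<close> are
  translates of infinity, where \<open>g\<close> is assumed to vanish for the contradiction, and
  everything else lies in \<open>W\<close>.\<close>

lemma vinf_nonpos:
 assumes g: "g : MG" "g ~= 0" and W: "!!v. v : W ==> 0 <= v g"
 shows   "vinf g <= 0"
proof (rule ccontr)
 assume *: "~ vinf g <= 0"
 have "vinf g <= 0"
 proof (rule no_regular_function_vanishing_at_iinf[OF MG_M14[OF g(1)] g(2)])
  show "0 <= vpt p g" if "p : \<H>" for p using W that by (auto simp: W_def)
  show "0 <= vcusp A g" if A: "A : SL2Z" for A
  proof (cases "A : Cinf")
   case False
   thus ?thesis using W A by (auto simp: W_def)
  next
   case True
   then obtain B n where B: "B : Gamma_sup2 \<inter> Gamma_principal 7" "!!z. z : \<H> ==> moebius A z = moebius B (z + of_int n)"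
    using Gamma1_7_decomposition[of A] unfolding Cinf_def by blast
   have "mslash g A = mslash g (shiftm n)"
   proof (rule eval_mero_ext)
    fix z assume z: "z : \<H>"
    have "z + of_int n : \<H>" using z by (simp add: upper_half_plane_def)
    hence "evm g (moebius B (z + of_int n)) = evm g (z + of_int n)"
     using g(1) B(1) by (auto simp: MG_def modular_functions_def)
    thus "evm (mslash g A) z = evm (mslash g (shiftm n)) z"
     using z by (simp add: eval_mslash[OF A] eval_mslash B(2))
   qed
   thus ?thesis using * vinf_shift[OF MG_M14[OF g(1)] g(2)] by (simp add: vcusp_def)
  qed
 qed
 thus False using * by contradiction
qed

section \<open>Polynomials in upsilon and the clearing of poles\<close>

definition pev :: "mero_uhp => complex poly => mero_uhp" where
 "pev t p = poly (map_poly cst p) t"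

lemma pev_pCons [simp]: "pev t (pCons a p) = cst a + t * pev t p"
 by (simp add: pev_def map_poly_pCons)

lemma pev_0 [simp]: "pev t 0 = 0" and pev_1 [simp]: "pev t 1 = 1"
 by (simp_all add: pev_def)

lemma pev_add: "pev t (p + q) = pev t p + pev t q"
proof (induction p arbitrary: q)
 case (pCons a p)
 show ?case by (cases q) (simp add: pCons.IH const_mero_add distrib_left add.assoc add.left_commute)
qed simp

lemma pev_smult: "pev t (smult c p) = cst c * pev t p"
 by (induction p) (simp_all add: const_mero_mult algebra_simps)

lemma pev_mult: "pev t (p * q) = pev t p * pev t q"
 by (induction p) (simp_all add: pev_add pev_smult algebra_simps)

lemma pev_power: "pev t (p ^ n) = pev t p ^ n"
 by (induction n) (simp_all add: pev_mult)

lemma pev_sum: "pev t (sum f I) = (\<Sum>i\<in>I. pev t (f i))"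
 by (induction I rule: infinite_finite_induct) (simp_all add: pev_add)

lemma pev_monom: "pev t (monom c n) = cst c * t ^ n"
 by (induction n) (simp_all add: monom_0 monom_Suc mult_ac)

lemma pev_in: "is_subfield K ==> range cst <= K ==> t : K ==> pev t p : K"
 by (induction p) (auto intro!: is_subfieldD)

lemma pev_valuation_neg:
 assumes v: "valuation_on K v" "is_subfield K" "range cst <= K" and t: "t : K" "t ~= 0" "v t < 0"
  and p: "p ~= 0"
 shows   "pev t p ~= 0" "v (pev t p) = int (degree p) * v t"
proof -
 have "pev t p ~= 0 & v (pev t p) = int (degree p) * v t" using p
 proof (induction p)
  case (pCons a p)
  show ?case
  proof (cases "p = 0")
   case True
   thus ?thesis using pCons valuation_const[OF v(1)] by simp
  next
   case False
   have IH: "pev t p ~= 0" "v (pev t p) = int (degree p) * v t" using pCons.IH[OF False] by auto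
   have K: "pev t p : K" "t * pev t p : K" "cst a : K"
    using pev_in[OF v(2,3) t(1)] is_subfieldD(4)[OF v(2) t(1)] v(3) by auto
   have m: "v (t * pev t p) = int (degree (pCons a p)) * v t"
    using valuation_mult[OF v(1) t(1,2) K(1) IH(1)] IH(2) False by (simp add: algebra_simps)
   have "cst a = 0 \<or> v (t * pev t p) < v (cst a)"
    using valuation_const[OF v(1), of a] False t(3) unfolding m by (cases "a = 0") (auto simp: mult_pos_neg)
   from valuation_add_eq[OF v K(2) _ K(3) this] show ?thesis
    using IH(1) t(2) unfolding pev_pCons m by (simp add: add.commute)
  qed
 qed simp
 thus "pev t p ~= 0" "v (pev t p) = int (degree p) * v t" by auto
qed

lemma pev_valuation_nonneg:
 assumes v: "valuation_on K v" "is_subfield K" "range cst <= K" and t: "t : K" "t = 0 \<or> 0 <= v t"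
 shows   "pev t p = 0 \<or> 0 <= v (pev t p)"
proof (induction p)
 case (pCons a p)
 have K: "pev t p : K" "t * pev t p : K" "cst a : K"
  using pev_in[OF v(2,3) t(1)] is_subfieldD(4)[OF v(2) t(1)] v(3) by auto
 have 1: "t * pev t p = 0 \<or> 0 <= v (t * pev t p)"
  using pCons.IH t valuation_mult[OF v(1) t(1) _ K(1)] by (cases "t = 0"; cases "pev t p = 0") auto
 have 2: "cst a = 0 \<or> 0 <= v (cst a)" using valuation_const[OF v(1), of a] by (cases "a = 0") auto
 show ?case using 1 2 valuation_add[OF v(1) K(3) _ K(2)] unfolding pev_pCons
  by (cases "cst a = 0"; cases "t * pev t p = 0") force+
qed simp

lemma vinf_valuation: "valuation_on M14 vinf"
 by (rule iinf.valuation_ord)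

abbreviation "ups_poly \<equiv> pev ups7"

lemma ups_poly_MG: "ups_poly p : MG"
 by (rule pev_in[OF MG_subfield range_const_MG upsilon7_MG])

lemma ups_poly_nz: "p ~= 0 ==> ups_poly p ~= 0"
 and vinf_ups_poly: "p ~= 0 ==> vinf (ups_poly p) = - 14 * int (degree p)"
 using pev_valuation_neg[OF vinf_valuation M14_subfield range_const_M14 MG_M14[OF upsilon7_MG] upsilon7_nz(1)] vinf_upsilon7
 by auto

lemma ups_poly_eq_0_iff [simp]: "ups_poly p = 0 \<longleftrightarrow> p = 0"
 using ups_poly_nz by auto

lemma W_ups_poly: "v : W ==> p ~= 0 ==> 0 <= v (ups_poly p)"
 using pev_valuation_nonneg[OF W_valuation M14_subfield range_const_M14 MG_M14[OF upsilon7_MG]] W_upsilon7 ups_poly_nz by blast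

lemma ups_poly_linear: "ups_poly [:- c, 1:] = ups7 - cst c"
 by (simp add: const_mero_minus)

text \<open>An accumulation point of poles would be a non-isolated singularity.\<close>

lemma finite_poles_compact:
 assumes K: "compact K" "K <= \<H>" and h: "h ~= 0"
 shows   "finite {q : K. vpt q h < 0}"
proof (rule ccontr)
 define S where "S = {q : K. vpt q h < 0}"
 assume "infinite {q : K. vpt q h < 0}"
 then obtain x where x: "x : K" "x islimpt S"
  using K(1) unfolding compact_eq_Bolzano_Weierstrass S_def by blast
 have "isolated_singularity_at (evm h) x"
  using eval_mero_meromorphic[of h] x K by (meson meromorphic_on_altdef subsetD)
 then obtain r where r: "r > 0" "evm h analytic_on ball x r - {x}" unfolding isolated_singularity_at_def by blast
 have "eventually (%y. y : ball x r \<inter> \<H> - {x}) (at x)"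
  using r x K by (intro eventually_at_in_open) auto
 hence "eventually (%y. y ~: S) (at x)"
 proof eventually_elim
  case (elim y)
  hence "evm h analytic_on {y}" using r(2) by (auto intro: analytic_on_subset)
  thus ?case using vpt_nonneg_iff_analytic[of y h] elim h by (auto simp: S_def)
 qed
 thus False using x(2) by (simp add: islimpt_iff_eventually)
qed

text \<open>The poles of \<open>f\<close> form infinitely many points, but only finitely many pairs
  of a value of upsilon and a pole order occur. Up to SL_2(Z) every pole lies in a compact box or at
  a cusp, and \<open>f\<close> and upsilon have finitely many conjugates.\<close>

lemma finite_polar_data:
 assumes f: "f : M14" "f ~= 0"
 obtains S where "finite S" "!!v. v : W ==> v f < 0 ==> EX c. (c, v f) : S & 0 < v (ups7 - cst c)"
proof -
 define Orb where "Orb = (%A. (mslash f A, mslash ups7 A)) ` SL2Z"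
 have fin: "finite Orb" unfolding Orb_def by (rule finite_M14_orbit[OF f(1) MG_M14[OF upsilon7_MG]])
 have Orb: "h1 : M14" "h1 ~= 0" if "(h1, h2) : Orb" for h1 h2
  using that f M14_slash mslash_eq_0_iff by (auto simp: Orb_def)
 have u_neq: "ups7 - cst c ~= 0" for c
  using ups_poly_nz[of "[:- c, 1:]"] unfolding ups_poly_linear by simp
 have "EX c. ALL z. Im z > c --> evm h1 analytic_on {z}" if h: "h1 : M14" "h1 ~= 0" for h1
  using qmeroE[OF M14_qmero[OF h(1)]] h(2) by metis
 then obtain C0 where C0: "!!h1 z. h1 : M14 ==> h1 ~= 0 ==> Im z > C0 h1 ==> evm h1 analytic_on {z}" by metis
 define C where "C = (%h1 (h2 :: mero_uhp). C0 h1)"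
 have C: "evm h1 analytic_on {z}" if "(h1, h2) : Orb" "Im z > C h1 h2" for h1 h2 z
  using C0[OF Orb(1,2)] that unfolding C_def by blast
 define Bx where "Bx = (%h1 h2. cbox (Complex (- 1 / 2) (1 / 5)) (Complex (1 / 2) (C h1 h2)))"
 \<comment> \<open>\<open>S1\<close> records the poles inside the box of each conjugate pair,
   \<open>S2\<close> the order at the cusp together with the value of upsilon there.\<close>
 define S1 where "S1 = (\<Union>(h1, h2)\<in>Orb. (%q. (evm h2 q, vpt q h1)) ` {q : Bx h1 h2. vpt q h1 < 0})"
 define S2 where "S2 = (%(h1, h2). (SOME c. h2 - cst c = 0 \<or> 0 < vinf (h2 - cst c), vinf h1)) ` Orb"
 have BxH: "Bx h1 h2 <= \<H>" for h1 h2 by (auto simp: Bx_def in_cbox_complex_iff upper_half_plane_def)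
 have "finite S1" unfolding S1_def
  using Orb by (intro finite_UN_I fin) (auto intro!: finite_imageI finite_poles_compact BxH simp: Bx_def[symmetric], simp add: Bx_def)
 moreover have "finite S2" unfolding S2_def using fin by (rule finite_imageI)
 ultimately have "finite (S1 \<union> S2)" by simp
 moreover have "EX c. (c, v f) : S1 \<union> S2 & 0 < v (ups7 - cst c)" if v: "v : W" "v f < 0" for v
 proof -
  consider p where "p : \<H>" "v = vpt p" | A where "A : SL2Z" "A ~: Cinf" "v = vcusp A"
   using v(1) unfolding W_def by blast
  thus ?thesis
  proof cases
   case 1
   obtain A where A: "A : SL2Z" "Im (moebius A p) \<ge> 1 / 5" "\<bar>Re (moebius A p)\<bar> <= 1 / 2"
    using fundamental_domain[OF 1(1)] by blast
   define q where "q = moebius A p"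
   define B where "B = adj2 A"
   have B: "B : SL2Z" using A by (simp add: B_def adj2_SL2Z)
   have q: "q : \<H>" unfolding q_def by (rule moebius_in_uhp[OF A(1) 1(1)])
   have Bq: "moebius B q = p"
    unfolding q_def using moebius_mult[OF B A(1) 1(1), symmetric] adj2_mult(2)[OF A(1)] by (simp add: B_def)
   have h: "(mslash f B, mslash ups7 B) : Orb" using B by (auto simp: Orb_def)
   have vq: "vpt q (mslash f B) = v f" using vpt_slash[OF B q f(2)] Bq 1 by simp
   have "~ evm (mslash f B) analytic_on {q}"
    using vpt_nonneg_iff_analytic[OF q Orb(2)[OF h]] vq v(2) by simp
   hence "Im q <= C (mslash f B) (mslash ups7 B)" using C[OF h, of q] by force
   hence "q : Bx (mslash f B) (mslash ups7 B)" using A by (auto simp: Bx_def in_cbox_complex_iff q_def)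
   moreover have "evm (mslash ups7 B) q = upsf p"
    by (simp add: eval_mslash[OF B q] Bq eval_upsilon7 1)
   ultimately have "(upsf p, v f) : S1"
    unfolding S1_def using h v(2) vq by (intro UN_I[OF h]) (auto intro!: image_eqI[of _ _ q])
   moreover have "0 < v (ups7 - cst (upsf p))"
   proof -
    let ?h = "ups7 - cst (upsf p)"
    have hol: "(%z. upsf z - upsf p) analytic_on {p}"
     by (rule holomorphic_uhp_imp_analytic_at[OF _ 1(1)]) (intro holomorphic_intros upsf_holomorphic)
    have ev: "eventually (%w. evm ?h w = upsf w - upsf p) (at p)"
     using eventually_eval_minus_mero[OF 1(1), of ups7 "cst (upsf p)"]
      eventually_at_in_open'[OF open_upper_half_plane 1(1)] eventually_eval_const_mero[OF 1(1), of "upsf p"]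
     by eventually_elim (simp add: eval_upsilon7)
    show ?thesis unfolding 1(2)
     by (rule vpt_pos_if_zero[OF 1(1) u_neq]) (use eval_mero_eqI_analytic[OF 1(1) ev hol] in auto)
   qed
   ultimately show ?thesis by blast
  next
   case 2
   define h2 where "h2 = mslash ups7 A"
   define c where "c = (SOME c. h2 - cst c = 0 \<or> 0 < vinf (h2 - cst c))"
   have "EX c. ups7 - cst c * 1 = 0 \<or> v 1 < v (ups7 - cst c * 1)"
    using W_residual[OF v(1)] MG_M14[OF upsilon7_MG] M14_closed(2) W_upsilon7[OF v(1)] valuation_1[OF W_valuation[OF v(1)]]
    unfolding residual_def by (metis one_neq_zero)
   hence "EX c. h2 - cst c = 0 \<or> 0 < vinf (h2 - cst c)"
    using valuation_1[OF W_valuation[OF v(1)]] u_neq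
    by (auto simp: h2_def 2 vcusp_def mslash_diff mslash_const)
   hence "h2 - cst c = 0 \<or> 0 < vinf (h2 - cst c)" unfolding c_def by (rule someI_ex)
   moreover have "h2 - cst c = mslash (ups7 - cst c) A"
    by (simp add: h2_def mslash_diff mslash_const 2)
   ultimately have "0 < v (ups7 - cst c)" using u_neq mslash_eq_0_iff[OF 2(1)] by (simp add: 2 vcusp_def)
   moreover have "(c, v f) : S2" unfolding S2_def
    by (rule image_eqI[of _ _ "(mslash f A, h2)"]) (use 2 in \<open>auto simp: Orb_def h2_def c_def vcusp_def\<close>)
   ultimately show ?thesis by blast
  qed
 qed
 ultimately show ?thesis using that by blast
qed

text \<open>A pole of order -n above upsilon = c is removed by (upsilon - c)^(-n), because upsilon -
  c has value at least 1 there.\<close>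

lemma clear_poles:
 assumes f: "f : M14"
 obtains p where "p ~= 0" "!!v. v : W ==> ups_poly p * f = 0 \<or> 0 <= v (ups_poly p * f)"
proof (cases "f = 0")
 case True
 thus ?thesis using that[of 1] by simp
next
 case False
 obtain S where S: "finite S" "!!v. v : W ==> v f < 0 ==> EX c. (c, v f) : S & 0 < v (ups7 - cst c)"
  using finite_polar_data[OF f False] by metis
 define F where "F = (%(c, n). [:- c, 1:] ^ nat (- n) :: complex poly)"
 have Fnz: "F s ~= 0" for s by (cases s) (simp add: F_def)
 define p where "p = prod F S"
 have p: "prod F T ~= 0" for T using Fnz by (cases "finite T") auto
 have "0 <= v (ups_poly p * f)" if v: "v : W" for v
 proof -
  note vv = W_valuation[OF v]
  have m: "v (ups_poly p * f) = v (ups_poly p) + v f"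
   by (rule valuation_mult[OF vv]) (use f False p MG_M14[OF ups_poly_MG] in \<open>auto simp: p_def\<close>)
  show ?thesis
  proof (cases "v f < 0")
   case False
   thus ?thesis using W_ups_poly[OF v p] m by (simp add: p_def)
  next
   case True
   then obtain c where c: "(c, v f) : S" "0 < v (ups7 - cst c)" using S(2)[OF v] by blast
   have "p = F (c, v f) * prod F (S - {(c, v f)})" unfolding p_def by (rule prod.remove[OF S(1) c(1)])
   hence "ups_poly p = (ups7 - cst c) ^ nat (- v f) * ups_poly (prod F (S - {(c, v f)}))"
    by (simp add: F_def pev_mult pev_power const_mero_minus)
   moreover have u: "ups7 - cst c : M14" "ups7 - cst c ~= 0"
    using MG_M14[OF upsilon7_MG] M14_const M14_closed(7) ups_poly_nz[of "[:- c, 1:]"] unfolding ups_poly_linear by auto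
   ultimately have "v (ups_poly p) = int (nat (- v f)) * v (ups7 - cst c) + v (ups_poly (prod F (S - {(c, v f)})))"
    using valuation_mult[OF vv, of "(ups7 - cst c) ^ nat (- v f)"] valuation_power[OF vv M14_subfield u]
     M14_closed(9)[OF u(1)] MG_M14[OF ups_poly_MG] p ups_poly_nz by simp
   moreover have "0 <= v (ups_poly (prod F (S - {(c, v f)})))" by (rule W_ups_poly[OF v p])
   moreover have "int (nat (- v f)) * 1 <= int (nat (- v f)) * v (ups7 - cst c)"
    using c(2) by (intro mult_left_mono) auto
   ultimately show ?thesis unfolding m using True by linarith
  qed
 qed
 thus ?thesis using that[of p] p[of S, folded p_def] by blast
qed

section \<open>The extension generated by psi, upsilon and Delta\<close>

lemma const_mero_sum: "cst (sum f I) = (\<Sum>i\<in>I. cst (f i))"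
 by (induction I rule: infinite_finite_induct) (simp_all add: const_mero_add)

text \<open>The induction step eliminates the leading coefficients by means of an element of lowest order.\<close>

lemma lin_dep:
 fixes g :: "'i => mero_uhp"
 assumes K: "valuation_on K v" "is_subfield K" "range cst <= K" "residual K v"
 shows "finite I ==> (!!i. i : I ==> g i : K) ==> (!!i. i : I ==> g i = 0 \<or> 1 - int n <= v (g i)) ==>
  (!!c. (\<Sum>i\<in>I. cst (c i) * g i) = 0 \<or> v (\<Sum>i\<in>I. cst (c i) * g i) <= 0) ==> n < card I ==>
  EX c. (EX i:I. c i ~= 0) & (\<Sum>i\<in>I. cst (c i) * g i) = 0"
proof (induction n arbitrary: I g)
 case 0
 then obtain i where i: "i : I" by (metis card.empty equals0I less_irrefl)
 define c where "c = (%j. if j = i then 1 else 0 :: complex)"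
 have "(\<Sum>j\<in>I. cst (c j) * g j) = (\<Sum>j\<in>I. if j = i then g i else 0)"
  by (rule sum.cong) (auto simp: c_def)
 hence s: "(\<Sum>j\<in>I. cst (c j) * g j) = g i" using i 0(1) by simp
 have "g i = 0" using 0(4)[of c] 0(3)[OF i] unfolding s by auto
 thus ?case using s i by (intro exI[of _ c]) (auto simp: c_def)
next
 case (Suc n)
 show ?case
 proof (cases "ALL i:I. g i = 0 \<or> 1 - int n <= v (g i)")
  case True
  show ?thesis by (rule Suc.IH) (use Suc.prems True in auto)
 next
  case False
  then obtain k where k: "k : I" "g k ~= 0" "v (g k) < 1 - int n" by auto
  have vk: "v (g k) = - int n" using Suc.prems(3)[OF k(1)] k by auto
  have "EX a. g i - cst a * g k = 0 \<or> v (g k) < v (g i - cst a * g k)" if i: "i : I" for i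
  proof -
   have "g i = 0 \<or> v (g k) <= v (g i)" using Suc.prems(3)[OF i] vk by auto
   thus ?thesis using K(4) Suc.prems(2)[OF i] Suc.prems(2)[OF k(1)] k(2) unfolding residual_def by blast
  qed
  then obtain a where a: "!!i. i : I ==> g i - cst (a i) * g k = 0 \<or> v (g k) < v (g i - cst (a i) * g k)" by metis
  define h where "h = (%i. g i - cst (a i) * g k)"
  define J where "J = I - {k}"
  define ext where "ext = (%c i. if i = k then - (\<Sum>j\<in>J. c j * a j) else c i)"
  have J: "finite J" "k ~: J" using Suc.prems(1) by (auto simp: J_def)
  have ext: "(\<Sum>i\<in>I. cst (ext c i) * g i) = (\<Sum>i\<in>J. cst (c i) * h i)" for c
  proof -
   have "(\<Sum>i\<in>I. cst (ext c i) * g i) = cst (ext c k) * g k + (\<Sum>i\<in>J. cst (ext c i) * g i)"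
    unfolding J_def by (rule sum.remove[OF Suc.prems(1) k(1)])
   also have "(\<Sum>i\<in>J. cst (ext c i) * g i) = (\<Sum>i\<in>J. cst (c i) * g i)"
    using J(2) by (intro sum.cong) (auto simp: ext_def)
   also have "cst (ext c k) * g k = - (\<Sum>i\<in>J. cst (c i) * cst (a i) * g k)"
    by (simp add: ext_def const_mero_minus const_mero_sum const_mero_mult sum_distrib_right)
   finally show ?thesis by (simp add: h_def right_diff_distrib sum_subtractf mult.assoc)
  qed
  have "EX c. (EX i:J. c i ~= 0) & (\<Sum>i\<in>J. cst (c i) * h i) = 0"
  proof (rule Suc.IH)
   show "h i : K" if "i : J" for i
    unfolding h_def using that Suc.prems(2) k(1) K(3) by (auto intro!: is_subfieldD[OF K(2)] simp: J_def)
   show "h i = 0 \<or> 1 - int n <= v (h i)" if "i : J" for i using a[of i] that vk by (auto simp: h_def J_def)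
   show "(\<Sum>i\<in>J. cst (c i) * h i) = 0 \<or> v (\<Sum>i\<in>J. cst (c i) * h i) <= 0" for c
    using Suc.prems(4)[of "ext c"] unfolding ext .
   show "n < card J" using Suc.prems(1,5) k(1) by (simp add: J_def)
  qed (use J in simp)
  then obtain c i where "i : J" "c i ~= 0" "(\<Sum>i\<in>J. cst (c i) * h i) = 0" by blast
  thus ?thesis unfolding ext[symmetric] using J by (intro exI[of _ "ext c"]) (auto simp: ext_def J_def)
 qed
qed

lemma coeff_sum_monom: "coeff (\<Sum>j\<le>N. monom (c j) j) k = (if k <= N then c k else (0::complex))"
 by (simp add: coeff_sum if_distrib sum.delta cong: if_cong)

text \<open>Once poles are cleared, the products of upsilon^j, j <= N, with the 15 functions are
  regular outside infinity and have pole order at most 14 N + N there. By \<open>vinf_nonpos\<close>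
  and \<open>lin_dep\<close> at most 15 N + 1 of them can be independent, but there are 15 N +
  15.\<close>

lemma ups_dependent:
 fixes f :: "nat => mero_uhp"
 assumes f: "!!i. i < 15 ==> f i : MG"
 obtains p :: "nat => complex poly" where "EX i<15. p i ~= 0" "(\<Sum>i<15. ups_poly (p i) * f i) = 0"
proof -
 have "EX p. p ~= 0 & (ALL v:W. ups_poly p * f i = 0 \<or> 0 <= v (ups_poly p * f i))" if "i < 15" for i
  using clear_poles[OF MG_M14[OF f[OF that]]] by metis
 then obtain P where P: "!!i. i < 15 ==> P i ~= 0"
  "!!i v. i < 15 ==> v : W ==> ups_poly (P i) * f i = 0 \<or> 0 <= v (ups_poly (P i) * f i)" by metis
 define g where "g = (%i. ups_poly (P i) * f i)"
 have gM: "g i : MG" if "i < 15" for i using f[OF that] by (auto simp: g_def intro: MG_closed ups_poly_MG)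
 define N where "N = (\<Sum>i<15. nat \<bar>vinf (g i)\<bar>)"
 have N: "- int N <= vinf (g i)" if "i < 15" for i
 proof -
  have "nat \<bar>vinf (g i)\<bar> <= N" unfolding N_def using that by (intro member_le_sum) auto
  thus ?thesis by linarith
 qed
 define I where "I = {..<15::nat} \<times> {..N}"
 define G where "G = (%(i, j). ups7 ^ j * g i)"
 have GM: "G s : MG" if "s : I" for s
  using that gM by (auto simp: I_def G_def intro: MG_closed upsilon7_MG)
 have uW: "ups7 ^ j = ups_poly (monom 1 j)" for j by (simp add: pev_monom)
 have GW: "G s = 0 \<or> 0 <= v (G s)" if s: "s : I" and v: "v : W" for s v
 proof -
  obtain i j where ij: "s = (i, j)" "i < 15" using s by (auto simp: I_def)
  show ?thesis
  proof (cases "g i = 0")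
   case False
   have "v (ups_poly (monom 1 j) * g i) = v (ups_poly (monom 1 j)) + v (g i)"
    by (rule valuation_mult[OF W_valuation[OF v]]) (use False ij gM MG_M14 ups_poly_MG in \<open>auto simp: monom_eq_0_iff\<close>)
   moreover have "g i = 0 \<or> 0 <= v (g i)" using P(2)[OF ij(2) v] by (simp only: g_def)
   ultimately show ?thesis using False W_ups_poly[OF v, of "monom 1 j"]
    by (simp add: G_def ij uW monom_eq_0_iff)
  qed (simp add: G_def ij)
 qed
 have "EX c. (EX s:I. c s ~= 0) & (\<Sum>s\<in>I. cst (c s) * G s) = 0"
 proof (rule lin_dep[OF vinf_valuation M14_subfield range_const_M14 iinf.residual_ord, where n = "15 * N + 1"])
  show "finite I" by (simp add: I_def)
  show "G s : M14" if "s : I" for s using MG_M14[OF GM[OF that]] .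
  show "G s = 0 \<or> 1 - int (15 * N + 1) <= vinf (G s)" if s: "s : I" for s
  proof -
   obtain i j where ij: "s = (i, j)" "i < 15" "j <= N" using s by (auto simp: I_def)
   show ?thesis
   proof (cases "g i = 0")
    case False
    have "vinf (ups_poly (monom 1 j) * g i) = vinf (ups_poly (monom 1 j)) + vinf (g i)"
     by (rule valuation_mult[OF vinf_valuation]) (use False ij gM MG_M14 ups_poly_MG in \<open>auto simp: monom_eq_0_iff\<close>)
    thus ?thesis using N[OF ij(2)] ij(3) vinf_ups_poly[of "monom 1 j"]
     by (simp add: G_def ij(1) uW monom_eq_0_iff degree_monom_eq)
   qed (simp add: G_def ij)
  qed
  show "15 * N + 1 < card I" by (simp add: I_def)
  fix c
  define S where "S = (\<Sum>s\<in>I. cst (c s) * G s)"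
  have S: "S : MG" unfolding S_def by (intro MG_closed(10) MG_closed(4) MG_const GM)
  have "S = 0 \<or> 0 <= v S" if v: "v : W" for v
   unfolding S_def
  proof (rule valuation_sum_ge[OF W_valuation[OF v] M14_subfield])
   fix s assume s: "s : I"
   show "cst (c s) * G s : M14 & (cst (c s) * G s = 0 \<or> 0 <= v (cst (c s) * G s))"
    using GW[OF s v] MG_M14[OF GM[OF s]] M14_const M14_closed(1,4) valuation_const[OF W_valuation[OF v], of "c s"]
     valuation_mult[OF W_valuation[OF v], of "cst (c s)" "G s"]
    by (cases "c s = 0"; cases "G s = 0") auto
  qed
  thus "S = 0 \<or> vinf S <= 0" using vinf_nonpos[OF S] by blast
 qed
 then obtain c k l where c: "(k, l) : I" "c (k, l) ~= 0" "(\<Sum>s\<in>I. cst (c s) * G s) = 0" by (metis surj_pair)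
 define q where "q = (%i. \<Sum>j\<le>N. monom (c (i, j)) j)"
 have "coeff (q k) l = c (k, l)" using c(1) by (simp add: q_def coeff_sum_monom I_def)
 hence "q k ~= 0" using c(2) by auto
 hence 1: "EX i<15. q i * P i ~= 0" using P(1) c(1) by (intro exI[of _ k]) (auto simp: I_def)
 have "(\<Sum>i<15. ups_poly (q i * P i) * f i) = (\<Sum>i<15. \<Sum>j\<le>N. cst (c (i, j)) * G (i, j))"
  by (rule sum.cong) (auto simp: pev_mult q_def pev_sum pev_monom G_def g_def sum_distrib_right sum_distrib_left mult_ac)
 also have "\<dots> = 0" using c(3) unfolding I_def sum.cartesian_product by (simp add: case_prod_unfold)
 finally show ?thesis using that[of "%i. q i * P i"] 1 by simp
qed

section \<open>The fourteen basis functions\<close>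

lemma mero_numeral_nz [simp]: "(numeral n :: mero_uhp) ~= 0"
 unfolding const_mero_numeral[symmetric] by simp

definition cpoly :: "complex poly" where "cpoly = [:1, 5, - 8, 1:]"

lemma cpoly_nz: "cpoly ~= 0" and degree_cpoly: "degree cpoly = 3"
 by (simp_all add: cpoly_def)

lemma ups_cpoly: "ups_poly cpoly = ups7 ^ 3 - 8 * ups7 ^ 2 + 5 * ups7 + 1"
 by (simp add: cpoly_def const_mero_minus const_mero_numeral algebra_simps power2_eq_square power3_eq_cube)

lemma ups_X: "ups_poly [:0, 1:] = ups7" and ups_X1: "ups_poly [:- 1, 1:] = ups7 - 1"
 by (simp_all add: const_mero_minus)

text \<open>A 7th root times a square root over C(upsilon). The second factor is Delta rescaled so
  that its square is a polynomial in upsilon, whence \<open>zz ^ 14\<close> is one too.\<close>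

definition zz :: mero_uhp where "zz = psi7 * (ups7 ^ 2 * Delta7 / (2 * (ups7 - 1)))"

lemma Delta_scaled_square: "(ups7 ^ 2 * Delta7 / (2 * (ups7 - 1))) ^ 2 = ups7 * (ups7 - 1) * ups_poly cpoly"
proof -
 define d where "d = ups7 ^ 2 * Delta7 / (2 * (ups7 - 1))"
 have nz: "ups7 - 1 ~= 0" using upsilon7_nz by simp
 have D: "Delta7 ^ 2 * ups7 ^ 3 = 4 * ((ups7 - 1) ^ 3 * ups_poly cpoly)"
  unfolding Delta7_square ups_cpoly using upsilon7_nz by simp
 have "d * (2 * (ups7 - 1)) = ups7 ^ 2 * Delta7" using nz by (simp add: d_def)
 hence "(d * (2 * (ups7 - 1))) ^ 2 = (ups7 ^ 2 * Delta7) ^ 2" by simp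
 hence "d ^ 2 * (2 ^ 2 * (ups7 - 1) ^ 2) = (ups7 ^ 2 * Delta7) ^ 2" unfolding power_mult_distrib .
 also have "(a ^ 2 * b) ^ 2 = a * (b ^ 2 * a ^ 3)" for a b :: mero_uhp by (simp add: eval_nat_numeral mult_ac)
 also have "ups7 * (Delta7 ^ 2 * ups7 ^ 3) = ups7 * (ups7 - 1) * ups_poly cpoly * (2 ^ 2 * (ups7 - 1) ^ 2)"
 proof -
  have "a * (4 * (w ^ 3 * c)) = a * w * c * (4 * w ^ 2)" for a w c :: mero_uhp by (simp add: eval_nat_numeral mult_ac)
  moreover have "(2 :: mero_uhp) ^ 2 = 4" by simp
  ultimately show ?thesis unfolding D by (simp only:)
 qed
 finally show ?thesis unfolding d_def[symmetric] using nz by simp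
qed

lemma zz_power: "zz ^ 14 = ups7 ^ 15 * (ups7 - 1) ^ 9 * ups_poly cpoly ^ 7"
proof -
 define d where "d = ups7 ^ 2 * Delta7 / (2 * (ups7 - 1))"
 have "zz ^ 14 = (psi7 ^ 7) ^ 2 * (d ^ 2) ^ 7"
  unfolding zz_def d_def[symmetric] power_mult_distrib power_mult[symmetric] by simp
 also have "\<dots> = (ups7 ^ 4 * (ups7 - 1)) ^ 2 * (ups7 * (ups7 - 1) * ups_poly cpoly) ^ 7"
  unfolding psi7_power_7 d_def Delta_scaled_square ..
 also have "(a ^ 4 * b) ^ 2 * (a * b * c) ^ 7 = a ^ 15 * b ^ 9 * c ^ 7" for a b c :: mero_uhp
 proof -
  have "(a ^ 4 * b) ^ 2 * (a * b * c) ^ 7 = (a ^ (4 * 2) * a ^ 7) * (b ^ 2 * b ^ 7) * c ^ 7"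
   by (simp only: power_mult_distrib power_mult[symmetric] mult_ac)
  thus ?thesis by simp
 qed
 finally show ?thesis .
qed

text \<open>\<open>zz ^ m\<close> with as many factors upsilon, upsilon - 1 and \<open>cpoly\<close>
  removed as integrality permits: in \<open>bb m ^ 14\<close> the exponents are reduced modulo
  14.\<close>

definition bb :: "nat => mero_uhp" where
 "bb m = zz ^ m / (ups7 ^ (15 * m div 14) * (ups7 - 1) ^ (9 * m div 14) * ups_poly cpoly ^ (7 * m div 14))"

definition BB :: "nat => complex poly" where
 "BB m = [:0, 1:] ^ (15 * m mod 14) * [:- 1, 1:] ^ (9 * m mod 14) * cpoly ^ (7 * m mod 14)"

text \<open>The degree of \<open>BB m\<close>, which is also the pole order of \<open>bb m\<close>
  at infinity in q^(1/14).\<close>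

definition ww :: "nat => nat" where "ww m = 15 * m mod 14 + 9 * m mod 14 + 3 * (7 * m mod 14)"

lemma BB_nz: "BB m ~= 0" and degree_BB: "degree (BB m) = ww m"
 by (simp_all add: BB_def ww_def cpoly_nz degree_mult_eq degree_power_eq degree_cpoly)

lemma bb_power: "bb m ^ 14 = ups_poly (BB m)"
proof -
 have pd: "x ^ k / (x ^ (k div 14)) ^ 14 = x ^ (k mod 14)" if "x ~= 0" for x :: mero_uhp and k
 proof -
  have "x ^ k = x ^ (14 * (k div 14) + k mod 14)" by simp
  also have "\<dots> = (x ^ (k div 14)) ^ 14 * x ^ (k mod 14)" by (simp only: power_add power_mult[symmetric] mult.commute)
  finally show ?thesis using that by simp
 qed
 have c: "ups_poly cpoly ~= 0" using cpoly_nz by simp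
 have "(zz ^ m) ^ 14 = (zz ^ 14) ^ m" by (simp only: power_mult[symmetric] mult.commute)
 also have "\<dots> = ups7 ^ (15 * m) * (ups7 - 1) ^ (9 * m) * ups_poly cpoly ^ (7 * m)"
  unfolding zz_power by (simp only: power_mult_distrib power_mult[symmetric])
 finally have "bb m ^ 14 = (ups7 ^ (15 * m) / (ups7 ^ (15 * m div 14)) ^ 14) *
   ((ups7 - 1) ^ (9 * m) / ((ups7 - 1) ^ (9 * m div 14)) ^ 14) * (ups_poly cpoly ^ (7 * m) / (ups_poly cpoly ^ (7 * m div 14)) ^ 14)"
  unfolding bb_def power_divide power_mult_distrib times_divide_times_eq by simp
 also have "\<dots> = ups7 ^ (15 * m mod 14) * (ups7 - 1) ^ (9 * m mod 14) * ups_poly cpoly ^ (7 * m mod 14)"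
  using upsilon7_nz c by (subst pd, simp)+ simp
 also have "\<dots> = ups_poly (BB m)" unfolding BB_def pev_mult pev_power ups_X ups_X1 ..
 finally show ?thesis .
qed

lemma bb_nz: "bb m ~= 0"
proof
 assume "bb m = 0"
 hence "ups_poly (BB m) = 0" using bb_power[of m] by simp
 thus False using BB_nz by simp
qed

lemma zz_MG: "zz : MG"
proof -
 have "2 : MG" using MG_const[of 2] by (simp add: const_mero_numeral)
 thus ?thesis unfolding zz_def by (intro MG_closed upsilon7_MG psi7_MG Delta7_MG)
qed

lemma bb_MG: "bb m : MG"
 unfolding bb_def by (intro MG_closed(2,4,7,8,9) zz_MG upsilon7_MG ups_poly_MG)

lemma bb_0 [simp]: "bb 0 = 1"
 by (simp add: bb_def)

text \<open>Modulo 14, \<open>ww m\<close> is 45 m = 3 m, and 5 is the inverse of 3.\<close>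

lemma ww_inj: "m < 14 ==> m' < 14 ==> ww m mod 14 = ww m' mod 14 ==> m = m'"
proof -
 have w: "ww m mod 14 = 45 * m mod 14" for m
 proof -
  have "ww m mod 14 = (15 * m + 9 * m + 3 * (7 * m)) mod 14"
   unfolding ww_def by (intro mod_add_cong mod_mult_cong) simp_all
  also have "15 * m + 9 * m + 3 * (7 * m) = 45 * m" by simp
  finally show ?thesis .
 qed
 have r: "(5 * (45 * m mod 14)) mod 14 = m mod 14" for m :: nat
 proof -
  have "(5 * (45 * m mod 14)) mod 14 = (5 * (45 * m)) mod 14" by (rule mod_mult_right_eq)
  also have "5 * (45 * m) = m + 14 * (16 * m)" by simp
  also have "\<dots> mod 14 = m mod 14" by (rule mod_mult_self2)
  finally show ?thesis .
 qed
 assume m: "m < 14" "m' < 14" "ww m mod 14 = ww m' mod 14"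
 have "m mod 14 = (5 * (ww m mod 14)) mod 14" unfolding w r ..
 also have "\<dots> = m' mod 14" unfolding m(3) unfolding w r ..
 finally show "m = m'" unfolding mod_less[OF m(1)] mod_less[OF m(2)] .
qed

lemma valuation_bb:
 assumes v: "valuation_on MG v" "v ups7 < 0"
 shows   "14 * v (bb m) = int (ww m) * v ups7"
proof -
 have "14 * v (bb m) = v (bb m ^ 14)" using valuation_power[OF v(1) MG_subfield bb_MG bb_nz] by simp
 also have "\<dots> = int (ww m) * v ups7"
  unfolding bb_power degree_BB[symmetric]
  by (rule pev_valuation_neg(2)[OF v(1) MG_subfield range_const_MG upsilon7_MG upsilon7_nz(1) v(2) BB_nz])
 finally show ?thesis .
qed

text \<open>Degrees contribute multiples of 14 and the \<open>ww m\<close> are distinct modulo 14,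
  so no two terms have the same value and the largest 14 deg + \<open>ww\<close> wins. It holds for
  every valuation with a pole of upsilon, not only \<open>vinf\<close>, because
  \<open>pole_unique\<close> compares the two.\<close>

lemma valuation_bb_sum:
 assumes v: "valuation_on MG v" "v ups7 < 0" and q: "EX m<14. q m ~= 0"
 defines "S \<equiv> \<Sum>m<14. ups_poly (q m) * bb m"
 shows "S ~= 0" "EX m<14. q m ~= 0 & 14 * v S = int (14 * degree (q m) + ww m) * v ups7 \<and>
  (ALL j<14. q j ~= 0 --> 14 * degree (q j) + ww j <= 14 * degree (q m) + ww m)"
proof -
 define f where "f = (%m. ups_poly (q m) * bb m)"
 have fM: "f m : MG" for m unfolding f_def by (intro MG_closed(4) ups_poly_MG bb_MG)
 have f0: "f m = 0 \<longleftrightarrow> q m = 0" for m using bb_nz by (simp add: f_def)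
 have vf: "14 * v (f m) = int (14 * degree (q m) + ww m) * v ups7" if "q m ~= 0" for m
 proof -
  have "v (f m) = v (ups_poly (q m)) + v (bb m)"
   unfolding f_def using that bb_nz by (intro valuation_mult[OF v(1)] ups_poly_MG bb_MG) auto
  thus ?thesis using valuation_bb[OF v, of m] that
    pev_valuation_neg(2)[OF v(1) MG_subfield range_const_MG upsilon7_MG upsilon7_nz(1) v(2) that]
   by (simp add: algebra_simps)
 qed
 have inj: "i = j" if "i : {..<14}" "j : {..<14}" "f i ~= 0" "f j ~= 0" "v (f i) = v (f j)" for i j
 proof -
  have "int (14 * degree (q i) + ww i) * v ups7 = int (14 * degree (q j) + ww j) * v ups7"
   using vf[of i] vf[of j] that f0 by metis
  hence "14 * degree (q i) + ww i = 14 * degree (q j) + ww j"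
   using v(2) by (metis less_irrefl mult_right_cancel of_nat_eq_iff)
  hence "(14 * degree (q i) + ww i) mod 14 = (14 * degree (q j) + ww j) mod 14" by simp
  hence "ww i mod 14 = ww j mod 14" by simp
  from ww_inj[OF _ _ this] that(1,2) show ?thesis by (simp only: lessThan_iff)
 qed
 have ex: "EX i:{..<14}. f i ~= 0" using q f0 by auto
 note sd = valuation_sum_distinct[OF v(1) MG_subfield range_const_MG, of "{..<14}" f, OF finite_lessThan fM ex inj]
 show "S ~= 0" using sd(1) by (simp add: S_def f_def)
 obtain m where m0: "m : {..<14}" "f m ~= 0 & v (sum f {..<14}) = v (f m) & (ALL j:{..<14}. f j ~= 0 --> v (f m) <= v (f j))"
  using sd(2) by (rule bexE)
 have m: "m < 14" "f m ~= 0" "v (sum f {..<14}) = v (f m)" using m0 by simp_all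
 have m4: "v (f m) <= v (f j)" if "j < 14" "f j ~= 0" for j
  using m0(2) that unfolding lessThan_iff Ball_def by blast
 have "14 * degree (q j) + ww j <= 14 * degree (q m) + ww m" if "j < 14" "q j ~= 0" for j
 proof -
  have "int (14 * degree (q m) + ww m) * v ups7 <= int (14 * degree (q j) + ww j) * v ups7"
   using m4[of j] vf[of j] vf[of m] that m(2) f0 by auto
  thus ?thesis using v(2) by (simp add: mult_le_cancel_right)
 qed
 thus "EX m<14. q m ~= 0 & 14 * v S = int (14 * degree (q m) + ww m) * v ups7 \<and>
  (ALL j<14. q j ~= 0 --> 14 * degree (q j) + ww j <= 14 * degree (q m) + ww m)"
  using m(1,2,3) vf[of m] f0 unfolding S_def f_def by (intro exI[of _ m]) auto
qed

lemma vinf_MG: "valuation_on MG vinf"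
 using valuation_on_subset[OF vinf_valuation] MG_M14 by auto

lemma vinf_bb: "vinf (bb m) = - int (ww m)"
 using valuation_bb[OF vinf_MG, of m] by (simp add: vinf_upsilon7)

text \<open>\<open>f\<close> and the \<open>bb m\<close> are 15 functions, hence dependent;
  independence of the \<open>bb m\<close> makes the coefficient of \<open>f\<close> nonzero.\<close>

lemma bb_spans:
 assumes f: "f : MG"
 obtains p q where "p ~= 0" "ups_poly p * f = (\<Sum>m<14. ups_poly (q m) * bb m)"
proof -
 obtain r where r: "EX i<15. r i ~= 0" "(\<Sum>i<15. ups_poly (r i) * (if i = 14 then f else bb i)) = 0"
  by (rule ups_dependent[of "%i. if i = 14 then f else bb i"]) (use f bb_MG in auto)
 have "{..<15::nat} = insert 14 {..<14}" by auto
 hence s: "ups_poly (r 14) * f + (\<Sum>m<14. ups_poly (r m) * bb m) = 0" using r(2) by simp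
 have "r 14 ~= 0"
 proof
  assume 0: "r 14 = 0"
  obtain i where i: "i < 15" "r i ~= 0" using r(1) by blast
  have "i ~= 14" using i 0 by auto
  hence "EX m<14. r m ~= 0" using i by (intro exI[of _ i]) auto
  from valuation_bb_sum(1)[OF vinf_MG _ this] show False using s 0 by (simp add: vinf_upsilon7)
 qed
 moreover have "ups_poly (r 14) * f = (\<Sum>m<14. ups_poly (- r m) * bb m)"
  using s by (simp add: eq_neg_iff_add_eq_0 sum_negf pev_smult[of _ "- 1", simplified] const_mero_minus)
 ultimately show ?thesis using that[of "r 14" "%m. - r m"] by blast
qed

section \<open>The field generated by psi, upsilon and Delta\<close>

lemma complex_adjoin_subfield: "is_subfield (complex_adjoin S)"
 unfolding complex_adjoin_def by (rule hull_in) (auto simp: is_subfield_def)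

lemma complex_adjoin_incl: "cst c : complex_adjoin S" "s : S ==> s : complex_adjoin S"
 using hull_subset[of "range cst \<union> S" is_subfield] by (auto simp: complex_adjoin_def)

lemma complex_adjoin_minimal:
 assumes "S <= K" "range cst <= K" "is_subfield K"
 shows   "complex_adjoin S <= K"
 unfolding complex_adjoin_def using assms by (intro hull_minimal) auto

lemma MG_eq_adjoin: "MG = complex_adjoin {psi7, ups7, Delta7}"
proof
 show "complex_adjoin {psi7, ups7, Delta7} <= MG"
  by (rule complex_adjoin_minimal) (use psi7_MG upsilon7_MG Delta7_MG MG_const MG_subfield in auto)
 let ?K = "complex_adjoin {psi7, ups7, Delta7}"
 note K = complex_adjoin_subfield[of "{psi7, ups7, Delta7}"]
 note cl = is_subfieldD[OF K]
 have c: "range cst <= ?K" using complex_adjoin_incl(1) by auto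
 have g: "psi7 : ?K" "ups7 : ?K" "Delta7 : ?K" by (auto intro: complex_adjoin_incl)
 have p: "ups_poly p : ?K" for p by (rule pev_in[OF K c g(2)])
 have "2 : ?K" using complex_adjoin_incl(1)[of 2] by (simp add: const_mero_numeral)
 hence "zz : ?K" unfolding zz_def using g cl by (intro cl) auto
 hence b: "bb m : ?K" for m unfolding bb_def by (intro cl(2,4,7,8,9) g p)
 show "MG <= ?K"
 proof
  fix f assume "f : MG"
  then obtain p' q where q: "p' ~= 0" "ups_poly p' * f = (\<Sum>m<14. ups_poly (q m) * bb m)" using bb_spans by metis
  have "f = (\<Sum>m<14. ups_poly (q m) * bb m) / ups_poly p'" unfolding q(2)[symmetric] using q(1) by simp
  also have "\<dots> : ?K" by (intro cl(4,8,10) p b)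
  finally show "f : ?K" .
 qed
qed

text \<open>
  Translations act on the \<open>bb m\<close> by distinct characters, so the components of a regular function are regular;
  as the zeros of \<open>bb m ^ 14\<close> have order less than 14, the components have no denominators.
\<close>

lemma algebraic_imp_const:
 assumes "p ~= 0" "pev r p = 0"
 shows   "EX c. r = cst c"
 using assms
proof (induction "degree p" arbitrary: p rule: less_induct)
 case less
 have "~ constant (poly p)"
 proof
  assume "constant (poly p)"
  then obtain a where "p = [:a:]" by (metis constant_degree degree_eq_zeroE)
  thus False using less.prems by simp
 qed
 from Fundamental_Theorem_Algebra.fundamental_theorem_of_algebra[OF this] obtain c where "poly p c = 0" ..
 then obtain q where q: "p = [:- c, 1:] * q" by (meson dvdE poly_eq_0_iff_dvd)
 have "q ~= 0" using q less.prems by auto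
 hence "degree q < degree p" unfolding q by (subst degree_mult_eq) auto
 moreover have "(r - cst c) * pev r q = 0" using less.prems(2) unfolding q pev_mult by (simp add: const_mero_minus)
 ultimately show ?case using less.hyps[of q] \<open>q ~= 0\<close> by auto
qed

lemma mslash_upsilon7_shift: "mslash ups7 (shiftm n) = ups7"
proof (rule eval_mero_ext)
 fix z assume z: "z : \<H>"
 have "z + of_int n : \<H>" using z by (simp add: upper_half_plane_def)
 moreover have "ee (z + of_int n) = ee z" by (simp add: ee_add)
 ultimately show "evm (mslash ups7 (shiftm n)) z = evm ups7 z"
  using z by (simp add: eval_mslash eval_upsilon7 upsf_Uq)
qed

lemma mslash_ups_poly_shift: "mslash (ups_poly p) (shiftm n) = ups_poly p"
 by (induction p) (simp_all add: mslash_add mslash_mult mslash_0 mslash_const mslash_upsilon7_shift)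

text \<open>\<open>bb m ^ 14\<close> is a polynomial in the translation-invariant upsilon, so the
  quotient of \<open>bb m\<close> and its translate is a 14th root of unity, hence constant. The
  leading coefficients tell which one.\<close>

lemma mslash_bb_shift: "mslash (bb m) (shiftm n) = cst (ee (of_int (- n * int (ww m)) / 14)) * bb m"
proof -
 define r where "r = mslash (bb m) (shiftm n) / bb m"
 have "mslash (bb m) (shiftm n) ^ 14 = bb m ^ 14"
  using mslash_ups_poly_shift[of "BB m" n] unfolding bb_power[symmetric] by (simp add: mslash_power)
 hence "r ^ 14 = 1" using bb_nz by (simp add: r_def power_divide)
 hence "pev r (monom 1 14 - 1) = 0"
  using pev_add[of r "monom 1 14 - 1" 1] by (simp add: pev_monom)
 moreover have "monom 1 14 - 1 ~= (0 :: complex poly)"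
 proof
  assume "monom 1 14 - 1 = (0 :: complex poly)"
  hence "coeff (monom 1 14 - 1 :: complex poly) 14 = 0" by simp
  thus False by simp
 qed
 ultimately obtain c where c: "r = cst c" using algebraic_imp_const by blast
 hence eq: "mslash (bb m) (shiftm n) = cst c * bb m" using bb_nz by (simp add: r_def field_simps)
 obtain d where d: "d ~= 0" "((%z. evm (bb m) z * ee (z / 14) powi (- vinf (bb m))) ---> d) at_iinf"
  using iinf.ord_limit[OF MG_M14[OF bb_MG] bb_nz] by metis
 have "((%z. c * (evm (bb m) z * ee (z / 14) powi (- vinf (bb m)))) ---> c * d) at_iinf"
  by (intro tendsto_intros d)
 hence "((%z. evm (mslash (bb m) (shiftm n)) z * ee (z / 14) powi (- vinf (bb m))) ---> c * d) at_iinf"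
  unfolding eq
  by (rule Lim_transform_eventually)
    (use iinf.ev_mult[OF M14_const MG_M14[OF bb_MG], of c m] iinf.ev_const[of c] in \<open>eventually_elim, simp\<close>)
 from tendsto_unique[OF at_iinf_neq_bot this iinf_shift_limit[OF d(2), of n]] d(1)
 have "c = ee (of_int (n * vinf (bb m)) / 14)" by simp
 thus ?thesis unfolding eq by (simp add: vinf_bb)
qed

text \<open>A translation moves points to points. On cusps, left multiplication by it keeps the
  lower left entry, and when 7 divides that entry also the upper left one modulo 7, so
  \<open>Cinf\<close> is respected.\<close>

lemma W_shift:
 assumes v: "v : W"
 shows   "EX v':W. ALL f:M14 - {0}. v (mslash f (shiftm n)) = v' f"
proof -
 consider p where "p : \<H>" "v = vpt p" | A where "A : SL2Z" "A ~: Cinf" "v = vcusp A"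
  using v unfolding W_def by blast
 thus ?thesis
 proof cases
  case 1
  have "vpt (p + of_int n) : W" using 1 by (auto simp: W_def upper_half_plane_def)
  thus ?thesis using vpt_slash[OF shiftm_SL2Z 1(1)] 1 by (intro bexI[of _ "vpt (p + of_int n)"]) auto
 next
  case 2
  have e: "(shiftm n ** A) $ 1 $ 1 = A $ 1 $ 1 + n * A $ 2 $ 1" "(shiftm n ** A) $ 2 $ 1 = A $ 2 $ 1"
   by (simp_all add: mat2_mult_nth shiftm_def)
  have "[A $ 1 $ 1 + n * A $ 2 $ 1 = k] (mod 7) \<longleftrightarrow> [A $ 1 $ 1 = k] (mod 7)" if "7 dvd A $ 2 $ 1" for k
  proof -
   have "[n * A $ 2 $ 1 = 0] (mod 7)" using that by (simp add: cong_0_iff)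
   from cong_add[OF cong_refl this, of "A $ 1 $ 1"]
   have "(A $ 1 $ 1 + n * A $ 2 $ 1) mod 7 = A $ 1 $ 1 mod 7" by (simp add: Cong.cong_def)
   thus ?thesis by (simp only: Cong.cong_def)
  qed
  hence "shiftm n ** A ~: Cinf" using 2 by (auto simp: Cinf_def e)
  hence "vcusp (shiftm n ** A) : W" using 2 SL2Z_mult[OF shiftm_SL2Z 2(1)] by (auto simp: W_def)
  thus ?thesis using 2 by (intro bexI[of _ "vcusp (shiftm n ** A)"]) (auto simp: vcusp_def mslash_mslash)
 qed
qed

text \<open>Otherwise 1/(upsilon - c) would be regular on \<open>W\<close> and vanish at infinity,
  against \<open>vinf_nonpos\<close>.\<close>

lemma W_above: "EX v:W. 0 < v (ups7 - cst c)"
proof (rule ccontr)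
 assume *: "~ ?thesis"
 define h where "h = ups_poly [:- c, 1:]"
 have h: "h : MG" "h ~= 0" unfolding h_def by (rule ups_poly_MG, rule ups_poly_nz) simp
 have vh: "v h = 0" if "v : W" for v
  using * W_ups_poly[OF that, of "[:- c, 1:]"] that unfolding h_def ups_poly_linear by force
 have "vinf (inverse h) <= 0"
 proof (rule vinf_nonpos)
  show "0 <= v (inverse h)" if "v : W" for v
   using valuation_inverse[OF W_valuation[OF that] M14_subfield MG_M14[OF h(1)] h(2)] vh[OF that] by simp
 qed (use h MG_closed in auto)
 moreover have "vinf (inverse h) = 14"
  using valuation_inverse[OF vinf_valuation M14_subfield MG_M14[OF h(1)] h(2)] vinf_ups_poly[of "[:- c, 1:]"] by (simp add: h_def)
 ultimately show False by simp
qed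

text \<open>Write r(t) = r(c) + (t - c) s(t): the first summand has value 0, and the second is zero
  or has positive value.\<close>

lemma valuation_pev_unit:
 assumes v: "valuation_on K v" "is_subfield K" "range cst <= K" and t: "t : K" "t ~= cst c" "0 < v (t - cst c)"
  and r: "poly r c ~= 0"
 shows   "pev t r ~= 0" "v (pev t r) = 0"
proof -
 have tc: "t - cst c : K" "t - cst c ~= 0" using t v by (auto intro: is_subfieldD(7)[OF v(2)])
 have "poly (r - [:poly r c:]) c = 0" by simp
 then obtain q where q: "r - [:poly r c:] = [:- c, 1:] * q" by (meson dvdE poly_eq_0_iff_dvd)
 have "r = [:poly r c:] + [:- c, 1:] * q" unfolding q[symmetric] by simp
 hence "pev t r = pev t [:poly r c:] + pev t [:- c, 1:] * pev t q" by (metis pev_add pev_mult)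
 hence e: "pev t r = cst (poly r c) + (t - cst c) * pev t q" by (simp add: const_mero_minus)
 have qK: "pev t q : K" by (rule pev_in[OF v(2,3) t(1)])
 have vt: "t = 0 \<or> 0 <= v t"
 proof (cases "c = 0 \<or> t = 0")
  case False
  have "min (v (t - cst c)) (v (cst c)) <= v (t - cst c + cst c)"
   using False tc v(3) by (intro valuation_add[OF v(1)]) auto
  thus ?thesis using t(3) valuation_const[OF v(1), of c] False by simp
 qed (use t in auto)
 have "(t - cst c) * pev t q = 0 \<or> v (cst (poly r c)) < v ((t - cst c) * pev t q)"
  using pev_valuation_nonneg[OF v t(1) vt, of q] valuation_mult[OF v(1) tc qK] valuation_const[OF v(1) r] t(3)
  by (cases "pev t q = 0") auto
 from valuation_add_eq[OF v _ _ _ this] show "pev t r ~= 0" "v (pev t r) = 0"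
  unfolding e using v(3) r tc qK is_subfieldD(4)[OF v(2)] valuation_const[OF v(1) r] by auto
qed

text \<open>The factors have no common roots and are squarefree, so each multiplicity is one of the
  exponents reduced modulo 14.\<close>

lemma order_BB: "order c (BB m) < 14"
proof -
 have o1: "order c ([:- a, 1:] ^ k) = (if c = a then k else 0)" for a :: complex and k
  using order_power_n_n[of a k] by (auto intro!: order_0I)
 have oc: "order c cpoly <= 1"
 proof (rule ccontr)
  assume "~ order c cpoly <= 1"
  hence "[:- c, 1:] ^ 2 dvd cpoly" by (simp add: order_divides cpoly_nz)
  then obtain q where q: "cpoly = [:- c, 1:] ^ 2 * q" by auto
  have "poly cpoly c = 0" "poly (pderiv cpoly) c = 0" unfolding q by (simp_all add: pderiv_mult pderiv_power)
  hence 0: "c ^ 3 - 8 * c ^ 2 + 5 * c + 1 = 0" "3 * c ^ 2 - 16 * c + 5 = 0"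
   by (simp_all add: cpoly_def pderiv_pCons algebra_simps power2_eq_square power3_eq_cube)
  \<comment> \<open>A Bezout combination of \<open>cpoly\<close> and its derivative with constant
    value 49, which shows that \<open>cpoly\<close> is squarefree.\<close>
  have "(29 - 6 * c) * (c ^ 3 - 8 * c ^ 2 + 5 * c + 1) + (4 - 15 * c + 2 * c ^ 2) * (3 * c ^ 2 - 16 * c + 5) = 49"
   by (simp add: algebra_simps power2_eq_square power3_eq_cube)
  thus False unfolding 0 by simp
 qed
 have c0: "c = 0 ==> order c cpoly = 0" "c = 1 ==> order c cpoly = 0" by (auto intro!: order_0I simp: cpoly_def)
 have opow: "order c (cpoly ^ k) = k * order c cpoly" for k by (induction k) (simp_all add: cpoly_nz order_mult)
 have "order c (BB m) = (if c = 0 then 15 * m mod 14 else 0) + (if c = 1 then 9 * m mod 14 else 0) + (7 * m mod 14) * order c cpoly"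
  unfolding BB_def using o1[of 0] o1[of 1] by (simp add: order_mult cpoly_nz opow)
 also have "\<dots> < 14"
 proof (cases "c = 0 \<or> c = 1")
  case False
  have "(7 * m mod 14) * order c cpoly <= (7 * m mod 14) * 1" using oc by (intro mult_left_mono) auto
  also have "\<dots> < 14" by simp
  finally show ?thesis using False by simp
 qed (use c0 in auto)
 finally show ?thesis .
qed

text \<open>Orthogonality of characters: distinct residues of \<open>ww\<close> modulo 14 give
  distinct characters of the translations.\<close>

lemma sum_ee_character:
 assumes "m < 14" "j < 14"
 shows "(\<Sum>k<14. ee (of_int (int k * int (ww m)) / 14) * ee (of_int (- int k * int (ww j)) / 14)) = (if j = m then 14 else 0)"
proof -
 define x where "x = ee (of_int (int (ww m) - int (ww j)) / 14)"
 have t: "ee (of_int (int k * int (ww m)) / 14) * ee (of_int (- int k * int (ww j)) / 14) = x ^ k" for k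
  unfolding x_def ee_of_nat_mult[symmetric] ee_add[symmetric] by (rule arg_cong[of _ _ ee]) (simp add: field_simps)
 show ?thesis
 proof (cases "j = m")
  case True
  hence "x = 1" using ee_of_int[of 0] by (simp add: x_def)
  thus ?thesis unfolding t by (simp add: True)
 next
  case False
  have "x ^ 14 = ee (of_nat 14 * (of_int (int (ww m) - int (ww j)) / 14))" unfolding x_def by (rule ee_of_nat_mult[symmetric])
  also have "of_nat 14 * (of_int (int (ww m) - int (ww j)) / 14) = (of_int (int (ww m) - int (ww j)) :: complex)"
   by (simp add: field_simps)
  finally have "x ^ 14 = ee (of_int (int (ww m) - int (ww j)))" .
  hence x14: "x ^ 14 = 1" using ee_of_int by metis
  have "x ~= 1"
  proof
   assume "x = 1"
   then obtain n :: int where "of_int (int (ww m) - int (ww j)) / 14 = (of_int n :: complex)" unfolding x_def ee_eq_1_iff by blast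
   hence "(of_int (int (ww m) - int (ww j)) :: complex) = of_int (14 * n)" by (simp add: field_simps)
   hence "int (ww m) - int (ww j) = 14 * n" unfolding of_int_eq_iff .
   hence "int (ww m) = int (ww j) + 14 * n" by simp
   hence "int (ww m) mod 14 = int (ww j) mod 14" by simp
   hence "int (ww m mod 14) = int (ww j mod 14)" by (simp add: zmod_int)
   hence "ww m mod 14 = ww j mod 14" by (simp only: of_nat_eq_iff)
   thus False using ww_inj[OF assms] False by simp
  qed
  hence "(\<Sum>k<14. x ^ k) = 0" using sum_gp_strict[of x 14] x14 by simp
  thus ?thesis unfolding t using False by simp
 qed
qed

lemma regular_components:
 assumes f: "f : MG" and reg: "!!v. v : W ==> f = 0 \<or> 0 <= v f" and p: "p ~= 0"
  and eq: "ups_poly p * f = (\<Sum>m<14. ups_poly (q m) * bb m)" and m: "m < 14" and v: "v : W" and qm: "q m ~= 0"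
 shows "0 <= v (ups_poly (q m) * bb m / ups_poly p)"
proof -
 have pz: "ups_poly p ~= 0" using p by simp
 have slash: "mslash f (shiftm n) = (\<Sum>j<14. cst (ee (of_int (- n * int (ww j)) / 14)) * (ups_poly (q j) * bb j / ups_poly p))" for n
 proof -
  have "f = (\<Sum>j<14. ups_poly (q j) * bb j) / ups_poly p" using eq pz by (simp add: field_simps)
  hence "f = (\<Sum>j<14. ups_poly (q j) * bb j / ups_poly p)" by (simp add: sum_divide_distrib)
  hence "mslash f (shiftm n) = (\<Sum>j<14. mslash (ups_poly (q j) * bb j / ups_poly p) (shiftm n))"
   by (simp add: mslash_sum)
  thus ?thesis by (simp add: mslash_divide mslash_mult mslash_ups_poly_shift mslash_bb_shift mult_ac)
 qed
 \<comment> \<open>14 times the projection of \<open>f\<close> to the m-th character. Every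
   translate of \<open>f\<close> is nonnegative at v by \<open>W_shift\<close>, hence so is the
   projection.\<close>
 define F where "F = (\<Sum>k<14. cst (ee (of_int (int k * int (ww m)) / 14)) * mslash f (shiftm (int k)))"
 have "F = (\<Sum>k<14. \<Sum>j<14. cst (ee (of_int (int k * int (ww m)) / 14) * ee (of_int (- int k * int (ww j)) / 14)) * (ups_poly (q j) * bb j / ups_poly p))"
  unfolding F_def slash by (simp add: sum_distrib_left const_mero_mult mult.assoc)
 also have "\<dots> = (\<Sum>j<14. cst (\<Sum>k<14. ee (of_int (int k * int (ww m)) / 14) * ee (of_int (- int k * int (ww j)) / 14)) * (ups_poly (q j) * bb j / ups_poly p))"
  by (subst sum.swap) (simp only: const_mero_sum sum_distrib_right)
 also have "\<dots> = (\<Sum>j<14. if j = m then cst 14 * (ups_poly (q m) * bb m / ups_poly p) else 0)"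
  by (intro sum.cong refl) (use sum_ee_character[OF m] in auto)
 also have "\<dots> = cst 14 * (ups_poly (q m) * bb m / ups_poly p)" using m by simp
 finally have F: "F = cst 14 * (ups_poly (q m) * bb m / ups_poly p)" .
 note vv = W_valuation[OF v]
 have "F = 0 \<or> 0 <= v F" unfolding F_def
 proof (rule valuation_sum_ge[OF vv M14_subfield])
  fix k :: nat
  define h where "h = mslash f (shiftm (int k))"
  have h: "h : M14" unfolding h_def by (rule M14_slash[OF MG_M14[OF f] shiftm_SL2Z])
  have hv: "h = 0 \<or> 0 <= v h"
   using W_shift[OF v, of "int k"] reg MG_M14[OF f] mslash_eq_0_iff[OF shiftm_SL2Z] unfolding h_def by (cases "f = 0") auto
  define c where "c = ee (of_int (int k * int (ww m)) / 14)"
  have "c ~= 0" by (simp add: c_def ee_def)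
  thus "cst c * h : M14 & (cst c * h = 0 \<or> 0 <= v (cst c * h))"
   using hv h M14_const[of c] M14_closed(4) valuation_mult[OF vv, of "cst c" h] valuation_const[OF vv, of c]
   by (cases "h = 0") auto
 qed
 moreover have hz: "ups_poly (q m) * bb m / ups_poly p ~= 0" "ups_poly (q m) * bb m / ups_poly p : M14"
  using qm p bb_nz MG_M14 by (auto intro!: MG_M14 MG_closed ups_poly_MG bb_MG)
 ultimately show ?thesis
  using valuation_mult[OF vv M14_const[of 14] _ hz(2,1)] valuation_const[OF vv, of 14] unfolding F by (simp del: times_divide_eq_right)
qed

lemma regular_coeffs:
 assumes f: "f : MG" and reg: "!!v. v : W ==> f = 0 \<or> 0 <= v f"
 obtains q where "f = (\<Sum>m<14. ups_poly (q m) * bb m)"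
proof -
 have "EX q. f = (\<Sum>m<14. ups_poly (q m) * bb m)"
  if "p ~= 0" "ups_poly p * f = (\<Sum>m<14. ups_poly (q m) * bb m)" for p q
  using that
 proof (induction "degree p" arbitrary: p q rule: less_induct)
  case (less p q)
  show ?case
  proof (cases "constant (poly p)")
   case True
   then obtain a where a: "p = [:a:]" by (metis constant_degree degree_eq_zeroE)
   have az: "a ~= 0" using a less.prems by auto
   have "f = cst (inverse a) * (ups_poly p * f)" using az by (simp add: a const_mero_inverse)
   also have "\<dots> = (\<Sum>m<14. ups_poly (smult (inverse a) (q m)) * bb m)"
    unfolding less.prems(2) by (simp add: pev_smult sum_distrib_left mult.assoc)
   finally show ?thesis by (rule exI[of _ "%m. smult (inverse a) (q m)"])
  next
   case False
   from Fundamental_Theorem_Algebra.fundamental_theorem_of_algebra[OF this] obtain c where "poly p c = 0" ..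
   then obtain p1 where p1: "p = [:- c, 1:] * p1" by (meson dvdE poly_eq_0_iff_dvd)
   have p1z: "p1 ~= 0" using p1 less.prems by auto
   have d: "degree p1 < degree p" unfolding p1 using p1z by (subst degree_mult_eq) auto
   obtain v where v: "v : W" "0 < v (ups7 - cst c)" using W_above by blast
   note vv = W_valuation[OF v(1)]
   let ?e = "v (ups7 - cst c)"
   have lz: "ups7 - cst c ~= 0" "ups7 ~= cst c"
    using ups_poly_nz[of "[:- c, 1:]"] unfolding ups_poly_linear by auto
   note unit = valuation_pev_unit[OF vv M14_subfield range_const_M14 MG_M14[OF upsilon7_MG] lz(2) v(2)]
   have mul: "v (ups_poly (a * b)) = v (ups_poly a) + v (ups_poly b)" if "a ~= 0" "b ~= 0" for a b
    unfolding pev_mult using that by (intro valuation_mult[OF vv] MG_M14[OF ups_poly_MG]) auto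
   \<comment> \<open>If c were not a root of \<open>q m\<close>, the m-th component would have value
     v(bb m) - v(p). With e = v(upsilon - c), \<open>order_BB\<close> gives 14 v(bb m) <= 13 e while
     v(p) >= e, so that value would be negative. Hence upsilon - c cancels from the denominator and
     the degree drops.\<close>
   have q0: "poly (q m) c = 0" if m: "m < 14" for m
   proof (rule ccontr)
    assume qc: "poly (q m) c ~= 0"
    hence qm: "q m ~= 0" by auto
    let ?h = "ups_poly (q m) * bb m / ups_poly p"
    have hM: "ups_poly (q m) : M14" "bb m : M14" "ups_poly p : M14" by (auto intro: MG_M14 ups_poly_MG bb_MG)
    have vq: "v (ups_poly (q m)) = 0" by (rule unit(2)[OF qc])
    have vh: "v ?h = v (bb m) - v (ups_poly p)"
     using valuation_divide[OF vv M14_subfield M14_closed(4)[OF hM(1,2)] _ hM(3)] valuation_mult[OF vv hM(1) _ hM(2) bb_nz]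
      vq qm bb_nz less.prems(1) by simp
    have vp: "v (ups_poly p) = ?e + v (ups_poly p1)"
     unfolding p1 using mul[of "[:- c, 1:]" p1] p1z by (simp add: ups_poly_linear del: pev_pCons)
    have vp1: "0 <= v (ups_poly p1)" by (rule W_ups_poly[OF v(1) p1z])
    obtain r where r: "BB m = [:- c, 1:] ^ order c (BB m) * r" "~ [:- c, 1:] dvd r"
     using order_decomp[OF BB_nz] by blast
    have rz: "r ~= 0" "poly r c ~= 0" using r(2) by (auto simp: poly_eq_0_iff_dvd)
    have "v (ups_poly (BB m)) = v (ups_poly ([:- c, 1:] ^ order c (BB m))) + v (ups_poly r)"
     using mul[of "[:- c, 1:] ^ order c (BB m)" r] rz(1) r(1) by simp
    also have "\<dots> = int (order c (BB m)) * ?e"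
     using unit(2)[OF rz(2)] valuation_power[OF vv M14_subfield MG_M14[OF ups_poly_MG[of "[:- c, 1:]"]]]
     unfolding pev_power ups_poly_linear using lz(1) by simp
    also have "\<dots> <= 13 * ?e" using order_BB[of c m] v(2) by (intro mult_right_mono) auto
    finally have "v (bb m ^ 14) <= 13 * ?e" unfolding bb_power .
    hence "14 * v (bb m) <= 13 * ?e" using valuation_power[OF vv M14_subfield hM(2) bb_nz] by simp
    moreover have "0 <= v ?h" by (rule regular_components[OF f _ less.prems m v(1) qm]) (rule reg)
    ultimately show False using vh vp vp1 v(2) by simp
   qed
   hence "EX r. m < 14 --> q m = [:- c, 1:] * r" for m by (meson dvdE poly_eq_0_iff_dvd)
   then obtain q1 where q1: "!!m. m < 14 ==> q m = [:- c, 1:] * q1 m" by metis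
   have "(ups7 - cst c) * (ups_poly p1 * f) = (ups7 - cst c) * (\<Sum>m<14. ups_poly (q1 m) * bb m)"
   proof -
    have "(ups7 - cst c) * (ups_poly p1 * f) = ups_poly p * f"
     unfolding p1 pev_mult ups_poly_linear by (simp only: mult.assoc)
    also have "\<dots> = (\<Sum>m<14. (ups7 - cst c) * (ups_poly (q1 m) * bb m))"
     unfolding less.prems(2)
    proof (rule sum.cong[OF refl])
     fix m :: nat assume "m : {..<14}"
     hence "q m = [:- c, 1:] * q1 m" using q1 by (simp only: lessThan_iff)
     thus "ups_poly (q m) * bb m = (ups7 - cst c) * (ups_poly (q1 m) * bb m)"
      by (simp only: pev_mult ups_poly_linear mult.assoc)
    qed
    finally show ?thesis by (simp only: sum_distrib_left)
   qed
   hence "ups_poly p1 * f = (\<Sum>m<14. ups_poly (q1 m) * bb m)" using lz(1) by simp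
   from less.hyps[OF d p1z this] show ?thesis .
  qed
 qed
 thus ?thesis using that bb_spans[OF f] by metis
qed

section \<open>Places\<close>

definition Pl :: "(mero_uhp => int) set" where
 "Pl = {v : extensional (MG - {0}). v ` (MG - {0}) = UNIV & valuation_on MG v}"

lemma Pl_val: "v : Pl ==> valuation_on MG v"
 by (simp add: Pl_def)

lemma Pl_onto:
 assumes "v : Pl"
 obtains f where "f : MG" "f ~= 0" "v f = n"
proof -
 have "n : v ` (MG - {0})" using assms by (auto simp: Pl_def)
 thus ?thesis using that by auto
qed

definition vP :: "mero_uhp => int" where "vP = restrict vinf (MG - {0})"

lemma vP_eq: "f : MG ==> f ~= 0 ==> vP f = vinf f"
 by (simp add: vP_def)

text \<open>The pole orders 5 * 31 = 155 and 11 * 14 = 154 differ by 1, so the inverse of this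
  function is a uniformizer at infinity.\<close>

definition ss :: mero_uhp where "ss = bb 1 ^ 5 / ups7 ^ 11"

lemma ss: "ss : MG" "ss ~= 0" and valuation_ss: "valuation_on MG v ==> v ups7 < 0 ==> 14 * v ss = v ups7"
proof -
 show s: "ss : MG" "ss ~= 0" using bb_nz upsilon7_nz by (auto simp: ss_def intro!: MG_closed bb_MG upsilon7_MG)
 assume v: "valuation_on MG v" "v ups7 < 0"
 have "v ss = 5 * v (bb 1) - 11 * v ups7"
  unfolding ss_def using bb_nz upsilon7_nz
  by (subst valuation_divide[OF v(1) MG_subfield]) (auto intro!: MG_closed(9) bb_MG upsilon7_MG simp: valuation_power[OF v(1) MG_subfield bb_MG] valuation_power[OF v(1) MG_subfield upsilon7_MG])
 thus "14 * v ss = v ups7" using valuation_bb[OF v, of 1] by (simp add: ww_def)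
qed

lemma vinf_ss: "vinf ss = - 1"
 using valuation_ss[OF vinf_MG] vinf_upsilon7 by simp

lemma vP_Pl: "vP : Pl"
proof -
 have "n : vP ` (MG - {0})" for n
 proof (cases "n \<ge> 0")
  case True
  have "vinf (inverse ss ^ nat n) = n"
   using valuation_power[OF vinf_MG MG_subfield MG_closed(6)[OF ss(1)], of "nat n"] ss(2) True
    valuation_inverse[OF vinf_MG MG_subfield ss] vinf_ss by simp
  moreover have "inverse ss ^ nat n : MG - {0}" using ss MG_closed by auto
  ultimately show ?thesis by (metis DiffE image_eqI singletonI vP_eq)
 next
  case False
  have "vinf (ss ^ nat (- n)) = n" using valuation_power[OF vinf_MG MG_subfield ss] False vinf_ss by simp
  moreover have "ss ^ nat (- n) : MG - {0}" using ss MG_closed by auto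
  ultimately show ?thesis by (metis DiffE image_eqI singletonI vP_eq)
 qed
 moreover have "valuation_on MG vP"
  unfolding valuation_on_def
 proof (intro conjI ballI allI impI)
  fix f g assume f: "f : MG - {0}" "g : MG - {0}"
  show "vP (f * g) = vP f + vP g"
   using f MG_closed(4)[of f g] valuation_mult[OF vinf_MG, of f g] by (simp add: vP_eq)
  show "min (vP f) (vP g) <= vP (f + g)" if "f + g ~= 0"
   using f MG_closed(3)[of f g] valuation_add[OF vinf_MG, of f g] that by (simp add: vP_eq)
 next
  fix c :: complex assume "c ~= 0"
  thus "vP (cst c) = 0" using valuation_const[OF vinf_MG] MG_const by (simp add: vP_eq)
 qed
 ultimately show ?thesis unfolding Pl_def vP_def by (auto simp: image_def)
qed

text \<open>By \<open>valuation_bb_sum\<close> the same term dominates for v and for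
  \<open>vinf\<close>, so v is proportional to \<open>vinf\<close> on all of \<open>MG\<close>;
  surjectivity makes the factor 1.\<close>

lemma pole_unique:
 assumes v: "v : Pl" "v ups7 < 0"
 shows   "v = vP"
proof -
 note vv = Pl_val[OF v(1)]
 have key: "14 * v f = - vinf f * v ups7" if f: "f : MG" "f ~= 0" for f
 proof -
  obtain p q where pq: "p ~= 0" "ups_poly p * f = (\<Sum>m<14. ups_poly (q m) * bb m)" using bb_spans[OF f(1)] by metis
  define S where "S = (\<Sum>m<14. ups_poly (q m) * bb m)"
  have "ups_poly p * f ~= 0" using pq(1) f(2) by simp
  hence "S ~= 0" using pq(2) S_def by simp
  hence ex: "EX m<14. q m ~= 0" unfolding S_def by (rule contrapos_np) simp
  define d where "d = (%m. 14 * degree (q m) + ww m)"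
  have ex_max: "EX m<14. q m ~= 0 & 14 * w S = int (d m) * w ups7 & (ALL j<14. q j ~= 0 --> d j <= d m)"
   if "valuation_on MG w" "w ups7 < 0" for w
   unfolding S_def d_def by (rule valuation_bb_sum(2)[OF that ex])
  from ex_max[OF vv v(2)] obtain m where
   m0: "m < 14 & q m ~= 0 & 14 * v S = int (d m) * v ups7 & (ALL j<14. q j ~= 0 --> d j <= d m)" ..
  hence m: "m < 14" "q m ~= 0" "14 * v S = int (d m) * v ups7" by blast+
  have "vinf ups7 < 0" by (simp add: vinf_upsilon7)
  from ex_max[OF vinf_MG this] obtain k where
   k0: "k < 14 & q k ~= 0 & 14 * vinf S = int (d k) * vinf ups7 & (ALL j<14. q j ~= 0 --> d j <= d k)" ..
  hence k: "k < 14" "q k ~= 0" "14 * vinf S = int (d k) * vinf ups7" by blast+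
  have "d m <= d k" using k0 m(1,2) by blast
  moreover have "d k <= d m" using m0 k(1,2) by blast
  ultimately have mk: "d m = d k" by (rule order_antisym)
  have vS: "w S = w (ups_poly p) + w f" if "valuation_on MG w" for w
   unfolding S_def pq(2)[symmetric] by (rule valuation_mult[OF that ups_poly_MG]) (use pq f in auto)
  have "v (ups_poly p) = int (degree p) * v ups7"
   by (rule pev_valuation_neg(2)[OF vv MG_subfield range_const_MG upsilon7_MG upsilon7_nz(1) v(2) pq(1)])
  hence 1: "14 * v f = (int (d k) - 14 * int (degree p)) * v ups7"
   using vS[OF vv] m(3) unfolding mk by (simp add: algebra_simps)
  have "vinf f = - (int (d k) - 14 * int (degree p))"
   using vS[OF vinf_MG] k(3) vinf_ups_poly[OF pq(1)] by (simp add: vinf_upsilon7)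
  show ?thesis unfolding 1 \<open>vinf f = _\<close> by (simp only: minus_minus)
 qed
 have f: "v f = - vinf f * v ss" if "f : MG" "f ~= 0" for f
 proof -
  have "14 * v f = 14 * (- vinf f * v ss)" unfolding key[OF that] valuation_ss[OF vv v(2), symmetric] by simp
  thus ?thesis by linarith
 qed
 obtain g where g: "g : MG" "g ~= 0" "v g = 1" using Pl_onto[OF v(1)] by metis
 have "v ss dvd 1" using f[OF g(1,2)] g(3) by (metis dvd_triv_right)
 moreover have "v ss < 0" using valuation_ss[OF vv v(2)] v(2) by linarith
 ultimately have "v ss = - 1" by auto
 hence eq: "v h = vP h" if "h : MG - {0}" for h using f[of h] vP_eq[of h] that by simp
 have ex: "v : extensional (MG - {0})" "vP : extensional (MG - {0})" using v(1) vP_Pl by (auto simp: Pl_def)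
 show ?thesis by (rule extensionalityI[OF ex eq])
qed

lemma valuation_linear_nonneg:
 assumes v: "valuation_on MG v" "h : MG" "h = 0 \<or> 0 <= v h" "h ~= cst c"
 shows "0 <= v (h - cst c)"
proof -
 have e: "pev h [:- c, 1:] = h - cst c" by (simp add: const_mero_minus)
 show ?thesis using pev_valuation_nonneg[OF v(1) MG_subfield range_const_MG v(2,3), of "[:- c, 1:]", unfolded e] v(4) by auto
qed

text \<open>Q splits into linear factors over C, and each h - c has value 0.\<close>

lemma valuation_pev_no_residue:
 assumes v: "valuation_on MG v" "h : MG" "!!c. h ~= cst c" "!!c. v (h - cst c) = 0" and Q: "Q ~= 0"
 shows "pev h Q ~= 0 & v (pev h Q) = 0"
 using Q
proof (induction "degree Q" arbitrary: Q rule: less_induct)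
 case less
 show ?case
 proof (cases "constant (poly Q)")
  case True
  then obtain a where "Q = [:a:]" by (metis constant_degree degree_eq_zeroE)
  thus ?thesis using less.prems valuation_const[OF v(1)] by simp
 next
  case False
  from Fundamental_Theorem_Algebra.fundamental_theorem_of_algebra[OF this] obtain c where "poly Q c = 0" ..
  then obtain R where R: "Q = [:- c, 1:] * R" by (meson dvdE poly_eq_0_iff_dvd)
  have Rz: "R ~= 0" using R less.prems by auto
  have "degree R < degree Q" unfolding R using Rz by (subst degree_mult_eq) auto
  note IH = less.hyps[OF this Rz]
  have e: "pev h Q = (h - cst c) * pev h R" unfolding R pev_mult by (simp add: const_mero_minus)
  have "v ((h - cst c) * pev h R) = v (h - cst c) + v (pev h R)"
   using IH v(3) by (intro valuation_mult[OF v(1)] MG_closed(7) v(2) MG_const pev_in[OF MG_subfield range_const_MG]) auto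
  thus ?thesis unfolding e using v(3,4) IH by auto
 qed
qed

lemma ups_neq_const: "ups7 ~= cst c"
 using ups_poly_nz[of "[:- c, 1:]"] unfolding ups_poly_linear by auto

text \<open>If upsilon had no residue in C, all nonzero polynomials in upsilon would have value 0.
  The powers 1, f, ..., f^14 of a uniformizer would then be independent over C(upsilon), but any 15
  functions are dependent.\<close>

lemma place_residue_ups:
 assumes v: "v : Pl" "0 <= v ups7"
 obtains c where "0 < v (ups7 - cst c)"
proof (rule ccontr)
 note vv = Pl_val[OF v(1)]
 assume "~ thesis"
 hence "~ 0 < v (ups7 - cst c)" for c using that by blast
 hence z: "v (ups7 - cst c) = 0" for c
  using valuation_linear_nonneg[OF vv upsilon7_MG _ ups_neq_const, of c] v(2) by (metis order_le_less)
 have pz: "v (ups_poly p) = 0" if "p ~= 0" for p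
  using valuation_pev_no_residue[OF vv upsilon7_MG ups_neq_const z that] by simp
 obtain f where f: "f : MG" "f ~= 0" "v f = 1" using Pl_onto[OF v(1)] by metis
 obtain p where p: "EX i<15. p i ~= 0" "(\<Sum>i<15. ups_poly (p i) * f ^ i) = 0"
  by (rule ups_dependent[of "%i. f ^ i"]) (use f MG_closed(9) in auto)
 have vt: "v (ups_poly (p i) * f ^ i) = int i" if "ups_poly (p i) * f ^ i ~= 0" for i
  using that pz[of "p i"] valuation_mult[OF vv ups_poly_MG _ MG_closed(9)[OF f(1)]] valuation_power[OF vv MG_subfield f(1,2)] f by simp
 have "(\<Sum>i<15. ups_poly (p i) * f ^ i) ~= 0"
 proof (rule valuation_sum_distinct(1)[OF vv MG_subfield range_const_MG])
  show "EX i:{..<15}. ups_poly (p i) * f ^ i ~= 0" using p(1) f(2) by auto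
  show "i = j" if "ups_poly (p i) * f ^ i ~= 0" "ups_poly (p j) * f ^ j ~= 0" "v (ups_poly (p i) * f ^ i) = v (ups_poly (p j) * f ^ j)" for i j
   using vt[OF that(1)] vt[OF that(2)] that(3) by linarith
 qed (use f MG_closed ups_poly_MG in auto)
 thus False using p(2) by simp
qed

lemma strip_common_root:
 fixes p :: "nat => complex poly"
 assumes "EX i<n. p i ~= 0"
 obtains k r where "!!i. i < n ==> p i = [:- c, 1:] ^ k * r i" "EX i<n. poly (r i) c ~= 0"
proof -
 obtain i0 where i0: "i0 < n & p i0 ~= 0" "!!i. i < n & p i ~= 0 ==> order c (p i0) <= order c (p i)"
  using ex_has_least_nat[of "%i. i < n & p i ~= 0" _ "%i. order c (p i)"] assms by metis
 define k where "k = order c (p i0)"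
 have "[:- c, 1:] ^ k dvd p i" if "i < n" for i
  unfolding order_divides using i0(2)[of i] that by (auto simp: k_def)
 hence "EX r. i < n --> p i = [:- c, 1:] ^ k * r" for i by (metis dvdE)
 then obtain r where r: "!!i. i < n ==> p i = [:- c, 1:] ^ k * r i" by metis
 have "poly (r i0) c ~= 0"
 proof
  assume "poly (r i0) c = 0"
  hence "[:- c, 1:] dvd r i0" by (simp add: poly_eq_0_iff_dvd)
  hence "[:- c, 1:] ^ Suc k dvd p i0" using r[of i0] i0(1) by (metis mult_dvd_mono dvd_refl power_Suc2)
  thus False using i0(1) unfolding order_divides k_def by simp
 qed
 thus ?thesis using that[of k r] r i0(1) by blast
qed

text \<open>Cancelling the common power of upsilon - c leaves a relation that stays nontrivial when
  reduced modulo upsilon - c.\<close>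

lemma ups_relation_stripped:
 fixes f :: "nat => mero_uhp"
 assumes "!!i. i < 15 ==> f i : MG"
 obtains r where "EX i<15. poly (r i) c ~= 0" "(\<Sum>i<15. ups_poly (r i) * f i) = 0"
proof -
 obtain p where p: "EX i<15. p i ~= 0" "(\<Sum>i<15. ups_poly (p i) * f i) = 0"
  using assms by (rule ups_dependent[of f])
 obtain k r where r: "!!i. i < 15 ==> p i = [:- c, 1:] ^ k * r i" "EX i<15. poly (r i) c ~= 0"
  using strip_common_root[of 15 p c] p(1) by metis
 have "(\<Sum>i<15. ups_poly (p i) * f i) = (\<Sum>i<15. (ups7 - cst c) ^ k * (ups_poly (r i) * f i))"
 proof (rule sum.cong[OF refl])
  fix i :: nat assume "i : {..<15}"
  hence "p i = [:- c, 1:] ^ k * r i" using r(1) by (simp only: lessThan_iff)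
  thus "ups_poly (p i) * f i = (ups7 - cst c) ^ k * (ups_poly (r i) * f i)"
   by (simp only: pev_mult pev_power ups_poly_linear mult.assoc)
 qed
 also have "\<dots> = (ups7 - cst c) ^ k * (\<Sum>i<15. ups_poly (r i) * f i)" by (simp only: sum_distrib_left)
 finally have "(\<Sum>i<15. ups_poly (r i) * f i) = 0" using p(2) ups_neq_const[of c] by simp
 thus ?thesis using that r(2) by blast
qed

text \<open>At a place above upsilon = a, reducing a relation among 1, h, ..., h^14 modulo upsilon -
  a gives a nonzero complex polynomial Q with v(Q(h)) > 0 or Q(h) = 0. If h had no residue, Q(h)
  would be a unit by \<open>valuation_pev_no_residue\<close>.\<close>

lemma place_residual:
 assumes v: "v : Pl"
 shows   "residual MG v"
proof (cases "v ups7 < 0")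
 case True
 hence vP: "v = vP" by (rule pole_unique[OF v])
 show ?thesis unfolding residual_def vP
 proof (intro ballI impI)
  fix f g assume fg: "f : MG" "g : MG" "g ~= 0 & (f = 0 \<or> vP g <= vP f)"
  hence "f = 0 \<or> vinf g <= vinf f" by (cases "f = 0") (use vP_eq[OF fg(1)] vP_eq[OF fg(2)] fg(3) in auto)
  then obtain c where c: "f - cst c * g = 0 \<or> vinf g < vinf (f - cst c * g)"
   using iinf.residual_ord MG_M14 fg unfolding residual_def by blast
  define h where "h = f - cst c * g"
  have "h : MG" unfolding h_def using fg MG_const by (intro MG_closed) auto
  hence "h = 0 \<or> vP g < vP h" using c[folded h_def] vP_eq[OF fg(2)] vP_eq[of h] fg(3) by (cases "h = 0") auto
  thus "EX c. f - cst c * g = 0 \<or> vP g < vP (f - cst c * g)" unfolding h_def by blast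
 qed
next
 case False
 hence u0: "0 <= v ups7" by simp
 note vv = Pl_val[OF v]
 obtain a where a: "0 < v (ups7 - cst a)" using place_residue_ups[OF v u0] by blast
 have res: "EX c. h = cst c \<or> 0 < v (h - cst c)" if h: "h : MG" "h ~= 0" "0 <= v h" for h
 proof (rule ccontr)
  assume *: "~ ?thesis"
  have hc: "h ~= cst c" for c using * by blast
  have hv: "v (h - cst c) = 0" for c
   using valuation_linear_nonneg[OF vv h(1) _ hc, of c] h(3) * by (metis order_le_less)
  obtain r where r: "EX i<15. poly (r i) a ~= 0" "(\<Sum>i<15. ups_poly (r i) * h ^ i) = 0"
   by (rule ups_relation_stripped[of "%i. h ^ i" a]) (use h MG_closed(9) in auto)
  define Q where "Q = (\<Sum>i\<le>14. monom (poly (r i) a) i)"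
  obtain k where k: "k < 15" "poly (r k) a ~= 0" using r(1) by blast
  have "coeff Q k = poly (r k) a" using k(1) by (simp add: Q_def coeff_sum_monom)
  hence "Q ~= 0" using k(2) by auto
  from valuation_pev_no_residue[OF vv h(1) hc hv this] have Q: "pev h Q ~= 0" "v (pev h Q) = 0" by auto
  have "{..14::nat} = {..<15}" by auto
  hence "pev h Q = (\<Sum>i<15. cst (poly (r i) a) * h ^ i)" by (simp add: Q_def pev_sum pev_monom)
  also have "\<dots> = (\<Sum>i<15. cst (poly (r i) a) * h ^ i) - (\<Sum>i<15. ups_poly (r i) * h ^ i)" by (simp add: r(2))
  also have "\<dots> = (\<Sum>i<15. (cst (poly (r i) a) - ups_poly (r i)) * h ^ i)"
   by (simp only: left_diff_distrib sum_subtractf)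
  finally have e: "pev h Q = (\<Sum>i<15. (cst (poly (r i) a) - ups_poly (r i)) * h ^ i)" .
  have "pev h Q = 0 \<or> 1 <= v (pev h Q)" unfolding e
  proof (rule valuation_sum_ge[OF vv MG_subfield])
   fix i
   have "poly ([:poly (r i) a:] - r i) a = 0" by simp
   then obtain s where s: "[:poly (r i) a:] - r i = [:- a, 1:] * s" by (meson dvdE poly_eq_0_iff_dvd)
   have "ups_poly ([:poly (r i) a:] - r i) + ups_poly (r i) = ups_poly [:poly (r i) a:]"
    unfolding pev_add[symmetric] by simp
   hence "ups_poly ([:poly (r i) a:] - r i) = cst (poly (r i) a) - ups_poly (r i)" by (simp add: eq_diff_eq)
   hence d: "cst (poly (r i) a) - ups_poly (r i) = (ups7 - cst a) * ups_poly s"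
    unfolding s pev_mult ups_poly_linear by simp
   have M: "ups7 - cst a : MG" "ups_poly s : MG" "h ^ i : MG"
    using MG_closed upsilon7_MG MG_const ups_poly_MG h by auto
   show "(cst (poly (r i) a) - ups_poly (r i)) * h ^ i : MG \<and>
     ((cst (poly (r i) a) - ups_poly (r i)) * h ^ i = 0 \<or> 1 <= v ((cst (poly (r i) a) - ups_poly (r i)) * h ^ i))"
   proof (cases "s = 0")
    case False
    have "0 <= v (ups_poly s)" using pev_valuation_nonneg[OF vv MG_subfield range_const_MG upsilon7_MG, of s] u0 False by auto
    moreover have "0 <= v (h ^ i)" using valuation_power[OF vv MG_subfield h(1,2)] h(3) by simp
    moreover have "v ((ups7 - cst a) * ups_poly s * h ^ i) = v (ups7 - cst a) + v (ups_poly s) + v (h ^ i)"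
     using M False h(2) ups_neq_const[of a] by (simp add: valuation_mult[OF vv] MG_closed(4))
    ultimately show ?thesis unfolding d using a M MG_closed(4) by auto
   qed (simp add: d MG_closed(1))
  qed
  thus False using Q by simp
 qed
 show ?thesis unfolding residual_def
 proof (intro ballI impI)
  fix f g assume fg: "f : MG" "g : MG" "g ~= 0 & (f = 0 \<or> v g <= v f)"
  show "EX c. f - cst c * g = 0 \<or> v g < v (f - cst c * g)"
  proof (cases "f = 0")
   case True
   thus ?thesis by (intro exI[of _ 0]) simp
  next
   case f0: False
   have h: "f / g : MG" "f / g ~= 0" "0 <= v (f / g)"
    using fg f0 MG_closed(8) valuation_divide[OF vv MG_subfield fg(1) f0 fg(2)] by auto
   from res[OF h] obtain c where c: "f / g = cst c \<or> 0 < v (f / g - cst c)" by blast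
   have e: "f - cst c * g = (f / g - cst c) * g" using fg by (simp add: left_diff_distrib)
   have "f / g - cst c : MG" using h(1) MG_const MG_closed by auto
   hence "(f / g - cst c) * g = 0 \<or> v g < v ((f / g - cst c) * g)"
    using c valuation_mult[OF vv _ _ fg(2), of "f / g - cst c"] fg(3) by (cases "f / g = cst c") auto
   thus ?thesis unfolding e[symmetric] by (rule exI[of _ c])
  qed
 qed
qed

text \<open>The inclusion of valuation rings makes w vanish where v does, so w = v * w(t) for a
  uniformizer t of v; normalisation gives w(t) = 1.\<close>

lemma place_eqI:
 assumes v: "v : Pl" and w: "w : Pl" and le: "!!f. f : MG ==> f ~= 0 ==> 0 <= v f ==> 0 <= w f"
 shows   "v = w"
proof -
 note vv = Pl_val[OF v] and wv = Pl_val[OF w]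
 have z: "w f = 0" if f: "f : MG" "f ~= 0" "v f = 0" for f
  using le[OF f(1,2)] le[OF MG_closed(6)[OF f(1)]] f valuation_inverse[OF vv MG_subfield f(1,2)]
   valuation_inverse[OF wv MG_subfield f(1,2)] by simp
 obtain t where t: "t : MG" "t ~= 0" "v t = 1" using Pl_onto[OF v] by metis
 have nn: "w f = v f * w t" if f: "f : MG" "f ~= 0" "0 <= v f" for f
 proof -
  have T: "t ^ nat (v f) : MG" "t ^ nat (v f) ~= 0" using t MG_closed by auto
  have "w (f / t ^ nat (v f)) = 0"
  proof (rule z)
   show "v (f / t ^ nat (v f)) = 0"
    using valuation_divide[OF vv MG_subfield f(1,2) T] valuation_power[OF vv MG_subfield t(1,2)] t(3) f(3) by simp
  qed (use f T MG_closed in auto)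
  thus ?thesis using valuation_divide[OF wv MG_subfield f(1,2) T] valuation_power[OF wv MG_subfield t(1,2)] f(3) by simp
 qed
 have all: "w f = v f * w t" if f: "f : MG" "f ~= 0" for f
 proof (cases "0 <= v f")
  case False
  have "w (inverse f) = v (inverse f) * w t"
   using False valuation_inverse[OF vv MG_subfield f] f MG_closed(6) by (intro nn) auto
  thus ?thesis using valuation_inverse[OF vv MG_subfield f] valuation_inverse[OF wv MG_subfield f] by simp
 qed (use nn f in auto)
 obtain g where g: "g : MG" "g ~= 0" "w g = 1" using Pl_onto[OF w] by metis
 have "w t dvd 1" using all[OF g(1,2)] g(3) by (metis dvd_triv_right)
 moreover have "0 <= w t" using le[OF t(1,2)] t(3) by simp
 ultimately have "w t = 1" by simp
 hence eq: "v h = w h" if "h : MG - {0}" for h using all[of h] that by simp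
 have ex: "v : extensional (MG - {0})" "w : extensional (MG - {0})" using v w by (auto simp: Pl_def)
 show ?thesis by (rule extensionalityI[OF ex eq])
qed

section \<open>Weak approximation\<close>

lemma separate_two:
 assumes v: "v : Pl" "w : Pl" "v ~= w"
 obtains f where "f : MG" "f ~= 0" "0 < v f" "w f < 0"
proof -
 obtain a where a: "a : MG" "a ~= 0" "0 <= v a" "w a < 0" using place_eqI[OF v(1,2)] v(3) by (meson not_le)
 obtain b where b: "b : MG" "b ~= 0" "0 <= w b" "v b < 0" using place_eqI[OF v(2,1)] v(3) by (metis not_le)
 have "a / b : MG" "a / b ~= 0" using a b MG_closed by auto
 moreover have "0 < v (a / b)" "w (a / b) < 0"
  using valuation_divide[OF Pl_val[OF v(1)] MG_subfield a(1,2) b(1,2)] valuation_divide[OF Pl_val[OF v(2)] MG_subfield a(1,2) b(1,2)] a b by auto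
 ultimately show ?thesis using that by blast
qed

text \<open>The function x found for the earlier places is corrected by a high power of a y that
  separates v from the new place u.\<close>

lemma separate_many:
 assumes v: "v : Pl" and T: "finite T" "T <= Pl - {v}"
 shows "EX f. f : MG & f ~= 0 & 0 < v f & (ALL w:T. w f < 0)"
 using T
proof (induction T rule: finite_induct)
 case empty
 obtain f where "f : MG" "f ~= 0" "v f = 1" using Pl_onto[OF v] by metis
 thus ?case by (intro exI[of _ f]) simp
next
 case (insert u T)
 have "T <= Pl - {v}" using insert.prems by auto
 from insert.IH[OF this] obtain x where "x : MG & x ~= 0 & 0 < v x & (ALL w:T. w x < 0)" ..
 hence x: "x : MG" "x ~= 0" "0 < v x" "!!w. w : T ==> w x < 0" by auto
 have u: "u : Pl" "v ~= u" using insert.prems by auto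
 note vv = Pl_val[OF v]
 show ?case
 proof (cases "u x < 0")
  case True
  thus ?thesis using x by (intro exI[of _ x]) auto
 next
  case False
  obtain y where y: "y : MG" "y ~= 0" "0 < v y" "u y < 0" using separate_two[OF v u] by blast
  \<comment> \<open>Exceeds every |w x|, so that w x and r * (w y) are never equal and no
    cancellation can occur in x + y^r.\<close>
  define r where "r = Suc (\<Sum>w\<in>T. nat \<bar>w x\<bar>)"
  have rpos: "0 < int r" unfolding r_def of_nat_Suc by linarith
  have r: "\<bar>w x\<bar> < int r" if "w : T" for w
  proof -
   have "nat \<bar>w x\<bar> <= (\<Sum>w\<in>T. nat \<bar>w x\<bar>)" by (rule member_le_sum[OF that]) (use insert in auto)
   hence "int (nat \<bar>w x\<bar>) <= int (\<Sum>w\<in>T. nat \<bar>w x\<bar>)" by (simp only: of_nat_le_iff)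
   thus ?thesis unfolding r_def of_nat_Suc by linarith
  qed
  have Y: "y ^ r : MG" "y ^ r ~= 0" using y MG_closed by auto
  have vY: "w (y ^ r) = int r * w y" if "w : Pl" for w by (rule valuation_power[OF Pl_val[OF that] MG_subfield y(1,2)])
  have neq: "x + y ^ r ~= 0 & u (x + y ^ r) < 0"
  proof -
   have "int r * u y < 0" by (rule mult_pos_neg[OF rpos y(4)])
   hence "x = 0 \<or> u (y ^ r) < u x" using False vY[OF u(1)] by simp
   from valuation_add_eq[OF Pl_val[OF u(1)] MG_subfield range_const_MG Y x(1) this] \<open>int r * u y < 0\<close> vY[OF u(1)]
   show ?thesis by (simp add: add.commute)
  qed
  have "w (x + y ^ r) < 0" if w: "w : T" for w
  proof -
   have wP: "w : Pl" using w insert.prems by auto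
   note wv = valuation_add_eq[OF Pl_val[OF wP] MG_subfield range_const_MG]
   have ne: "w x ~= int r * w y"
   proof (cases "w y = 0")
    case False
    hence "int r * 1 <= int r * \<bar>w y\<bar>" by (intro mult_left_mono) auto
    hence "\<bar>w x\<bar> < \<bar>int r * w y\<bar>" using r[OF w] by (simp add: abs_mult)
    thus ?thesis by auto
   qed (use x(4)[OF w] in simp)
   show ?thesis
   proof (cases "w x < w (y ^ r)")
    case True
    thus ?thesis using wv(2)[OF x(1,2) Y(1)] x(4)[OF w] by simp
   next
    case F: False
    hence "w (y ^ r) < w x" using ne vY[OF wP] by simp
    thus ?thesis using wv(2)[OF Y x(1)] x(4)[OF w] by (simp add: add.commute)
   qed
  qed
  moreover have "0 < v (x + y ^ r)"
  proof -
   have "0 < v (y ^ r)" using vY[OF v] mult_pos_pos[OF rpos y(3)] by simp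
   thus ?thesis using valuation_add[OF vv x(1,2) Y] neq x(3) by auto
  qed
  ultimately show ?thesis using neq MG_closed(3)[OF x(1) Y(1)] by (intro exI[of _ "x + y ^ r"]) auto
 qed
qed

text \<open>With a zero of z at v and poles on \<open>T\<close>, the function 1/(1 + z^n) is close
  to 1 at v and vanishes to high order on \<open>T\<close>.\<close>

lemma approximate_idempotent:
 assumes v: "v : Pl" and T: "finite T" "T <= Pl - {v}"
 obtains f where "f : MG" "f ~= 0" "v f = 0" "!!w. w : T ==> int N <= w f"
proof -
 obtain z where z: "z : MG" "z ~= 0" "0 < v z" "!!w. w : T ==> w z < 0" using separate_many[OF assms] by (elim exE conjE) auto
 define n where "n = Suc N"
 have Z: "z ^ n : MG" "z ^ n ~= 0" using z MG_closed by auto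
 have vZ: "w (z ^ n) = int n * w z" if "w : Pl" for w by (rule valuation_power[OF Pl_val[OF that] MG_subfield z(1,2)])
 have "0 < v (z ^ n)" using vZ[OF v] z(3) by (simp add: n_def)
 hence "z ^ n = 0 \<or> v 1 < v (z ^ n)" using valuation_1[OF Pl_val[OF v]] by simp
 note 1 = valuation_add_eq[OF Pl_val[OF v] MG_subfield range_const_MG MG_closed(2) one_neq_zero Z(1) this]
 have M: "1 + z ^ n : MG" using Z MG_closed by auto
 have "int N <= w (inverse (1 + z ^ n))" if w: "w : T" for w
 proof -
  have wP: "w : Pl" using w T by auto
  note wv = Pl_val[OF wP]
  have le: "int n * w z <= int n * (- 1)" using z(4)[OF w] by (intro mult_left_mono) auto
  hence "1 = (0 :: mero_uhp) \<or> w (z ^ n) < w 1" using vZ[OF wP] valuation_1[OF wv] by (simp add: n_def)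
  from valuation_add_eq(2)[OF wv MG_subfield range_const_MG Z MG_closed(2) this] have "w (1 + z ^ n) = int n * w z"
   using vZ[OF wP] by (simp add: add.commute)
  thus ?thesis using valuation_inverse[OF wv MG_subfield M 1(1)] le by (simp add: n_def)
 qed
 thus ?thesis using that[of "inverse (1 + z ^ n)"] 1 M MG_closed(6) valuation_inverse[OF Pl_val[OF v] MG_subfield M 1(1)]
   valuation_1[OF Pl_val[OF v]] by simp
qed

definition above :: "complex => (mero_uhp => int) set" where
 "above c = {v : Pl. 0 < v (ups7 - cst c)}"

text \<open>Elements \<open>h v j\<close> with \<open>v (h v j) = j\<close> for \<open>j < v (\<upsilon> - c)\<close> that are small at the other places above \<open>c\<close> are
  linearly independent over \<open>\<complex>(\<upsilon>)\<close>.\<close>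

lemma above_sum_le_finite:
 assumes T: "finite T" "T <= above c"
 shows "(\<Sum>v\<in>T. v (ups7 - cst c)) <= 14"
proof (rule ccontr)
 define e where "e = (%v :: mero_uhp => int. nat (v (ups7 - cst c)))"
 have TP: "v : Pl" "int (e v) = v (ups7 - cst c)" "0 < e v" if "v : T" for v
  using T(2) that by (auto simp: above_def e_def)
 assume "~ ?thesis"
 moreover have "(\<Sum>v\<in>T. v (ups7 - cst c)) = int (\<Sum>v\<in>T. e v)" using TP(2) by simp
 ultimately have big: "15 <= (\<Sum>v\<in>T. e v)" by linarith
 have "EX t. v : T --> t : MG & t ~= 0 & v t = 1" for v using Pl_onto[OF TP(1)] by metis
 then obtain t where t: "!!v. v : T ==> t v : MG & t v ~= 0 & v (t v) = 1" by metis
 \<comment> \<open>Large enough to outweigh, at every other place w, the required order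
   \<open>e w\<close> together with any poles introduced by the powers of
   \<open>t v\<close>.\<close>
 define N where "N = (\<Sum>v\<in>T. \<Sum>w\<in>T. e w + e v * nat \<bar>w (t v)\<bar>)"
 have N: "e w + e v * nat \<bar>w (t v)\<bar> <= N" if "v : T" "w : T" for v w
 proof -
  have "e w + e v * nat \<bar>w (t v)\<bar> <= (\<Sum>w\<in>T. e w + e v * nat \<bar>w (t v)\<bar>)"
   by (rule member_le_sum[OF that(2)]) (use T in auto)
  also have "\<dots> <= N" unfolding N_def by (rule member_le_sum[OF that(1)]) (use T in auto)
  finally show ?thesis .
 qed
 have "EX f. v : T --> f : MG & f ~= 0 & v f = 0 & (ALL w:T - {v}. int N <= w f)" for v
 proof (cases "v : T")
  case True
  obtain f where "f : MG" "f ~= 0" "v f = 0" "!!w. w : T - {v} ==> int N <= w f"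
   using approximate_idempotent[OF TP(1)[OF True], of "T - {v}" N] T TP(1) by blast
  thus ?thesis by blast
 qed auto
 then obtain f where f: "!!v. v : T ==> f v : MG & f v ~= 0 & v (f v) = 0 & (ALL w:T - {v}. int N <= w (f v))" by metis
 define h where "h = (%(v, j). f v * t v ^ j)"
 define J where "J = Sigma T (%v. {..<e v})"
 have hM: "h s : MG" "h s ~= 0" if "s : J" for s
  using that f t MG_closed by (auto simp: h_def J_def)
 have hw: "w (h (v, j)) = w (f v) + int j * w (t v)" if "v : T" "w : T" for v w j
  using f[OF that(1)] t[OF that(1)] valuation_mult[OF Pl_val[OF TP(1)[OF that(2)]], of "f v" "t v ^ j"]
   valuation_power[OF Pl_val[OF TP(1)[OF that(2)]] MG_subfield, of "t v" j] MG_closed(9)[of "t v" j] by (simp add: h_def)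
 have hv: "v (h (v, j)) = int j" if "v : T" for v j using hw[OF that that] f[OF that] t[OF that] by simp
 have ho: "int (e w) <= w (h (v, j))" if "v : T" "w : T" "w ~= v" "j < e v" for v w j
 proof -
  have "int N <= w (f v)" using f[OF that(1)] that by auto
  moreover have "int j * \<bar>w (t v)\<bar> <= int (e v) * \<bar>w (t v)\<bar>" using that(4) by (intro mult_right_mono) auto
  moreover have "int (e w) + int (e v) * \<bar>w (t v)\<bar> <= int N"
  proof -
   have "int (e w + e v * nat \<bar>w (t v)\<bar>) <= int N" using N[OF that(1,2)] by (simp only: of_nat_le_iff)
   thus ?thesis by simp
  qed
  moreover have "- (int j * \<bar>w (t v)\<bar>) <= int j * w (t v)"
   using mult_left_mono[of "- \<bar>w (t v)\<bar>" "w (t v)" "int j"] by simp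
  ultimately show ?thesis unfolding hw[OF that(1,2)] by linarith
 qed
 have "finite J" unfolding J_def using T by auto
 moreover have "card J = (\<Sum>v\<in>T. e v)" unfolding J_def using T by simp
 ultimately obtain A where A: "A <= J" "card A = 15" "finite A" using big by (metis obtain_subset_with_card_n)
 then obtain g where g: "bij_betw g {0..<15::nat} A" using ex_bij_betw_nat_finite[OF A(3)] by auto
 have gJ: "g i : J" if "i < 15" for i using bij_betwE[OF g] A(1) that by auto
 obtain r where r: "EX i<15. poly (r i) c ~= 0" "(\<Sum>i<15. ups_poly (r i) * h (g i)) = 0"
  by (rule ups_relation_stripped[of "%i. h (g i)" c]) (use hM gJ in auto)
 then obtain i0 where i0: "i0 < 15" "poly (r i0) c ~= 0" by blast
 define v where "v = fst (g i0)"
 have vT: "v : T" using gJ[OF i0(1)] by (auto simp: v_def J_def)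
 \<comment> \<open>Among the terms belonging to v whose coefficient does not vanish at c, the one
   with least j has value exactly j. The others at v have larger j or a coefficient divisible by
   upsilon - c, which adds \<open>e v\<close> > j; terms of other places have value at least
   \<open>e v\<close>. So this term cannot be cancelled.\<close>
 obtain i where i: "i < 15 & poly (r i) c ~= 0 & fst (g i) = v"
  "!!k. k < 15 & poly (r k) c ~= 0 & fst (g k) = v ==> snd (g i) <= snd (g k)"
  using ex_has_least_nat[of "%i. i < 15 & poly (r i) c ~= 0 & fst (g i) = v" i0 "%i. snd (g i)"] i0 v_def by metis
 define j where "j = snd (g i)"
 have gi: "g i = (v, j)" "j < e v" using i(1) gJ[of i] by (auto simp: j_def J_def prod_eq_iff)
 note vv = Pl_val[OF TP(1)[OF vT]]
 have pos: "0 < v (ups7 - cst c)" using TP(2,3)[OF vT] by simp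
 note unit = valuation_pev_unit[OF vv MG_subfield range_const_MG upsilon7_MG ups_neq_const pos]
 have u0: "ups7 = 0 \<or> 0 <= v ups7"
  using unit[of "[:0, 1:]"] pos by (cases "c = 0") auto
 define F where "F = (%k. ups_poly (r k) * h (g k))"
 have FM: "F k : MG" if "k < 15" for k unfolding F_def using hM gJ[OF that] by (intro MG_closed(4) ups_poly_MG)
 have Fi: "F i ~= 0" "v (F i) = int j"
  using unit[of "r i"] i(1) gi hM[OF gJ, of i] valuation_mult[OF vv ups_poly_MG, of "r i" "h (g i)"] hv[OF vT, of j]
  by (auto simp: F_def)
 have rest: "(\<Sum>k\<in>{..<15} - {i}. F k) = 0 \<or> int j + 1 <= v (\<Sum>k\<in>{..<15} - {i}. F k)"
 proof (rule valuation_sum_ge[OF vv MG_subfield])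
  fix k assume k: "k : {..<15} - {i}"
  hence k15: "k < 15" by simp
  obtain w l where gk: "g k = (w, l)" by (cases "g k")
  have wl: "w : T" "l < e w" using gJ[OF k15] gk by (auto simp: J_def)
  have "F k = 0 \<or> int j + 1 <= v (F k)"
  proof (cases "r k = 0")
   case False
   have vF: "v (F k) = v (ups_poly (r k)) + v (h (w, l))"
    using valuation_mult[OF vv ups_poly_MG, of "r k" "h (g k)"] False hM[OF gJ[OF k15]] by (simp add: F_def gk)
   have rk: "0 <= v (ups_poly (r k))"
    using pev_valuation_nonneg[OF vv MG_subfield range_const_MG upsilon7_MG u0, of "r k"] False by auto
   show ?thesis
   proof (cases "w = v")
    case wv: False
    thus ?thesis using ho[OF wl(1) vT _ wl(2)] rk vF gi(2) by auto
   next
    case wv: True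
    show ?thesis
    proof (cases "poly (r k) c = 0")
     case True
     then obtain s where s: "r k = [:- c, 1:] * s" by (meson dvdE poly_eq_0_iff_dvd)
     have sz: "s ~= 0" using s False by auto
     have "v (ups_poly (r k)) = v (ups7 - cst c) + v (ups_poly s)"
      unfolding s pev_mult ups_poly_linear using sz ups_neq_const[of c]
      by (intro valuation_mult[OF vv] MG_closed(7) upsilon7_MG MG_const ups_poly_MG) auto
     moreover have "0 <= v (ups_poly s)"
      using pev_valuation_nonneg[OF vv MG_subfield range_const_MG upsilon7_MG u0, of s] sz by auto
     ultimately show ?thesis using vF hv[OF vT, of l] TP(2)[OF vT] gi(2) wv by auto
    next
     case nz: False
     have "j <= l" using i(2)[of k] k15 nz gk wv by (simp add: j_def)
     moreover have "j ~= l"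
     proof
      assume "j = l"
      hence "g k = g i" using gk gi wv by simp
      hence "k = i" using bij_betw_imp_inj_on[OF g] k15 i(1) by (auto dest: inj_onD)
      thus False using k by simp
     qed
     ultimately show ?thesis using vF rk hv[OF vT, of l] wv by simp
    qed
   qed
  qed (simp add: F_def)
  thus "F k : MG & (F k = 0 \<or> int j + 1 <= v (F k))" using FM[OF k15] by simp
 qed
 have "sum F {..<15} = F i + (\<Sum>k\<in>{..<15} - {i}. F k)" using i(1) by (intro sum.remove) auto
 moreover have "F i + (\<Sum>k\<in>{..<15} - {i}. F k) ~= 0"
 proof (rule valuation_add_eq(1)[OF vv MG_subfield range_const_MG FM _ MG_closed(10)])
  show "(\<Sum>k\<in>{..<15} - {i}. F k) = 0 \<or> v (F i) < v (\<Sum>k\<in>{..<15} - {i}. F k)" using rest Fi(2) by auto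
 qed (use i Fi FM in auto)
 ultimately show False using r(2) by (simp add: F_def)
qed

lemma finite_above: "finite (above c)"
proof (rule ccontr)
 assume "infinite (above c)"
 then obtain T where T: "T <= above c" "finite T" "card T = 15" using infinite_arbitrarily_large by metis
 have "(\<Sum>v\<in>T. 1) <= (\<Sum>v\<in>T. v (ups7 - cst c))" using T(1) by (intro sum_mono) (auto simp: above_def)
 thus False using above_sum_le_finite[OF T(2,1)] T(3) by simp
qed

lemma above_sum_le: "(\<Sum>v\<in>above c. v (ups7 - cst c)) <= 14"
 by (rule above_sum_le_finite[OF finite_above order_refl])

section \<open>Riemann-Roch spaces\<close>

definition MGR :: "mero_uhp ring" where
 "MGR = \<lparr>carrier = MG, monoid.mult = (*), one = 1, zero = 0, add = (+)\<rparr>"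

lemma MGR_simps [simp]: "carrier MGR = MG" "a \<otimes>\<^bsub>MGR\<^esub> b = a * b" "\<one>\<^bsub>MGR\<^esub> = 1" "\<zero>\<^bsub>MGR\<^esub> = 0" "a \<oplus>\<^bsub>MGR\<^esub> b = a + b"
 by (simp_all add: MGR_def)

lemma field_MGR: "Ring.field MGR"
proof -
 have "abelian_group MGR"
 proof (rule abelian_groupI)
  show "EX y:carrier MGR. y \<oplus>\<^bsub>MGR\<^esub> x = \<zero>\<^bsub>MGR\<^esub>" if "x : carrier MGR" for x
   using that MG_closed(5)[of x] by (intro bexI[of _ "- x"]) simp_all
 qed (simp_all add: MG_closed(1,3) add.assoc add.commute)
 moreover have "Group.comm_monoid MGR"
  by (rule comm_monoidI) (simp_all add: MG_closed(2,4) mult.assoc mult.commute)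
 ultimately have "cring MGR" by (rule cringI) (simp add: distrib_right)
 then interpret cring MGR .
 show ?thesis
 proof (rule cring_fieldI2)
  show "EX b:carrier MGR. a \<otimes>\<^bsub>MGR\<^esub> b = \<one>\<^bsub>MGR\<^esub>" if "a : carrier MGR" "a ~= \<zero>\<^bsub>MGR\<^esub>" for a
   using that MG_closed(6)[of a] by (intro bexI[of _ "inverse a"]) simp_all
 qed simp
qed

interpretation MGR: Ring.field MGR by (rule field_MGR)

lemma subfield_const: "subfield (range cst) MGR"
proof (rule MGR.subfieldI')
 show "subring (range cst) MGR"
 proof (rule MGR.subringI)
  show "\<ominus>\<^bsub>MGR\<^esub> h : range cst" if "h : range cst" for h
  proof -
   have "\<ominus>\<^bsub>MGR\<^esub> h = - h" using that MG_const MG_closed(5) by (intro MGR.minus_equality) auto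
   thus ?thesis using that const_mero_minus by (metis imageE rangeI)
  qed
 qed (auto simp: MG_const const_mero_add[symmetric] const_mero_mult[symmetric] intro: range_eqI[of _ _ 1])
 show "inv\<^bsub>MGR\<^esub> h : range cst" if "h : range cst - {\<zero>\<^bsub>MGR\<^esub>}" for h
 proof -
  have "inv\<^bsub>MGR\<^esub> h = inverse h" using that MG_const MG_closed(6) by (intro MGR.comm_inv_char) auto
  thus ?thesis using that const_mero_inverse by (metis DiffD1 imageE rangeI)
 qed
qed

lemma places_MGR: "places MGR (range cst) = Pl"
proof -
 have "(ALL c:range cst - {0}. v c = 0) \<longleftrightarrow> (ALL c. c ~= 0 --> v (cst c) = 0)" for v :: "mero_uhp => int" by auto
 thus ?thesis unfolding places_def Pl_def valuation_on_def by simp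
qed

abbreviation "RR \<equiv> riemann_roch_space MGR (range cst)"
abbreviation "dimC n \<equiv> MGR.dimension n (range cst)"

lemma RR_iff: "f : RR D \<longleftrightarrow> f : MG & (f ~= 0 --> (ALL v:Pl. 0 <= v f + D v))"
 by (simp add: riemann_roch_space_def places_MGR)

lemma line_extension_MGR: "MGR.line_extension (range cst) w E = {cst c * w + e | c e. e : E}"
 unfolding MGR.line_extension_def set_add_def set_mult_def r_coset_def by (auto simp: MGR_def)

lemma RR_0: "0 : RR D"
 by (simp add: RR_iff MG_closed(1))

lemma RR_add: "f : RR D ==> g : RR D ==> f + g : RR D"
proof -
 assume f: "f : RR D" and g: "g : RR D"
 have M: "f : MG" "g : MG" using f g by (auto simp: RR_iff)
 show ?thesis
 proof (cases "f = 0 \<or> g = 0 \<or> f + g = 0")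
  case True
  thus ?thesis using f g RR_0 by auto
 next
  case False
  have "0 <= v (f + g) + D v" if v: "v : Pl" for v
  proof -
   have "0 <= v f + D v" "0 <= v g + D v" using f g v False by (auto simp: RR_iff)
   thus ?thesis using valuation_add[OF Pl_val[OF v] M(1) _ M(2)] False by linarith
  qed
  thus ?thesis using M MG_closed(3) by (simp add: RR_iff)
 qed
qed

lemma RR_cmult: "f : RR D ==> cst c * f : RR D"
proof -
 assume f: "f : RR D"
 hence M: "f : MG" by (simp add: RR_iff)
 show ?thesis
 proof (cases "f = 0 \<or> c = 0")
  case True
  thus ?thesis using RR_0 by auto
 next
  case False
  have "0 <= v (cst c * f) + D v" if v: "v : Pl" for v
  proof -
   have "v (cst c * f) = v f"
    using valuation_mult[OF Pl_val[OF v] MG_const[of c] _ M] valuation_const[OF Pl_val[OF v], of c] False by simp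
   moreover have "0 <= v f + D v" using f v False unfolding RR_iff by blast
   ultimately show ?thesis by linarith
  qed
  thus ?thesis using MG_closed(4)[OF MG_const M] unfolding RR_iff by blast
 qed
qed

lemma RR_diff: "f : RR D ==> g : RR D ==> f - cst c * g : RR D"
 using RR_add[of f D "cst (- c) * g"] RR_cmult[of g D "- c"] by (simp add: const_mero_minus)

lemma RR_mono: "(!!v. v : Pl ==> D v <= D' v) ==> RR D <= RR D'"
 unfolding RR_iff subset_iff by (meson add_left_mono order_trans)

lemma RR_cong: "(!!v. v : Pl ==> D v = D' v) ==> RR D = RR D'"
 by (simp add: set_eq_iff RR_iff)

text \<open>A new element has order exactly -D v - 1 at v. Since the residue field is C, any other
  element agrees with a constant multiple of it modulo the smaller space, so the dimension grows by
  at most one.\<close>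

lemma RR_step:
 assumes v: "v : Pl" and w: "w : RR (D(v := D v + 1))" "w ~: RR D"
 shows "RR (D(v := D v + 1)) = {cst c * w + e | c e. e : RR D}"
proof
 have w0: "w ~= 0" "w : MG" using w RR_0 by (auto simp: RR_iff)
 have up: "0 <= u f + (D(v := D v + 1)) u" if "f : RR (D(v := D v + 1))" "f ~= 0" "u : Pl" for f u
  using that unfolding RR_iff by blast
 have inD: "f : RR D" if f: "f : RR (D(v := D v + 1))" "f = 0 \<or> 0 <= v f + D v" for f
 proof (cases "f = 0")
  case False
  have "0 <= u f + D u" if "u : Pl" for u
   using up[OF f(1) False that] f(2) False by (cases "u = v") auto
  thus ?thesis using f(1) unfolding RR_iff by blast
 qed (simp add: RR_0)
 have vw: "v w = - D v - 1"
 proof -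
  have "0 <= v w + D v + 1" using up[OF w(1) w0(1) v] by simp
  moreover have "~ 0 <= v w + D v" using inD[OF w(1)] w(2) by blast
  ultimately show ?thesis by linarith
 qed
 have sub: "RR D <= RR (D(v := D v + 1))" by (rule RR_mono) simp
 show "{cst c * w + e | c e. e : RR D} <= RR (D(v := D v + 1))"
  using sub RR_add RR_cmult[OF w(1)] by blast
 show "RR (D(v := D v + 1)) <= {cst c * w + e | c e. e : RR D}"
 proof
  fix f assume f: "f : RR (D(v := D v + 1))"
  hence fM: "f : MG" by (simp add: RR_iff)
  have "f = 0 \<or> v w <= v f" using up[OF f _ v] vw by (cases "f = 0") auto
  then obtain c where c: "f - cst c * w = 0 \<or> v w < v (f - cst c * w)"
   using place_residual[OF v] fM w0 unfolding residual_def by blast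
  have "f - cst c * w : RR D"
   by (rule inD[OF RR_diff[OF f w(1)]]) (use c vw in auto)
  moreover have "f = cst c * w + (f - cst c * w)" by simp
  ultimately show "f : {cst c * w + e | c e. e : RR D}" by blast
 qed
qed

lemma dim_RR_extend:
 assumes "v : Pl" "w : RR (D(v := D v + 1))" "w ~: RR D" "dimC l (RR D)"
 shows   "dimC (Suc l) (RR (D(v := D v + 1)))"
proof -
 have "w : carrier MGR" using assms(2) by (simp add: RR_iff)
 from MGR.dimension.Suc_dim[OF this assms(3,4)] show ?thesis
  unfolding line_extension_MGR RR_step[OF assms(1-3)] .
qed

lemma dim_RR_step:
 assumes "v : Pl" "dimC l (RR D)"
 shows   "EX l'. dimC l' (RR (D(v := D v + 1))) & l' <= l + 1"
proof (cases "RR (D(v := D v + 1)) <= RR D")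
 case True
 have "RR D <= RR (D(v := D v + 1))" by (rule RR_mono) simp
 hence "RR (D(v := D v + 1)) = RR D" using True by blast
 thus ?thesis using assms(2) by (intro exI[of _ l]) simp
next
 case False
 then obtain w where w: "w : RR (D(v := D v + 1))" "w ~: RR D" by blast
 show ?thesis by (rule exI[of _ "Suc l"]) (use dim_RR_extend[OF assms(1) w assms(2)] in simp)
qed

lemma dim_RR_grow:
 assumes T: "finite T" "T <= Pl"
 shows "(!!v. v : T ==> D v <= D' v) ==> (!!v. v : Pl - T ==> D v = D' v) ==> dimC l (RR D) ==>
  (\<Sum>v\<in>T. D' v - D v) = int n ==> EX l'. dimC l' (RR D') & l' <= l + n"
proof (induction n arbitrary: D l)
 case 0
 have "ALL v:T. D' v - D v = 0"
  using sum_nonneg_eq_0_iff[OF T(1), of "%v. D' v - D v"] 0(1,4) by simp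
 hence "D v = D' v" if "v : Pl" for v using 0(2)[of v] that by (cases "v : T") auto
 hence "RR D = RR D'" by (rule RR_cong)
 thus ?case using 0(3) by (intro exI[of _ l]) simp
next
 case (Suc n)
 have "EX v:T. D v < D' v"
 proof (rule ccontr)
  assume "~ ?thesis"
  hence "(\<Sum>v\<in>T. D' v - D v) <= (\<Sum>v\<in>T. 0)" by (intro sum_mono) auto
  thus False using Suc.prems(4) by simp
 qed
 then obtain v where v: "v : T" "D v < D' v" by blast
 define E where "E = D(v := D v + 1)"
 obtain m where m: "dimC m (RR E)" "m <= l + 1" using dim_RR_step[of v l D] v T Suc.prems(3) unfolding E_def by blast
 have "(\<Sum>u\<in>T. D' u - E u) = (D' v - E v) + (\<Sum>u\<in>T - {v}. D' u - E u)" by (rule sum.remove[OF T(1) v(1)])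
 also have "(\<Sum>u\<in>T - {v}. D' u - E u) = (\<Sum>u\<in>T - {v}. D' u - D u)" by (rule sum.cong) (auto simp: E_def)
 also have "(D' v - E v) + (\<Sum>u\<in>T - {v}. D' u - D u) = (\<Sum>u\<in>T. D' u - D u) - 1"
  unfolding sum.remove[OF T(1) v(1), of "%u. D' u - D u"] by (simp add: E_def)
 finally have s: "(\<Sum>u\<in>T. D' u - E u) = int n" using Suc.prems(4) by simp
 have "EX l'. dimC l' (RR D') & l' <= m + n"
 proof (rule Suc.IH[OF _ _ m(1) s])
  show "E u <= D' u" if "u : T" for u using Suc.prems(1)[OF that] v(2) by (auto simp: E_def)
  show "E u = D' u" if "u : Pl - T" for u using Suc.prems(2)[OF that] v(1) that by (auto simp: E_def)
 qed
 then obtain l' where l': "dimC l' (RR D')" "l' <= m + n" by blast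
 have "l' <= l + Suc n" using l'(2) m(2) by linarith
 thus ?case using l'(1) by blast
qed

lemma dim_mult:
 assumes a: "a : MG" "a ~= 0"
 shows "dimC n E ==> dimC n ((*) a ` E)"
proof (induction n arbitrary: E)
 case 0
 hence "E = {0}" using MGR.dimension_zero[OF subfield_const] by simp
 thus ?case using MGR.dimension.zero_dim[of "range cst"] by simp
next
 case (Suc n)
 then obtain v E' where v: "v : MG" "dimC n E'" "v ~: E'" "E = MGR.line_extension (range cst) v E'"
  using MGR.dimension_backwards[OF subfield_const Suc.prems] by auto
 have "a * v ~: (*) a ` E'" using v(3) a(2) by auto
 moreover have "a * v : carrier MGR" using a v MG_closed(4) by simp
 ultimately have "dimC (Suc n) (MGR.line_extension (range cst) (a * v) ((*) a ` E'))"
  using MGR.dimension.Suc_dim Suc.IH[OF v(2)] by blast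
 moreover have "MGR.line_extension (range cst) (a * v) ((*) a ` E') = (*) a ` E"
 proof -
  have "cst c * (a * v) + a * e = a * (cst c * v + e)" for c e by (simp add: algebra_simps)
  thus ?thesis unfolding v(4) line_extension_MGR by (auto simp: image_iff) metis+
 qed
 ultimately show ?case by simp
qed

lemma PlI_uniformizer:
 assumes v: "v : extensional (MG - {0})" "valuation_on MG v" and t: "t : MG" "t ~= 0" "v t = 1"
 shows   "v : Pl"
proof -
 have "n : v ` (MG - {0})" for n
 proof (cases "n \<ge> 0")
  case True
  have "v (t ^ nat n) = n" using valuation_power[OF v(2) MG_subfield t(1,2)] t(3) True by simp
  moreover have "t ^ nat n : MG - {0}" using t MG_closed(9) by simp
  ultimately show ?thesis by (metis image_eqI)
 next
  case False
  have "v (inverse t ^ nat (- n)) = n"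
   using valuation_power[OF v(2) MG_subfield MG_closed(6)[OF t(1)], of "nat (- n)"] t False
    valuation_inverse[OF v(2) MG_subfield t(1,2)] by simp
  moreover have "inverse t ^ nat (- n) : MG - {0}" using t MG_closed(6,9) by simp
  ultimately show ?thesis by (metis image_eqI)
 qed
 thus ?thesis using v by (auto simp: Pl_def)
qed

text \<open>A valuation in \<open>W\<close> may be ramified over \<open>MG\<close>. Its least
  positive value e divides all others, and dividing by e yields a place.\<close>

lemma W_place:
 assumes w: "w : W"
 obtains v e where "v : Pl" "v ~= vP" "e > 0" "!!h. h : MG ==> h ~= 0 ==> w h = e * v h"
proof -
 have wv: "valuation_on MG w" using valuation_on_subset[OF W_valuation[OF w]] MG_M14 by blast
 have "1 ~= (0 :: mero_uhp)" "ups7 = 0 \<or> w 1 <= w ups7" using W_upsilon7[OF w] valuation_1[OF wv] by simp_all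
 then obtain c where "ups7 - cst c * 1 = 0 \<or> w 1 < w (ups7 - cst c * 1)"
  using W_residual[OF w] MG_M14[OF upsilon7_MG] M14_closed(2) unfolding residual_def by blast
 hence c: "0 < w (ups7 - cst c)" using ups_neq_const[of c] valuation_1[OF wv] by simp
 define Q where "Q = (%n::nat. 0 < n & (EX f:MG. f ~= 0 & w f = int n))"
 have "Q (nat (w (ups7 - cst c)))" unfolding Q_def
  using c ups_neq_const[of c] MG_closed(7)[OF upsilon7_MG MG_const[of c]]
  by (intro conjI bexI[of _ "ups7 - cst c"]) auto
 hence QL: "Q (LEAST n. Q n)" by (rule LeastI)
 define e where "e = int (LEAST n. Q n)"
 obtain t where t: "t : MG" "t ~= 0" "w t = e" and e: "e > 0" using QL unfolding Q_def e_def by auto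
 have dv: "w h mod e = 0" if h: "h : MG" "h ~= 0" for h
 proof (rule ccontr)
  assume r: "w h mod e ~= 0"
  define k where "k = w h div e"
  have kr: "w h = k * e + w h mod e" by (simp add: k_def)
  have "EX g:MG. g ~= 0 & w g = w h - k * e"
  proof (cases "k \<ge> 0")
   case True
   have T: "t ^ nat k : MG" "t ^ nat k ~= 0" using t MG_closed(9) by auto
   have "w (h / t ^ nat k) = w h - k * e"
    using valuation_divide[OF wv MG_subfield h T] valuation_power[OF wv MG_subfield t(1,2), of "nat k"] t(3) True by simp
   moreover have "h / t ^ nat k : MG" "h / t ^ nat k ~= 0" using h T MG_closed(8) by auto
   ultimately show ?thesis by blast
  next
   case False
   have T: "t ^ nat (- k) : MG" "t ^ nat (- k) ~= 0" using t MG_closed(9) by auto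
   have "w (h * t ^ nat (- k)) = w h - k * e"
    using valuation_mult[OF wv h T] valuation_power[OF wv MG_subfield t(1,2), of "nat (- k)"] t(3) False by simp
   moreover have "h * t ^ nat (- k) : MG" "h * t ^ nat (- k) ~= 0" using h T MG_closed(4) by auto
   ultimately show ?thesis by blast
  qed
  moreover have r2: "0 < w h mod e" "w h mod e < e"       using r pos_mod_sign[OF e, of "w h"] pos_mod_bound[OF e, of "w h"] by linarith+
  ultimately have "Q (nat (w h mod e))" unfolding Q_def using kr by auto
  hence "(LEAST n. Q n) <= nat (w h mod e)" by (rule Least_le)
  thus False using r2 unfolding e_def by linarith
 qed
 define v where "v = restrict (%h. w h div e) (MG - {0})"
 have we: "w h = e * v h" if h: "h : MG" "h ~= 0" for h
 proof -
  have "v h = w h div e" unfolding v_def by (rule restrict_apply') (use h in simp)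
  moreover have "e * (w h div e) + w h mod e = w h" by (rule mult_div_mod_eq)
  ultimately show ?thesis unfolding dv[OF h] by (metis add.right_neutral)
 qed
 have "valuation_on MG v" unfolding valuation_on_def
 proof (intro conjI ballI allI impI)
  fix f g assume "f : MG - {0}" "g : MG - {0}"
  hence fg: "f : MG" "f ~= 0" "g : MG" "g ~= 0" by auto
  have "e * v (f * g) = e * (v f + v g)"
   using valuation_mult[OF wv fg] we[OF fg(1,2)] we[OF fg(3,4)] we[OF MG_closed(4)[OF fg(1,3)]] fg by (simp add: distrib_left)
  thus "v (f * g) = v f + v g" using e by simp
  show "min (v f) (v g) <= v (f + g)" if "f + g ~= 0"
  proof -
   have "min (e * v f) (e * v g) <= e * v (f + g)"
    using valuation_add[OF wv fg that] we[OF fg(1,2)] we[OF fg(3,4)] we[OF MG_closed(3)[OF fg(1,3)] that] by simp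
   thus ?thesis using e by (auto simp: min_def split: if_splits)
  qed
 next
  fix a :: complex assume "a ~= 0"
  hence "e * v (cst a) = 0" using we[OF MG_const[of a]] valuation_const[OF wv, of a] by simp
  thus "v (cst a) = 0" using e by simp
 qed
 moreover have "v t = 1" using we[OF t(1,2)] t(3) e by simp
 moreover have "v : extensional (MG - {0})" by (simp add: v_def)
 ultimately have "v : Pl" using PlI_uniformizer t by blast
 moreover have "v ~= vP"
 proof
  assume "v = vP"
  hence "w ups7 = e * (- 14)" using we[OF upsilon7_MG upsilon7_nz(1)] vP_eq[OF upsilon7_MG upsilon7_nz(1)] vinf_upsilon7 by simp
  thus False using W_upsilon7[OF w] e by simp
 qed
 ultimately show ?thesis using that we e by blast
qed

section \<open>Multiples of the place at infinity and the gap count\<close>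

definition NP :: "int => (mero_uhp => int) => int" where "NP n = (%v. if v = vP then n else 0)"

lemma place_ups_nonneg: "v : Pl ==> v ~= vP ==> 0 <= v ups7"
 using pole_unique by force

lemma valuation_bb_nonneg:
 assumes v: "valuation_on MG v" "0 <= v ups7"
 shows   "0 <= v (bb m)"
proof -
 have "0 <= v (ups_poly (BB m))"
  using pev_valuation_nonneg[OF v(1) MG_subfield range_const_MG upsilon7_MG, of "BB m"] v(2) BB_nz[of m] by auto
 thus ?thesis using valuation_power[OF v(1) MG_subfield bb_MG bb_nz, of m 14] unfolding bb_power by simp
qed

lemma valuation_ups_bb_nonneg:
 assumes v: "valuation_on MG v" "0 <= v ups7" and q: "q ~= 0"
 shows   "0 <= v (ups_poly q * bb m)"
proof -
 have "0 <= v (ups_poly q)"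
  using pev_valuation_nonneg[OF v(1) MG_subfield range_const_MG upsilon7_MG, of q] v(2) q by auto
 moreover have "v (ups_poly q * bb m) = v (ups_poly q) + v (bb m)"
  by (rule valuation_mult[OF v(1) ups_poly_MG _ bb_MG bb_nz]) (use q in simp)
 ultimately show ?thesis using valuation_bb_nonneg[OF v, of m] by simp
qed

text \<open>The passage from analysis to abstract places. Regularity on \<open>W\<close> yields
  polynomial coefficients by \<open>regular_coeffs\<close>, and polynomials in upsilon times
  \<open>bb m\<close> are nonnegative wherever upsilon is, which by \<open>pole_unique\<close> means
  everywhere except at \<open>vP\<close>.\<close>

lemma RR_NP_iff: "f : RR (NP n) \<longleftrightarrow> f : MG & (f ~= 0 --> - n <= vinf f & (ALL w:W. 0 <= w f))"
proof (cases "f = 0 \<or> f ~: MG")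
 case True
 thus ?thesis by (auto simp: RR_iff)
next
 case False
 hence f: "f : MG" "f ~= 0" by auto
 show ?thesis
 proof
  assume R: "f : RR (NP n)"
  have P: "0 <= v f + NP n v" if "v : Pl" for v using R f that unfolding RR_iff by blast
  have "- n <= vinf f" using P[OF vP_Pl] vP_eq[OF f] by (simp add: NP_def)
  moreover have "0 <= w f" if w: "w : W" for w
  proof -
   obtain v e where v: "v : Pl" "v ~= vP" "e > 0" "!!h. h : MG ==> h ~= 0 ==> w h = e * v h" using W_place[OF w] by metis
   have "0 <= v f" using P[OF v(1)] v(2) by (simp add: NP_def)
   thus ?thesis using v(3) v(4)[OF f] by simp
  qed
  ultimately show "f : MG & (f ~= 0 --> - n <= vinf f & (ALL w:W. 0 <= w f))" using f by blast
 next
  assume R: "f : MG & (f ~= 0 --> - n <= vinf f & (ALL w:W. 0 <= w f))"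
  hence R': "- n <= vinf f" "!!w. w : W ==> f = 0 \<or> 0 <= w f" using f by auto
  obtain q where q: "f = (\<Sum>m<14. ups_poly (q m) * bb m)" by (rule regular_coeffs[OF f(1)]) (use R'(2) in blast)
  have "0 <= v f + NP n v" if v: "v : Pl" for v
  proof (cases "v = vP")
   case True
   thus ?thesis using R'(1) vP_eq[OF f] by (simp add: NP_def)
  next
   case False
   have "f = 0 \<or> 0 <= v f" unfolding q
   proof (rule valuation_sum_ge[OF Pl_val[OF v] MG_subfield])
    fix m
    show "ups_poly (q m) * bb m : MG & (ups_poly (q m) * bb m = 0 \<or> 0 <= v (ups_poly (q m) * bb m))"
     using valuation_ups_bb_nonneg[OF Pl_val[OF v] place_ups_nonneg[OF v False], of "q m" m] MG_closed(4)[OF ups_poly_MG bb_MG]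
     by (cases "q m = 0") (auto simp: MG_closed(1))
   qed
   thus ?thesis using f False by (simp add: NP_def)
  qed
  thus "f : RR (NP n)" using f unfolding RR_iff by blast
 qed
qed

text \<open>The Weierstrass gaps at infinity: the numbers not of the form 14 j +
  \<open>ww m\<close>. The residue class of \<open>ww m\<close> modulo 14 contains
  floor(\<open>ww m\<close> / 14) of them.\<close>

definition gaps :: "nat set" where "gaps = {1, 2, 3, 4, 5, 7, 8, 9, 11, 13, 15, 17, 19, 21, 23, 25, 27}"

lemma ww_values: "ww 0 = 0" "ww (Suc 0) = 31" "ww 2 = 6" "ww 3 = 37" "ww 4 = 12" "ww 5 = 29" "ww 6 = 18" "ww 7 = 35" "ww 8 = 10"
 "ww 9 = 41" "ww 10 = 16" "ww 11 = 33" "ww 12 = 22" "ww 13 = 39"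
 by (simp_all add: ww_def)

lemma not_gap_if: "m < 14 ==> 14 * j + ww m ~: gaps"
proof
 assume m: "m < 14" and g: "14 * j + ww m : gaps"
 have "m = 0 \<or> m = Suc 0 \<or> m = 2 \<or> m = 3 \<or> m = 4 \<or> m = 5 \<or> m = 6 \<or> m = 7 \<or> m = 8 \<or> m = 9 \<or> m = 10 \<or> m = 11 \<or> m = 12 \<or> m = 13"
  using m by (auto simp: numeral_eq_Suc less_Suc_eq)
 moreover have "j = 0 \<or> j = 1 \<or> 2 <= j" by linarith
 moreover have "14 * j + ww m <= 27" using g unfolding gaps_def by auto
 ultimately show False using g by (elim disjE) (simp_all add: ww_values gaps_def)
qed

text \<open>Each class r modulo 14 is met by one m, with \<open>ww m\<close> = 14 s + r. All numbers
  of the class from \<open>ww m\<close> on are attained, and those below are listed as gaps.\<close>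

lemma ex_if_not_gap:
 assumes k: "k ~: gaps"
 shows "EX m<14. EX j. k = 14 * j + ww m"
proof -
 define i r where "i = k div 14" and "r = k mod 14"
 have kir: "k = 14 * i + r" and r: "r < 14" by (simp_all add: i_def r_def)
 have step: "EX m<14. EX j. k = 14 * j + ww m" if "ww m = 14 * s + r" "s <= i" "m < 14" for m s
  using that kir by (intro exI[of _ m] conjI exI[of _ "i - s"]) (auto simp: diff_mult_distrib2)
 have i: "i = 0 \<or> i = 1 \<or> 2 <= i" by linarith
 have "r = 0 \<or> r = Suc 0 \<or> r = 2 \<or> r = 3 \<or> r = 4 \<or> r = 5 \<or> r = 6 \<or> r = 7 \<or> r = 8 \<or> r = 9 \<or> r = 10 \<or> r = 11 \<or> r = 12 \<or> r = 13"
  using r by (auto simp: numeral_eq_Suc less_Suc_eq)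
 thus ?thesis
 proof (elim disjE)
  assume e: "r = 0"
  have "0 <= i" using i k unfolding kir e by (auto simp: gaps_def)
  thus ?thesis by (intro step[of "0" 0]) (simp_all add: ww_values e)
 next
  assume e: "r = Suc 0"
  have "2 <= i" using i k unfolding kir e by (auto simp: gaps_def)
  thus ?thesis by (intro step[of "5" 2]) (simp_all add: ww_values e)
 next
  assume e: "r = 2"
  have "1 <= i" using i k unfolding kir e by (auto simp: gaps_def)
  thus ?thesis by (intro step[of "10" 1]) (simp_all add: ww_values e)
 next
  assume e: "r = 3"
  have "2 <= i" using i k unfolding kir e by (auto simp: gaps_def)
  thus ?thesis by (intro step[of "Suc 0" 2]) (simp_all add: ww_values e)
 next
  assume e: "r = 4"
  have "1 <= i" using i k unfolding kir e by (auto simp: gaps_def)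
  thus ?thesis by (intro step[of "6" 1]) (simp_all add: ww_values e)
 next
  assume e: "r = 5"
  have "2 <= i" using i k unfolding kir e by (auto simp: gaps_def)
  thus ?thesis by (intro step[of "11" 2]) (simp_all add: ww_values e)
 next
  assume e: "r = 6"
  have "0 <= i" using i k unfolding kir e by (auto simp: gaps_def)
  thus ?thesis by (intro step[of "2" 0]) (simp_all add: ww_values e)
 next
  assume e: "r = 7"
  have "2 <= i" using i k unfolding kir e by (auto simp: gaps_def)
  thus ?thesis by (intro step[of "7" 2]) (simp_all add: ww_values e)
 next
  assume e: "r = 8"
  have "1 <= i" using i k unfolding kir e by (auto simp: gaps_def)
  thus ?thesis by (intro step[of "12" 1]) (simp_all add: ww_values e)
 next
  assume e: "r = 9"
  have "2 <= i" using i k unfolding kir e by (auto simp: gaps_def)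
  thus ?thesis by (intro step[of "3" 2]) (simp_all add: ww_values e)
 next
  assume e: "r = 10"
  have "0 <= i" using i k unfolding kir e by (auto simp: gaps_def)
  thus ?thesis by (intro step[of "8" 0]) (simp_all add: ww_values e)
 next
  assume e: "r = 11"
  have "2 <= i" using i k unfolding kir e by (auto simp: gaps_def)
  thus ?thesis by (intro step[of "13" 2]) (simp_all add: ww_values e)
 next
  assume e: "r = 12"
  have "0 <= i" using i k unfolding kir e by (auto simp: gaps_def)
  thus ?thesis by (intro step[of "4" 0]) (simp_all add: ww_values e)
 next
  assume e: "r = 13"
  have "2 <= i" using i k unfolding kir e by (auto simp: gaps_def)
  thus ?thesis by (intro step[of "9" 2]) (simp_all add: ww_values e)
 qed
qed

lemma dim_NP: "dimC (card ({..<n} - gaps)) (RR (NP (int n - 1)))"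
proof (induction n)
 case 0
 have "RR (NP (- 1)) = {0}"
 proof -
  have "f = 0" if "f : RR (NP (- 1))" for f
   using that vinf_nonpos[of f] unfolding RR_NP_iff by force
  thus ?thesis using RR_0 by blast
 qed
 thus ?case using MGR.dimension.zero_dim[of "range cst"] by simp
next
 case (Suc n)
 have e: "NP (int (Suc n) - 1) = (NP (int n - 1))(vP := NP (int n - 1) vP + 1)" by (auto simp: NP_def)
 show ?case
 proof (cases "n : gaps")
  case True
  have "RR (NP (int (Suc n) - 1)) <= RR (NP (int n - 1))"
  proof
   fix f assume f: "f : RR (NP (int (Suc n) - 1))"
   show "f : RR (NP (int n - 1))"
   proof (cases "f = 0")
    case False
    have R: "f : MG" "- int n <= vinf f" "!!w. w : W ==> 0 <= w f" using f False unfolding RR_NP_iff by auto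
    have "vinf f ~= - int n"
    proof
     assume v: "vinf f = - int n"
     obtain q where q: "f = (\<Sum>m<14. ups_poly (q m) * bb m)" using regular_coeffs[of f] R(1,3) by metis
     have ex: "EX m<14. q m ~= 0" using False unfolding q by (rule contrapos_np) simp
     have "vinf ups7 < 0" by (simp add: vinf_upsilon7)
     from valuation_bb_sum(2)[OF vinf_MG this ex, folded q] obtain m where
      m: "m < 14 & q m ~= 0 & 14 * vinf f = int (14 * degree (q m) + ww m) * vinf ups7 \<and>
       (ALL j<14. q j ~= 0 --> 14 * degree (q j) + ww j <= 14 * degree (q m) + ww m)" ..
     have "14 * vinf f = int (14 * degree (q m) + ww m) * vinf ups7" using m by blast
     hence "14 * (- int n) = int (14 * degree (q m) + ww m) * (- 14)" unfolding v vinf_upsilon7 .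
     hence "int n = int (14 * degree (q m) + ww m)" by simp
     hence "n = 14 * degree (q m) + ww m" by (simp only: of_nat_eq_iff)
     thus False using True not_gap_if m by blast
    qed
    thus ?thesis using R False unfolding RR_NP_iff by auto
   qed (simp add: RR_0)
  qed
  moreover have "RR (NP (int n - 1)) <= RR (NP (int (Suc n) - 1))" by (rule RR_mono) (simp add: NP_def)
  ultimately have "RR (NP (int (Suc n) - 1)) = RR (NP (int n - 1))" by blast
  moreover have "{..<Suc n} - gaps = {..<n} - gaps" using True by (auto simp: less_Suc_eq)
  ultimately show ?thesis using Suc.IH by simp
 next
  case False
  then obtain m j where mj: "m < 14" "n = 14 * j + ww m" using ex_if_not_gap by blast
  define f where "f = ups_poly (monom 1 j) * bb m"
  have mz: "monom 1 j ~= (0 :: complex poly)" by (simp add: monom_eq_0_iff)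
  have f: "f : MG" "f ~= 0" unfolding f_def using MG_closed(4)[OF ups_poly_MG bb_MG] mz bb_nz by simp_all
  have vf: "vinf f = - int n"
   using valuation_mult[OF vinf_MG ups_poly_MG _ bb_MG bb_nz, of "monom 1 j" m] vinf_ups_poly[OF mz] mz mj(2)
   by (simp add: f_def vinf_bb degree_monom_eq)
  have fw: "0 <= w f" if w: "w : W" for w
  proof -
   have wv: "valuation_on MG w" using valuation_on_subset[OF W_valuation[OF w]] MG_M14 by blast
   show ?thesis unfolding f_def using valuation_ups_bb_nonneg[OF wv W_upsilon7[OF w] mz, of m] .
  qed
  have "f : RR (NP (int (Suc n) - 1))" "f ~: RR (NP (int n - 1))" using f vf fw unfolding RR_NP_iff by auto
  from dim_RR_extend[OF vP_Pl this[unfolded e] Suc.IH] have "dimC (Suc (card ({..<n} - gaps))) (RR (NP (int (Suc n) - 1)))"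
   unfolding e .
  moreover have "{..<Suc n} - gaps = insert n ({..<n} - gaps)" using False by (auto simp: less_Suc_eq)
  ultimately show ?thesis by simp
 qed
qed

lemma card_not_gaps: "28 <= n ==> card ({..<n} - gaps) = n - 17"
proof -
 assume n: "28 <= n"
 have "gaps <= {..<n}" using n by (auto simp: gaps_def)
 moreover have "card gaps = 17" by (simp add: gaps_def)
 moreover have "finite gaps" by (simp add: gaps_def)
 ultimately show ?thesis by (simp add: card_Diff_subset)
qed

lemma place_ups_poly:
 assumes v: "v : above c"
 shows "poly r c ~= 0 ==> v (ups_poly r) = 0" and "v ~= vP"
proof -
 have vP: "v : Pl" and pos: "0 < v (ups7 - cst c)" using v by (auto simp: above_def)
 show "poly r c ~= 0 ==> v (ups_poly r) = 0"
  by (rule valuation_pev_unit(2)[OF Pl_val[OF vP] MG_subfield range_const_MG upsilon7_MG ups_neq_const pos])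
 show "v ~= vP"
 proof
  assume e: "v = vP"
  have "ups7 - cst c : MG" "ups7 - cst c ~= 0" using ups_poly_MG[of "[:- c, 1:]"] ups_neq_const[of c] unfolding ups_poly_linear by auto
  hence "v (ups7 - cst c) = vinf (ups_poly [:- c, 1:])" unfolding e ups_poly_linear by (rule vP_eq)
  thus False using pos vinf_ups_poly[of "[:- c, 1:]"] by simp
 qed
qed

lemma above_disjoint: "c ~= c' ==> above c \<inter> above c' = {}"
proof (rule ccontr)
 assume c: "c ~= c'" and "above c \<inter> above c' ~= {}"
 then obtain v where v: "v : above c" "v : above c'" by blast
 have "v (ups_poly [:- c', 1:]) = 0" by (rule place_ups_poly(1)[OF v(1)]) (use c in simp)
 thus False using v(2) unfolding ups_poly_linear by (simp add: above_def)
qed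

text \<open>D is enlarged to a divisor D' that differs from the zero divisor of a = p(upsilon) only
  at infinity, at the cost of at most deg D' - deg D dimensions. Multiplication by a carries the
  space of D' onto that of a multiple of infinity, whose dimension is known. That upsilon - c has at
  most 14 zeros, counted with multiplicity, bounds deg D'.\<close>

lemma riemann_inequality:
 assumes D: "D : divisors MGR (range cst)" and l: "dimC l (RR D)"
 shows   "divisor_degree D - int l + 1 <= 17"
proof -
 define A where "A = {v. D v ~= 0}"
 have A: "finite A" "A <= Pl" using D by (auto simp: divisors_def places_MGR A_def)
 have "EX c. v : Pl - {vP} --> v : above c" for v
  using place_residue_ups[of v] place_ups_nonneg[of v] by (auto simp: above_def)
 then obtain r where r: "!!v. v : Pl - {vP} ==> v : above (r v)" by metis
 \<comment> \<open>The values of upsilon below the support of D; 0 is added to make the set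
   nonempty, so that p has degree at least \<open>N\<close>.\<close>
 define C where "C = insert 0 (r ` (A - {vP}))"
 have C: "finite C" "C ~= {}" using A by (auto simp: C_def)
 \<comment> \<open>Dominates all coefficients of D, and at least 6, which puts \<open>k\<close>
   below well past the last gap 27.\<close>
 define N where "N = Suc (\<Sum>v\<in>insert vP A. nat \<bar>D v\<bar>) + 5"
 have ND: "\<bar>D v\<bar> <= int N" if "v : insert vP A" for v
 proof -
  have "nat \<bar>D v\<bar> <= (\<Sum>v\<in>insert vP A. nat \<bar>D v\<bar>)" by (rule member_le_sum[OF that]) (use A in auto)
  thus ?thesis unfolding N_def by linarith
 qed
 define p where "p = (\<Prod>c\<in>C. [:- c, 1:] ^ N)"
 have pz: "p ~= 0" using C by (simp add: p_def)
 have dp: "degree p = N * card C"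
  unfolding p_def by (subst degree_prod_eq_sum_degree) (simp_all add: degree_power_eq)
 define a where "a = ups_poly p"
 have a: "a : MG" "a ~= 0" using pz by (simp_all add: a_def ups_poly_MG)
 define T where "T = (\<Union>c\<in>C. above c)"
 have T: "finite T" "T <= Pl" using C finite_above by (auto simp: T_def above_def)
 have vPT: "vP ~: T" using place_ups_poly(2) by (auto simp: T_def)
 have va: "v a = int N * v (ups7 - cst c)" if c: "c : C" "v : above c" for v c
 proof -
  have vv: "valuation_on MG v" using c by (auto simp: above_def intro: Pl_val)
  define p' where "p' = (\<Prod>c\<in>C - {c}. [:- c, 1:] ^ N)"
  have pe: "p = [:- c, 1:] ^ N * p'" unfolding p_def p'_def by (rule prod.remove[OF C(1) c(1)])
  have p'c: "poly p' c ~= 0" using C(1) by (auto simp: p'_def poly_prod poly_power)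
  hence p'z: "p' ~= 0" by auto
  have lz: "ups7 - cst c : MG" "ups7 - cst c ~= 0" using ups_poly_MG[of "[:- c, 1:]"] ups_neq_const[of c] unfolding ups_poly_linear by auto
  have "v a = v ((ups7 - cst c) ^ N) + v (ups_poly p')"
   unfolding a_def pe pev_mult pev_power ups_poly_linear
   by (rule valuation_mult[OF vv MG_closed(9)[OF lz(1)] _ ups_poly_MG]) (use lz p'z in auto)
  thus ?thesis using valuation_power[OF vv MG_subfield lz] place_ups_poly(1)[OF c(2) p'c] by simp
 qed
 \<comment> \<open>At infinity D is kept. Elsewhere D' v = v a, so \<open>a * f\<close> is regular
   at v exactly when \<open>f\<close> satisfies the bound given by D'.\<close>
 define D' where "D' = (%v. if v = vP then D vP else v a)"
 have DT: "D v <= D' v" if v: "v : T" for v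
 proof -
  obtain c where c: "c : C" "v : above c" using v by (auto simp: T_def)
  have "int N * 1 <= int N * v (ups7 - cst c)" using c(2) by (intro mult_left_mono) (auto simp: above_def)
  moreover have "D v <= int N" using ND[of v] by (cases "v : A") (auto simp: A_def)
  moreover have "D' v = int N * v (ups7 - cst c)" using va[OF c] place_ups_poly(2)[OF c(2)] by (simp add: D'_def)
  ultimately show ?thesis by linarith
 qed
 have Dout: "D v = D' v" if v: "v : Pl - T" for v
 proof (cases "v = vP")
  case False
  have "v : above (r v)" using r v False by blast
  hence "r v ~: C" using v by (auto simp: T_def)
  hence "v ~: A" using False by (auto simp: C_def)
  moreover have "poly p (r v) ~= 0" using C(1) \<open>r v ~: C\<close> by (auto simp: p_def poly_prod poly_power)
  hence "v a = 0" unfolding a_def by (rule place_ups_poly(1)[OF \<open>v : above (r v)\<close>])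
  ultimately show ?thesis using False by (simp add: D'_def A_def)
 qed (simp add: D'_def)
 define n where "n = nat (\<Sum>v\<in>T. D' v - D v)"
 have n: "(\<Sum>v\<in>T. D' v - D v) = int n" unfolding n_def using DT by (simp add: sum_nonneg)
 obtain l' where l': "dimC l' (RR D')" "l' <= l + n" using dim_RR_grow[OF T DT Dout l n] by blast
 define k where "k = nat (D vP + 14 * int (degree p) + 1)"
 have "int N <= int (degree p)" using C unfolding dp by (cases "card C") auto
 moreover have "\<bar>D vP\<bar> <= int N" by (rule ND) simp
 moreover have "6 <= int N" by (simp add: N_def)
 ultimately have k: "int k = D vP + 14 * int (degree p) + 1" "28 <= k" unfolding k_def by linarith+
 have shift: "a * f : RR (NP (int k - 1)) \<longleftrightarrow> f : RR D'" if f: "f : MG" for f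
 proof (cases "f = 0")
  case False
  have e: "v (a * f) = v a + v f" if "v : Pl" for v by (rule valuation_mult[OF Pl_val[OF that] a f False])
  have "vP a = - 14 * int (degree p)" using vP_eq[OF a] vinf_ups_poly[OF pz] by (simp add: a_def)
  hence eq: "v (a * f) + NP (int k - 1) v = v f + D' v" if "v : Pl" for v
   using e[OF that] k(1) by (cases "v = vP") (auto simp: NP_def D'_def)
  have "(ALL v:Pl. 0 <= v (a * f) + NP (int k - 1) v) \<longleftrightarrow> (ALL v:Pl. 0 <= v f + D' v)"
  proof (rule ball_cong[OF refl])
   fix v assume "v : Pl"
   thus "(0 <= v (a * f) + NP (int k - 1) v) = (0 <= v f + D' v)" by (simp only: eq)
  qed
  thus ?thesis using False f a MG_closed(4)[OF a(1) f] unfolding RR_iff by simp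
 qed (simp add: RR_0)
 have "RR (NP (int k - 1)) = (*) a ` RR D'"
 proof
  show "(*) a ` RR D' <= RR (NP (int k - 1))" using shift by (auto simp: RR_iff)
  show "RR (NP (int k - 1)) <= (*) a ` RR D'"
  proof
   fix g assume g: "g : RR (NP (int k - 1))"
   hence "g / a : MG" using a MG_closed(8) by (auto simp: RR_iff)
   moreover have "a * (g / a) = g" using a by simp
   ultimately show "g : (*) a ` RR D'" using shift[of "g / a"] g by (metis image_eqI)
  qed
 qed
 hence "dimC l' (RR (NP (int k - 1)))" using dim_mult[OF a l'(1)] by simp
 hence lk: "l' = k - 17" using MGR.dimension_is_inj[OF subfield_const _ dim_NP[of k]] card_not_gaps[OF k(2)] by simp
 have sD': "(\<Sum>v\<in>T. D' v) <= 14 * int (degree p)"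
 proof -
  have "(\<Sum>v\<in>T. D' v) = (\<Sum>c\<in>C. \<Sum>v\<in>above c. D' v)"
   unfolding T_def by (rule sum.UNION_disjoint) (use C finite_above above_disjoint in auto)
  also have "\<dots> = (\<Sum>c\<in>C. int N * (\<Sum>v\<in>above c. v (ups7 - cst c)))"
   unfolding sum_distrib_left using va place_ups_poly(2) by (intro sum.cong) (auto simp: D'_def)
  also have "\<dots> <= (\<Sum>c\<in>C. int N * 14)" by (intro sum_mono mult_left_mono above_sum_le) simp
  also have "\<dots> = 14 * int (degree p)" unfolding dp by simp
  finally show ?thesis .
 qed
 have "divisor_degree D = (\<Sum>v\<in>insert vP T. D v)"
  unfolding divisor_degree_def
 proof (rule sum.mono_neutral_left)
  show "{v. D v ~= 0} <= insert vP T"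
  proof
   fix v assume "v : {v. D v ~= 0}"
   hence v: "v : A" by (simp add: A_def)
   show "v : insert vP T"
   proof (cases "v = vP")
    case False
    hence "v : above (r v)" "r v : C" using r[of v] v A by (auto simp: C_def)
    thus ?thesis by (auto simp: T_def)
   qed simp
  qed
 qed (use T in auto)
 also have "\<dots> = D vP + (\<Sum>v\<in>T. D v)" using T vPT by simp
 finally have dD: "divisor_degree D = D vP + (\<Sum>v\<in>T. D v)" .
 have "(\<Sum>v\<in>T. D' v) - (\<Sum>v\<in>T. D v) = int n" using n by (simp add: sum_subtractf)
 thus ?thesis using sD' dD lk l'(2) k by linarith
qed

lemma genus_MGR: "has_genus MGR (range cst) 17"
 unfolding has_genus_def
proof (intro conjI ballI allI impI)
 \<comment> \<open>Beyond the last gap every multiple of infinity attains the maximum; here 41 - (42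
   - 17) + 1 = 17.\<close>
 show "EX D:divisors MGR (range cst). EX l. dimC l (RR D) & divisor_degree D - int l + 1 = int 17"
 proof (intro bexI[of _ "NP 41"] exI[of _ 25] conjI)
  have "dimC (card ({..<42} - gaps)) (RR (NP (int 42 - 1)))" by (rule dim_NP)
  thus "dimC 25 (RR (NP 41))" by (simp add: card_not_gaps)
  have s: "{v. NP 41 v ~= 0} = {vP}" by (auto simp: NP_def)
  show "divisor_degree (NP 41) - int 25 + 1 = int 17" unfolding divisor_degree_def s by (simp add: NP_def)
  show "NP 41 : divisors MGR (range cst)" unfolding divisors_def mem_Collect_eq s places_MGR using vP_Pl by simp
 qed
 show "divisor_degree D - int l + 1 <= int 17" if "D : divisors MGR (range cst)" "dimC l (RR D)" for D l
  using riemann_inequality[OF that] by simp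
qed

section \<open>The plane curve\<close>

definition pull :: "('a, 'm) ring_scheme => ('a => 'b) => ('b => int) => 'a => int" where
 "pull R h w = restrict (w \<circ> h) (carrier R - {\<zero>\<^bsub>R\<^esub>})"

lemma ring_iso_zero:
 assumes "ring R" "ring S" "h : ring_iso R S"
 shows "h \<zero>\<^bsub>R\<^esub> = \<zero>\<^bsub>S\<^esub>" and "x : carrier R ==> h x = \<zero>\<^bsub>S\<^esub> \<longleftrightarrow> x = \<zero>\<^bsub>R\<^esub>"
  and "h ` (carrier R - {\<zero>\<^bsub>R\<^esub>}) = carrier S - {\<zero>\<^bsub>S\<^esub>}"
proof -
 have b: "bij_betw h (carrier R) (carrier S)" by (rule ring_iso_memE(5)[OF assms(3)])
 have hom: "h : ring_hom R S" using assms(3) by (simp add: ring_iso_def)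
 show z: "h \<zero>\<^bsub>R\<^esub> = \<zero>\<^bsub>S\<^esub>" by (rule ring_hom_zero[OF hom assms(1,2)])
 have zc: "\<zero>\<^bsub>R\<^esub> : carrier R" by (rule ring.ring_simprules(2)[OF assms(1)])
 show "x : carrier R ==> h x = \<zero>\<^bsub>S\<^esub> \<longleftrightarrow> x = \<zero>\<^bsub>R\<^esub>"
  using bij_betw_imp_inj_on[OF b] z zc by (metis inj_onD)
 show "h ` (carrier R - {\<zero>\<^bsub>R\<^esub>}) = carrier S - {\<zero>\<^bsub>S\<^esub>}"
  using inj_on_image_set_diff[OF bij_betw_imp_inj_on[OF b], of "carrier R" "{\<zero>\<^bsub>R\<^esub>}"] zc z bij_betw_imp_surj_on[OF b] by simp
qed

lemma pull_place:
 assumes RS: "ring R" "ring S" and h: "h : ring_iso R S" and k: "k <= carrier R"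
  and dom: "!!a b. a : carrier R - {\<zero>\<^bsub>R\<^esub>} ==> b : carrier R - {\<zero>\<^bsub>R\<^esub>} ==> a \<otimes>\<^bsub>R\<^esub> b ~= \<zero>\<^bsub>R\<^esub>"
  and w: "w : places S (h ` k)"
 shows "pull R h w : places R k"
proof -
 note iso = ring_iso_memE[OF h] and zero = ring_iso_zero[OF RS h]
 let ?X = "carrier R - {\<zero>\<^bsub>R\<^esub>}" and ?Y = "carrier S - {\<zero>\<^bsub>S\<^esub>}"
 have p: "pull R h w a = w (h a)" if "a : ?X" for a using that by (simp add: pull_def)
 have hX: "h a : ?Y" if "a : ?X" for a using zero(3) that by blast
 have W: "w ` ?Y = UNIV" "!!a b. a : ?Y ==> b : ?Y ==> w (a \<otimes>\<^bsub>S\<^esub> b) = w a + w b"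
  "!!a b. a : ?Y ==> b : ?Y ==> a \<oplus>\<^bsub>S\<^esub> b ~= \<zero>\<^bsub>S\<^esub> ==> min (w a) (w b) <= w (a \<oplus>\<^bsub>S\<^esub> b)"
  "!!c. c : h ` k - {\<zero>\<^bsub>S\<^esub>} ==> w c = 0"
  using w unfolding places_def by blast+
 show ?thesis unfolding places_def mem_Collect_eq
 proof (intro conjI ballI impI)
  show "pull R h w : extensional ?X" by (simp add: pull_def)
  have "pull R h w ` ?X = w ` (h ` ?X)" unfolding image_image by (rule image_cong[OF refl p])
  thus "pull R h w ` ?X = UNIV" unfolding zero(3) W(1) .
 next
  fix a b assume ab: "a : ?X" "b : ?X"
  have c: "a \<otimes>\<^bsub>R\<^esub> b : ?X" using ab dom[OF ab] ring.ring_simprules(5)[OF RS(1)] by simp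
  show "pull R h w (a \<otimes>\<^bsub>R\<^esub> b) = pull R h w a + pull R h w b"
   unfolding p[OF c] p[OF ab(1)] p[OF ab(2)] using iso(2)[of a b] W(2)[OF hX[OF ab(1)] hX[OF ab(2)]] ab by simp
  assume s: "a \<oplus>\<^bsub>R\<^esub> b ~= \<zero>\<^bsub>R\<^esub>"
  have d: "a \<oplus>\<^bsub>R\<^esub> b : ?X" using ab s ring.ring_simprules(1)[OF RS(1)] by simp
  have e: "h (a \<oplus>\<^bsub>R\<^esub> b) = h a \<oplus>\<^bsub>S\<^esub> h b" using iso(3)[of a b] ab by simp
  have "h a \<oplus>\<^bsub>S\<^esub> h b ~= \<zero>\<^bsub>S\<^esub>" using hX[OF d] unfolding e by simp
  from W(3)[OF hX[OF ab(1)] hX[OF ab(2)] this] show "min (pull R h w a) (pull R h w b) <= pull R h w (a \<oplus>\<^bsub>R\<^esub> b)"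
   unfolding p[OF d] p[OF ab(1)] p[OF ab(2)] e .
 next
  fix c assume c: "c : k - {\<zero>\<^bsub>R\<^esub>}"
  hence cX: "c : ?X" using k by blast
  have "h c : h ` k - {\<zero>\<^bsub>S\<^esub>}" using c hX[OF cX] by blast
  thus "pull R h w c = 0" unfolding p[OF cX] by (rule W(4))
 qed
qed

text \<open>Places are pulled back along h and along its inverse g. Extensionality makes the two
  pullbacks mutually inverse, so supports, degrees and spaces correspond.\<close>

lemma divisor_transport:
 assumes RS: "ring R" "ring S" and h: "h : ring_iso R S" and g: "g : ring_iso S R"
  and gh: "!!a. a : carrier R ==> g (h a) = a" and hg: "!!b. b : carrier S ==> h (g b) = b" and k: "k <= carrier R"
  and dom: "!!a b. a : carrier R - {\<zero>\<^bsub>R\<^esub>} ==> b : carrier R - {\<zero>\<^bsub>R\<^esub>} ==> a \<otimes>\<^bsub>R\<^esub> b ~= \<zero>\<^bsub>R\<^esub>"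
  and domS: "!!a b. a : carrier S - {\<zero>\<^bsub>S\<^esub>} ==> b : carrier S - {\<zero>\<^bsub>S\<^esub>} ==> a \<otimes>\<^bsub>S\<^esub> b ~= \<zero>\<^bsub>S\<^esub>"
  and D: "D : divisors S (h ` k)"
 obtains D' where "D' : divisors R k" "divisor_degree D' = divisor_degree D"
  "riemann_roch_space S (h ` k) D = h ` riemann_roch_space R k D'"
proof -
 let ?X = "carrier R - {\<zero>\<^bsub>R\<^esub>}" and ?Y = "carrier S - {\<zero>\<^bsub>S\<^esub>}"
 have hX: "h a : ?Y" if "a : ?X" for a using ring_iso_zero(3)[OF RS h] that by blast
 have gY: "g b : ?X" if "b : ?Y" for b using ring_iso_zero(3)[OF RS(2,1) g] that by blast
 have ghk: "g ` h ` k = k" unfolding image_image using gh k by (simp add: subset_iff cong: image_cong_simp)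
 have hk: "h ` k <= carrier S" using k ring_iso_memE(1)[OF h] by blast
 have P1: "pull R h w : places R k" if "w : places S (h ` k)" for w by (rule pull_place[OF RS h k dom that])
 have P2: "pull S g v : places S (h ` k)" if "v : places R k" for v
  by (rule pull_place[OF RS(2,1) g hk domS]) (simp_all add: ghk that)
 have pp1: "pull R h (pull S g v) = v" if "v : places R k" for v
 proof (rule extensionalityI[of _ ?X])
  show "v : extensional ?X" using that by (simp add: places_def)
  show "pull R h (pull S g v) a = v a" if "a : ?X" for a using that hX[OF that] gh by (simp add: pull_def)
 qed (simp add: pull_def)
 have pp2: "pull S g (pull R h w) = w" if "w : places S (h ` k)" for w
 proof (rule extensionalityI[of _ ?Y])
  show "w : extensional ?Y" using that by (simp add: places_def)
  show "pull S g (pull R h w) b = w b" if "b : ?Y" for b using that gY[OF that] hg by (simp add: pull_def)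
 qed (simp add: pull_def)
 define D' where "D' = (%v. if v : places R k then D (pull S g v) else 0)"
 have DA: "finite {w. D w ~= 0}" "{w. D w ~= 0} <= places S (h ` k)" using D by (auto simp: divisors_def)
 have supp: "{v. D' v ~= 0} = pull R h ` {w. D w ~= 0}"
 proof
  show "{v. D' v ~= 0} <= pull R h ` {w. D w ~= 0}"
  proof
   fix v assume "v : {v. D' v ~= 0}"
   hence v: "v : places R k" "D (pull S g v) ~= 0" by (auto simp: D'_def split: if_splits)
   thus "v : pull R h ` {w. D w ~= 0}" using pp1[OF v(1)] by (intro image_eqI[of _ _ "pull S g v"]) auto
  qed
  show "pull R h ` {w. D w ~= 0} <= {v. D' v ~= 0}" using DA(2) P1 pp2 by (auto simp: D'_def)
 qed
 have "inj_on (pull R h) {w. D w ~= 0}" using DA(2) pp2 by (intro inj_on_inverseI[of _ "pull S g"]) blast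
 hence "(\<Sum>v\<in>pull R h ` {w. D w ~= 0}. D' v) = (\<Sum>w\<in>{w. D w ~= 0}. D' (pull R h w))" by (rule sum.reindex[unfolded o_def])
 also have "\<dots> = (\<Sum>w\<in>{w. D w ~= 0}. D w)" using DA(2) P1 pp2 by (intro sum.cong) (auto simp: D'_def)
 finally have deg: "divisor_degree D' = divisor_degree D" unfolding divisor_degree_def supp .
 have div: "D' : divisors R k" unfolding divisors_def mem_Collect_eq supp using DA P1 by auto
 have "h f : riemann_roch_space S (h ` k) D \<longleftrightarrow> f : riemann_roch_space R k D'" if f: "f : carrier R" for f
 proof (cases "f = \<zero>\<^bsub>R\<^esub>")
  case True
  thus ?thesis using f ring_iso_zero(1)[OF RS h] ring_iso_memE(1)[OF h f] by (simp add: riemann_roch_space_def)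
 next
  case False
  hence fX: "f : ?X" using f by simp
  have "(ALL w:places S (h ` k). w (h f) + D w \<ge> 0) \<longleftrightarrow> (ALL v:places R k. v f + D' v \<ge> 0)"
  proof
   assume L: "ALL w:places S (h ` k). w (h f) + D w \<ge> 0"
   show "ALL v:places R k. v f + D' v \<ge> 0"
   proof
    fix v assume v: "v : places R k"
    have "pull S g v (h f) = v f" using hX[OF fX] gh[OF f] by (simp add: pull_def)
    thus "v f + D' v \<ge> 0" using L P2[OF v] v by (auto simp: D'_def)
   qed
  next
   assume L: "ALL v:places R k. v f + D' v \<ge> 0"
   show "ALL w:places S (h ` k). w (h f) + D w \<ge> 0"
   proof
    fix w assume w: "w : places S (h ` k)"
    have "pull R h w f = w (h f)" using fX by (simp add: pull_def)
    moreover have "D' (pull R h w) = D w" using P1[OF w] pp2[OF w] by (simp add: D'_def)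
    moreover have "pull R h w f + D' (pull R h w) \<ge> 0" using L P1[OF w] by blast
    ultimately show "w (h f) + D w \<ge> 0" by simp
   qed
  qed
  thus ?thesis using f False hX[OF fX] by (simp add: riemann_roch_space_def)
 qed
 note mem = this
 have "riemann_roch_space S (h ` k) D = h ` riemann_roch_space R k D'"
 proof
  show "h ` riemann_roch_space R k D' <= riemann_roch_space S (h ` k) D"
   using mem by (auto simp: riemann_roch_space_def[of R])
  show "riemann_roch_space S (h ` k) D <= h ` riemann_roch_space R k D'"
  proof
   fix b assume b: "b : riemann_roch_space S (h ` k) D"
   hence bS: "b : carrier S" by (simp add: riemann_roch_space_def)
   have "g b : carrier R" by (rule ring_iso_memE(1)[OF g bS])
   thus "b : h ` riemann_roch_space R k D'" using mem[of "g b"] b hg[OF bS] by (metis image_eqI)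
  qed
 qed
 thus ?thesis using that div deg by blast
qed

lemma has_genus_iso:
 assumes R: "Ring.field R" and S: "ring S" and h: "h : ring_iso R S" and k: "subfield k R" and gen: "has_genus R k n"
 shows "has_genus S (h ` k) n"
proof -
 interpret R: Ring.field R by (rule R)
 interpret S: ring S by (rule S)
 define g where "g = inv_into (carrier R) h"
 have g: "g : ring_iso S R" unfolding g_def by (rule ring_iso_set_sym[OF R.ring_axioms h])
 have b: "bij_betw h (carrier R) (carrier S)" by (rule ring_iso_memE(5)[OF h])
 have gh: "g (h a) = a" if "a : carrier R" for a
  unfolding g_def by (rule inv_into_f_f[OF bij_betw_imp_inj_on[OF b] that])
 have hg: "h (g c) = c" if "c : carrier S" for c
  unfolding g_def using that bij_betw_imp_surj_on[OF b] by (intro f_inv_into_f) simp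
 have kR: "k <= carrier R" by (rule subfieldE(3)[OF k])
 have ghk: "g ` h ` k = k" unfolding image_image using gh kR by (simp add: subset_iff cong: image_cong_simp)
 have hkS: "h ` k <= carrier S" using kR ring_iso_memE(1)[OF h] by blast
 have dom: "a \<otimes>\<^bsub>R\<^esub> b ~= \<zero>\<^bsub>R\<^esub>" if "a : carrier R - {\<zero>\<^bsub>R\<^esub>}" "b : carrier R - {\<zero>\<^bsub>R\<^esub>}" for a b
  using R.integral[of a b] that by auto
 have domS: "a \<otimes>\<^bsub>S\<^esub> b ~= \<zero>\<^bsub>S\<^esub>" if ab: "a : carrier S - {\<zero>\<^bsub>S\<^esub>}" "b : carrier S - {\<zero>\<^bsub>S\<^esub>}" for a b
 proof
  assume z: "a \<otimes>\<^bsub>S\<^esub> b = \<zero>\<^bsub>S\<^esub>"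
  have "g a \<otimes>\<^bsub>R\<^esub> g b = g (a \<otimes>\<^bsub>S\<^esub> b)" using ring_iso_memE(2)[OF g, of a b] ab by simp
  also have "\<dots> = \<zero>\<^bsub>R\<^esub>" unfolding z by (rule ring_iso_zero(1)[OF S R.ring_axioms g])
  finally show False using dom ring_iso_zero(3)[OF S R.ring_axioms g] ab by blast
 qed
 have hh: "ring_hom_ring R S h" using h R.ring_axioms S by (intro ring_hom_ringI2) (auto simp: ring_iso_def)
 have gg: "ring_hom_ring S R g" using g R.ring_axioms S by (intro ring_hom_ringI2) (auto simp: ring_iso_def)
 have oz: "\<one>\<^bsub>S\<^esub> ~= \<zero>\<^bsub>S\<^esub>"
  using ring_iso_memE(4)[OF h] ring_iso_zero(2)[OF R.ring_axioms S h R.one_closed] R.one_not_zero by metis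
 have kS: "subfield (h ` k) S" by (rule ring_hom_ring.img_is_subfield(2)[OF hh k oz])
 have rrR: "riemann_roch_space R k E <= carrier R" for E by (auto simp: riemann_roch_space_def)
 have rrS: "riemann_roch_space S (h ` k) E <= carrier S" for E by (auto simp: riemann_roch_space_def)
 have dimS: "S.dimension l (h ` k) (h ` E)" if "R.dimension l k E" "E <= carrier R" for l E
  using ring_hom_ring.inj_hom_dimension[OF hh k oz _ that(1)] inj_on_subset[OF bij_betw_imp_inj_on[OF b] that(2)] by blast
 have dimR: "R.dimension l (g ` h ` k) (g ` E)" if "S.dimension l (h ` k) E" "E <= carrier S" for l E
  using ring_hom_ring.inj_hom_dimension[OF gg kS R.one_not_zero _ that(1)]
   inj_on_subset[OF bij_betw_imp_inj_on[OF ring_iso_memE(5)[OF g]] that(2)] by blast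
 show ?thesis unfolding has_genus_def
 proof (intro conjI ballI allI impI)
  obtain D l where D: "D : divisors R k" "R.dimension l k (riemann_roch_space R k D)" "divisor_degree D - int l + 1 = int n"
   using gen unfolding has_genus_def by blast
  obtain D' where D': "D' : divisors S (h ` k)" "divisor_degree D' = divisor_degree D"
   "riemann_roch_space R (g ` h ` k) D = g ` riemann_roch_space S (h ` k) D'"
   using divisor_transport[OF S R.ring_axioms g h hg gh hkS domS dom, of D] D(1) unfolding ghk by blast
  have "h ` riemann_roch_space R k D = (%a. h (g a)) ` riemann_roch_space S (h ` k) D'"
   using D'(3) unfolding ghk by (simp add: image_image)
  also have "\<dots> = (%a. a) ` riemann_roch_space S (h ` k) D'" by (rule image_cong[OF refl]) (use hg rrS in blast)
  also have "\<dots> = riemann_roch_space S (h ` k) D'" by simp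
  finally have "S.dimension l (h ` k) (riemann_roch_space S (h ` k) D')" using dimS[OF D(2) rrR] by simp
  thus "EX D:divisors S (h ` k). EX l. S.dimension l (h ` k) (riemann_roch_space S (h ` k) D) & divisor_degree D - int l + 1 = int n"
   using D'(1,2) D(3) by metis
 next
  fix D l assume D: "D : divisors S (h ` k)" and l: "S.dimension l (h ` k) (riemann_roch_space S (h ` k) D)"
  obtain D' where D': "D' : divisors R k" "divisor_degree D' = divisor_degree D"
   "riemann_roch_space S (h ` k) D = h ` riemann_roch_space R k D'"
   using divisor_transport[OF R.ring_axioms S h g gh hg kR dom domS D] by blast
  have "g ` riemann_roch_space S (h ` k) D = (%a. g (h a)) ` riemann_roch_space R k D'" unfolding D'(3) image_image ..
  also have "\<dots> = (%a. a) ` riemann_roch_space R k D'" by (rule image_cong[OF refl]) (use gh rrR in blast)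
  also have "\<dots> = riemann_roch_space R k D'" by simp
  finally have "R.dimension l k (riemann_roch_space R k D')" using dimR[OF l rrS] ghk by simp
  thus "divisor_degree D - int l + 1 <= int n" using gen D'(1,2) unfolding has_genus_def by metis
 qed
qed

instance mero_uhp :: field_char_0
proof
 show "inj (of_nat :: nat => mero_uhp)"
  by (rule injI) (simp add: const_mero_of_nat[symmetric])
qed

text \<open>Multiplied by u^12, the equation involves only S = x^2 u and V = y^7 u^3 besides u;
  inserting their expressions in u leaves a polynomial identity.\<close>

lemma curve_eqn_param:
 fixes x y u :: "'a :: field_char_0"
 assumes s: "x ^ 2 * u = 4 * ((u - 1) * (u ^ 3 - 8 * u ^ 2 + 5 * u + 1))" and y: "y ^ 7 * u ^ 3 = u - 1" and u: "u ~= 0"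
 shows "curve_eqn x y = 0"
proof -
 define s Y where "s = x ^ 2" and "Y = y ^ 7"
 have p: "x ^ 6 = s ^ 3" "x ^ 4 = s ^ 2" "y ^ 28 = Y ^ 4" "y ^ 21 = Y ^ 3" "y ^ 14 = Y ^ 2"
  by (simp_all add: s_def Y_def flip: power_mult)
 define S V where "S = s * u" and "V = Y * u ^ 3"
 have "curve_eqn x y * u ^ 12 = 64 * V ^ 4 - (S ^ 3 + 52 * S ^ 2 * u + 1520 * S * u ^ 2 + 18496 * u ^ 3) * V ^ 3
   + (5264 * S * u ^ 5 - 84 * S ^ 2 * u ^ 4 - 3648 * u ^ 6) * V ^ 2 + (64 * u ^ 9 - 1072 * S * u ^ 8) * V + 16 * S * u ^ 11"
  unfolding curve_eqn_def p s_def[symmetric] Y_def[symmetric] S_def V_def by Groebner_Basis.algebra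
 also have "\<dots> = 0"
 proof -
  have SV: "S = 4 * ((u - 1) * (u ^ 3 - 8 * u ^ 2 + 5 * u + 1))" "V = u - 1" using assms by (simp_all add: S_def V_def s_def Y_def)
  show ?thesis unfolding SV by Groebner_Basis.algebra
 qed
 finally show ?thesis using u by simp
qed

text \<open>Eliminating \<open>u\<close> between the two relations: they give \<open>(4 + 52Y) u\<^sup>2 - (40 + 16Y + sY) u + 36 - 4Y = 0\<close>, and reducing
  \<open>Y u\<^sup>3 - u + 1 = 0\<close> modulo this quadratic leaves a linear equation for \<open>u\<close>.\<close>

lemma curve_param_inverse:
 fixes s Y u :: "'a :: field_char_0"
 assumes s: "s * u = 4 * ((u - 1) * (u ^ 3 - 8 * u ^ 2 + 5 * u + 1))" and y: "Y * u ^ 3 = u - 1" and u: "u ~= 0"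
 defines "A0 \<equiv> 36 - 4 * Y" and "A1 \<equiv> - (40 + 16 * Y + s * Y)" and "A2 \<equiv> 4 + 52 * Y"
 defines "B \<equiv> Y * (A1 ^ 2 - A0 * A2) - A2 ^ 2"
 defines "a1 \<equiv> - (40 * u ^ 4 + 16 * (u - 1) * u + 4 * ((u - 1) * (u ^ 3 - 8 * u ^ 2 + 5 * u + 1)) * (u - 1))"
  and "a0 \<equiv> 36 * u ^ 3 - 4 * (u - 1)" and "a2 \<equiv> 4 * u ^ 3 + 52 * (u - 1)"
 shows "u * B = - (Y * A1 * A0 + A2 ^ 2)" "B * u ^ 11 = (u - 1) * a1 ^ 2 - u ^ 2 * (u - 1) * a0 * a2 - u ^ 5 * a2 ^ 2"
proof -
 have A: "A0 * u ^ 3 = a0" "A1 * u ^ 4 = a1" "A2 * u ^ 3 = a2"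
 proof -
  have "A0 * u ^ 3 = 36 * u ^ 3 - 4 * (Y * u ^ 3)" unfolding A0_def by Groebner_Basis.algebra
  thus "A0 * u ^ 3 = a0" unfolding y a0_def .
  have "A1 * u ^ 4 = - (40 * u ^ 4 + 16 * (Y * u ^ 3) * u + (s * u) * (Y * u ^ 3))" unfolding A1_def by Groebner_Basis.algebra
  thus "A1 * u ^ 4 = a1" unfolding y s a1_def .
  have "A2 * u ^ 3 = 4 * u ^ 3 + 52 * (Y * u ^ 3)" unfolding A2_def by Groebner_Basis.algebra
  thus "A2 * u ^ 3 = a2" unfolding y a2_def .
 qed
 have "B * u ^ 11 = (Y * u ^ 3) * (A1 * u ^ 4) ^ 2 - u ^ 2 * (Y * u ^ 3) * (A0 * u ^ 3) * (A2 * u ^ 3) - u ^ 5 * (A2 * u ^ 3) ^ 2"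
  unfolding B_def by Groebner_Basis.algebra
 thus N: "B * u ^ 11 = (u - 1) * a1 ^ 2 - u ^ 2 * (u - 1) * a0 * a2 - u ^ 5 * a2 ^ 2" unfolding A y .
 have "(u * B + (Y * A1 * A0 + A2 ^ 2)) * u ^ 11 = u * (B * u ^ 11) + u * (Y * u ^ 3) * (A1 * u ^ 4) * (A0 * u ^ 3) + u ^ 5 * (A2 * u ^ 3) ^ 2"
  by Groebner_Basis.algebra
 also have "\<dots> = 0" unfolding N A y a0_def a1_def a2_def by Groebner_Basis.algebra
 finally have "u * B + (Y * A1 * A0 + A2 ^ 2) = 0" using u by simp
 thus "u * B = - (Y * A1 * A0 + A2 ^ 2)" by (simp only: eq_neg_iff_add_eq_0)
qed

text \<open>A minimum attained only once would dominate the sum, which could then not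
  vanish.\<close>

lemma valuation_min_twice:
 assumes v: "valuation_on K v" "is_subfield K" "range cst <= K"
  and I: "finite I" "!!i. i : I ==> f i : K" "sum f I = 0" "k : I" "f k ~= 0"
 shows "EX i j. i : I & j : I & i ~= j & f i ~= 0 & f j ~= 0 & v (f i) = v (f j) & (ALL l:I. f l ~= 0 --> v (f i) <= v (f l))"
proof -
 define J where "J = {i : I. f i ~= 0}"
 have J: "finite J" "J ~= {}" using I by (auto simp: J_def)
 obtain i where i: "i : J" "!!l. l : J ==> v (f i) <= v (f l)"
  using ex_min_if_finite[of "(%i. v (f i)) ` J"] J by (force simp: not_less)
 have "EX j:J - {i}. v (f j) = v (f i)"
 proof (rule ccontr)
  assume n: "~ ?thesis"
  have "sum f (I - {i}) = 0 \<or> v (f i) + 1 <= v (sum f (I - {i}))"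
  proof (rule valuation_sum_ge[OF v(1,2)])
   fix l assume l: "l : I - {i}"
   have "f l = 0 \<or> v (f i) + 1 <= v (f l)"
   proof (cases "f l = 0")
    case False
    hence "l : J - {i}" using l by (auto simp: J_def)
    hence "v (f l) ~= v (f i)" "v (f i) <= v (f l)" using n i(2)[of l] by auto
    thus ?thesis by simp
   qed simp
   thus "f l : K & (f l = 0 \<or> v (f i) + 1 <= v (f l))" using I(2) l by blast
  qed
  hence le: "sum f (I - {i}) = 0 \<or> v (f i) < v (sum f (I - {i}))" by auto
  have iI: "i : I" "f i ~= 0" using i(1) by (auto simp: J_def)
  have "sum f (I - {i}) : K" by (rule is_subfieldD(10)[OF v(2)]) (use I(2) in auto)
  from valuation_add_eq(1)[OF v I(2)[OF iI(1)] iI(2) this le] show False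
   using sum.remove[OF I(1) iI(1), of f] I(3) by simp
 qed
 then obtain j where "j : J - {i}" "v (f j) = v (f i)" by blast
 thus ?thesis using i by (intro exI[of _ i] exI[of _ j]) (auto simp: J_def)
qed

text \<open>The relations involve x only through its square, so they do not depend on the sign
  chosen for Delta.\<close>

locale curve_params =
 fixes x y :: mero_uhp
 assumes x: "x : MG" "x ^ 2 * ups7 = 4 * ((ups7 - 1) * ups_poly cpoly)"
  and y: "y : MG" "y ^ 7 * ups7 ^ 3 = ups7 - 1"
  and gen: "MG = complex_adjoin {x, y}"
begin

lemma curve_zero: "curve_eqn x y = 0"
 by (rule curve_eqn_param[OF _ y(2) upsilon7_nz(1)]) (use x(2) in \<open>simp add: ups_cpoly\<close>)

lemma xy_nz: "x ~= 0" "y ~= 0"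
proof -
 show "x ~= 0" using x(2) upsilon7_nz cpoly_nz by (auto simp: ups_poly_eq_0_iff[symmetric] simp del: ups_poly_eq_0_iff)
 show "y ~= 0" using y(2) upsilon7_nz by auto
qed

lemma valuation_xy:
 assumes v: "valuation_on MG v"
 shows "2 * v x + v ups7 = v (ups_poly ([:4:] * [:- 1, 1:] * cpoly))" "7 * v y + 3 * v ups7 = v (ups_poly [:- 1, 1:])"
proof -
 have "ups_poly ([:4:] * [:- 1, 1:] * cpoly) = x ^ 2 * ups7"
  unfolding x(2) pev_mult ups_X1 by (simp add: const_mero_numeral mult.assoc)
 moreover have "v (x ^ 2 * ups7) = 2 * v x + v ups7"
  using valuation_mult[OF v MG_closed(9)[OF x(1)] _ upsilon7_MG upsilon7_nz(1), of 2] valuation_power[OF v MG_subfield x(1) xy_nz(1), of 2] xy_nz by simp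
 ultimately show "2 * v x + v ups7 = v (ups_poly ([:4:] * [:- 1, 1:] * cpoly))" by metis
 have "ups_poly [:- 1, 1:] = y ^ 7 * ups7 ^ 3" unfolding y(2) ups_X1 ..
 moreover have "v (y ^ 7 * ups7 ^ 3) = 7 * v y + 3 * v ups7"
  using valuation_mult[OF v MG_closed(9)[OF y(1)] _ MG_closed(9)[OF upsilon7_MG], of 7 3] valuation_power[OF v MG_subfield y(1) xy_nz(2), of 7]
   valuation_power[OF v MG_subfield upsilon7_MG upsilon7_nz(1), of 3] xy_nz upsilon7_nz by simp
 ultimately show "7 * v y + 3 * v ups7 = v (ups_poly [:- 1, 1:])" by metis
qed

lemma vinf_xy: "vinf x = - 21" "vinf y = 4"
proof -
 have d: "degree ([:4:] * [:- 1, 1:] * cpoly) = 4" and nz: "[:4:] * [:- 1, 1:] * cpoly ~= 0"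
  by (simp_all add: degree_mult_eq cpoly_nz degree_cpoly del: mult_pCons_left)
 have "vinf (ups_poly ([:4:] * [:- 1, 1:] * cpoly)) = - 14 * int 4" unfolding vinf_ups_poly[OF nz] d ..
 hence "vinf (ups_poly ([:4:] * [:- 1, 1:] * cpoly)) = - 56" by linarith
 thus "vinf x = - 21" using valuation_xy(1)[OF vinf_MG] unfolding vinf_upsilon7 by linarith
 have "vinf (ups_poly [:- 1, 1:]) = - 14" using vinf_ups_poly[of "[:- 1, 1:]"] by simp
 thus "vinf y = 4" using valuation_xy(2)[OF vinf_MG] unfolding vinf_upsilon7 by linarith
qed

text \<open>A Newton polygon argument. With d the degree of \<open>r i\<close>, term i has order -21
  d + 4 i at infinity and -(7 d + 6 i) e / 14 at a zero of upsilon of order e. In a vanishing sum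
  each minimum is attained twice. At infinity this forces two indices 21 apart. At the zero of
  upsilon it forces two different indices congruent modulo 7, and comparison with the first pair
  shows that both are at least 21. Below 28 there is no room for them.\<close>

lemma xy_independent:
 assumes s: "(\<Sum>i<28. pev x (r i) * y ^ i) = 0" and i: "i < 28"
 shows "r i = 0"
proof (rule ccontr)
 assume ri: "r i ~= 0"
 define f where "f = (%i. pev x (r i) * y ^ i)"
 have fM: "f k : MG" for k unfolding f_def by (intro MG_closed(4,9) y(1) pev_in[OF MG_subfield range_const_MG x(1)])
 have f: "f k ~= 0 & v (f k) = int (degree (r k)) * v x + int k * v y"
  if v: "valuation_on MG v" "v x < 0" and k: "r k ~= 0" for v k
 proof -
  have 1: "pev x (r k) ~= 0" "v (pev x (r k)) = int (degree (r k)) * v x"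
   using pev_valuation_neg[OF v(1) MG_subfield range_const_MG x(1) xy_nz(1) v(2) k] by simp_all
  have 2: "v (y ^ k) = int k * v y" by (rule valuation_power[OF v(1) MG_subfield y(1) xy_nz(2)])
  show ?thesis unfolding f_def
   using valuation_mult[OF v(1) pev_in[OF MG_subfield range_const_MG x(1)] 1(1) MG_closed(9)[OF y(1)], of k] 1 2 xy_nz by simp
 qed
 have f0: "f k ~= 0 \<longleftrightarrow> r k ~= 0" for k
  using f[OF vinf_MG] vinf_xy by (cases "r k = 0") (simp_all add: f_def)
 have fs: "sum f {..<28} = 0" using s by (simp add: f_def)
 have fi: "f i ~= 0" using ri f0 by blast
 define d where "d = (%k. int (degree (r k)))"
 have v1: "vinf (f k) = - 21 * d k + 4 * int k" if "r k ~= 0" for k using f[OF vinf_MG _ that] vinf_xy by (simp add: d_def)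
 obtain w where w: "w : W" "0 < w (ups7 - cst 0)" using W_above by blast
 have wv: "valuation_on MG w" using valuation_on_subset[OF W_valuation[OF w(1)]] MG_M14 by blast
 define e where "e = w ups7"
 have e: "e > 0" using w(2) by (simp add: e_def)
 note unit = valuation_pev_unit(2)[OF wv MG_subfield range_const_MG upsilon7_MG ups_neq_const w(2)]
 have "w (ups_poly ([:4:] * [:- 1, 1:] * cpoly)) = 0" by (rule unit) (simp add: cpoly_def)
 hence wx: "2 * w x = - e" using valuation_xy(1)[OF wv] unfolding e_def by linarith
 have "w (ups_poly [:- 1, 1:]) = 0" by (rule unit) simp
 hence wy: "7 * w y = - 3 * e" using valuation_xy(2)[OF wv] unfolding e_def by linarith
 have v2: "14 * w (f k) = - e * (7 * d k + 6 * int k)" if "r k ~= 0" for k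
 proof -
  have "w x < 0" using wx e by linarith
  hence "w (f k) = d k * w x + int k * w y" using f[OF wv _ that] by (simp add: d_def)
  hence "14 * w (f k) = 7 * d k * (2 * w x) + 2 * int k * (7 * w y)" by (simp add: algebra_simps)
  thus ?thesis unfolding wx wy by (simp add: algebra_simps)
 qed
 have i0: "i : {..<28}" using i by simp
 obtain a b where ab: "a : {..<28}" "b : {..<28}" "a ~= b" "f a ~= 0" "f b ~= 0" "w (f a) = w (f b)"
  "ALL l:{..<28}. f l ~= 0 --> w (f a) <= w (f l)"
  using valuation_min_twice[OF wv MG_subfield range_const_MG finite_lessThan fM fs i0 fi] by (elim exE conjE)
 obtain i j where ij: "i : {..<28}" "j : {..<28}" "i ~= j" "f i ~= 0" "f j ~= 0" "vinf (f i) = vinf (f j)"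
  "ALL l:{..<28}. f l ~= 0 --> vinf (f i) <= vinf (f l)"
  using valuation_min_twice[OF vinf_MG MG_subfield range_const_MG finite_lessThan fM fs i0 fi] by (elim exE conjE)
 have m1: "21 * d l - 4 * int l <= 21 * d i - 4 * int i" if "l < 28" "f l ~= 0" for l
 proof -
  have "vinf (f i) <= vinf (f l)" using ij(7) that by blast
  moreover have "r l ~= 0" "r i ~= 0" using f0 that(2) ij(4) by blast+
  ultimately show ?thesis using v1[of l] v1[of i] by linarith
 qed
 have m2: "7 * d l + 6 * int l <= 7 * d a + 6 * int a" if l: "l < 28" "f l ~= 0" for l
 proof -
  have "w (f a) <= w (f l)" using ab(7) l by blast
  hence "14 * w (f a) <= 14 * w (f l)" by simp
  hence "- e * (7 * d a + 6 * int a) <= - e * (7 * d l + 6 * int l)" using v2 f0 ab(4) l by metis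
  hence "e * (7 * d l + 6 * int l) <= e * (7 * d a + 6 * int a)" by simp
  thus ?thesis using e by simp
 qed
 have eq1: "21 * d i - 4 * int i = 21 * d j - 4 * int j" using ij(4,5,6) v1 f0 by force
 have eq2: "7 * d a + 6 * int a = 7 * d b + 6 * int b"
 proof -
  have "- e * (7 * d a + 6 * int a) = - e * (7 * d b + 6 * int b)" using v2[of a] v2[of b] ab(4,5,6) f0 by metis
  thus ?thesis using e by simp
 qed
 have lt: "i < 28" "j < 28" "a < 28" "b < 28" using ij ab by auto
 \<comment> \<open>Since 4 is prime to 21 and the indices are below 28, the two indices differ by
   exactly 21 and the degrees accordingly by 4.\<close>
 have "21 dvd 4 * (int j - int i)"
 proof
  show "4 * (int j - int i) = 21 * (d j - d i)" using eq1 by simp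
 qed
 hence "21 dvd int j - int i" by presburger
 then obtain t where t: "int j - int i = 21 * t" by auto
 have "21 * t < 21 * 2" "21 * (- 2) < 21 * t" unfolding t[symmetric] using lt by linarith+
 hence "t < 2" "- 2 < t" by (simp_all only: mult_less_cancel_left_pos zero_less_numeral)
 moreover have "t ~= 0" using t ij(3) by auto
 ultimately have t1: "t = 1 \<or> t = - 1" by linarith
 have dj: "d j - d i = 4 * t" using eq1 t by linarith
 define m where "m = (if t = 1 then int i else int j)"
 define dm where "dm = (if t = 1 then d i else d j)"
 have mx: "21 * d l - 4 * int l <= 21 * dm - 4 * m" if "l < 28" "f l ~= 0" for l
  using m1[OF that] eq1 by (simp add: dm_def m_def)
 have top: "7 * (dm + 4) + 6 * (m + 21) <= 7 * d a + 6 * int a"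
  using m2[OF lt(1) ij(4)] m2[OF lt(2) ij(5)] t1 t dj by (auto simp: dm_def m_def)
 have m0: "0 <= m" by (simp add: m_def)
 \<comment> \<open>With k = a' - m' <= 20 the first inequality gives q <= 3 for the difference q of
   the degrees. Then 7 q + 6 k <= 141, against the 154 = 7 * 4 + 6 * 21 required by the
   second.\<close>
 have bound: "21 <= a' - m'" if "21 * da - 4 * a' <= 21 * dm' - 4 * m'" "7 * (dm' + 4) + 6 * (m' + 21) <= 7 * da + 6 * a'"
  for a' m' da dm' :: int
 proof (rule ccontr)
  assume "~ 21 <= a' - m'"
  moreover define k where "k = a' - m'"
  moreover define q where "q = da - dm'"
  ultimately have k: "k <= 20" "21 * q <= 4 * k" "154 <= 7 * q + 6 * k" using that by (linarith | simp)+
  have "21 * q < 21 * 4" using k by linarith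
  hence "q < 4" by (simp only: mult_less_cancel_left_pos zero_less_numeral)
  hence "7 * q + 6 * k <= 7 * 3 + 6 * 20" using k(1) by (intro add_mono mult_left_mono) auto
  thus False using k(3) by simp
 qed
 have A: "21 <= int a - m" by (rule bound[OF mx[OF lt(3) ab(4)] top])
 have B: "21 <= int b - m" by (rule bound[OF mx[OF lt(4) ab(5)] top[unfolded eq2]])
 have "7 dvd 6 * (int a - int b)"
 proof
  show "6 * (int a - int b) = 7 * (d b - d a)" using eq2 by simp
 qed
 hence "7 dvd int a - int b" by presburger
 moreover have "int a - int b ~= 0" "int a - int b < 7" "- 7 < int a - int b" using A B lt ab(3) m0 by auto
 ultimately show False by presburger
qed

section \<open>Evaluation at (x, y) and irreducibility of the equation\<close>

definition ev :: "complex poly poly => mero_uhp" where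
 "ev P = poly (map_poly (pev x) P) y"

lemma ev_pCons [simp]: "ev (pCons a P) = pev x a + y * ev P"
 by (simp add: ev_def map_poly_pCons)

lemma ev_0 [simp]: "ev 0 = 0" and ev_1 [simp]: "ev 1 = 1"
proof -
 show "ev 0 = 0" by (simp add: ev_def)
 thus "ev 1 = 1" unfolding one_pCons by simp
qed

lemma ev_add: "ev (P + Q) = ev P + ev Q"
proof (induction P arbitrary: Q)
 case (pCons a P)
 show ?case by (cases Q) (simp add: pCons.IH pev_add distrib_left add.assoc add.left_commute)
qed simp

lemma ev_smult: "ev (smult c P) = pev x c * ev P"
 by (induction P) (simp_all add: pev_mult algebra_simps)

lemma ev_mult: "ev (P * Q) = ev P * ev Q"
 by (induction P) (simp_all add: ev_add ev_smult algebra_simps)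

lemma ev_power: "ev (P ^ n) = ev P ^ n"
 by (induction n) (simp_all add: ev_mult)

lemma ev_uminus: "ev (- P) = - ev P"
 using ev_add[of P "- P"] by (simp add: eq_neg_iff_add_eq_0 add.commute)

lemma ev_diff: "ev (P - Q) = ev P - ev Q"
 using ev_add[of P "- Q"] by (simp add: ev_uminus)

lemma ev_of_nat: "ev (of_nat n) = of_nat n"
 by (induction n) (simp_all add: ev_add)

lemma ev_numeral: "ev (numeral n) = numeral n"
 using ev_of_nat[of "numeral n"] by simp

lemma ev_monom: "ev (monom c n) = pev x c * y ^ n"
 by (induction n) (simp_all add: monom_0 monom_Suc mult_ac)

lemma ev_sum: "ev (sum f I) = (\<Sum>i\<in>I. ev (f i))"
 by (induction I rule: infinite_finite_induct) (simp_all add: ev_add)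

lemma ev_MG: "ev P : MG"
 by (induction P) (auto intro!: MG_closed(1,3,4) y(1) pev_in[OF MG_subfield range_const_MG x(1)])

abbreviation "F \<equiv> curve_eqn var_X var_Y"

lemma ev_F: "ev F = 0"
proof -
 have "ev var_X = x" "ev var_Y = y" by (simp_all add: var_X_def var_Y_def)
 hence "ev F = curve_eqn x y" unfolding curve_eqn_def by (simp add: ev_add ev_diff ev_mult ev_power ev_numeral)
 thus ?thesis by (simp add: curve_zero)
qed

lemma F_degree: "degree F = 28" "coeff F 28 = [:64:]"
proof -
 define X :: "complex poly" where "X = [:0, 1:]"
 have mY: "[:c:] * var_Y ^ n = monom c n" for c n
 proof (induction n)
  case (Suc n)
  have "[:c:] * var_Y ^ Suc n = var_Y * ([:c:] * var_Y ^ n)" by (simp add: mult.left_commute del: mult_pCons_left mult_pCons_right)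
  thus ?case unfolding Suc by (simp add: var_Y_def monom_Suc)
 qed (simp add: monom_0)
 have cp: "[:a:] ^ n = [:a ^ n:]" for a :: "complex poly" and n by (induction n) (simp_all add: one_pCons)
 define c21 where "c21 = - (X ^ 6) - 52 * X ^ 4 - 1520 * X ^ 2 - 18496"
 define c14 where "c14 = 5264 * X ^ 2 - 84 * X ^ 4 - 3648"
 define c7 where "c7 = 64 - 1072 * X ^ 2"
 define c0 where "c0 = 16 * X ^ 2"
 have vX: "var_X = [:X:]" by (simp add: var_X_def X_def)
 have e: "[:c21:] = - (var_X ^ 6) - 52 * var_X ^ 4 - 1520 * var_X ^ 2 - 18496"
  "[:c14:] = 5264 * var_X ^ 2 - 84 * var_X ^ 4 - 3648" "[:c7:] = 64 - 1072 * var_X ^ 2" "[:c0:] = 16 * var_X ^ 2" "[:64:] = (64 :: complex poly poly)"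
  unfolding c21_def c14_def c7_def c0_def vX cp by (simp_all add: numeral_poly)
 have "F = [:64:] * var_Y ^ 28 + [:c21:] * var_Y ^ 21 + [:c14:] * var_Y ^ 14 + [:c7:] * var_Y ^ 7 + [:c0:]"
  unfolding e curve_eqn_def by (simp add: algebra_simps del: mult_pCons_left mult_pCons_right)
 hence F: "F = monom 64 28 + monom c21 21 + monom c14 14 + monom c7 7 + monom c0 0" unfolding mY by (simp add: monom_0)
 show c: "coeff F 28 = [:64:]" unfolding F by (simp add: numeral_poly)
 have "degree F <= 28" unfolding F by (rule degree_le) simp
 moreover have "28 <= degree F" by (rule le_degree) (simp add: c)
 ultimately show "degree F = 28" by simp
qed

lemma F_nz: "F ~= 0"
 using F_degree(1) by auto

text \<open>The leading coefficient of F in Y is the constant 64, so pseudo-division is division up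
  to a nonzero constant. The remainder has degree below 28 in Y and vanishes by
  \<open>xy_independent\<close>. So F generates the kernel of evaluation into a field, which makes
  it prime.\<close>

lemma ev_eq_0_iff: "ev P = 0 \<longleftrightarrow> F dvd P"
proof
 assume "F dvd P"
 thus "ev P = 0" using ev_F by (auto simp: ev_mult)
next
 assume P: "ev P = 0"
 obtain Q R where QR: "pseudo_divmod P F = (Q, R)" by (cases "pseudo_divmod P F")
 define c where "c = (64 :: complex) ^ (Suc (degree P) - degree F)"
 have cp: "[:64:] ^ n = [:(64 :: complex) ^ n:]" for n by (induction n) (simp_all add: one_pCons)
 have eq: "smult [:c:] P = F * Q + R"
  using pseudo_divmod(1)[OF F_nz QR] unfolding F_degree(1)[symmetric] c_def cp[symmetric] using F_degree by simp
 have dR: "degree R <= 27" using pseudo_divmod(2)[OF F_nz QR] F_degree(1) by auto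
 have "ev R = ev (smult [:c:] P) - ev F * ev Q" unfolding eq ev_add ev_mult by simp
 hence "ev R = 0" by (simp add: ev_smult P ev_F)
 have "ev R = ev (\<Sum>i\<le>27. monom (coeff R i) i)" unfolding poly_as_sum_of_monoms'[OF dR] ..
 also have "\<dots> = (\<Sum>i\<le>27. pev x (coeff R i) * y ^ i)" by (simp only: ev_sum ev_monom)
 also have "{..27} = {..<28::nat}" by auto
 finally have s: "(\<Sum>i<28. pev x (coeff R i) * y ^ i) = 0" using \<open>ev R = 0\<close> by simp
 have "coeff R i = 0" for i
 proof (cases "i < 28")
  case True
  show ?thesis by (rule xy_independent[OF s True])
 next
  case False
  thus ?thesis using dR by (intro coeff_eq_0) simp
 qed
 hence "R = 0" by (simp add: poly_eq_iff)
 hence "F dvd smult [:c:] P" using eq by simp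
 hence "F dvd smult [:inverse c:] (smult [:c:] P)" by (rule dvd_smult)
 moreover have "smult [:inverse c:] (smult [:c:] P) = P" by (simp add: c_def one_pCons[symmetric])
 ultimately show "F dvd P" by simp
qed

lemma F_prime: "prime_elem F"
proof (rule prime_elemI)
 show "F ~= 0" by (rule F_nz)
 show "~ F dvd 1" unfolding ev_eq_0_iff[symmetric] by simp
 show "F dvd a \<or> F dvd b" if "F dvd a * b" for a b
  using that unfolding ev_eq_0_iff[symmetric] ev_mult by simp
qed

lemma F_not_dvd_mult: "~ F dvd b ==> ~ F dvd d ==> ~ F dvd b * d"
 unfolding ev_eq_0_iff[symmetric] ev_mult by simp

lemma F_not_dvd_1: "~ F dvd 1"
 unfolding ev_eq_0_iff[symmetric] by simp

lemma not_dvd_nz: "~ F dvd b ==> b ~= 0"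
 by auto

text \<open>Evaluation extended to fractions whose denominator is not divisible by F;
  \<open>evf_Fract\<close> shows that the representation chosen does not matter.\<close>

definition evf :: "complex poly poly fract => mero_uhp" where
 "evf q = (THE z. EX a b. q = Fract a b & ~ F dvd b & z = ev a / ev b)"

lemma evf_Fract:
 assumes b: "~ F dvd b"
 shows   "evf (Fract a b) = ev a / ev b"
 unfolding evf_def
proof (rule the_equality)
 show "EX a' b'. Fract a b = Fract a' b' & ~ F dvd b' & ev a / ev b = ev a' / ev b'" using b by blast
 fix z assume "EX a' b'. Fract a b = Fract a' b' & ~ F dvd b' & z = ev a' / ev b'"
 then obtain a' b' where z: "Fract a b = Fract a' b'" "~ F dvd b'" "z = ev a' / ev b'" by blast
 have "a * b' = a' * b" using z(1) eq_fract(1)[OF not_dvd_nz[OF b] not_dvd_nz[OF z(2)]] by simp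
 hence "ev a * ev b' = ev a' * ev b" using ev_mult by metis
 moreover have "ev b ~= 0" "ev b' ~= 0" using b z(2) ev_eq_0_iff by blast+
 ultimately show "z = ev a / ev b" unfolding z(3) by (simp add: frac_eq_eq)
qed

abbreviation "LR \<equiv> curve_local_ring F"

lemma LR_simps [simp]: "carrier LR = {Fract a b | a b. ~ F dvd b}" "p \<otimes>\<^bsub>LR\<^esub> q = p * q" "\<one>\<^bsub>LR\<^esub> = 1" "\<zero>\<^bsub>LR\<^esub> = 0" "p \<oplus>\<^bsub>LR\<^esub> q = p + q"
 by (simp_all add: curve_local_ring_def)

lemma LR_E:
 assumes "q : carrier LR"
 obtains a b where "q = Fract a b" "~ F dvd b" "b ~= 0"
 using assms not_dvd_nz by auto

lemma LR_I: "~ F dvd b ==> Fract a b : carrier LR"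
 by auto

lemma LR_ops:
 assumes "p : carrier LR" "q : carrier LR"
 shows "p * q : carrier LR" "p + q : carrier LR" "- p : carrier LR"
  "evf (p * q) = evf p * evf q" "evf (p + q) = evf p + evf q" "evf (- p) = - evf p"
proof -
 obtain a b where p: "p = Fract a b" "~ F dvd b" "b ~= 0" using LR_E[OF assms(1)] by metis
 obtain c d where q: "q = Fract c d" "~ F dvd d" "d ~= 0" using LR_E[OF assms(2)] by metis
 have bd: "~ F dvd b * d" by (rule F_not_dvd_mult[OF p(2) q(2)])
 have z: "ev b ~= 0" "ev d ~= 0" using p(2) q(2) ev_eq_0_iff by blast+
 have m: "p * q = Fract (a * c) (b * d)" by (simp add: p q)
 have s: "p + q = Fract (a * d + c * b) (b * d)" using p q by simp
 have u: "- p = Fract (- a) b" by (simp add: p)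
 show "p * q : carrier LR" unfolding m by (rule LR_I[OF bd])
 show "p + q : carrier LR" unfolding s by (rule LR_I[OF bd])
 show "- p : carrier LR" unfolding u by (rule LR_I[OF p(2)])
 show "evf (p * q) = evf p * evf q" unfolding m evf_Fract[OF bd] unfolding p(1) q(1) evf_Fract[OF p(2)] evf_Fract[OF q(2)] by (simp add: ev_mult)
 show "evf (p + q) = evf p + evf q" unfolding s evf_Fract[OF bd] unfolding p(1) q(1) evf_Fract[OF p(2)] evf_Fract[OF q(2)]
  using z by (simp add: ev_mult ev_add add_frac_eq)
 show "evf (- p) = - evf p" unfolding u unfolding p(1) evf_Fract[OF p(2)] by (simp add: ev_uminus)
qed

lemma LR_0: "0 : carrier LR" and LR_1: "1 : carrier LR"
proof -
 show "0 : carrier LR" using LR_I[OF F_not_dvd_1, of 0] by (simp only: fract_collapse)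
 show "1 : carrier LR" using LR_I[OF F_not_dvd_1, of 1] by (simp only: fract_collapse)
qed

lemma evf_0: "evf 0 = 0" and evf_1: "evf 1 = 1"
 using evf_Fract[OF F_not_dvd_1, of 0] evf_Fract[OF F_not_dvd_1, of 1] by (simp_all add: fract_collapse)

lemma ring_LR: "ring LR"
proof -
 have "abelian_group LR"
 proof (rule abelian_groupI)
  show "p \<oplus>\<^bsub>LR\<^esub> q : carrier LR" if "p : carrier LR" "q : carrier LR" for p q using LR_ops(2)[OF that] by (simp only: LR_simps(5))
  show "\<zero>\<^bsub>LR\<^esub> : carrier LR" using LR_0 by (simp only: LR_simps(4))
  show "EX q:carrier LR. q \<oplus>\<^bsub>LR\<^esub> p = \<zero>\<^bsub>LR\<^esub>" if "p : carrier LR" for p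
   using LR_ops(3)[OF that that] by (intro bexI[of _ "- p"]) (simp_all only: LR_simps(4,5) left_minus)
 qed (simp_all only: LR_simps(4,5) add.assoc add.left_neutral, simp only: add.commute)
 moreover have "Group.monoid LR"
 proof (rule monoidI)
  show "p \<otimes>\<^bsub>LR\<^esub> q : carrier LR" if "p : carrier LR" "q : carrier LR" for p q using LR_ops(1)[OF that] by (simp only: LR_simps(2))
  show "\<one>\<^bsub>LR\<^esub> : carrier LR" using LR_1 by (simp only: LR_simps(3))
 qed (simp_all only: LR_simps(2,3) mult.assoc mult_1_left mult_1_right)
 ultimately show ?thesis
  by (rule ringI) (simp_all only: LR_simps(2,5) distrib_left distrib_right)
qed

lemma evf_surj: "evf ` carrier LR = MG"
proof
 show "evf ` carrier LR <= MG"
 proof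
  fix z assume "z : evf ` carrier LR"
  then obtain q where q: "q : carrier LR" "z = evf q" by blast
  obtain a b where "q = Fract a b" "~ F dvd b" "b ~= 0" using LR_E[OF q(1)] by metis
  thus "z : MG" using q(2) evf_Fract MG_closed(8)[OF ev_MG ev_MG] by simp
 qed
 have K: "is_subfield (evf ` carrier LR)"
  unfolding is_subfield_def
 proof (intro conjI ballI)
  show "0 : evf ` carrier LR" using LR_0 evf_0 by (metis image_eqI)
  show "1 : evf ` carrier LR" using LR_1 evf_1 by (metis image_eqI)
  fix z assume "z : evf ` carrier LR"
  then obtain p where p: "p : carrier LR" "z = evf p" by blast
  show "- z : evf ` carrier LR" using LR_ops(3,6)[OF p(1) p(1)] p(2) by (metis image_eqI)
  show "inverse z : evf ` carrier LR"
  proof (cases "z = 0")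
   case True
   thus ?thesis using LR_0 evf_0 by (metis image_eqI inverse_zero)
  next
   case False
   obtain a b where ab: "p = Fract a b" "~ F dvd b" "b ~= 0" using LR_E[OF p(1)] by metis
   have z: "z = ev a / ev b" using p(2) ab evf_Fract by simp
   hence "ev a ~= 0" using False by auto
   hence a: "~ F dvd a" using ev_eq_0_iff by blast
   have "inverse z = evf (Fract b a)" unfolding z evf_Fract[OF a] by simp
   thus ?thesis using LR_I[OF a] by (metis image_eqI)
  qed
  fix w assume "w : evf ` carrier LR"
  then obtain q where q: "q : carrier LR" "w = evf q" by blast
  show "z + w : evf ` carrier LR" using LR_ops(2,5)[OF p(1) q(1)] p(2) q(2) by (metis image_eqI)
  show "z * w : evf ` carrier LR" using LR_ops(1,4)[OF p(1) q(1)] p(2) q(2) by (metis image_eqI)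
 qed
 have im: "ev P : evf ` carrier LR" for P
  using LR_I[OF F_not_dvd_1, of P] evf_Fract[OF F_not_dvd_1, of P] by (metis div_by_1 ev_1 image_eqI)
 show "MG <= evf ` carrier LR" unfolding gen
 proof (rule complex_adjoin_minimal[OF _ _ K])
  have "ev var_X = x" "ev var_Y = y" by (simp_all add: var_X_def var_Y_def)
  thus "{x, y} <= evf ` carrier LR" using im[of var_X] im[of var_Y] by (simp only: insert_subset empty_subsetI simp_thms)
  have "ev [:[:c:]:] = cst c" for c by simp
  thus "range cst <= evf ` carrier LR" using im by (metis image_subsetI)
 qed
qed

text \<open>The maximal ideal is the kernel of \<open>evf\<close>, so the homomorphism theorem
  identifies the function field of the curve with \<open>MG\<close>, and the genus is transported
  along the inverse isomorphism.\<close>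

lemma curve_genus: "normalization_has_genus F 17"
proof -
 have hom: "ring_hom_ring LR MGR evf"
 proof (rule ring_hom_ringI[OF ring_LR MGR.ring_axioms])
  show "evf q : carrier MGR" if "q : carrier LR" for q using evf_surj that by (simp only: MGR_simps(1)) blast
  show "evf (p \<otimes>\<^bsub>LR\<^esub> q) = evf p \<otimes>\<^bsub>MGR\<^esub> evf q" if "p : carrier LR" "q : carrier LR" for p q
   using LR_ops(4)[OF that] by (simp only: LR_simps(2) MGR_simps(2))
  show "evf (p \<oplus>\<^bsub>LR\<^esub> q) = evf p \<oplus>\<^bsub>MGR\<^esub> evf q" if "p : carrier LR" "q : carrier LR" for p q
   using LR_ops(5)[OF that] by (simp only: LR_simps(5) MGR_simps(5))
  show "evf \<one>\<^bsub>LR\<^esub> = \<one>\<^bsub>MGR\<^esub>" using evf_1 by (simp only: LR_simps(3) MGR_simps(3))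
 qed
 interpret h: ring_hom_ring LR MGR evf by (rule hom)
 have ker: "a_kernel LR MGR evf = curve_maximal_ideal F"
 proof -
  have "evf (Fract a b) = 0 \<longleftrightarrow> F dvd a" if b: "~ F dvd b" for a b
  proof -
   have "ev b ~= 0" using b ev_eq_0_iff by blast
   thus ?thesis unfolding evf_Fract[OF b] ev_eq_0_iff[symmetric] by simp
  qed
  thus ?thesis unfolding a_kernel_def' curve_maximal_ideal_def MGR_simps(4) LR_simps(1) by blast
 qed
 let ?C = "curve_function_field F"
 define T where "T = (%X. the_elem (evf ` X))"
 have iso: "T : ring_iso ?C MGR"
  using h.FactRing_iso_set evf_surj unfolding curve_function_field_def ker T_def MGR_simps(1) by blast
 have ringC: "ring ?C"
  unfolding curve_function_field_def ker[symmetric] by (rule ideal.quotient_is_ring[OF h.kernel_is_ideal])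
 define g where "g = inv_into (carrier ?C) T"
 have g: "g : ring_iso MGR ?C" unfolding g_def by (rule ring_iso_set_sym[OF ringC iso])
 have "has_genus ?C (g ` range cst) 17" by (rule has_genus_iso[OF field_MGR ringC g subfield_const genus_MGR])
 moreover have "g ` range cst = curve_constants F"
 proof -
  have "g (cst c) = curve_maximal_ideal F +>\<^bsub>LR\<^esub> Fract [:[:c:]:] 1" for c
  proof -
   let ?q = "Fract [:[:c:]:] 1 :: complex poly poly fract"
   have q: "?q : carrier LR" by (rule LR_I[OF F_not_dvd_1])
   have "evf ?q = cst c" using evf_Fract[OF F_not_dvd_1] by simp
   hence t: "T (curve_maximal_ideal F +>\<^bsub>LR\<^esub> ?q) = cst c" unfolding T_def ker[symmetric] using h.the_elem_simp[OF q] by simp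
   have "curve_maximal_ideal F +>\<^bsub>LR\<^esub> ?q : carrier ?C"
    unfolding curve_function_field_def FactRing_def A_RCOSETS_def' using q by auto
   thus ?thesis unfolding g_def t[symmetric] by (rule inv_into_f_f[OF bij_betw_imp_inj_on[OF ring_iso_memE(5)[OF iso]]])
  qed
  thus ?thesis unfolding curve_constants_def image_image by simp
 qed
 ultimately show ?thesis unfolding normalization_has_genus_def using prime_elem_imp_irreducible[OF F_prime] by simp
qed

end

theorem proposition6p3:
  fixes \<Delta> x y :: mero_uhp
  assumes "\<Delta> ^ 2 = 4 * ((upsilon7 - 1) ^ 3 *
      (upsilon7 ^ 3 - 8 * upsilon7 ^ 2 + 5 * upsilon7 + 1) / upsilon7 ^ 3)"
    and "x = upsilon7 * \<Delta> / (upsilon7 - 1)"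
    and "y = psi7 / upsilon7"
  shows "modular_functions (Gamma_sup2 \<inter> Gamma_principal 7) = complex_adjoin {psi7, upsilon7, \<Delta>} \<and>
         complex_adjoin {psi7, upsilon7, \<Delta>} = complex_adjoin {x, y} \<and>
         curve_eqn x y = 0 \<and>
         normalization_has_genus (curve_eqn var_X var_Y) 17"
proof -
 let ?u = ups7
 have u: "?u ~= 0" "?u - 1 ~= 0" using upsilon7_nz by auto
 have "\<Delta> ^ 2 = Delta7 ^ 2" unfolding assms(1) Delta7_square ..
 hence D: "\<Delta> = Delta7 \<or> \<Delta> = - Delta7" by (simp add: power2_eq_iff)
 have M: "MG = complex_adjoin {psi7, ?u, \<Delta>}"
 proof
  let ?K = "complex_adjoin {psi7, ?u, \<Delta>}"
  have "psi7 : ?K" "?u : ?K" "\<Delta> : ?K" by (auto intro: complex_adjoin_incl)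
  hence "{psi7, ?u, Delta7} <= ?K" using D is_subfieldD(5)[OF complex_adjoin_subfield, of \<Delta> "{psi7, ?u, \<Delta>}"] by auto
  thus "MG <= ?K" unfolding MG_eq_adjoin
   by (rule complex_adjoin_minimal[OF _ _ complex_adjoin_subfield]) (use complex_adjoin_incl(1) in auto)
  show "?K <= MG"
   by (rule complex_adjoin_minimal[OF _ range_const_MG MG_subfield]) (use D psi7_MG upsilon7_MG Delta7_MG MG_closed(5)[OF Delta7_MG] in auto)
 qed
 have DM: "\<Delta> : MG" using D Delta7_MG MG_closed(5)[OF Delta7_MG] by auto
 have xM: "x : MG" "y : MG" unfolding assms(2,3) by (intro MG_closed(2,4,7,8) upsilon7_MG DM psi7_MG)+
 have D2: "\<Delta> ^ 2 * ?u ^ 3 = 4 * ((?u - 1) ^ 3 * ups_poly cpoly)"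
  unfolding assms(1) ups_cpoly using u by simp
 have x2: "x ^ 2 * ?u = 4 * ((?u - 1) * ups_poly cpoly)"
 proof -
  have "x * (?u - 1) = ?u * \<Delta>" using u by (simp add: assms(2))
  hence "(x * (?u - 1)) ^ 2 * ?u = (?u * \<Delta>) ^ 2 * ?u" by (rule arg_cong)
  hence "x ^ 2 * ?u * (?u - 1) ^ 2 = (?u * \<Delta>) ^ 2 * ?u" by (simp only: power_mult_distrib mult_ac)
  also have "\<dots> = \<Delta> ^ 2 * ?u ^ 3" by (simp add: power2_eq_square power3_eq_cube mult_ac)
  also have "\<dots> = 4 * ((?u - 1) * ups_poly cpoly) * (?u - 1) ^ 2"
  proof -
   have "4 * (w ^ 3 * c) = 4 * (w * c) * w ^ 2" for w c :: mero_uhp by (simp add: eval_nat_numeral mult_ac)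
   thus ?thesis unfolding D2 .
  qed
  finally have "x ^ 2 * ?u * (?u - 1) ^ 2 = 4 * ((?u - 1) * ups_poly cpoly) * (?u - 1) ^ 2" .
  thus ?thesis using u(2) by simp
 qed
 have y7: "y ^ 7 * ?u ^ 3 = ?u - 1"
 proof -
  have "y ^ 7 * ?u ^ 7 = ?u ^ 4 * (?u - 1)" using u(1) psi7_power_7 by (simp add: assms(3) power_divide)
  moreover have "?u ^ 7 = ?u ^ 3 * ?u ^ 4" by (simp flip: power_add)
  moreover have "(y ^ 7 * ?u ^ 3) * ?u ^ 4 = y ^ 7 * (?u ^ 3 * ?u ^ 4)" by (rule mult.assoc)
  ultimately have "(y ^ 7 * ?u ^ 3) * ?u ^ 4 = (?u - 1) * ?u ^ 4" by (metis mult.commute)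
  thus ?thesis using u(1) by simp
 qed
 have "MG = complex_adjoin {x, y}"
 proof
  let ?K = "complex_adjoin {x, y}"
  note cl = is_subfieldD[OF complex_adjoin_subfield[of "{x, y}"]]
  have xK: "x : ?K" "y : ?K" by (auto intro: complex_adjoin_incl)
  have nK: "numeral n : ?K" for n using complex_adjoin_incl(1)[of "numeral n" "{x, y}"] by (simp add: const_mero_numeral)
  \<comment> \<open>The elimination data of \<open>curve_param_inverse\<close>: upsilon solves a
    linear equation over C(x, y) whose leading coefficient is \<open>B\<close>.\<close>
  define s Y where "s = x ^ 2" and "Y = y ^ 7"
  define A0 where "A0 = 36 - 4 * Y"
  define A1 where "A1 = - (40 + 16 * Y + s * Y)"
  define A2 where "A2 = 4 + 52 * Y"
  define B where "B = Y * (A1 ^ 2 - A0 * A2) - A2 ^ 2"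
  have sy: "s * ?u = 4 * ((?u - 1) * (?u ^ 3 - 8 * ?u ^ 2 + 5 * ?u + 1))" "Y * ?u ^ 3 = ?u - 1"
   using x2 y7 by (simp_all add: s_def Y_def ups_cpoly)
  note inv = curve_param_inverse[OF sy u(1), folded A0_def A1_def A2_def, folded B_def]
  define X V :: "complex poly" where "X = [:0, 1:]" and "V = [:- 1, 1:]"
  define b1 where "b1 = - ([:40:] * X ^ 4 + [:16:] * V * X + [:4:] * (V * cpoly) * V)"
  define b0 where "b0 = [:36:] * X ^ 3 - [:4:] * V"
  define b2 where "b2 = [:4:] * X ^ 3 + [:52:] * V"
  define N where "N = V * b1 ^ 2 - X ^ 2 * V * b0 * b2 - X ^ 5 * b2 ^ 2"
  have pu: "pev t (- p) = - pev t p" for t p using pev_smult[of t "- 1" p] by (simp add: const_mero_minus)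
  have pd: "pev t (p - q) = pev t p - pev t q" for t p q using pev_add[of t p "- q"] by (simp add: pu)
  have pc: "pev t [:numeral k:] = numeral k" for t k by (simp add: const_mero_numeral)
  have "ups_poly N = B * ?u ^ 11"
   unfolding inv(2) N_def b0_def b1_def b2_def X_def V_def pd pu pev_add pev_mult pev_power pc ups_X ups_X1 ups_cpoly ..
  \<comment> \<open>One nonzero value shows that the polynomial N is not zero. Hence B u^11 = N(u)
    is nonzero, and the linear equation can be solved for upsilon.\<close>
  moreover have "poly N 2 = 63184" by (simp add: N_def b0_def b1_def b2_def X_def V_def cpoly_def)
  hence "N ~= 0" by auto
  ultimately have Bz: "B ~= 0" using ups_poly_nz by force
  hence "?u = - (Y * A1 * A0 + A2 ^ 2) / B" using inv(1) by (simp add: nonzero_eq_divide_eq)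
  moreover have "- (Y * A1 * A0 + A2 ^ 2) / B : ?K"
   unfolding B_def A0_def A1_def A2_def s_def Y_def by (intro cl(3,4,5,7,8,9) nK xK)
  ultimately have uK: "?u : ?K" by simp
  have "psi7 = y * ?u" using u by (simp add: assms(3))
  hence "psi7 : ?K" using cl(4)[OF xK(2) uK] by simp
  moreover have "\<Delta> = x * (?u - 1) / ?u" using u by (simp add: assms(2))
  hence "\<Delta> : ?K" using cl(8)[OF cl(4)[OF xK(1) cl(7)[OF uK cl(2)]] uK] by simp
  ultimately show "MG <= ?K" unfolding M using uK
   by (intro complex_adjoin_minimal complex_adjoin_subfield) (auto intro: complex_adjoin_incl)
  show "?K <= MG" by (rule complex_adjoin_minimal[OF _ range_const_MG MG_subfield]) (use xM in auto)
 qed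
 moreover from this interpret curve_params x y by unfold_locales (use xM x2 y7 in auto)
 have "curve_eqn x y = 0" "normalization_has_genus (curve_eqn var_X var_Y) 17" by (rule curve_zero, rule curve_genus)
 ultimately show ?thesis using M unfolding MG_def[symmetric] by simp
qed

end
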